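(* Let $n\ge2$. Then the $R_0^a$-algebra $\mathrm{ATL}_n$ has a presentation with generators $$F_1,\dots,F_{n-1},w_1,\dots,w_{n-1},t_1,\dots,t_n,t_1^{-1},\dots,t_n^{-1}$$ (the arrow flat $n$-tangles specified in the context) and relations $$t_it_i^{-1}=t_i^{-1}t_i=1\text{ for }1\le i\le n,\quad t_it_j=t_jt_i\text{ for }1\le i<j\le n,$$ $$w_i^2=1\text{ for }1\le i\le n-1,\quad w_iw_j=w_jw_i\text{ for }|i-j|\ge2,$$ $$w_iw_jw_i=w_jw_iw_j\text{ for }|i-j|=1,\quad w_it_i=t_{i+1}w_i\text{ for }1\le i\le n-1,$$ $$w_it_{i+1}=t_iw_i\text{ for }1\le i\le n-1,\quad w_it_j=t_jw_i\text{ for }j\ne i,i+1,$$ $$F_it_i^mF_i=z_{|m|}F_i\text{ for }1\le i\le n-1\text{ and }m\in\mathbb{Z},\quad F_iw_i=F_it_i=F_it_{i+1}^{-1}\text{ for }1\le i\le n-1,$$ $$w_iF_i=t_i^{-1}F_i=t_{i+1}F_i\text{ for }1\le i\le n-1,\quad F_iF_j=F_jF_i\text{ for }|i-j|\ge2,$$ $$F_iw_j=w_jF_i\text{ for }|i-j|\ge2,\quad F_it_j=t_jF_i\text{ for }j\ne i,i+1,$$ $$F_iw_jF_i=F_i\text{ for }|i-j|=1,\quad w_iw_jF_i=F_jw_iw_j\text{ for }|i-j|=1.$$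
   Context: Let $R_0^a=\mathbb{Z}[z_0,z_1,z_2,\dots]$. For $n\ge1$ let $V_n=\{0,1\}\times\{1,\dots,n\}$, ordered by $(0,1)<(0,2)<\cdots<(0,n)<(1,n)<\cdots<(1,2)<(1,1)$. A flat virtual $n$-tangle is a partition of $V_n$ into pairs; $\mathcal{E}_n$ is the set of these. An arrow flat $n$-tangle is a pair $F=(E,f)$ with $E\in\mathcal{E}_n$ and $f:E\to\mathbb{Z}$ such that, for $\alpha=\{(a,b),(c,d)\}\in E$, $f(\alpha)$ is odd if $a=c$ and even if $a\ne c$. $\mathcal{F}_n$ is the set of arrow flat $n$-tangles, and $\mathrm{ATL}_n$ is the free $R_0^a$-module with basis $\mathcal{F}_n$, with the multiplication defined as follows. Let $E,E'\in\mathcal{E}_n$. An arc of length $\ell$ in $E\sqcup E'$ is an $\ell$-tuple $\hat\alpha=(\alpha_1,\dots,\alpha_\ell)$ of elements of $E\sqcup E'$, $\alpha_i=\{(a_i,b_{i-1}),(c_i,b_i)\}$, such that: (a) if $\alpha_i\in E$ and $i<\ell$, then $c_i=1$, $\alpha_{i+1}\in E'$ and $a_{i+1}=0$; (b) if $\alpha_i\in E'$ and $i<\ell$, then $c_i=0$, $\alpha_{i+1}\in E$ and $a_{i+1}=1$; (c) $a_1=0$ if $\alpha_1\in E$, $a_1=1$ if $\alpha_1\in E'$, $c_\ell=0$ if $\alpha_\ell\in E$, $c_\ell=1$ if $\alpha_\ell\in E'$, and $(a_1,b_0)<(c_\ell,b_\ell)$. Its boundary is $\partial\hat\alpha=\{(a_1,b_0),(c_\ell,b_\ell)\}$.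 There are $n$ arcs and their boundaries form a flat virtual $n$-tangle $E*E'$. A cycle of length $2p\ge2$ in $E\sqcup E'$ is a $2p$-tuple $\hat\gamma=(\gamma_1,\dots,\gamma_{2p})$, $\gamma_i=\{(a_i,b_{i-1}),(c_i,b_i)\}$, such that $\gamma_i\in E$ and $a_i=c_i=1$ for $i$ odd, $\gamma_i\in E'$ and $a_i=c_i=0$ for $i$ even, and $b_0=b_{2p}<b_i$ for $1\le i\le 2p-1$. The parity of $\alpha=\{(a,b),(c,d)\}$ is $\varpi(\alpha)=-1$ if $a=c$ and $\varpi(\alpha)=1$ if $a\ne c$. For an arc or cycle $(\alpha_1,\dots,\alpha_\ell)$ with $\alpha_i=\{(a_i,b_{i-1}),(c_i,b_i)\}$, the cumulated parity is $\varpi^c(\alpha_i)=\prod_{j=1}^{i-1}\varpi(\alpha_j)$ if $(a_i,b_{i-1})<(c_i,b_i)$, and $\varpi^c(\alpha_i)=\prod_{j=1}^{i}\varpi(\alpha_j)$ if $(c_i,b_i)<(a_i,b_{i-1})$. Let $F=(E,f)$, $F'=(E',f')\in\mathcal{F}_n$, and let $f^*$ equal $f$ on $E$ and $f'$ on $E'$. For an arc $\hat\alpha$ of $E\sqcup E'$ put $g(\partial\hat\alpha)=\sum_{i=1}^\ell\varpi^c(\alpha_i)f^*(\alpha_i)$, and set $F*F'=(E*E',g)\in\mathcal{F}_n$. For a cycle $\hat\gamma$ put $h(\hat\gamma)=\sum_i\varpi^c(\gamma_i)f^*(\gamma_i)$ (an even number) and $\zeta(\hat\gamma)=|h(\hat\gamma)|/2$.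 If $\hat\gamma_1,\dots,\hat\gamma_m$ are the cycles of $E\sqcup E'$, then $F\,F'=z_{\zeta(\hat\gamma_1)}\cdots z_{\zeta(\hat\gamma_m)}(F*F')$. This makes $\mathrm{ATL}_n$ an associative unital algebra (unit: all pairs $\{(0,k),(1,k)\}$ labeled $0$). Generators. $F_i$ ($1\le i\le n-1$): pairs $\{(0,i),(0,i+1)\}$ and $\{(1,i),(1,i+1)\}$ both labeled $1$, and $\{(0,k),(1,k)\}$ labeled $0$ for $k\ne i,i+1$. $w_i$ ($1\le i\le n-1$): pairs $\{(0,i),(1,i+1)\}$, $\{(0,i+1),(1,i)\}$, and $\{(0,k),(1,k)\}$ for $k\ne i,i+1$, all labeled $0$. $t_j^{\pm1}$ ($1\le j\le n$): pairs $\{(0,k),(1,k)\}$ for all $k$, with label $\pm2$ for $k=j$ and $0$ for $k\ne j$. *)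

theory Defs
  imports
    "HOL-Library.Poly_Mapping"
    "HOL-Library.FuncSet"
    "HOL-Library.Disjoint_Sets"
    "HOL-Algebra.Module"
    "HOL-Algebra.Ideal"
    "HOL-Algebra.Algebraic_Closure_Type"
begin

text \<open>The library's \<open>algebra\<close> locale demands a commutative multiplication; this one does not.\<close>

locale assoc_algebra = module R A + A?: ring A for R (structure) and A (structure) +
  assumes smult_mult_left:
      "\<lbrakk>a \<in> carrier R; x \<in> carrier A; y \<in> carrier A\<rbrakk> \<Longrightarrow>
        (a \<odot>\<^bsub>A\<^esub> x) \<otimes>\<^bsub>A\<^esub> y = a \<odot>\<^bsub>A\<^esub> (x \<otimes>\<^bsub>A\<^esub> y)"
    and smult_mult_right:
      "\<lbrakk>a \<in> carrier R; x \<in> carrier A; y \<in> carrier A\<rbrakk> \<Longrightarrow>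
        x \<otimes>\<^bsub>A\<^esub> (a \<odot>\<^bsub>A\<^esub> y) = a \<odot>\<^bsub>A\<^esub> (x \<otimes>\<^bsub>A\<^esub> y)"

definition algebra_hom ::
    "('r, 'm) ring_scheme \<Rightarrow> ('r, 'a) module \<Rightarrow> ('r, 'b) module \<Rightarrow> ('a \<Rightarrow> 'b) set" where
  "algebra_hom R A B = {h \<in> ring_hom A B.
     \<forall>r \<in> carrier R. \<forall>x \<in> carrier A. h (r \<odot>\<^bsub>A\<^esub> x) = r \<odot>\<^bsub>B\<^esub> h x}"

definition scale :: "'r \<Rightarrow> ('k \<Rightarrow>\<^sub>0 'r) \<Rightarrow> ('k \<Rightarrow>\<^sub>0 'r::comm_ring_1)" where
  "scale c x = Poly_Mapping.map (\<lambda>r. c * r) x"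

text \<open>The free module with basis \<open>B\<close>, with the bilinear multiplication that is given on
  basis elements by \<open>m\<close>, and with the basis element \<open>e\<close> as unit.\<close>

definition based_algebra ::
    "'k set \<Rightarrow> ('k \<Rightarrow> 'k \<Rightarrow> ('k \<Rightarrow>\<^sub>0 'r)) \<Rightarrow> 'k \<Rightarrow> ('r::comm_ring_1, 'k \<Rightarrow>\<^sub>0 'r) module" where
  "based_algebra B m e =
    \<lparr>carrier = {x. Poly_Mapping.keys x \<subseteq> B},
     monoid.mult = (\<lambda>x y. \<Sum>u \<in> Poly_Mapping.keys x. \<Sum>v \<in> Poly_Mapping.keys y.
       scale (Poly_Mapping.lookup x u * Poly_Mapping.lookup y v) (m u v)),
     one = Poly_Mapping.single e 1,
     ring.zero = 0,
     add = (+),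
     module.smult = scale\<rparr>"

text \<open>The free associative unital algebra on \<open>S\<close>: its basis is the free monoid on \<open>S\<close>.\<close>

definition free_algebra :: "'g set \<Rightarrow> ('r::comm_ring_1, 'g list \<Rightarrow>\<^sub>0 'r) module" where
  "free_algebra S = based_algebra (lists S) (\<lambda>u v. Poly_Mapping.single (u @ v) 1) []"

abbreviation word :: "'g list \<Rightarrow> ('g list \<Rightarrow>\<^sub>0 'r::comm_ring_1)" where
  "word u \<equiv> Poly_Mapping.single u 1"

text \<open>\<open>A\<close> is presented by the generators \<open>val x\<close>, \<open>x \<in> S\<close>, and the relations \<open>l = r\<close>,
  \<open>(l, r) \<in> rels\<close>.  Note that \<open>genideal\<close> is the generated two-sided ideal.\<close>

definition has_presentation ::
    "('r::comm_ring_1, 'a) module \<Rightarrow> 'g set \<Rightarrow> ('g \<Rightarrow> 'a) \<Rightarrow>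
      (('g list \<Rightarrow>\<^sub>0 'r) \<times> ('g list \<Rightarrow>\<^sub>0 'r)) set \<Rightarrow> bool" where
  "has_presentation A S val rels \<longleftrightarrow>
     assoc_algebra (ring_of_type_algebra :: 'r ring) A \<and>
     (\<exists>\<phi> \<in> algebra_hom (ring_of_type_algebra :: 'r ring) (free_algebra S) A.
        (\<forall>x \<in> S. \<phi> (word [x]) = val x) \<and>
        \<phi> ` carrier (free_algebra S) = carrier A \<and>
        a_kernel (free_algebra S) A \<phi> = genideal (free_algebra S) {l - r | l r. (l, r) \<in> rels})"

type_synonym vertex = "nat \<times> nat"
type_synonym flat_tangle = "vertex set set"
type_synonym arrow_tangle = "flat_tangle \<times> (vertex set \<Rightarrow> int)"

definition vertices :: "nat \<Rightarrow> vertex set" where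
  "vertices n = {0, 1} \<times> {1..n}"

text \<open>The order \<open>(0,1) < \<dots> < (0,n) < (1,n) < \<dots> < (1,1)\<close>.\<close>

definition vless :: "vertex \<Rightarrow> vertex \<Rightarrow> bool" where
  "vless p q \<longleftrightarrow> fst p < fst q
     \<or> (fst p = 0 \<and> fst q = 0 \<and> snd p < snd q)
     \<or> (fst p = 1 \<and> fst q = 1 \<and> snd q < snd p)"

definition flat_tangles :: "nat \<Rightarrow> flat_tangle set" where
  "flat_tangles n = {E. partition_on (vertices n) E \<and> (\<forall>\<alpha> \<in> E. card \<alpha> = 2)}"

definition arrow_flat_tangles :: "nat \<Rightarrow> arrow_tangle set" where
  "arrow_flat_tangles n = {(E, f). E \<in> flat_tangles n \<and> f \<in> extensional E \<and>
     (\<forall>a b c d. {(a, b), (c, d)} \<in> E \<longrightarrow>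
        (if a = c then odd (f {(a, b), (c, d)}) else even (f {(a, b), (c, d)})))}"

text \<open>The entries \<open>\<alpha>\<^sub>i = {(a\<^sub>i, b\<^sub>i\<^sub>-\<^sub>1), (c\<^sub>i, b\<^sub>i)}\<close> of an arc or a cycle are encoded as triples
  \<open>(k, (a\<^sub>i, b\<^sub>i\<^sub>-\<^sub>1), (c\<^sub>i, b\<^sub>i))\<close>, where \<open>k\<close> tells which summand of the disjoint union of \<open>E\<close> and
  \<open>E'\<close> the pair is taken from.  The conditions on arcs and cycles determine the orientations of
  the pairs, so that recording them does not change the number of arcs or cycles.  Lists are
  indexed from \<open>0\<close>, so \<open>\<alpha>\<^sub>i\<close> is \<open>\<alpha> ! (i - 1)\<close>.\<close>

datatype factor = Left_Factor | Right_Factor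

type_synonym step = "factor \<times> vertex \<times> vertex"

abbreviation fac :: "step \<Rightarrow> factor" where "fac s \<equiv> fst s"
abbreviation src :: "step \<Rightarrow> vertex" where "src s \<equiv> fst (snd s)"
abbreviation tgt :: "step \<Rightarrow> vertex" where "tgt s \<equiv> snd (snd s)"

definition is_step :: "flat_tangle \<Rightarrow> flat_tangle \<Rightarrow> step \<Rightarrow> bool" where
  "is_step E E' s \<longleftrightarrow> {src s, tgt s} \<in> (case fac s of Left_Factor \<Rightarrow> E | Right_Factor \<Rightarrow> E')"

definition is_arc :: "flat_tangle \<Rightarrow> flat_tangle \<Rightarrow> step list \<Rightarrow> bool" where
  "is_arc E E' \<alpha> \<longleftrightarrow> \<alpha> \<noteq> [] \<and> (\<forall>s \<in> set \<alpha>. is_step E E' s) \<and>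
     (\<forall>i. Suc i < length \<alpha> \<longrightarrow>
        snd (tgt (\<alpha> ! i)) = snd (src (\<alpha> ! Suc i)) \<and>
        (fac (\<alpha> ! i) = Left_Factor \<longrightarrow>
           fst (tgt (\<alpha> ! i)) = 1 \<and> fac (\<alpha> ! Suc i) = Right_Factor \<and> fst (src (\<alpha> ! Suc i)) = 0) \<and>
        (fac (\<alpha> ! i) = Right_Factor \<longrightarrow>
           fst (tgt (\<alpha> ! i)) = 0 \<and> fac (\<alpha> ! Suc i) = Left_Factor \<and> fst (src (\<alpha> ! Suc i)) = 1)) \<and>
     fst (src (hd \<alpha>)) = (case fac (hd \<alpha>) of Left_Factor \<Rightarrow> 0 | Right_Factor \<Rightarrow> 1) \<and>
     fst (tgt (last \<alpha>)) = (case fac (last \<alpha>) of Left_Factor \<Rightarrow> 0 | Right_Factor \<Rightarrow> 1) \<and>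
     vless (src (hd \<alpha>)) (tgt (last \<alpha>))"

definition boundary :: "step list \<Rightarrow> vertex set" where
  "boundary \<alpha> = {src (hd \<alpha>), tgt (last \<alpha>)}"

definition is_cycle :: "flat_tangle \<Rightarrow> flat_tangle \<Rightarrow> step list \<Rightarrow> bool" where
  "is_cycle E E' \<gamma> \<longleftrightarrow> \<gamma> \<noteq> [] \<and> even (length \<gamma>) \<and> (\<forall>s \<in> set \<gamma>. is_step E E' s) \<and>
     (\<forall>i < length \<gamma>.
        if even i
        then fac (\<gamma> ! i) = Left_Factor \<and> fst (src (\<gamma> ! i)) = 1 \<and> fst (tgt (\<gamma> ! i)) = 1
        else fac (\<gamma> ! i) = Right_Factor \<and> fst (src (\<gamma> ! i)) = 0 \<and> fst (tgt (\<gamma> ! i)) = 0) \<and>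
     (\<forall>i. Suc i < length \<gamma> \<longrightarrow>
        snd (tgt (\<gamma> ! i)) = snd (src (\<gamma> ! Suc i)) \<and> snd (src (hd \<gamma>)) < snd (tgt (\<gamma> ! i))) \<and>
     snd (tgt (last \<gamma>)) = snd (src (hd \<gamma>))"

definition pair_parity :: "vertex set \<Rightarrow> int" where
  "pair_parity \<alpha> = (if \<exists>a b d. \<alpha> = {(a, b), (a, d)} then -1 else 1)"

definition cum_parity :: "step list \<Rightarrow> nat \<Rightarrow> int" where
  "cum_parity \<alpha> i =
     (\<Prod>j < (if vless (src (\<alpha> ! i)) (tgt (\<alpha> ! i)) then i else Suc i).
        pair_parity {src (\<alpha> ! j), tgt (\<alpha> ! j)})"

definition total_label ::
    "(vertex set \<Rightarrow> int) \<Rightarrow> (vertex set \<Rightarrow> int) \<Rightarrow> step list \<Rightarrow> int" where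
  "total_label f f' \<alpha> = (\<Sum>i < length \<alpha>. cum_parity \<alpha> i *
     (case fac (\<alpha> ! i) of Left_Factor \<Rightarrow> f | Right_Factor \<Rightarrow> f') {src (\<alpha> ! i), tgt (\<alpha> ! i)})"

text \<open>The polynomial ring \<open>\<int>[z\<^sub>0, z\<^sub>1, z\<^sub>2, \<dots>]\<close>: monomials are finitely supported exponent
  functions.\<close>

type_synonym coeff_ring = "(nat \<Rightarrow>\<^sub>0 nat) \<Rightarrow>\<^sub>0 int"

definition z :: "nat \<Rightarrow> coeff_ring" where
  "z i = Poly_Mapping.single (Poly_Mapping.single i 1) 1"

definition flat_star :: "flat_tangle \<Rightarrow> flat_tangle \<Rightarrow> flat_tangle" where
  "flat_star E E' = {boundary \<alpha> | \<alpha>. is_arc E E' \<alpha>}"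

definition arrow_star :: "arrow_tangle \<Rightarrow> arrow_tangle \<Rightarrow> arrow_tangle" where
  "arrow_star F F' = (case (F, F') of ((E, f), (E', f')) \<Rightarrow>
     (flat_star E E',
      \<lambda>\<beta> \<in> flat_star E E'. total_label f f' (THE \<alpha>. is_arc E E' \<alpha> \<and> boundary \<alpha> = \<beta>)))"

definition cycle_coeff :: "arrow_tangle \<Rightarrow> arrow_tangle \<Rightarrow> coeff_ring" where
  "cycle_coeff F F' = (case (F, F') of ((E, f), (E', f')) \<Rightarrow>
     (\<Prod>\<gamma> | is_cycle E E' \<gamma>. z (nat (\<bar>total_label f f' \<gamma>\<bar> div 2))))"

definition id_pairs :: "nat set \<Rightarrow> flat_tangle" where
  "id_pairs K = {{(0, k), (1, k)} | k. k \<in> K}"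

definition id_tangle :: "nat \<Rightarrow> arrow_tangle" where
  "id_tangle n = (id_pairs {1..n}, \<lambda>\<alpha> \<in> id_pairs {1..n}. 0)"

definition ATL :: "nat \<Rightarrow> (coeff_ring, arrow_tangle \<Rightarrow>\<^sub>0 coeff_ring) module" where
  "ATL n = based_algebra (arrow_flat_tangles n)
     (\<lambda>F F'. Poly_Mapping.single (arrow_star F F') (cycle_coeff F F')) (id_tangle n)"

definition F_tangle :: "nat \<Rightarrow> nat \<Rightarrow> arrow_tangle" where
  "F_tangle n i =
     (let C = {{(0, i), (0, i + 1)}, {(1, i), (1, i + 1)}}; D = id_pairs ({1..n} - {i, i + 1})
      in (C \<union> D, \<lambda>\<alpha> \<in> C \<union> D. if \<alpha> \<in> C then 1 else 0))"

definition w_tangle :: "nat \<Rightarrow> nat \<Rightarrow> arrow_tangle" where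
  "w_tangle n i =
     (let E = {{(0, i), (1, i + 1)}, {(0, i + 1), (1, i)}} \<union> id_pairs ({1..n} - {i, i + 1})
      in (E, \<lambda>\<alpha> \<in> E. 0))"

text \<open>\<open>t_tangle n j 1\<close> is \<open>t\<^sub>j\<close> and \<open>t_tangle n j (-1)\<close> is its inverse.\<close>

definition t_tangle :: "nat \<Rightarrow> nat \<Rightarrow> int \<Rightarrow> arrow_tangle" where
  "t_tangle n j \<epsilon> =
     (id_pairs {1..n}, \<lambda>\<alpha> \<in> id_pairs {1..n}. if \<alpha> = {(0, j), (1, j)} then 2 * \<epsilon> else 0)"

datatype gen = GF nat | GW nat | GT nat | GTinv nat

definition gens :: "nat \<Rightarrow> gen set" where
  "gens n = GF ` {1..n - 1} \<union> GW ` {1..n - 1} \<union> GT ` {1..n} \<union> GTinv ` {1..n}"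

fun gen_tangle :: "nat \<Rightarrow> gen \<Rightarrow> arrow_tangle" where
  "gen_tangle n (GF i) = F_tangle n i"
| "gen_tangle n (GW i) = w_tangle n i"
| "gen_tangle n (GT j) = t_tangle n j 1"
| "gen_tangle n (GTinv j) = t_tangle n j (-1)"

definition gen_val :: "nat \<Rightarrow> gen \<Rightarrow> (arrow_tangle \<Rightarrow>\<^sub>0 coeff_ring)" where
  "gen_val n x = Poly_Mapping.single (gen_tangle n x) 1"

definition t_power :: "nat \<Rightarrow> int \<Rightarrow> gen list" where
  "t_power i m = (if m \<ge> 0 then replicate (nat m) (GT i) else replicate (nat (- m)) (GTinv i))"

inductive_set relations ::
    "nat \<Rightarrow> ((gen list \<Rightarrow>\<^sub>0 coeff_ring) \<times> (gen list \<Rightarrow>\<^sub>0 coeff_ring)) set" for n :: nat where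
  t_tinv: "i \<in> {1..n} \<Longrightarrow> (word [GT i, GTinv i], word []) \<in> relations n"
| tinv_t: "i \<in> {1..n} \<Longrightarrow> (word [GTinv i, GT i], word []) \<in> relations n"
| t_t: "\<lbrakk>i \<in> {1..n}; j \<in> {1..n}; i < j\<rbrakk> \<Longrightarrow>
    (word [GT i, GT j], word [GT j, GT i]) \<in> relations n"
| w_w: "i \<in> {1..n - 1} \<Longrightarrow> (word [GW i, GW i], word []) \<in> relations n"
| w_far: "\<lbrakk>i \<in> {1..n - 1}; j \<in> {1..n - 1}; \<bar>int i - int j\<bar> \<ge> 2\<rbrakk> \<Longrightarrow>
    (word [GW i, GW j], word [GW j, GW i]) \<in> relations n"
| w_braid: "\<lbrakk>i \<in> {1..n - 1}; j \<in> {1..n - 1}; \<bar>int i - int j\<bar> = 1\<rbrakk> \<Longrightarrow>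
    (word [GW i, GW j, GW i], word [GW j, GW i, GW j]) \<in> relations n"
| w_t: "i \<in> {1..n - 1} \<Longrightarrow> (word [GW i, GT i], word [GT (i + 1), GW i]) \<in> relations n"
| w_t_Suc: "i \<in> {1..n - 1} \<Longrightarrow> (word [GW i, GT (i + 1)], word [GT i, GW i]) \<in> relations n"
| w_t_far: "\<lbrakk>i \<in> {1..n - 1}; j \<in> {1..n}; j \<noteq> i; j \<noteq> i + 1\<rbrakk> \<Longrightarrow>
    (word [GW i, GT j], word [GT j, GW i]) \<in> relations n"
| F_t_F: "i \<in> {1..n - 1} \<Longrightarrow>
    (word ([GF i] @ t_power i m @ [GF i]), scale (z (nat \<bar>m\<bar>)) (word [GF i])) \<in> relations n"
| F_w: "i \<in> {1..n - 1} \<Longrightarrow> (word [GF i, GW i], word [GF i, GT i]) \<in> relations n"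
| F_t: "i \<in> {1..n - 1} \<Longrightarrow> (word [GF i, GT i], word [GF i, GTinv (i + 1)]) \<in> relations n"
| w_F: "i \<in> {1..n - 1} \<Longrightarrow> (word [GW i, GF i], word [GTinv i, GF i]) \<in> relations n"
| t_F: "i \<in> {1..n - 1} \<Longrightarrow> (word [GTinv i, GF i], word [GT (i + 1), GF i]) \<in> relations n"
| F_far: "\<lbrakk>i \<in> {1..n - 1}; j \<in> {1..n - 1}; \<bar>int i - int j\<bar> \<ge> 2\<rbrakk> \<Longrightarrow>
    (word [GF i, GF j], word [GF j, GF i]) \<in> relations n"
| F_w_far: "\<lbrakk>i \<in> {1..n - 1}; j \<in> {1..n - 1}; \<bar>int i - int j\<bar> \<ge> 2\<rbrakk> \<Longrightarrow>
    (word [GF i, GW j], word [GW j, GF i]) \<in> relations n"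
| F_t_far: "\<lbrakk>i \<in> {1..n - 1}; j \<in> {1..n}; j \<noteq> i; j \<noteq> i + 1\<rbrakk> \<Longrightarrow>
    (word [GF i, GT j], word [GT j, GF i]) \<in> relations n"
| F_w_F: "\<lbrakk>i \<in> {1..n - 1}; j \<in> {1..n - 1}; \<bar>int i - int j\<bar> = 1\<rbrakk> \<Longrightarrow>
    (word [GF i, GW j, GF i], word [GF i]) \<in> relations n"
| w_w_F: "\<lbrakk>i \<in> {1..n - 1}; j \<in> {1..n - 1}; \<bar>int i - int j\<bar> = 1\<rbrakk> \<Longrightarrow>
    (word [GW i, GW j, GF i], word [GF j, GW i, GW j]) \<in> relations n"

end

theory Submission
  imports Defs "HOL-Combinatorics.Permutations"
begin

text \<open>Give each pair of a tangle a gain that changes sign with the direction of traversal. Up to the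
  sign of the starting point, the label of an arc or of a cycle of a stack of tangles is then the sum
  of the gains of its steps, so that associativity reduces to a statement on first-return maps of a
  partial permutation, and the multiplication by a generator can be read off from an explicit
  formula.

  For the presentation, the relations generate a semidirect product of the symmetric group (the
  \<open>w\<^sub>i\<close>) and a free abelian group (the \<open>t\<^sub>j\<close>). Conjugating \<open>F\<^sub>1\<close> by permutations gives elements
  \<open>U i j\<close>, and the relations rewrite every word as a scalar times a twist, a product of \<open>U i j\<close> over
  disjoint pairs, a twist and a permutation. Two such normal forms with the same tangle differ by
  elements that the product of the \<open>U i j\<close> absorbs, hence are equal modulo the relations. As every
  tangle is the value of some word with coefficient 1, the kernel of the evaluation of words is the
  ideal generated by the relations.\<close>

section \<open>Symmetric groups by adjacent transpositions\<close>

text \<open>Two ambiguities shape the proof. As an orbit, a cycle appears twice, once in each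
  direction, so that orbits give only the square of the product of the z's. The square root is
  unique because all coefficients are monomials with coefficient 1, for which doubling the exponents
  is injective. The same fact keeps the scalar of a normal form nonzero, so that its value in the
  algebra determines both the tangle and the scalar. The second ambiguity: the cups do not remember
  which caps they came with. The group element below them is determined only up to the stabiliser of
  the cups, which is exhausted by turning a pair around together with one twist, exchanging two
  pairs, and twisting both ends of a pair equally. That an exchange is absorbed is not among the
  relations; it is derived from F_i w_j F_i = F_i and the commutation of disjoint pairs. Rewriting
  takes place in an arbitrary monoid in which the relations hold, while values of words as tangles
  are given by closed formulas; the same concrete words are evaluated on both sides.\<close>

typedef 'a endo = "UNIV :: ('a \<Rightarrow> 'a) set" morphisms app Endo ..

setup_lifting type_definition_endo

text \<open>Makes composition the multiplication of a type class instance, so that statements about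
  an arbitrary monoid apply both to permutations and to operators on the cosets of an ideal.\<close>

instantiation endo :: (type) monoid_mult
begin
lift_definition one_endo :: "'a endo" is id .
lift_definition times_endo :: "'a endo \<Rightarrow> 'a endo \<Rightarrow> 'a endo" is "(\<circ>)" .
instance by standard (transfer; simp add: comp_assoc)+
end

lemma app_Endo [simp]: "app (Endo f) = f" by (simp add: Endo_inverse)
lemma app_times: "app (a * b) = app a \<circ> app b" by transfer simp
lemma app_one: "app 1 = id" by transfer simp
lemma endo_eqI: "app a = app b \<Longrightarrow> a = b" by (simp add: app_inject)

lemma commute_prod_list:
  fixes x :: "'m :: monoid_mult"
  assumes "\<And>y. y \<in> set ys \<Longrightarrow> x * y = y * x"
  shows "x * prod_list ys = prod_list ys * x"
  using assms
proof (induction ys)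
  case (Cons y ys)
  have "x * prod_list (y # ys) = y * (x * prod_list ys)" using Cons.prems[of y] by (simp add: mult.assoc[symmetric])
  also have "\<dots> = y * (prod_list ys * x)" using Cons by simp
  finally show ?case by (simp add: mult.assoc)
qed simp

text \<open>The head of \<open>xs\<close> occurs somewhere in \<open>ys\<close> and commutes past
  everything in front of it, so that it can be stripped from both lists.\<close>

lemma prod_list_reorder:
  fixes f :: "'a \<Rightarrow> 'm :: monoid_mult"
  assumes "mset xs = mset ys" "\<And>x y. x \<in> set xs \<Longrightarrow> y \<in> set xs \<Longrightarrow> f x * f y = f y * f x"
  shows "prod_list (map f xs) = prod_list (map f ys)"
  using assms
proof (induction xs arbitrary: ys)
  case (Cons x xs)
  have "x \<in> set ys" using Cons.prems(1) by (metis list.set_intros(1) set_mset_mset)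
  then obtain us vs where ys: "ys = us @ x # vs" by (meson split_list)
  then have m: "mset xs = mset (us @ vs)" using Cons.prems(1) by simp
  have sub: "set us \<subseteq> set (x # xs)" using mset_eq_setD[OF Cons.prems(1)] ys by auto
  have c: "f x * prod_list (map f us) = prod_list (map f us) * f x"
  proof (rule commute_prod_list)
    fix y assume "y \<in> set (map f us)"
    then obtain a where "a \<in> set us" "y = f a" by auto
    then show "f x * y = y * f x" using Cons.prems(2)[of x a] sub by auto
  qed
  have "prod_list (map f xs) = prod_list (map f (us @ vs))" using Cons.IH[OF m] Cons.prems(2) by simp
  then show ?case using c by (simp add: ys mult.assoc[symmetric])
qed simp

text \<open>The words s_k s_(k-1) ... s_j, with the empty word for j = k + 1, represent the right
  cosets of the subgroup generated by s_1, ..., s_(k-1) in the symmetric group generated by s_1,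
  ..., s_k.\<close>

definition desc :: "nat \<Rightarrow> nat \<Rightarrow> nat list" where
  "desc k j = rev [j..<Suc k]"

lemma desc_snoc: "j \<le> k \<Longrightarrow> desc k j = desc k (Suc j) @ [j]"
  by (simp add: desc_def upt_conv_Cons)

lemma desc_Nil [simp]: "desc k (Suc k) = []"
  by (simp add: desc_def)

lemma set_desc: "set (desc k j) = {j..k}"
  by (auto simp: desc_def)

lemma desc_split: "\<lbrakk>j \<le> Suc i; i \<le> k\<rbrakk> \<Longrightarrow> desc k j = desc k (Suc i) @ desc i j"
  unfolding desc_def by (metis Suc_le_mono rev_append le_Suc_ex upt_add_eq_append)

lemma desc_Cons: "\<lbrakk>j \<le> Suc i\<rbrakk> \<Longrightarrow> desc (Suc i) j = Suc i # desc i j"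
  by (simp add: desc_def)

text \<open>The pair (v, j) stands for the word \<open>v\<close> followed by
  \<open>desc k j\<close>. One more letter on the right passes to the left of the descending part,
  possibly with its index lowered, or lengthens or shortens that part.\<close>

fun sort_step :: "nat list \<times> nat \<Rightarrow> nat \<Rightarrow> nat list \<times> nat" where
  "sort_step (v, j) i = (if i + 1 < j then (v @ [i], j) else if i + 1 = j then (v, i)
     else if i = j then (v, j + 1) else (v @ [i - 1], j))"

definition sort_word :: "nat \<Rightarrow> nat list \<Rightarrow> nat list \<times> nat" where
  "sort_word k ws = foldl sort_step ([], Suc k) ws"

locale coxeter =
  fixes r :: nat and w :: "nat \<Rightarrow> 'm :: monoid_mult"
  assumes square: "\<And>i. i \<in> {1..r} \<Longrightarrow> w i * w i = 1"
    and far: "\<And>i j. \<lbrakk>i \<in> {1..r}; j \<in> {1..r}; i + 2 \<le> j\<rbrakk> \<Longrightarrow> w i * w j = w j * w i"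
    and braid: "\<And>i. \<lbrakk>i \<in> {1..r}; Suc i \<in> {1..r}\<rbrakk> \<Longrightarrow> w i * w (Suc i) * w i = w (Suc i) * w i * w (Suc i)"
begin

definition W :: "nat list \<Rightarrow> 'm" where
  "W is = prod_list (map w is)"

lemma W_append: "W (u @ v) = W u * W v" by (simp add: W_def)
lemma W_Nil [simp]: "W [] = 1" by (simp add: W_def)
lemma W_Cons: "W (i # u) = w i * W u" by (simp add: W_def)

lemma W_far:
  assumes "i \<in> {1..r}" "set u \<subseteq> {1..r}" "\<And>j. j \<in> set u \<Longrightarrow> i + 2 \<le> j \<or> j + 2 \<le> i"
  shows "W u * w i = w i * W u"
  unfolding W_def
proof (rule commute_prod_list[symmetric])
  fix y assume "y \<in> set (map w u)"
  then obtain j where j: "j \<in> set u" "y = w j" by auto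
  then have "j \<in> {1..r}" using assms(2) by auto
  then show "w i * y = y * w i" using assms(3)[OF j(1)] far[of i j] far[of j i] assms(1) j(2) by metis
qed

text \<open>A far letter commutes, the letter just below the last one extends the word, the last
  letter cancels, and an interior letter is carried to the left end by one braid move, which lowers
  its index.\<close>

lemma desc_step:
  assumes k: "k \<le> r" and j: "1 \<le> j" "j \<le> Suc k" and i: "i \<in> {1..k}"
  shows "i + 1 < j \<Longrightarrow> W (desc k j) * w i = w i * W (desc k j)"
    "i + 1 = j \<Longrightarrow> W (desc k j) * w i = W (desc k i)"
    "i = j \<Longrightarrow> W (desc k j) * w i = W (desc k (Suc j))"
    "j < i \<Longrightarrow> W (desc k j) * w i = w (i - 1) * W (desc k j)"
proof -
  show "W (desc k j) * w i = w i * W (desc k j)" if "i + 1 < j"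
    by (rule W_far) (use that k j i in \<open>auto simp: set_desc\<close>)
  show "W (desc k j) * w i = W (desc k i)" if "i + 1 = j"
    using desc_snoc[of i k] i that by (auto simp: W_append W_Cons)
  show "W (desc k j) * w i = W (desc k (Suc j))" if "i = j"
    using desc_snoc[of i k] i that square[of i] k by (simp add: W_append W_Cons mult.assoc)
  show "W (desc k j) * w i = w (i - 1) * W (desc k j)" if ji: "j < i"
  proof -
    obtain h where h: "i = Suc (Suc h)" using ji j i by (cases i; cases "i - 1") auto
    have r: "Suc h \<in> {1..r}" "i \<in> {1..r}" using i k h by auto
    \<comment> \<open>The word is cut around the letters i and i - 1, between which the braid
      relation takes place. The letters after them commute with i, those before them with i -
      1.\<close>
    have d: "desc k j = desc k (Suc i) @ i # Suc h # desc h j"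
      using desc_split[of j i k] desc_Cons[of j "Suc h"] desc_Cons[of j h] ji i h by auto
    have c1: "W (desc h j) * w i = w i * W (desc h j)"
      by (rule W_far) (use r h j i k in \<open>auto simp: set_desc\<close>)
    have c2: "W (desc k (Suc i)) * w (Suc h) = w (Suc h) * W (desc k (Suc i))"
      by (rule W_far) (use r h j i k in \<open>auto simp: set_desc\<close>)
    have b: "w i * w (Suc h) * w i = w (Suc h) * w i * w (Suc h)" using braid[of "Suc h"] r h by auto
    have "W (desc k j) * w i = W (desc k (Suc i)) * (w i * w (Suc h) * (W (desc h j) * w i))"
      unfolding d by (simp add: W_append W_Cons mult.assoc)
    also have "\<dots> = W (desc k (Suc i)) * ((w i * w (Suc h) * w i) * W (desc h j))"
      unfolding c1 by (simp add: mult.assoc)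
    also have "\<dots> = (W (desc k (Suc i)) * w (Suc h)) * (w i * w (Suc h) * W (desc h j))"
      unfolding b by (simp add: mult.assoc)
    also have "\<dots> = w (i - 1) * W (desc k j)" unfolding c2 d using h by (simp add: W_append W_Cons mult.assoc)
    finally show ?thesis .
  qed
qed

lemma sort_word:
  assumes "k \<le> r" "set ws \<subseteq> {1..k}" "sort_word k ws = (v, j)"
  shows "set v \<subseteq> {1..<k} \<and> 1 \<le> j \<and> j \<le> Suc k \<and> W ws = W v * W (desc k j)"
  using assms(2,3)
proof (induction ws arbitrary: v j rule: rev_induct)
  case Nil
  then show ?case by (auto simp: sort_word_def)
next
  case (snoc i ws)
  obtain v' j' where s: "sort_word k ws = (v', j')" by (cases "sort_word k ws")
  have IH: "set v' \<subseteq> {1..<k}" "1 \<le> j'" "j' \<le> Suc k" "W ws = W v' * W (desc k j')"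
    using snoc.IH[OF _ s] snoc.prems(1) by auto
  have i: "i \<in> {1..k}" using snoc.prems by auto
  have e: "(v, j) = sort_step (v', j') i" using snoc.prems(2) s by (simp add: sort_word_def)
  note D = desc_step[OF assms(1) IH(2,3) i]
  have Ws: "W (ws @ [i]) = W v' * (W (desc k j') * w i)" by (simp add: W_append W_Cons IH(4) mult.assoc)
  consider "i + 1 < j'" | "i + 1 = j'" | "i = j'" | "j' < i" by linarith
  then show ?case
  proof cases
    case 1
    then show ?thesis unfolding Ws D(1)[OF 1] using e i IH by (auto simp: W_append W_Cons mult.assoc)
  next
    case 2
    then show ?thesis unfolding Ws D(2)[OF 2] using e i IH by auto
  next
    case 3
    then show ?thesis unfolding Ws D(3)[OF 3] using e i IH by auto
  next
    case 4
    then have "v = v' @ [i - 1]" "j = j'" using e by auto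
    then show ?thesis unfolding Ws D(4)[OF 4] using i IH 4 by (auto simp: W_append W_Cons mult.assoc)
  qed
qed

end

definition perm :: "nat list \<Rightarrow> nat \<Rightarrow> nat" where
  "perm ws = foldr (\<lambda>i f. transpose i (Suc i) \<circ> f) ws id"

lemma perm_Nil [simp]: "perm [] = id" by (simp add: perm_def)
lemma perm_Cons: "perm (i # ws) = transpose i (Suc i) \<circ> perm ws" by (simp add: perm_def)
lemma perm_append: "perm (us @ ws) = perm us \<circ> perm ws" by (induction us) (auto simp: perm_Cons)

lemma perm_permutes: "(\<And>i. i \<in> set ws \<Longrightarrow> a \<le> i \<and> Suc i \<le> b) \<Longrightarrow> perm ws permutes {a..b}"
proof (induction ws)
  case Nil
  show ?case unfolding perm_Nil by (rule permutes_id)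
next
  case (Cons i ws)
  then have "a \<le> i" "Suc i \<le> b" by simp_all
  then have "transpose i (Suc i) permutes {a..b}" by (intro permutes_swap_id) auto
  then show ?case unfolding perm_Cons using Cons by (intro permutes_compose) simp_all
qed

lemma bij_perm: "bij (perm ws)"
proof (induction ws)
  case (Cons i ws)
  then show ?case unfolding perm_Cons by (intro bij_comp) auto
qed (simp only: perm_Nil bij_id)

abbreviation pinv :: "('a \<Rightarrow> 'a) \<Rightarrow> 'a \<Rightarrow> 'a" where
  "pinv \<equiv> inv_into UNIV"

text \<open>The relations hold for the actual transpositions, so the sorting of a word is at the
  same time a factorization of its permutation.\<close>

interpretation perm_model: coxeter r "\<lambda>i. Endo (transpose i (Suc i))" for r
proof
  fix i j :: nat
  show "Endo (transpose i (Suc i)) * Endo (transpose i (Suc i)) = 1"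
    by (rule endo_eqI) (simp add: app_times app_one)
  show "Endo (transpose i (Suc i)) * Endo (transpose j (Suc j)) = Endo (transpose j (Suc j)) * Endo (transpose i (Suc i))"
    if "i + 2 \<le> j"
  proof (rule endo_eqI, rule ext)
    fix x show "app (Endo (transpose i (Suc i)) * Endo (transpose j (Suc j))) x =
        app (Endo (transpose j (Suc j)) * Endo (transpose i (Suc i))) x"
      using that by (auto simp: app_times transpose_def)
  qed
  show "Endo (transpose i (Suc i)) * Endo (transpose (Suc i) (Suc (Suc i))) * Endo (transpose i (Suc i)) =
      Endo (transpose (Suc i) (Suc (Suc i))) * Endo (transpose i (Suc i)) * Endo (transpose (Suc i) (Suc (Suc i)))"
    by (rule endo_eqI) (auto simp: app_times transpose_def fun_eq_iff)
qed

lemma app_W: "app (perm_model.W ws) = perm ws"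
  by (induction ws) (auto simp: perm_model.W_Cons perm_model.W_Nil app_times app_one perm_Cons)

lemma perm_desc: "j \<le> Suc k \<Longrightarrow> perm (desc k j) j = Suc k"
proof (induction "Suc k - j" arbitrary: j)
  case (Suc d)
  then have "perm (desc k j) j = perm (desc k (Suc j)) (Suc j)"
    using desc_snoc[of j k] by (simp add: perm_append perm_Cons)
  then show ?case using Suc by simp
qed simp

text \<open>The part \<open>v\<close> fixes k + 1 and the descending part sends j to k + 1. Thus j,
  which names the coset, can be read off from the permutation alone.\<close>

lemma perm_sort_word:
  assumes "set ws \<subseteq> {1..k}" "sort_word k ws = (v, j)"
  shows "perm ws = perm v \<circ> perm (desc k j)" "perm ws j = Suc k"
proof -
  have S: "set v \<subseteq> {1..<k}" "j \<le> Suc k" "perm_model.W ws = perm_model.W v * perm_model.W (desc k j)"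
    using perm_model.sort_word[OF order.refl assms] by auto
  then show e: "perm ws = perm v \<circ> perm (desc k j)" by (metis app_W app_times)
  have "perm v permutes {1..k}" by (rule perm_permutes) (use S in auto)
  then have "perm v (Suc k) = Suc k" by (simp add: permutes_def)
  then show "perm ws j = Suc k" using perm_desc[OF S(2)] e by simp
qed

context coxeter
begin

text \<open>Completeness of the Coxeter relations. After sorting, both words end in the same
  descending part, because its parameter is the preimage of k + 1. Cancelling this part leaves words
  in one generator less with equal permutations.\<close>

theorem W_eq_if_perm_eq:
  "\<lbrakk>k \<le> r; set us \<subseteq> {1..k}; set ws \<subseteq> {1..k}; perm us = perm ws\<rbrakk> \<Longrightarrow> W us = W ws"
proof (induction k arbitrary: us ws)
  case (Suc k)
  obtain v j where s: "sort_word (Suc k) us = (v, j)" by (cases "sort_word (Suc k) us")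
  obtain v' j' where s': "sort_word (Suc k) ws = (v', j')" by (cases "sort_word (Suc k) ws")
  note S = sort_word[OF Suc.prems(1,2) s] and S' = sort_word[OF Suc.prems(1,3) s']
  note P = perm_sort_word[OF Suc.prems(2) s] and P' = perm_sort_word[OF Suc.prems(3) s']
  have "j = j'" using P(2) P'(2) Suc.prems(4) bij_perm[of ws] by (metis bij_is_inj injD)
  moreover have "perm v = perm v'"
  proof
    fix x
    obtain y where "perm (desc (Suc k) j) y = x" using bij_perm[of "desc (Suc k) j"] by (metis bij_pointE)
    then show "perm v x = perm v' x" using P(1) P'(1) Suc.prems(4) \<open>j = j'\<close> by (metis comp_apply)
  qed
  then have "W v = W v'" using Suc.IH[of v v'] S S' Suc.prems(1) by force
  ultimately show ?case using S S' by metis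
next
  case 0
  then have "us = []" "ws = []" by (auto simp: subset_eq)
  then show ?case by simp
qed

end

text \<open>A descending word carries the preimage of b + 1 to b + 1, and what remains of the
  permutation fixes b + 1. The lower end stays free, since a permutation that fixes 1 and 2 will
  have to be written without the first two generators.\<close>

lemma adjacent_word_exists:
  "\<sigma> permutes {a..b} \<Longrightarrow> \<exists>ws. set ws \<subseteq> {a..<b} \<and> perm ws = \<sigma>"
proof (induction b arbitrary: \<sigma>)
  case 0
  have "\<sigma> = id"
  proof (cases "a = 0")
    case True
    then show ?thesis using 0 by (auto simp: permutes_sing)
  qed (use 0 in \<open>auto simp: permutes_empty\<close>)
  then show ?case by (intro exI[of _ "[]"]) auto
next
  case (Suc b)
  show ?case
  proof (cases "a \<le> Suc b")
    case False
    then have "\<sigma> = id" using Suc.prems by (auto simp: permutes_empty)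
    then show ?thesis by (intro exI[of _ "[]"]) auto
  next
    case True
    define j where "j = pinv \<sigma> (Suc b)"
    have j: "j \<in> {a..Suc b}" "\<sigma> j = Suc b"
      using permutes_in_image[OF permutes_inv[OF Suc.prems]] True permutes_inverses(1)[OF Suc.prems]
      by (auto simp: j_def)
    let ?d = "perm (desc b j)"
    have d: "?d permutes {a..Suc b}" by (rule perm_permutes) (use j in \<open>auto simp: set_desc\<close>)
    have dj: "?d j = Suc b" using perm_desc[of j b] j by simp
    have a1: "\<sigma> \<circ> pinv ?d permutes {a..Suc b}" using permutes_compose[OF permutes_inv[OF d] Suc.prems] .
    have a2: "(\<sigma> \<circ> pinv ?d) (Suc b) = Suc b" using dj j(2) permutes_inverses(2)[OF d] by (metis comp_apply)
    have "\<sigma> \<circ> pinv ?d permutes {a..b}"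
    proof (rule permutes_superset[OF a1])
      fix x assume "x \<in> {a..Suc b} - {a..b}"
      then have "x = Suc b" by auto
      then show "(\<sigma> \<circ> pinv ?d) x = x" using a2 by simp
    qed
    then obtain ws where ws: "set ws \<subseteq> {a..<b}" "perm ws = \<sigma> \<circ> pinv ?d" using Suc.IH by blast
    have "perm (ws @ desc b j) = \<sigma>"
      using ws(2) permutes_inv_o(2)[OF d] by (simp add: perm_append comp_assoc)
    moreover have "set (ws @ desc b j) \<subseteq> {a..<Suc b}" using ws(1) j by (auto simp: set_desc)
    ultimately show ?thesis by blast
  qed
qed

text \<open>Multiple transitivity: a transposition applied first corrects the next value and keeps
  the earlier ones. It serves to carry the strands 1, 2, 3, 4, on which the relations are used, to
  any other positions.\<close>

lemma permutes_with_values: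
  fixes n :: nat
  assumes "distinct xs" "set xs \<subseteq> {1..n}"
  shows "\<exists>\<pi>. \<pi> permutes {1..n} \<and> (\<forall>m<length xs. \<pi> (Suc m) = xs ! m)"
  using assms
proof (induction xs rule: rev_induct)
  case Nil
  then show ?case by (intro exI[of _ id] conjI permutes_id) simp
next
  case (snoc x xs)
  then obtain \<pi> where p: "\<pi> permutes {1..n}" "\<forall>m<length xs. \<pi> (Suc m) = xs ! m" by auto
  define y where "y = pinv \<pi> x"
  have y: "\<pi> y = x" using permutes_inverses(1)[OF p(1)] by (simp add: y_def)
  have yn: "y \<in> {1..n}" using permutes_in_image[OF permutes_inv[OF p(1)]] snoc.prems(2) by (auto simp: y_def)
  have len: "Suc (length xs) \<le> n"
    using card_mono[OF _ snoc.prems(2)] distinct_card[OF snoc.prems(1)] by simp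
  have ny: "y \<noteq> Suc m" if "m < length xs" for m using p(2) that y snoc.prems(1) by auto
  have "\<pi> \<circ> transpose (Suc (length xs)) y permutes {1..n}"
    by (rule permutes_compose[OF permutes_swap_id p(1)]) (use len yn in auto)
  moreover have "(\<pi> \<circ> transpose (Suc (length xs)) y) (Suc m) = (xs @ [x]) ! m" if "m < length (xs @ [x])" for m
  proof (cases "m = length xs")
    case True
    then show ?thesis using y by simp
  next
    case False
    then have m: "m < length xs" using that by simp
    then show ?thesis using p(2) ny[OF m] by (simp add: transpose_apply_other nth_append)
  qed
  ultimately show ?case by blast
qed

section \<open>Monoids satisfying the relations\<close>

text \<open>Twists, permutations and caps are fixed as concrete words because they are evaluated
  twice, in a monoid with the relations and as tangles. The choices made by \<open>SOME\<close> turn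
  out to be immaterial in both evaluations.\<close>

definition tword :: "nat \<Rightarrow> (nat \<Rightarrow> int) \<Rightarrow> gen list" where
  "tword n m = concat (map (\<lambda>i. t_power i (m i)) [1..<Suc n])"

definition wword :: "nat \<Rightarrow> (nat \<Rightarrow> nat) \<Rightarrow> gen list" where
  "wword n \<sigma> = map GW (SOME ws. set ws \<subseteq> {1..<n} \<and> perm ws = \<sigma>)"

text \<open>A conjugate of \<open>GF 1\<close> with a cap and a cup at i and j. The pair is ordered:
  exchanging i and j changes the value by twists.\<close>

definition uword :: "nat \<Rightarrow> nat \<Rightarrow> nat \<Rightarrow> gen list" where
  "uword n i j = (let \<pi> = SOME \<pi>. \<pi> permutes {1..n} \<and> \<pi> 1 = i \<and> \<pi> 2 = j
     in wword n \<pi> @ [GF 1] @ wword n (pinv \<pi>))"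

lemma wword_ex:
  assumes "\<sigma> permutes {1..n}"
  shows "\<exists>ws. set ws \<subseteq> {1..<n} \<and> perm ws = \<sigma> \<and> wword n \<sigma> = map GW ws"
proof -
  have "\<exists>ws. set ws \<subseteq> {1..<n} \<and> perm ws = \<sigma>" using adjacent_word_exists[OF assms] .
  from someI_ex[OF this] show ?thesis unfolding wword_def by blast
qed

lemma uword_ex:
  assumes "i \<in> {1..n}" "j \<in> {1..n}" "i \<noteq> j"
  shows "\<exists>\<pi>. \<pi> permutes {1..n} \<and> \<pi> 1 = i \<and> \<pi> 2 = j \<and> uword n i j = wword n \<pi> @ [GF 1] @ wword n (pinv \<pi>)"
proof -
  have "\<exists>\<pi>. \<pi> permutes {1..n} \<and> (\<forall>m<length [i, j]. \<pi> (Suc m) = [i, j] ! m)"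
    by (rule permutes_with_values) (use assms in auto)
  then obtain \<pi> where p: "\<pi> permutes {1..n}" "\<forall>m<2. \<pi> (Suc m) = [i, j] ! m" by auto
  then have "\<pi> 1 = i" "\<pi> 2 = j" using p(2)[rule_format, of 0] p(2)[rule_format, of 1] by (auto simp: numeral_2_eq_2)
  then have "\<exists>\<pi>. \<pi> permutes {1..n} \<and> \<pi> 1 = i \<and> \<pi> 2 = j" using p by blast
  from someI_ex[OF this] show ?thesis unfolding uword_def Let_def by blast
qed

lemma wword_gens: "\<sigma> permutes {1..n} \<Longrightarrow> set (wword n \<sigma>) \<subseteq> gens n"
proof -
  assume "\<sigma> permutes {1..n}"
  then obtain ws where ws: "set ws \<subseteq> {1..<n}" "wword n \<sigma> = map GW ws" using wword_ex by blast
  have "{1..<n} \<subseteq> {1..n - 1}" by auto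
  then show ?thesis using ws by (auto simp: gens_def)
qed

lemma tword_gens: "set (tword n m) \<subseteq> gens n"
  by (auto simp: tword_def t_power_def gens_def)

lemma uword_gens:
  assumes "n \<ge> 2" "i \<in> {1..n}" "j \<in> {1..n}" "i \<noteq> j"
  shows "set (uword n i j) \<subseteq> gens n"
proof -
  obtain \<pi> where pi: "\<pi> permutes {1..n}" "uword n i j = wword n \<pi> @ [GF 1] @ wword n (pinv \<pi>)"
    using uword_ex[OF assms(2-4)] by blast
  have "GF 1 \<in> gens n" using assms(1) by (auto simp: gens_def)
  then show ?thesis using wword_gens[OF pi(1)] wword_gens[OF permutes_inv[OF pi(1)]] pi(2) by auto
qed

text \<open>A monoid suffices, since the normal form involves no sums; the scalars z_k become
  elements \<open>\<zeta> k\<close> that commute with the generators. Most relations with an F are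
  stated for \<open>GF 1\<close> only: \<open>w_w_F\<close>, stated at all indices, makes every
  \<open>GF i\<close> a conjugate of it.\<close>

locale atl_monoid =
  fixes n :: nat and \<chi> :: "gen \<Rightarrow> 'm :: monoid_mult" and \<zeta> :: "nat \<Rightarrow> 'm"
  assumes n2: "n \<ge> 2"
    and t_tinv: "i \<in> {1..n} \<Longrightarrow> \<chi> (GT i) * \<chi> (GTinv i) = 1"
    and tinv_t: "i \<in> {1..n} \<Longrightarrow> \<chi> (GTinv i) * \<chi> (GT i) = 1"
    and t_t: "\<lbrakk>i \<in> {1..n}; j \<in> {1..n}; i < j\<rbrakk> \<Longrightarrow> \<chi> (GT i) * \<chi> (GT j) = \<chi> (GT j) * \<chi> (GT i)"
    and w_w: "i \<in> {1..n - 1} \<Longrightarrow> \<chi> (GW i) * \<chi> (GW i) = 1"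
    and w_far: "\<lbrakk>i \<in> {1..n - 1}; j \<in> {1..n - 1}; i + 2 \<le> j\<rbrakk> \<Longrightarrow> \<chi> (GW i) * \<chi> (GW j) = \<chi> (GW j) * \<chi> (GW i)"
    and w_braid: "\<lbrakk>i \<in> {1..n - 1}; Suc i \<in> {1..n - 1}\<rbrakk> \<Longrightarrow>
      \<chi> (GW i) * \<chi> (GW (Suc i)) * \<chi> (GW i) = \<chi> (GW (Suc i)) * \<chi> (GW i) * \<chi> (GW (Suc i))"
    and w_t: "i \<in> {1..n - 1} \<Longrightarrow> \<chi> (GW i) * \<chi> (GT i) = \<chi> (GT (Suc i)) * \<chi> (GW i)"
    and w_t_Suc: "i \<in> {1..n - 1} \<Longrightarrow> \<chi> (GW i) * \<chi> (GT (Suc i)) = \<chi> (GT i) * \<chi> (GW i)"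
    and w_t_far: "\<lbrakk>i \<in> {1..n - 1}; j \<in> {1..n}; j \<noteq> i; j \<noteq> Suc i\<rbrakk> \<Longrightarrow> \<chi> (GW i) * \<chi> (GT j) = \<chi> (GT j) * \<chi> (GW i)"
    and F_t_F: "\<chi> (GF 1) * prod_list (map \<chi> (t_power 1 a)) * \<chi> (GF 1) = \<zeta> (nat \<bar>a\<bar>) * \<chi> (GF 1)"
    and F_w: "\<chi> (GF 1) * \<chi> (GW 1) = \<chi> (GF 1) * \<chi> (GT 1)"
    and F_t: "\<chi> (GF 1) * \<chi> (GT 1) = \<chi> (GF 1) * \<chi> (GTinv 2)"
    and w_F: "\<chi> (GW 1) * \<chi> (GF 1) = \<chi> (GTinv 1) * \<chi> (GF 1)"
    and t_F: "\<chi> (GTinv 1) * \<chi> (GF 1) = \<chi> (GT 2) * \<chi> (GF 1)"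
    and F_far: "n \<ge> 4 \<Longrightarrow> \<chi> (GF 1) * \<chi> (GF 3) = \<chi> (GF 3) * \<chi> (GF 1)"
    and F_w_far: "\<lbrakk>j \<in> {1..n - 1}; 3 \<le> j\<rbrakk> \<Longrightarrow> \<chi> (GF 1) * \<chi> (GW j) = \<chi> (GW j) * \<chi> (GF 1)"
    and F_t_far: "\<lbrakk>j \<in> {1..n}; 3 \<le> j\<rbrakk> \<Longrightarrow> \<chi> (GF 1) * \<chi> (GT j) = \<chi> (GT j) * \<chi> (GF 1)"
    and F_w_F: "n \<ge> 3 \<Longrightarrow> \<chi> (GF 1) * \<chi> (GW 2) * \<chi> (GF 1) = \<chi> (GF 1)"
    and F_w_F': "n \<ge> 3 \<Longrightarrow> \<chi> (GF 2) * \<chi> (GW 1) * \<chi> (GF 2) = \<chi> (GF 2)"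
    and w_w_F: "\<lbrakk>i \<in> {1..n - 1}; Suc i \<in> {1..n - 1}\<rbrakk> \<Longrightarrow>
      \<chi> (GW i) * \<chi> (GW (Suc i)) * \<chi> (GF i) = \<chi> (GF (Suc i)) * \<chi> (GW i) * \<chi> (GW (Suc i))"
    and \<zeta>_commute: "x \<in> gens n \<Longrightarrow> \<zeta> k * \<chi> x = \<chi> x * \<zeta> k"
begin

definition ev :: "gen list \<Rightarrow> 'm" where
  "ev u = prod_list (map \<chi> u)"

lemma ev_append: "ev (u @ v) = ev u * ev v" by (simp add: ev_def)
lemma ev_Nil [simp]: "ev [] = 1" by (simp add: ev_def)
lemma ev_Cons: "ev (x # u) = \<chi> x * ev u" by (simp add: ev_def)

lemma ev_\<zeta>: "set u \<subseteq> gens n \<Longrightarrow> \<zeta> k * ev u = ev u * \<zeta> k"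
  unfolding ev_def by (rule commute_prod_list) (use \<zeta>_commute in auto)

abbreviation ix :: "nat set" where "ix \<equiv> {1..n}"
abbreviation pm :: "(nat \<Rightarrow> nat) \<Rightarrow> bool" where "pm \<sigma> \<equiv> \<sigma> permutes {1..n}"

subsection \<open>The group generated by the crossings and the twists\<close>

definition tz :: "nat \<Rightarrow> int \<Rightarrow> 'm" where
  "tz i a = ev (t_power i a)"

lemma tz_0 [simp]: "tz i 0 = 1"
  by (simp add: tz_def t_power_def)

lemma tz_1: "tz i 1 = \<chi> (GT i)" and tz_neg_1: "tz i (- 1) = \<chi> (GTinv i)"
  by (simp_all add: tz_def t_power_def ev_Cons)

lemma ev_replicate: "ev (replicate k x) = \<chi> x ^ k"
  by (induction k) (auto simp: ev_Cons)

lemma tz_nat: "tz i (int k) = \<chi> (GT i) ^ k" and tz_neg_nat: "tz i (- int k) = \<chi> (GTinv i) ^ k"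
  by (auto simp: tz_def t_power_def ev_replicate)

lemma tz_Suc: "i \<in> ix \<Longrightarrow> tz i (a + 1) = tz i a * \<chi> (GT i)"
proof (cases a)
  case (nonneg k)
  have "tz i (int (Suc k)) = tz i (int k) * \<chi> (GT i)" unfolding tz_nat by (simp add: power_commutes)
  then show ?thesis using nonneg by (simp add: add.commute)
next
  assume i: "i \<in> ix"
  case (neg k)
  have "tz i (- int (Suc k)) * \<chi> (GT i) = tz i (- int k)"
    unfolding tz_neg_nat using tinv_t[OF i] by (simp add: power_commutes[symmetric] mult.assoc)
  then show ?thesis using neg by simp
qed

lemma tz_pred: "i \<in> ix \<Longrightarrow> tz i (a - 1) = tz i a * \<chi> (GTinv i)"
  using tz_Suc[of i "a - 1"] t_tinv[of i] by (simp add: mult.assoc)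

lemma tz_add: "i \<in> ix \<Longrightarrow> tz i (a + b) = tz i a * tz i b"
proof (induction b rule: int_induct[of _ 0])
  case base
  then show ?case by simp
next
  case (step1 b)
  then show ?case using tz_Suc[of i "a + b"] tz_Suc[of i b] by (simp add: mult.assoc add.assoc)
next
  case (step2 b)
  then show ?case using tz_pred[of i "a + b"] tz_pred[of i b] by (simp add: mult.assoc add_diff_eq)
qed

lemma tz_cancel: "i \<in> ix \<Longrightarrow> tz i a * tz i (- a) = 1"
  using tz_add[of i a "- a"] by simp

lemma commute_tinv:
  assumes "i \<in> ix" "x * \<chi> (GT i) = \<chi> (GT j) * x" "j \<in> ix"
  shows "x * \<chi> (GTinv i) = \<chi> (GTinv j) * x"
proof -
  have "x * \<chi> (GTinv i) = \<chi> (GTinv j) * (\<chi> (GT j) * x) * \<chi> (GTinv i)"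
    using tinv_t[OF assms(3)] by (simp add: mult.assoc[symmetric])
  also have "\<dots> = \<chi> (GTinv j) * (x * \<chi> (GT i)) * \<chi> (GTinv i)" using assms(2) by simp
  also have "\<dots> = \<chi> (GTinv j) * x" using t_tinv[OF assms(1)] by (simp add: mult.assoc)
  finally show ?thesis .
qed

lemma commute_power: "x * y = y' * x \<Longrightarrow> x * y ^ k = y' ^ k * (x :: 'm)"
proof (induction k)
  case (Suc k)
  have "x * y ^ Suc k = (x * y) * y ^ k" by (simp add: mult.assoc)
  also have "\<dots> = y' * (x * y ^ k)" using Suc by (simp add: mult.assoc)
  also have "\<dots> = y' ^ Suc k * x" using Suc by (simp add: mult.assoc)
  finally show ?case .
qed simp

lemma commute_tz:
  assumes "i \<in> ix" "x * \<chi> (GT i) = \<chi> (GT j) * x" "j \<in> ix"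
  shows "x * tz i a = tz j a * x"
proof (cases a)
  case (nonneg k)
  then show ?thesis using commute_power[OF assms(2)] by (simp add: tz_nat)
next
  case (neg k)
  then show ?thesis unfolding neg tz_neg_nat by (intro commute_power commute_tinv assms)
qed

lemma tz_commute: "i \<in> ix \<Longrightarrow> j \<in> ix \<Longrightarrow> tz i a * tz j b = tz j b * tz i a"
proof -
  assume i: "i \<in> ix" "j \<in> ix"
  have "\<chi> (GT j) * \<chi> (GT i) = \<chi> (GT i) * \<chi> (GT j)" using t_t[of i j] t_t[of j i] i by (cases i j rule: linorder_cases) auto
  then have "\<chi> (GT j) * tz i a = tz i a * \<chi> (GT j)" using commute_tz i by blast
  then show ?thesis using commute_tz[of j "tz i a" j b] i by simp
qed

lemma set_upt_ix: "set [1..<Suc n] = ix" by auto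

definition tau :: "(nat \<Rightarrow> int) \<Rightarrow> 'm" where
  "tau m = ev (tword n m)"

lemma tau_prod: "tau m = prod_list (map (\<lambda>i. tz i (m i)) [1..<Suc n])"
proof -
  have "ev (concat (map (\<lambda>i. t_power i (m i)) is)) = prod_list (map (\<lambda>i. tz i (m i)) is)" for "is"
    by (induction "is") (auto simp: ev_append tz_def)
  then show ?thesis by (simp only: tau_def tword_def)
qed

lemma tau_cong: "(\<And>i. i \<in> ix \<Longrightarrow> m i = m' i) \<Longrightarrow> tau m = tau m'"
  unfolding tau_prod by (intro arg_cong[of _ _ prod_list] map_cong) auto

lemma tau_add: "tau (\<lambda>i. m i + m' i) = tau m * tau m'"
proof -
  have "set is \<subseteq> ix \<Longrightarrow> prod_list (map (\<lambda>i. tz i (m i + m' i)) is) =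
      prod_list (map (\<lambda>i. tz i (m i)) is) * prod_list (map (\<lambda>i. tz i (m' i)) is)" for "is"
  proof (induction "is")
    case (Cons i "is")
    let ?A = "prod_list (map (\<lambda>i. tz i (m i)) is)" and ?B = "prod_list (map (\<lambda>i. tz i (m' i)) is)"
    have c: "tz i (m' i) * ?A = ?A * tz i (m' i)"
      by (rule commute_prod_list) (use Cons.prems tz_commute in auto)
    have "prod_list (map (\<lambda>i. tz i (m i + m' i)) (i # is)) = tz i (m i) * (tz i (m' i) * ?A) * ?B"
      using Cons tz_add[of i] by (simp add: mult.assoc)
    then show ?case unfolding c by (simp add: mult.assoc)
  qed simp
  from this[OF equalityD1[OF set_upt_ix]] show ?thesis unfolding tau_prod .
qed

definition dl :: "nat \<Rightarrow> int \<Rightarrow> nat \<Rightarrow> int" where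
  "dl i a = (\<lambda>k. if k = i then a else 0)"

lemma tau_zero [simp]: "tau (\<lambda>_. 0) = 1"
proof -
  have "prod_list (map (\<lambda>i. tz i 0) is) = 1" for "is" :: "nat list" by (induction "is") auto
  then show ?thesis by (simp only: tau_prod)
qed

lemma tau_dl: "i \<in> ix \<Longrightarrow> tau (dl i a) = tz i a"
proof -
  assume i: "i \<in> ix"
  have one: "i \<notin> set is \<Longrightarrow> prod_list (map (\<lambda>k. tz k (dl i a k)) is) = 1" for "is"
    by (induction "is") (auto simp: dl_def)
  have "[1..<Suc n] = [1..<i] @ [i..<Suc n]" using i upt_add_eq_append[of 1 i "Suc n - i"] by simp
  also have "[i..<Suc n] = i # [Suc i..<Suc n]" using i by (intro upt_conv_Cons) auto
  finally have "[1..<Suc n] = [1..<i] @ i # [Suc i..<Suc n]" .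
  then have "tau (dl i a) = prod_list (map (\<lambda>k. tz k (dl i a k)) ([1..<i] @ i # [Suc i..<Suc n]))"
    by (simp only: tau_prod)
  also have "\<dots> = tz i a" using one[of "[1..<i]"] one[of "[Suc i..<Suc n]"] by (simp add: dl_def)
  finally show ?thesis .
qed

sublocale cox: coxeter "n - 1" "\<lambda>i. \<chi> (GW i)"
  by unfold_locales (use w_w w_far w_braid in auto)

definition p :: "(nat \<Rightarrow> nat) \<Rightarrow> 'm" where
  "p \<sigma> = ev (wword n \<sigma>)"

lemma ev_map_GW: "ev (map GW ws) = cox.W ws"
  by (simp add: ev_def cox.W_def comp_def)

lemma lessn: "{1..<n} = {1..n - 1}" using n2 by auto

text \<open>Completeness of the Coxeter relations removes the arbitrary choice in
  \<open>wword\<close>. This is what makes \<open>p\<close> multiplicative.\<close>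

lemma p_perm: "set ws \<subseteq> {1..<n} \<Longrightarrow> p (perm ws) = cox.W ws"
proof -
  assume ws: "set ws \<subseteq> {1..<n}"
  have "perm ws permutes {1..n}" by (rule perm_permutes) (use ws in force)
  then obtain us where us: "set us \<subseteq> {1..<n}" "perm us = perm ws" "wword n (perm ws) = map GW us"
    using wword_ex by blast
  then have "p (perm ws) = cox.W us" by (simp add: p_def ev_map_GW)
  also have "\<dots> = cox.W ws" using us ws cox.W_eq_if_perm_eq[OF order.refl, of us ws] unfolding lessn by blast
  finally show ?thesis .
qed

lemma pm_word: "pm \<sigma> \<Longrightarrow> \<exists>ws. set ws \<subseteq> {1..<n} \<and> perm ws = \<sigma>"
  using adjacent_word_exists by blast

lemma p_comp: "pm \<sigma> \<Longrightarrow> pm \<rho> \<Longrightarrow> p (\<sigma> \<circ> \<rho>) = p \<sigma> * p \<rho>"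
proof -
  assume "pm \<sigma>" "pm \<rho>"
  then obtain us ws where u: "set us \<subseteq> {1..<n}" "perm us = \<sigma>" "set ws \<subseteq> {1..<n}" "perm ws = \<rho>"
    using pm_word by metis
  have "p (perm (us @ ws)) = p (perm us) * p (perm ws)"
    using p_perm[of "us @ ws"] p_perm[of us] p_perm[of ws] u by (simp add: cox.W_append)
  then show ?thesis by (simp add: u perm_append)
qed

lemma p_id [simp]: "p id = 1"
  using p_perm[of "[]"] by simp

lemma p_w: "i \<in> {1..n - 1} \<Longrightarrow> p (transpose i (Suc i)) = \<chi> (GW i)"
  using p_perm[of "[i]"] lessn by (auto simp: perm_Cons cox.W_Cons)

lemma p_inv: "pm \<sigma> \<Longrightarrow> p \<sigma> * p (pinv \<sigma>) = 1" "pm \<sigma> \<Longrightarrow> p (pinv \<sigma>) * p \<sigma> = 1"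
  using p_comp[of \<sigma> "pinv \<sigma>"] p_comp[of "pinv \<sigma>" \<sigma>] permutes_inv[of \<sigma> ix] permutes_inv_o[of \<sigma> ix] p_id
  by metis+

lemma pm_in: "pm \<sigma> \<Longrightarrow> i \<in> ix \<Longrightarrow> \<sigma> i \<in> ix"
  using permutes_in_image by metis

lemma p_tz: "pm \<sigma> \<Longrightarrow> i \<in> ix \<Longrightarrow> p \<sigma> * tz i a = tz (\<sigma> i) a * p \<sigma>"
proof -
  assume s: "pm \<sigma>" and i: "i \<in> ix"
  obtain ws where ws: "set ws \<subseteq> {1..<n}" "perm ws = \<sigma>" using pm_word[OF s] by blast
  have "i \<in> ix \<Longrightarrow> cox.W ws * tz i a = tz (perm ws i) a * cox.W ws \<and> perm ws i \<in> ix" for i using ws(1)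
  proof (induction ws)
    case (Cons k ws)
    let ?j = "perm ws i"
    have IH: "cox.W ws * tz i a = tz ?j a * cox.W ws" "?j \<in> ix" using Cons by auto
    have k: "k \<in> {1..n - 1}" using Cons.prems(2) lessn by auto
    have "\<chi> (GW k) * \<chi> (GT ?j) = \<chi> (GT (transpose k (Suc k) ?j)) * \<chi> (GW k)"
      using w_t[OF k] w_t_Suc[OF k] w_t_far[OF k IH(2)] by (cases "?j = k"; cases "?j = Suc k") auto
    moreover have m: "transpose k (Suc k) ?j \<in> ix" using k IH(2) by (auto simp: transpose_def)
    ultimately have "\<chi> (GW k) * tz ?j a = tz (transpose k (Suc k) ?j) a * \<chi> (GW k)"
      using commute_tz IH(2) by blast
    then show ?case using IH m by (simp add: cox.W_Cons perm_Cons mult.assoc) (simp add: mult.assoc[symmetric])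
  qed simp
  from this[OF i] show ?thesis using ws p_perm[OF ws(1)] by simp
qed

lemma p_tau: "pm \<sigma> \<Longrightarrow> p \<sigma> * tau m = tau (m \<circ> pinv \<sigma>) * p \<sigma>"
proof -
  assume s: "pm \<sigma>"
  have "set is \<subseteq> ix \<Longrightarrow> p \<sigma> * prod_list (map (\<lambda>i. tz i (m i)) is) = prod_list (map (\<lambda>i. tz (\<sigma> i) (m i)) is) * p \<sigma>" for "is"
  proof (induction "is")
    case (Cons i "is")
    have "p \<sigma> * prod_list (map (\<lambda>i. tz i (m i)) (i # is)) = (p \<sigma> * tz i (m i)) * prod_list (map (\<lambda>i. tz i (m i)) is)"
      by (simp add: mult.assoc)
    also have "\<dots> = tz (\<sigma> i) (m i) * (p \<sigma> * prod_list (map (\<lambda>i. tz i (m i)) is))"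
      using p_tz[OF s, of i] Cons.prems by (simp add: mult.assoc)
    also have "\<dots> = prod_list (map (\<lambda>i. tz (\<sigma> i) (m i)) (i # is)) * p \<sigma>" using Cons by (simp add: mult.assoc)
    finally show ?case .
  qed simp
  from this[OF equalityD1[OF set_upt_ix]]
  have "p \<sigma> * tau m = prod_list (map (\<lambda>i. tz (\<sigma> i) (m i)) [1..<Suc n]) * p \<sigma>"
    unfolding tau_prod .
  also have "map (\<lambda>i. tz (\<sigma> i) (m i)) [1..<Suc n] = map (\<lambda>i. tz i ((m \<circ> pinv \<sigma>) i)) (map \<sigma> [1..<Suc n])"
    using permutes_inverses(2)[OF s] by simp
  also have "prod_list (map (\<lambda>i. tz i ((m \<circ> pinv \<sigma>) i)) (map \<sigma> [1..<Suc n])) = tau (m \<circ> pinv \<sigma>)"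
    unfolding tau_prod
  proof (rule prod_list_reorder)
    have st: "set [1..<Suc n] = ix" by auto
    have "set (map \<sigma> [1..<Suc n]) = set [1..<Suc n]" unfolding set_map st using permutes_image[OF s] .
    moreover have "distinct (map \<sigma> [1..<Suc n])" unfolding distinct_map using permutes_inj_on[OF s] by simp
    ultimately show "mset (map \<sigma> [1..<Suc n]) = mset [1..<Suc n]"
      using set_eq_iff_mset_eq_distinct distinct_upt by blast
    show "tz x ((m \<circ> pinv \<sigma>) x) * tz y ((m \<circ> pinv \<sigma>) y) = tz y ((m \<circ> pinv \<sigma>) y) * tz x ((m \<circ> pinv \<sigma>) x)"
      if "x \<in> set (map \<sigma> [1..<Suc n])" "y \<in> set (map \<sigma> [1..<Suc n])" for x y
      using that tz_commute \<open>set (map \<sigma> [1..<Suc n]) = set [1..<Suc n]\<close> st by blast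
  qed
  finally show ?thesis .
qed

text \<open>A general element of the semidirect product, with the twist on the left;
  \<open>g_mult\<close> is its multiplication law.\<close>

definition g :: "(nat \<Rightarrow> int) \<Rightarrow> (nat \<Rightarrow> nat) \<Rightarrow> 'm" where
  "g m \<sigma> = tau m * p \<sigma>"

lemma g_mult: "pm \<sigma> \<Longrightarrow> pm \<sigma>' \<Longrightarrow> g m \<sigma> * g m' \<sigma>' = g (\<lambda>i. m i + m' (pinv \<sigma> i)) (\<sigma> \<circ> \<sigma>')"
proof -
  assume s: "pm \<sigma>" "pm \<sigma>'"
  have "g m \<sigma> * g m' \<sigma>' = tau m * (p \<sigma> * tau m') * p \<sigma>'" by (simp add: g_def mult.assoc)
  also have "\<dots> = tau m * tau (m' \<circ> pinv \<sigma>) * p (\<sigma> \<circ> \<sigma>')" using p_tau s p_comp by (simp add: mult.assoc)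
  also have "\<dots> = g (\<lambda>i. m i + m' (pinv \<sigma> i)) (\<sigma> \<circ> \<sigma>')" by (simp add: g_def tau_add comp_def)
  finally show ?thesis .
qed

subsection \<open>Caps and cups in arbitrary position\<close>

definition U :: "nat \<Rightarrow> nat \<Rightarrow> 'm" where
  "U i j = ev (uword n i j)"

text \<open>A permutation fixing 1 and 2 is a word in w_3, ..., w_(n-1), and each of these commutes
  with F_1.\<close>

lemma F_commute_p:
  assumes s: "pm \<sigma>" and f: "\<sigma> 1 = 1" "\<sigma> 2 = 2"
  shows "p \<sigma> * \<chi> (GF 1) = \<chi> (GF 1) * p \<sigma>"
proof -
  have "\<sigma> permutes {3..n}"
  proof (rule permutes_superset[OF s])
    fix x assume "x \<in> ix - {3..n}"
    then have "x = 1 \<or> x = 2" by auto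
    then show "\<sigma> x = x" using f by auto
  qed
  then obtain ws where ws: "set ws \<subseteq> {3..<n}" "perm ws = \<sigma>" using adjacent_word_exists by blast
  have "set ws \<subseteq> {1..<n}" using ws(1) by force
  then have "p \<sigma> = prod_list (map (\<lambda>i. \<chi> (GW i)) ws)" using p_perm ws(2) cox.W_def by auto
  moreover have "\<chi> (GF 1) * prod_list (map (\<lambda>i. \<chi> (GW i)) ws) = prod_list (map (\<lambda>i. \<chi> (GW i)) ws) * \<chi> (GF 1)"
  proof (rule commute_prod_list)
    fix y assume "y \<in> set (map (\<lambda>i. \<chi> (GW i)) ws)"
    then obtain k where "k \<in> set ws" "y = \<chi> (GW k)" by auto
    then show "\<chi> (GF 1) * y = y * \<chi> (GF 1)" using F_w_far[of k] ws(1) by force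
  qed
  ultimately show ?thesis by simp
qed

lemma one_two: "1 \<in> ix" "2 \<in> ix" using n2 by auto

text \<open>Two permutations with the same values at 1 and 2 differ by one that fixes 1 and 2, and
  F_1 lets that one through. Hence the permutation chosen in \<open>uword\<close> may be replaced by
  any other suitable one.\<close>

lemma U_conj:
  assumes s: "pm \<sigma>"
  shows "p \<sigma> * \<chi> (GF 1) * p (pinv \<sigma>) = U (\<sigma> 1) (\<sigma> 2)"
proof -
  have ne: "\<sigma> 1 \<noteq> \<sigma> 2" using permutes_inj[OF s] by (simp add: inj_eq)
  obtain \<pi> where pi: "pm \<pi>" "\<pi> 1 = \<sigma> 1" "\<pi> 2 = \<sigma> 2"
    "uword n (\<sigma> 1) (\<sigma> 2) = wword n \<pi> @ [GF 1] @ wword n (pinv \<pi>)"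
    using uword_ex[OF pm_in[OF s one_two(1)] pm_in[OF s one_two(2)] ne] by blast
  have U: "U (\<sigma> 1) (\<sigma> 2) = p \<pi> * \<chi> (GF 1) * p (pinv \<pi>)"
    unfolding U_def pi(4) by (simp add: ev_append ev_Cons p_def mult.assoc)
  define \<rho> where "\<rho> = pinv \<pi> \<circ> \<sigma>"
  have r: "pm \<rho>" unfolding \<rho>_def using permutes_compose[OF s permutes_inv[OF pi(1)]] .
  have "\<rho> 1 = 1" "\<rho> 2 = 2" using pi(2,3) permutes_inverses(2)[OF pi(1)] unfolding \<rho>_def by (metis comp_apply)+
  then have c: "p \<rho> * \<chi> (GF 1) = \<chi> (GF 1) * p \<rho>" using F_commute_p r by blast
  have "\<sigma> = \<pi> \<circ> \<rho>" unfolding \<rho>_def using permutes_inv_o(1)[OF pi(1)] by (simp add: comp_assoc[symmetric])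
  then have ps: "p \<sigma> = p \<pi> * p \<rho>" using p_comp[OF pi(1) r] by simp
  have "p \<sigma> * \<chi> (GF 1) * p (pinv \<sigma>) = p \<pi> * (p \<rho> * \<chi> (GF 1)) * p (pinv \<sigma>)" by (simp add: ps mult.assoc)
  also have "\<dots> = p \<pi> * \<chi> (GF 1) * (p \<rho> * p (pinv \<sigma>))" unfolding c by (simp add: mult.assoc)
  also have "p \<rho> * p (pinv \<sigma>) = p (pinv \<pi>)"
  proof -
    have "p \<rho> * p (pinv \<sigma>) = p (pinv \<pi>) * (p \<pi> * p \<rho>) * p (pinv \<sigma>)"
      using p_inv(2)[OF pi(1)] by (simp add: mult.assoc[symmetric])
    also have "\<dots> = p (pinv \<pi>)" unfolding ps[symmetric] using p_inv(1)[OF s] by (simp add: mult.assoc)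
    finally show ?thesis .
  qed
  finally show ?thesis unfolding U by (simp add: mult.assoc)
qed

lemma p_U:
  assumes s: "pm \<sigma>" and ij: "i \<in> ix" "j \<in> ix" "i \<noteq> j"
  shows "p \<sigma> * U i j = U (\<sigma> i) (\<sigma> j) * p \<sigma>"
proof -
  obtain \<pi> where pi: "pm \<pi>" "\<pi> 1 = i" "\<pi> 2 = j" using uword_ex[OF ij] by blast
  have sp: "pm (\<sigma> \<circ> \<pi>)" using permutes_compose[OF pi(1) s] .
  have ip: "p (pinv (\<sigma> \<circ> \<pi>)) * p \<sigma> = p (pinv \<pi>)"
  proof -
    have "p (pinv (\<sigma> \<circ> \<pi>)) * p \<sigma> = p (pinv (\<sigma> \<circ> \<pi>)) * (p \<sigma> * p \<pi>) * p (pinv \<pi>)"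
      using p_inv(1)[OF pi(1)] by (simp add: mult.assoc)
    also have "\<dots> = p (pinv \<pi>)" unfolding p_comp[OF s pi(1), symmetric] using p_inv(2)[OF sp] by simp
    finally show ?thesis .
  qed
  have "p \<sigma> * U i j = p \<sigma> * (p \<pi> * \<chi> (GF 1) * p (pinv \<pi>))" using U_conj[OF pi(1)] pi by simp
  also have "\<dots> = p (\<sigma> \<circ> \<pi>) * \<chi> (GF 1) * p (pinv (\<sigma> \<circ> \<pi>)) * p \<sigma>"
    using ip p_comp[OF s pi(1)] by (simp add: mult.assoc)
  also have "\<dots> = U (\<sigma> i) (\<sigma> j) * p \<sigma>" using U_conj[OF sp] pi by simp
  finally show ?thesis .
qed

lemma U_12: "U 1 2 = \<chi> (GF 1)"
  using U_conj[OF permutes_id[of ix]] p_id by (simp add: inv_id)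

text \<open>The element w_i w_(i+1) conjugates F_i to F_(i+1), and its permutation sends i, i + 1 to
  i + 1, i + 2.\<close>

lemma F_U: "i \<in> {1..n - 1} \<Longrightarrow> \<chi> (GF i) = U i (Suc i)"
proof (induction i)
  case (Suc i)
  show ?case
  proof (cases "i = 0")
    case True
    then show ?thesis using U_12 by (simp add: numeral_2_eq_2)
  next
    case False
    then have i: "i \<in> {1..n - 1}" "Suc i \<in> {1..n - 1}" using Suc.prems by auto
    let ?\<sigma> = "transpose i (Suc i) \<circ> transpose (Suc i) (Suc (Suc i))"
    have s1: "pm (transpose i (Suc i))" "pm (transpose (Suc i) (Suc (Suc i)))"
      using i by (auto intro!: permutes_swap_id)
    then have s: "pm ?\<sigma>" by (intro permutes_compose)
    have pw: "p ?\<sigma> = \<chi> (GW i) * \<chi> (GW (Suc i))" using p_comp[OF s1] p_w i by simp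
    have "\<chi> (GF (Suc i)) * p ?\<sigma> = p ?\<sigma> * U i (Suc i)"
      unfolding pw using w_w_F[OF i] Suc.IH[OF i(1)] by (simp add: mult.assoc)
    also have "\<dots> = U (Suc i) (Suc (Suc i)) * p ?\<sigma>"
      using p_U[OF s, of i "Suc i"] i by auto
    finally have "\<chi> (GF (Suc i)) * p ?\<sigma> * p (pinv ?\<sigma>) = U (Suc i) (Suc (Suc i)) * p ?\<sigma> * p (pinv ?\<sigma>)" by simp
    then show ?thesis using p_inv(1)[OF s] by (simp add: mult.assoc)
  qed
qed simp

end

lemma conj_transpose:
  assumes "\<pi> permutes S"
  shows "\<pi> \<circ> transpose a b \<circ> pinv \<pi> = transpose (\<pi> a) (\<pi> b)"
proof
  fix x
  obtain y where y: "x = \<pi> y" using permutes_surj[OF assms] by (metis surjD)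
  have "pinv \<pi> x = y" using permutes_inverses(2)[OF assms] y by simp
  then show "(\<pi> \<circ> transpose a b \<circ> pinv \<pi>) x = transpose (\<pi> a) (\<pi> b) x"
    using permutes_inj[OF assms] y by (auto simp: transpose_def inj_eq)
qed

context atl_monoid
begin

text \<open>Applying \<open>cj\<close> to both sides transports a relation among the first few
  strands to arbitrary strands.\<close>

definition cj :: "(nat \<Rightarrow> nat) \<Rightarrow> 'm \<Rightarrow> 'm" where
  "cj \<pi> x = p \<pi> * x * p (pinv \<pi>)"

lemma cj_mult: "pm \<pi> \<Longrightarrow> cj \<pi> (x * y) = cj \<pi> x * cj \<pi> y"
proof -
  assume "pm \<pi>"
  have "cj \<pi> x * cj \<pi> y = p \<pi> * x * (p (pinv \<pi>) * p \<pi>) * y * p (pinv \<pi>)" by (simp add: cj_def mult.assoc)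
  then show ?thesis using p_inv(2)[OF \<open>pm \<pi>\<close>] by (simp add: cj_def mult.assoc)
qed

lemma cj_F: "pm \<pi> \<Longrightarrow> cj \<pi> (\<chi> (GF 1)) = U (\<pi> 1) (\<pi> 2)"
  unfolding cj_def by (rule U_conj)

lemma cj_U: "pm \<pi> \<Longrightarrow> i \<in> ix \<Longrightarrow> j \<in> ix \<Longrightarrow> i \<noteq> j \<Longrightarrow> cj \<pi> (U i j) = U (\<pi> i) (\<pi> j)"
  unfolding cj_def using p_U p_inv(1) by (simp add: mult.assoc)

lemma cj_tz: "pm \<pi> \<Longrightarrow> i \<in> ix \<Longrightarrow> cj \<pi> (tz i a) = tz (\<pi> i) a"
  unfolding cj_def using p_tz p_inv(1) by (simp add: mult.assoc)

lemma cj_p: "pm \<pi> \<Longrightarrow> pm \<rho> \<Longrightarrow> cj \<pi> (p \<rho>) = p (\<pi> \<circ> \<rho> \<circ> pinv \<pi>)"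
  unfolding cj_def using p_comp permutes_compose permutes_inv by metis

lemma pm_tr: "i \<in> ix \<Longrightarrow> j \<in> ix \<Longrightarrow> pm (transpose i j)"
  by (rule permutes_swap_id)

lemma cj_tr: "pm \<pi> \<Longrightarrow> i \<in> ix \<Longrightarrow> j \<in> ix \<Longrightarrow> cj \<pi> (p (transpose i j)) = p (transpose (\<pi> i) (\<pi> j))"
  using cj_p pm_tr conj_transpose by metis

lemma cj_\<zeta>: "pm \<pi> \<Longrightarrow> cj \<pi> (\<zeta> k * x) = \<zeta> k * cj \<pi> x"
proof -
  assume "pm \<pi>"
  then have "\<zeta> k * p \<pi> = p \<pi> * \<zeta> k" unfolding p_def using ev_\<zeta> wword_gens by blast
  then show ?thesis by (simp add: cj_def mult.assoc[symmetric])
qed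

lemma tr_tr: "i \<in> ix \<Longrightarrow> j \<in> ix \<Longrightarrow> p (transpose i j) * p (transpose i j) = 1"
  using p_comp[OF pm_tr pm_tr, of i j i j] p_id by (simp add: transpose_comp_involutory)

lemma obtain_perm2:
  assumes "i \<in> ix" "j \<in> ix" "i \<noteq> j"
  obtains \<pi> where "pm \<pi>" "\<pi> 1 = i" "\<pi> 2 = j"
  using uword_ex[OF assms] by blast

lemma obtain_perm3:
  assumes "i \<in> ix" "j \<in> ix" "k \<in> ix" "distinct [i, j, k]"
  obtains \<pi> where "pm \<pi>" "\<pi> 1 = i" "\<pi> 2 = j" "\<pi> 3 = k" "n \<ge> 3"
proof -
  have s: "set [i, j, k] \<subseteq> ix" using assms by auto
  obtain \<pi> where p: "pm \<pi>" "\<forall>m<length [i, j, k]. \<pi> (Suc m) = [i, j, k] ! m"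
    using permutes_with_values[OF assms(4) s] by blast
  have "card (set [i, j, k]) \<le> card ix" using s by (intro card_mono) auto
  then have "n \<ge> 3" using distinct_card[OF assms(4)] by simp
  moreover have "\<pi> 1 = i" "\<pi> 2 = j" "\<pi> 3 = k"
    using p(2)[rule_format, of 0] p(2)[rule_format, of 1] p(2)[rule_format, of 2]
    by (auto simp: numeral_2_eq_2 numeral_3_eq_3)
  ultimately show ?thesis using that p(1) by blast
qed

lemma obtain_perm4:
  assumes "i \<in> ix" "j \<in> ix" "k \<in> ix" "l \<in> ix" "distinct [i, j, k, l]"
  obtains \<pi> where "pm \<pi>" "\<pi> 1 = i" "\<pi> 2 = j" "\<pi> 3 = k" "\<pi> 4 = l" "n \<ge> 4"
proof -
  have s: "set [i, j, k, l] \<subseteq> ix" using assms by auto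
  obtain \<pi> where p: "pm \<pi>" "\<forall>m<length [i, j, k, l]. \<pi> (Suc m) = [i, j, k, l] ! m"
    using permutes_with_values[OF assms(5) s] by blast
  have "card (set [i, j, k, l]) \<le> card ix" using s by (intro card_mono) auto
  then have "n \<ge> 4" using distinct_card[OF assms(5)] by simp
  moreover have "\<pi> 1 = i" "\<pi> 2 = j" "\<pi> 3 = k" "\<pi> 4 = l"
    using p(2)[rule_format, of 0] p(2)[rule_format, of 1] p(2)[rule_format, of 2] p(2)[rule_format, of 3]
    by (auto simp: numeral_2_eq_2 numeral_3_eq_3 numeral_eq_Suc)
  ultimately show ?thesis using that p(1) by blast
qed

text \<open>A twist slides around the cup and changes sign. The relation is the case a = 1,
  inserting inverse twists gives a = -1, and induction in both directions the rest.\<close>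

lemma F_tz_swap: "\<chi> (GF 1) * tz 1 a = \<chi> (GF 1) * tz 2 (- a)"
proof (induction a rule: int_induct[of _ 0])
  case (step1 a)
  have "\<chi> (GF 1) * tz 1 (a + 1) = (\<chi> (GF 1) * tz 2 (- a)) * tz 1 1"
    using tz_add[OF one_two(1), of a 1] step1 by (simp add: mult.assoc[symmetric])
  also have "\<dots> = (\<chi> (GF 1) * tz 1 1) * tz 2 (- a)" using tz_commute[OF one_two, of 1 "- a"] by (simp add: mult.assoc)
  also have "\<dots> = \<chi> (GF 1) * (tz 2 (- 1) * tz 2 (- a))" using F_t by (simp add: tz_1 tz_neg_1 mult.assoc)
  also have "\<dots> = \<chi> (GF 1) * tz 2 (- (a + 1))" using tz_add[OF one_two(2), of "- 1" "- a"] by (metis add.commute minus_add_distrib)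
  finally show ?case .
next
  case (step2 a)
  have b: "\<chi> (GF 1) * tz 1 (- 1) = \<chi> (GF 1) * tz 2 1"
  proof -
    have "\<chi> (GF 1) * tz 1 (- 1) = \<chi> (GF 1) * (tz 2 (- 1) * tz 2 1) * tz 1 (- 1)"
      using tz_add[OF one_two(2), of "- 1" 1] by simp
    also have "\<dots> = (\<chi> (GF 1) * tz 2 (- 1)) * (tz 1 (- 1) * tz 2 1)"
      using tz_commute[OF one_two, of "- 1" 1] by (simp add: mult.assoc)
    also have "\<dots> = \<chi> (GF 1) * (tz 1 1 * tz 1 (- 1)) * tz 2 1" using F_t by (simp add: tz_1 tz_neg_1 mult.assoc[symmetric])
    also have "\<dots> = \<chi> (GF 1) * tz 2 1" using tz_cancel[OF one_two(1), of 1] by simp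
    finally show ?thesis .
  qed
  have "\<chi> (GF 1) * tz 1 (a - 1) = (\<chi> (GF 1) * tz 2 (- a)) * tz 1 (- 1)"
    using tz_add[OF one_two(1), of a "- 1"] step2 by (simp add: mult.assoc[symmetric])
  also have "\<dots> = (\<chi> (GF 1) * tz 1 (- 1)) * tz 2 (- a)" using tz_commute[OF one_two, of "- 1" "- a"] by (simp add: mult.assoc)
  also have "\<dots> = \<chi> (GF 1) * tz 2 (- (a - 1))" unfolding b using tz_add[OF one_two(2), of 1 "- a"] by (simp add: mult.assoc)
  finally show ?case .
qed simp

lemma tz_F_swap: "tz 1 a * \<chi> (GF 1) = tz 2 (- a) * \<chi> (GF 1)"
proof (induction a rule: int_induct[of _ 0])
  case (step2 a)
  have "tz 1 (a - 1) * \<chi> (GF 1) = tz 1 a * (tz 1 (- 1) * \<chi> (GF 1))"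
    using tz_add[OF one_two(1), of a "- 1"] by (simp add: mult.assoc)
  also have "\<dots> = (tz 1 a * tz 2 1) * \<chi> (GF 1)" using t_F by (simp add: tz_1 tz_neg_1 mult.assoc)
  also have "\<dots> = tz 2 1 * (tz 1 a * \<chi> (GF 1))" using tz_commute[OF one_two, of a 1] by (simp add: mult.assoc)
  also have "\<dots> = tz 2 (- (a - 1)) * \<chi> (GF 1)"
    unfolding step2 using tz_add[OF one_two(2), of 1 "- a"] by (simp add: mult.assoc[symmetric])
  finally show ?case .
next
  case (step1 a)
  have b: "tz 1 1 * \<chi> (GF 1) = tz 2 (- 1) * \<chi> (GF 1)"
  proof -
    have "tz 1 1 * \<chi> (GF 1) = tz 1 1 * (tz 2 (- 1) * tz 2 1) * \<chi> (GF 1)"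
      using tz_add[OF one_two(2), of "- 1" 1] by simp
    also have "\<dots> = (tz 1 1 * tz 2 (- 1)) * (tz 2 1 * \<chi> (GF 1))" by (simp add: mult.assoc)
    also have "\<dots> = tz 2 (- 1) * (tz 1 1 * tz 1 (- 1)) * \<chi> (GF 1)"
      using t_F tz_commute[OF one_two, of 1 "- 1"] by (simp add: tz_1 tz_neg_1 mult.assoc)
    also have "\<dots> = tz 2 (- 1) * \<chi> (GF 1)" using tz_cancel[OF one_two(1), of 1] by simp
    finally show ?thesis .
  qed
  have "tz 1 (a + 1) * \<chi> (GF 1) = tz 1 a * (tz 1 1 * \<chi> (GF 1))"
    using tz_add[OF one_two(1), of a 1] by (simp add: mult.assoc)
  also have "\<dots> = (tz 1 a * tz 2 (- 1)) * \<chi> (GF 1)" unfolding b by (simp add: mult.assoc)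
  also have "\<dots> = tz 2 (- 1) * (tz 1 a * \<chi> (GF 1))" using tz_commute[OF one_two, of a "- 1"] by (simp add: mult.assoc)
  also have "\<dots> = tz 2 (- (a + 1)) * \<chi> (GF 1)"
    unfolding step1 using tz_add[OF one_two(2), of "- 1" "- a"] by (metis add.commute minus_add_distrib mult.assoc)
  finally show ?case .
qed simp

lemma w1: "\<chi> (GW 1) = p (transpose 1 2)"
  using p_w[of 1] n2 by (simp add: numeral_2_eq_2)

text \<open>All but the last are images under \<open>cj\<close> of facts about the strands 1 and 2.
  The last, reversal of the pair, conjugates by the transposition of i and j and absorbs it as a
  twist on either side.\<close>

lemma U_pair:
  assumes ij: "i \<in> ix" "j \<in> ix" "i \<noteq> j"
  shows "U i j * tz i a * U i j = \<zeta> (nat \<bar>a\<bar>) * U i j"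
    "U i j * p (transpose i j) = U i j * tz i 1"
    "p (transpose i j) * U i j = tz i (- 1) * U i j"
    "U i j * tz i a = U i j * tz j (- a)"
    "tz i a * U i j = tz j (- a) * U i j"
    "U j i = tz i (- 1) * U i j * tz i 1"
proof -
  obtain \<pi> where pi: "pm \<pi>" "\<pi> 1 = i" "\<pi> 2 = j" using obtain_perm2[OF ij] .
  note cj = cj_mult[OF pi(1)] cj_F[OF pi(1)] cj_tz[OF pi(1)] cj_tr[OF pi(1) one_two] pi one_two
  have "cj \<pi> (\<chi> (GF 1) * tz 1 a * \<chi> (GF 1)) = cj \<pi> (\<zeta> (nat \<bar>a\<bar>) * \<chi> (GF 1))"
    using F_t_F by (simp add: tz_def ev_def)
  then have "cj \<pi> (\<chi> (GF 1) * tz 1 a * \<chi> (GF 1)) = \<zeta> (nat \<bar>a\<bar>) * cj \<pi> (\<chi> (GF 1))"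
    by (simp only: cj_\<zeta>[OF pi(1)])
  then show "U i j * tz i a * U i j = \<zeta> (nat \<bar>a\<bar>) * U i j" by (simp only: cj)
  have "cj \<pi> (\<chi> (GF 1) * p (transpose 1 2)) = cj \<pi> (\<chi> (GF 1) * tz 1 1)"
    using F_w by (simp only: w1 tz_1)
  then show r: "U i j * p (transpose i j) = U i j * tz i 1" by (simp only: cj)
  have "cj \<pi> (p (transpose 1 2) * \<chi> (GF 1)) = cj \<pi> (tz 1 (- 1) * \<chi> (GF 1))"
    using w_F by (simp only: w1 tz_neg_1)
  then show l: "p (transpose i j) * U i j = tz i (- 1) * U i j" by (simp only: cj)
  have "cj \<pi> (\<chi> (GF 1) * tz 1 a) = cj \<pi> (\<chi> (GF 1) * tz 2 (- a))" by (simp only: F_tz_swap)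
  then show "U i j * tz i a = U i j * tz j (- a)" by (simp only: cj)
  have "cj \<pi> (tz 1 a * \<chi> (GF 1)) = cj \<pi> (tz 2 (- a) * \<chi> (GF 1))" by (simp only: tz_F_swap)
  then show "tz i a * U i j = tz j (- a) * U i j" by (simp only: cj)
  have "p (transpose i j) * U i j = U j i * p (transpose i j)"
    using p_U[OF pm_tr[OF ij(1,2)] ij] by simp
  then have "U j i = p (transpose i j) * U i j * p (transpose i j)" using tr_tr[OF ij(1,2)] by (simp add: mult.assoc)
  also have "\<dots> = tz i (- 1) * (U i j * p (transpose i j))" unfolding l by (simp add: mult.assoc)
  finally show "U j i = tz i (- 1) * U i j * tz i 1" unfolding r by (simp add: mult.assoc)
qed

text \<open>The second claim is transported from F_1 w_2 F_1 = F_1 and the third from F_2 w_1 F_2 =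
  F_2. Two factors that share a strand thus reduce to one factor and a transposition.\<close>

lemma U_triple:
  assumes ijk: "i \<in> ix" "j \<in> ix" "k \<in> ix" "distinct [i, j, k]"
  shows "U i j * tz k a = tz k a * U i j"
    "U i j * U i k = U i j * p (transpose j k)"
    "U i j * U k j = U i j * p (transpose i k)"
proof -
  obtain \<pi> where pi: "pm \<pi>" "\<pi> 1 = i" "\<pi> 2 = j" "\<pi> 3 = k" "n \<ge> 3" using obtain_perm3[OF ijk] .
  have i3: "3 \<in> ix" "2 \<in> {1..n - 1}" "1 \<in> {1..n - 1}" using pi(5) by auto
  note cj = cj_mult[OF pi(1)] cj_F[OF pi(1)] cj_tz[OF pi(1)] cj_tr[OF pi(1)] pi(2-4) one_two i3
  have "\<chi> (GF 1) * tz 3 a = tz 3 a * \<chi> (GF 1)" by (rule commute_tz) (use i3 F_t_far[of 3] in auto)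
  then have "cj \<pi> (\<chi> (GF 1) * tz 3 a) = cj \<pi> (tz 3 a * \<chi> (GF 1))" by simp
  then show "U i j * tz k a = tz k a * U i j" by (simp only: cj)
  have w2: "\<chi> (GW 2) = p (transpose 2 3)" using p_w[OF i3(2)] by (simp add: numeral_2_eq_2 numeral_3_eq_3)
  have "cj \<pi> (\<chi> (GF 1) * p (transpose 2 3) * \<chi> (GF 1)) = cj \<pi> (\<chi> (GF 1))"
    using F_w_F[OF pi(5)] by (simp only: w2)
  then have a: "U i j * p (transpose j k) * U i j = U i j" by (simp only: cj)
  have "p (transpose j k) * U i j = U i k * p (transpose j k)"
    using p_U[OF pm_tr[OF ijk(2,3)] ijk(1,2)] ijk(4) by (simp add: transpose_apply_other)
  then have "U i j * U i k * p (transpose j k) = U i j" using a by (simp add: mult.assoc)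
  then have "U i j * U i k * (p (transpose j k) * p (transpose j k)) = U i j * p (transpose j k)"
    by (simp only: mult.assoc[symmetric])
  then show "U i j * U i k = U i j * p (transpose j k)" using tr_tr[OF ijk(2,3)] by simp
  obtain \<pi>' where pi': "pm \<pi>'" "\<pi>' 1 = k" "\<pi>' 2 = i" "\<pi>' 3 = j"
    using obtain_perm3[of k i j] ijk by auto
  have F2: "\<chi> (GF 2) = U 2 3" using F_U[OF i3(2)] by (simp add: numeral_2_eq_2 numeral_3_eq_3)
  have "cj \<pi>' (U 2 3 * p (transpose 1 2) * U 2 3) = cj \<pi>' (U 2 3)"
    using F_w_F'[OF pi(5)] by (simp only: w1 F2)
  moreover have "cj \<pi>' (U 2 3) = U i j" using cj_U[OF pi'(1) one_two(2) i3(1)] pi' by simp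
  moreover have "cj \<pi>' (p (transpose 1 2)) = p (transpose k i)" using cj_tr[OF pi'(1) one_two] pi' by simp
  ultimately have b: "U i j * p (transpose i k) * U i j = U i j"
    by (simp add: cj_mult[OF pi'(1)] transpose_commute)
  have "p (transpose i k) * U i j = U k j * p (transpose i k)"
    using p_U[OF pm_tr[OF ijk(1,3)] ijk(1,2)] ijk(4) by (simp add: transpose_apply_other)
  then have "U i j * U k j * p (transpose i k) = U i j" using b by (simp add: mult.assoc)
  then have "U i j * U k j * (p (transpose i k) * p (transpose i k)) = U i j * p (transpose i k)"
    by (simp only: mult.assoc[symmetric])
  then show "U i j * U k j = U i j * p (transpose i k)" using tr_tr[OF ijk(1,3)] by simp
qed

text \<open>Multiplied by the transposition of j and l, the product \<open>U i j * U k l\<close>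
  becomes \<open>U i j * U i l * U k j\<close>; multiplied by that of i and k it becomes
  \<open>U i j * U k j * U i l\<close>. The last two factors commute, so the two transpositions have
  the same effect and their product has none.\<close>

lemma U_quad:
  assumes d: "i \<in> ix" "j \<in> ix" "k \<in> ix" "l \<in> ix" "distinct [i, j, k, l]"
  shows "U i j * U k l = U k l * U i j"
    "U i j * U k l = U i j * U k l * p (transpose i k \<circ> transpose j l)"
proof -
  have comm: "U i j * U k l = U k l * U i j"
    if d: "i \<in> ix" "j \<in> ix" "k \<in> ix" "l \<in> ix" "distinct [i, j, k, l]" for i j k l
  proof -
    obtain \<pi> where pi: "pm \<pi>" "\<pi> 1 = i" "\<pi> 2 = j" "\<pi> 3 = k" "\<pi> 4 = l" "n \<ge> 4" using obtain_perm4[OF d] .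
    have i3: "3 \<in> ix" "4 \<in> ix" "3 \<in> {1..n - 1}" using pi(6) by auto
    have F3: "\<chi> (GF 3) = U 3 4" using F_U[OF i3(3)] by (simp add: numeral_eq_Suc)
    have "cj \<pi> (\<chi> (GF 1) * U 3 4) = cj \<pi> (U 3 4 * \<chi> (GF 1))" using F_far[OF pi(6)] by (simp only: F3)
    moreover have "cj \<pi> (U 3 4) = U k l" using cj_U[OF pi(1) i3(1,2)] pi by simp
    ultimately show ?thesis by (simp only: cj_mult[OF pi(1)] cj_F[OF pi(1)] pi)
  qed
  show "U i j * U k l = U k l * U i j" using comm[OF d] .
  have pj: "pm (transpose j l)" "pm (transpose i k)" using d pm_tr by auto
  have c1: "p (transpose j l) * U k j = U k l * p (transpose j l)"
    using p_U[OF pj(1), of k j] d by (simp add: transpose_apply_other)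
  have c2: "p (transpose i k) * U i l = U k l * p (transpose i k)"
    using p_U[OF pj(2), of i l] d by (simp add: transpose_apply_other)
  have "U i j * U k l * p (transpose j l) = U i j * p (transpose j l) * U k j" using c1 by (simp add: mult.assoc)
  also have "\<dots> = U i j * U i l * U k j" using U_triple(2)[of i j l] d by simp
  also have "\<dots> = U i j * (U k j * U i l)" using comm[of i l k j] d by (auto simp: mult.assoc)
  also have "\<dots> = U i j * p (transpose i k) * U i l" using U_triple(3)[of i j k] d by (simp add: mult.assoc[symmetric])
  also have "\<dots> = U i j * U k l * p (transpose i k)" using c2 by (simp add: mult.assoc)
  finally have E: "U i j * U k l * p (transpose j l) * p (transpose j l) = U i j * U k l * p (transpose i k) * p (transpose j l)"
    by simp
  have "U i j * U k l * p (transpose j l) * p (transpose j l) = U i j * U k l"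
    using tr_tr[of j l] d by (simp add: mult.assoc)
  then show "U i j * U k l = U i j * U k l * p (transpose i k \<circ> transpose j l)"
    using E p_comp[OF pj(2,1)] by (metis mult.assoc)
qed

end

section \<open>Systems of disjoint pairs of strands\<close>

definition ents :: "(nat \<times> nat) list \<Rightarrow> nat list" where
  "ents P = concat (map (\<lambda>(i, j). [i, j]) P)"

definition upword :: "nat \<Rightarrow> (nat \<times> nat) list \<Rightarrow> gen list" where
  "upword n P = concat (map (\<lambda>(i, j). uword n i j) P)"

definition pairing :: "nat \<Rightarrow> (nat \<times> nat) list \<Rightarrow> bool" where
  "pairing n P \<longleftrightarrow> distinct (ents P) \<and> set (ents P) \<subseteq> {1..n}"

text \<open>Every pair in both directions, together with the gain picked up by traversing it: 1
  along the order of the pair and -1 against it.\<close>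

definition arcs :: "(nat \<times> nat) list \<Rightarrow> (nat \<times> nat \<times> int) set" where
  "arcs P = {(i, j, 1) | i j. (i, j) \<in> set P} \<union> {(j, i, - 1) | i j. (i, j) \<in> set P}"

lemma ents_Nil [simp]: "ents [] = []" by (simp add: ents_def)
lemma ents_Cons [simp]: "ents ((i, j) # P) = i # j # ents P" by (simp add: ents_def)

lemma set_ents: "set (ents P) = (\<Union>(i, j)\<in>set P. {i, j})"
  by (auto simp: ents_def)

lemma mset_ents: "mset P = mset P' \<Longrightarrow> mset (ents P) = mset (ents P')"
proof (induction P arbitrary: P')
  case (Cons x P)
  have "x \<in> set P'" using Cons.prems by (metis list.set_intros(1) set_mset_mset)
  then obtain us vs where ys: "P' = us @ x # vs" by (meson split_list)
  then have "mset (ents P) = mset (ents (us @ vs))" using Cons by simp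
  then show ?case by (simp add: ys ents_def)
qed simp

lemma pairing_reorder: "mset P = mset P' \<Longrightarrow> pairing n P \<Longrightarrow> pairing n P'"
  unfolding pairing_def using mset_ents mset_eq_imp_distinct_iff mset_eq_setD by metis

lemma pairing_Cons: "pairing n ((i, j) # P) \<longleftrightarrow>
    pairing n P \<and> i \<in> {1..n} \<and> j \<in> {1..n} \<and> i \<noteq> j \<and> i \<notin> set (ents P) \<and> j \<notin> set (ents P)"
  by (auto simp: pairing_def)

lemma pairing_Nil [simp]: "pairing n []" by (simp add: pairing_def)

lemma ents_map: "ents (map (map_prod \<sigma> \<sigma>) P) = map \<sigma> (ents P)"
  by (induction P) auto

lemma pairing_map:
  assumes "\<sigma> permutes {1..n}" "pairing n P"
  shows "pairing n (map (map_prod \<sigma> \<sigma>) P)"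
  using assms permutes_inj_on[OF assms(1)] permutes_in_image[OF assms(1)]
  by (auto simp: pairing_def ents_map distinct_map)

lemma arcs_Cons: "arcs ((i, j) # P) = {(i, j, 1), (j, i, - 1)} \<union> arcs P"
  by (auto simp: arcs_def)

lemma arcs_Nil [simp]: "arcs [] = {}" by (simp add: arcs_def)

lemma arcs_ents: "(i, j, s) \<in> arcs P \<Longrightarrow> i \<in> set (ents P) \<and> j \<in> set (ents P)"
  by (auto simp: arcs_def set_ents)

lemma ents_arcs: "i \<in> set (ents P) \<Longrightarrow> \<exists>j s. (i, j, s) \<in> arcs P"
  by (auto simp: arcs_def set_ents)

lemma arcs_unique: "pairing n P \<Longrightarrow> (i, j, s) \<in> arcs P \<Longrightarrow> (i, j', s') \<in> arcs P \<Longrightarrow> j' = j \<and> s' = s"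
proof (induction P)
  case (Cons x P)
  obtain a b where x: "x = (a, b)" by (cases x)
  show ?case using Cons arcs_ents[of i j s P] arcs_ents[of i j' s' P] by (auto simp: x pairing_Cons arcs_Cons)
qed simp

section \<open>Reduction of words to the normal form\<close>

context atl_monoid
begin

definition UP :: "(nat \<times> nat) list \<Rightarrow> 'm" where
  "UP P = ev (upword n P)"

lemma UP_Nil [simp]: "UP [] = 1" by (simp add: UP_def upword_def)
lemma UP_Cons: "UP ((i, j) # P) = U i j * UP P" by (simp add: UP_def upword_def ev_append U_def)

lemma UP_prod: "UP P = prod_list (map (case_prod U) P)"
  by (induction P) (auto simp: UP_Cons)

lemma tau_split:
  assumes "i \<in> ix"
  shows "tau m = tz i (m i) * tau (m(i := 0))"
proof -
  have "tau m = tau (\<lambda>k. dl i (m i) k + (m(i := 0)) k)" by (rule tau_cong) (simp add: dl_def)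
  then show ?thesis using tau_add[of "dl i (m i)" "m(i := 0)"] tau_dl[OF assms] by simp
qed

lemma tz_tau: "i \<in> ix \<Longrightarrow> tz i a * tau m = tau m * tz i a"
  using tau_add[of "dl i a" m] tau_add[of m "dl i a"] tau_dl[of i a] by (simp add: add.commute)

lemma U_tau:
  assumes "i \<in> ix" "j \<in> ix" "i \<noteq> j" "m i = 0" "m j = 0"
  shows "U i j * tau m = tau m * U i j"
  unfolding tau_prod
proof (rule commute_prod_list)
  fix y assume "y \<in> set (map (\<lambda>i. tz i (m i)) [1..<Suc n])"
  then obtain k where k: "k \<in> ix" "y = tz k (m k)" unfolding set_map set_upt_ix by blast
  show "U i j * y = y * U i j"
  proof (cases "k = i \<or> k = j")
    case True
    then show ?thesis using assms k by auto
  next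
    case False
    then show ?thesis using U_triple(1)[of i j k] assms k by auto
  qed
qed

lemma UP_tau:
  assumes "pairing n P" "\<And>k. k \<in> set (ents P) \<Longrightarrow> m k = 0"
  shows "UP P * tau m = tau m * UP P"
  using assms
proof (induction P)
  case (Cons x P)
  obtain i j where x: "x = (i, j)" by (cases x)
  have w: "i \<in> ix" "j \<in> ix" "i \<noteq> j" "pairing n P" using Cons.prems(1) by (auto simp: x pairing_Cons)
  have "UP (x # P) * tau m = U i j * (UP P * tau m)" by (simp add: x UP_Cons mult.assoc)
  also have "\<dots> = (U i j * tau m) * UP P" using Cons w by (simp add: x mult.assoc)
  also have "\<dots> = tau m * UP (x # P)" using U_tau[OF w(1-3)] Cons.prems(2) by (simp add: x UP_Cons mult.assoc)
  finally show ?case .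
qed simp

lemma UP_tz:
  assumes "pairing n P" "k \<in> ix" "k \<notin> set (ents P)"
  shows "UP P * tz k a = tz k a * UP P"
  using UP_tau[OF assms(1), of "dl k a"] assms tau_dl[OF assms(2)] by (force simp: dl_def)

lemma p_UP:
  assumes s: "pm \<sigma>" and "pairing n P"
  shows "p \<sigma> * UP P = UP (map (map_prod \<sigma> \<sigma>) P) * p \<sigma>"
  using assms(2)
proof (induction P)
  case (Cons x P)
  obtain i j where x: "x = (i, j)" by (cases x)
  have w: "i \<in> ix" "j \<in> ix" "i \<noteq> j" "pairing n P" using Cons.prems(1) by (auto simp: x pairing_Cons)
  have "p \<sigma> * UP (x # P) = (p \<sigma> * U i j) * UP P" by (simp add: x UP_Cons mult.assoc)
  also have "\<dots> = U (\<sigma> i) (\<sigma> j) * (p \<sigma> * UP P)" using p_U[OF s w(1-3)] by (simp add: mult.assoc)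
  also have "\<dots> = UP (map (map_prod \<sigma> \<sigma>) (x # P)) * p \<sigma>" using Cons w by (simp add: x UP_Cons mult.assoc)
  finally show ?case .
qed simp

lemma UP_reorder:
  assumes "pairing n P" "mset P = mset P'"
  shows "UP P = UP P'"
  unfolding UP_prod
proof (rule prod_list_reorder[OF assms(2)])
  fix x y assume xy: "x \<in> set P" "y \<in> set P"
  obtain i j k l where ij: "x = (i, j)" "y = (k, l)" by (cases x, cases y)
  show "case_prod U x * case_prod U y = case_prod U y * case_prod U x"
  proof (cases "x = y")
    case False
    then have "y \<in> set (remove1 x P)" using xy by (simp add: in_set_remove1)
    have rm: "z \<in> set R \<Longrightarrow> mset R = mset (z # remove1 z R)" for z and R :: "(nat \<times> nat) list" by simp
    have "mset P = mset (x # y # remove1 y (remove1 x P))"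
      using rm[OF xy(1)] rm[OF \<open>y \<in> set (remove1 x P)\<close>] by (metis mset.simps(2))
    from pairing_reorder[OF this assms(1)] have "distinct [i, j, k, l] \<and> {i, j, k, l} \<subseteq> ix"
      unfolding ij by (auto simp: pairing_Cons)
    then show ?thesis using U_quad(1)[of i j k l] by (simp add: ij)
  qed simp
qed

lemma front:
  assumes "pairing n P" "(i, j) \<in> set P"
  obtains P' where "pairing n ((i, j) # P')" "UP P = UP ((i, j) # P')" "set P = insert (i, j) (set P')"
proof -
  have m: "mset P = mset ((i, j) # remove1 (i, j) P)" using assms(2) by simp
  show ?thesis
    using that[of "remove1 (i, j) P"] pairing_reorder[OF m assms(1)] UP_reorder[OF assms(1) m] mset_eq_setD[OF m] by simp
qed

definition Zs :: "nat list \<Rightarrow> 'm" where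
  "Zs ks = prod_list (map \<zeta> ks)"

lemma Zs_commute: "set u \<subseteq> gens n \<Longrightarrow> ev u * Zs ks = Zs ks * ev u"
  unfolding Zs_def by (rule commute_prod_list) (use ev_\<zeta> in auto)

lemma Zs_append: "Zs (us @ vs) = Zs us * Zs vs" by (simp add: Zs_def)

lemma upword_gens: "pairing n P \<Longrightarrow> set (upword n P) \<subseteq> gens n"
proof (induction P)
  case (Cons x P)
  obtain i j where x: "x = (i, j)" by (cases x)
  then show ?case using Cons uword_gens[OF n2, of i j] by (auto simp: pairing_Cons upword_def)
qed (simp add: upword_def)

text \<open>A scalar, a twist above the caps, the caps and cups, and a group element below them. A
  permutation on the left moves through by renaming the pairs; a twist on a capped strand does not
  move through, which is why twists stand on both sides.\<close>

definition inNF :: "'m \<Rightarrow> bool" where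
  "inNF x \<longleftrightarrow> (\<exists>ks m P m' \<sigma>. pairing n P \<and> pm \<sigma> \<and> x = Zs ks * (tau m * (UP P * g m' \<sigma>)))"

lemma inNFI: "pairing n P \<Longrightarrow> pm \<sigma> \<Longrightarrow> inNF (tau m * (UP P * g m' \<sigma>))"
  unfolding inNF_def Zs_def by (intro exI[of _ "[]"]) auto

lemma inNF_Zs: "inNF x \<Longrightarrow> inNF (Zs ks * x)"
  unfolding inNF_def using Zs_append by (metis mult.assoc)

lemma inNF_tau: "inNF x \<Longrightarrow> inNF (tau m0 * x)"
proof -
  assume "inNF x"
  then obtain ks m P m' \<sigma> where x: "pairing n P" "pm \<sigma>" "x = Zs ks * (tau m * (UP P * g m' \<sigma>))" unfolding inNF_def by blast
  have "tau m0 * x = Zs ks * (tau (\<lambda>i. m0 i + m i) * (UP P * g m' \<sigma>))"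
    using Zs_commute[OF tword_gens, of m0 ks] by (simp add: x(3) tau_add tau_def[symmetric] mult.assoc[symmetric])
  then show ?thesis unfolding inNF_def using x by blast
qed

lemma inNF_tz: "i \<in> ix \<Longrightarrow> inNF x \<Longrightarrow> inNF (tz i a * x)"
  using inNF_tau[of x "dl i a"] tau_dl by simp

lemma p_g: "pm \<rho> \<Longrightarrow> pm \<sigma> \<Longrightarrow> p \<rho> * g m \<sigma> = g (m \<circ> pinv \<rho>) (\<rho> \<circ> \<sigma>)"
  using g_mult[of \<rho> \<sigma> "\<lambda>_. 0" m] by (simp add: g_def comp_def)

lemma tau_g: "tau m0 * g m \<sigma> = g (\<lambda>i. m0 i + m i) \<sigma>"
  by (simp add: g_def tau_add mult.assoc)

lemma tz_g: "i \<in> ix \<Longrightarrow> tz i a * g m \<sigma> = g (\<lambda>k. dl i a k + m k) \<sigma>"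
  using tau_g[of "dl i a"] tau_dl by simp

lemma inNF_p: "pm \<rho> \<Longrightarrow> inNF x \<Longrightarrow> inNF (p \<rho> * x)"
proof -
  assume r: "pm \<rho>" and "inNF x"
  then obtain ks m P m' \<sigma> where x: "pairing n P" "pm \<sigma>" "x = Zs ks * (tau m * (UP P * g m' \<sigma>))" unfolding inNF_def by blast
  have "p \<rho> * x = Zs ks * ((p \<rho> * tau m) * (UP P * g m' \<sigma>))"
    using Zs_commute[OF wword_gens[OF r], of ks] by (simp add: x(3) p_def mult.assoc[symmetric])
  also have "\<dots> = Zs ks * (tau (m \<circ> pinv \<rho>) * ((p \<rho> * UP P) * g m' \<sigma>))" using p_tau[OF r] by (simp add: mult.assoc)
  also have "\<dots> = Zs ks * (tau (m \<circ> pinv \<rho>) * (UP (map (map_prod \<rho> \<rho>) P) * (p \<rho> * g m' \<sigma>)))"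
    using p_UP[OF r x(1)] by (simp add: mult.assoc)
  finally show ?thesis unfolding inNF_def using p_g[OF r x(2)] pairing_map[OF r x(1)] permutes_compose[OF x(2) r] by metis
qed

text \<open>If the new pair is the old one, the twist between the two is caught in a loop and
  becomes a scalar. Otherwise the twist slides to k, where it commutes with \<open>U i j\<close>;
  then the two factors become one factor and a transposition, and the latter is carried through the
  other pairs into the group element.\<close>

lemma inNF_U_front:
  assumes w: "pairing n ((i, k) # P)" and s: "pm \<sigma>" and j: "j \<in> ix" "j \<noteq> i"
  shows "inNF (U i j * (tz i c * (UP ((i, k) # P) * g m \<sigma>)))"
proof -
  have i: "i \<in> ix" "k \<in> ix" "i \<noteq> k" "pairing n P" "i \<notin> set (ents P)" "k \<notin> set (ents P)" using w by (auto simp: pairing_Cons)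
  show ?thesis
  proof (cases "k = j")
    case True
    have "U i j * (tz i c * (UP ((i, k) # P) * g m \<sigma>)) = (U i j * tz i c * U i j) * (UP P * g m \<sigma>)"
      by (simp add: True UP_Cons mult.assoc)
    also have "\<dots> = Zs [nat \<bar>c\<bar>] * (tau (\<lambda>_. 0) * (UP ((i, k) # P) * g m \<sigma>))"
      using U_pair(1)[of i j] i j by (simp add: True UP_Cons Zs_def mult.assoc)
    finally show ?thesis using w s unfolding inNF_def by blast
  next
    case False
    let ?t = "transpose j k"
    have t: "pm ?t" using pm_tr j i by blast
    have d: "distinct [i, j, k]" using False j i by auto
    define P' where "P' = map (map_prod ?t ?t) P"
    have wP: "pairing n P'" unfolding P'_def using pairing_map[OF t i(4)] .
    have e: "set (ents P') = ?t ` set (ents P)" by (simp add: P'_def ents_map)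
    have "i \<notin> set (ents P')" "j \<notin> set (ents P')"
      using i(5,6) d unfolding e by (auto simp: transpose_def split: if_splits)
    then have wP': "pairing n ((i, j) # P')" using wP i j by (auto simp: pairing_Cons)
    have "U i j * (tz i c * (UP ((i, k) # P) * g m \<sigma>)) = U i j * ((tz i c * U i k) * (UP P * g m \<sigma>))"
      by (simp add: UP_Cons mult.assoc)
    also have "\<dots> = (U i j * tz k (- c)) * (U i k * (UP P * g m \<sigma>))"
      using U_pair(5)[of i k c] i by (simp add: mult.assoc)
    also have "\<dots> = tz k (- c) * ((U i j * U i k) * (UP P * g m \<sigma>))"
      using U_triple(1)[of i j k] i j d by (simp add: mult.assoc)
    also have "\<dots> = tz k (- c) * (U i j * ((p ?t * UP P) * g m \<sigma>))"
      using U_triple(2)[of i j k] i j d by (simp add: mult.assoc)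
    also have "\<dots> = tz k (- c) * (UP ((i, j) # P') * (p ?t * g m \<sigma>))"
      using p_UP[OF t i(4)] by (simp add: P'_def UP_Cons mult.assoc)
    also have "\<dots> = tz k (- c) * (tau (\<lambda>_. 0) * (UP ((i, j) # P') * g (m \<circ> pinv ?t) (?t \<circ> \<sigma>)))"
      using p_g[OF t s] by simp
    finally show ?thesis using inNF_tz[OF i(2)] inNFI[OF wP' permutes_compose[OF s t]] by metis
  qed
qed

text \<open>A pair that ends in i instead of starting there is reversed, at the price of twists at i
  on both sides.\<close>

lemma inNF_U_in:
  assumes w: "pairing n P" and s: "pm \<sigma>" and j: "i \<in> ix" "j \<in> ix" "j \<noteq> i" and iP: "i \<in> set (ents P)"
  shows "inNF (U i j * (tz i c * (UP P * g m \<sigma>)))"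
proof -
  obtain k where "(i, k) \<in> set P \<or> (k, i) \<in> set P" using iP by (auto simp: set_ents)
  then show ?thesis
  proof
    assume "(i, k) \<in> set P"
    then obtain P' where "pairing n ((i, k) # P')" "UP P = UP ((i, k) # P')" using front[OF w] by metis
    then show ?thesis using inNF_U_front s j by simp
  next
    assume "(k, i) \<in> set P"
    then obtain P' where P': "pairing n ((k, i) # P')" "UP P = UP ((k, i) # P')" using front[OF w] by metis
    then have w': "pairing n ((i, k) # P')" "k \<in> ix" "k \<noteq> i" "pairing n P'" "i \<notin> set (ents P')" by (auto simp: pairing_Cons)
    have "UP P * g m \<sigma> = tz i (- 1) * U i k * (tz i 1 * UP P') * g m \<sigma>"
      using U_pair(6)[OF j(1) w'(2)] w'(3) by (simp add: P'(2) UP_Cons mult.assoc)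
    also have "\<dots> = tz i (- 1) * (UP ((i, k) # P') * (tz i 1 * g m \<sigma>))"
      unfolding UP_tz[OF w'(4) j(1) w'(5), of 1, symmetric] by (simp add: UP_Cons mult.assoc)
    finally have "tz i c * (UP P * g m \<sigma>) = tz i (c - 1) * (UP ((i, k) # P') * g (\<lambda>l. dl i 1 l + m l) \<sigma>)"
      using tz_add[OF j(1), of c "- 1"] tz_g[OF j(1)] by (simp add: mult.assoc[symmetric])
    then show ?thesis using inNF_U_front[OF w'(1) s j(2,3)] by simp
  qed
qed

text \<open>The twists at i and j that meet the new cup are gathered into a single power of t_i with
  exponent \<open>m i - m j\<close>; sliding from j to i changes the sign. The rest depends on which
  of i and j already belong to a pair.\<close>

lemma inNF_U: "i \<in> ix \<Longrightarrow> j \<in> ix \<Longrightarrow> i \<noteq> j \<Longrightarrow> inNF x \<Longrightarrow> inNF (U i j * x)"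
proof -
  assume ij: "i \<in> ix" "j \<in> ix" "i \<noteq> j" and "inNF x"
  then obtain ks m P m' \<sigma> where x: "pairing n P" "pm \<sigma>" "x = Zs ks * (tau m * (UP P * g m' \<sigma>))" unfolding inNF_def by blast
  define m0 where "m0 = m(i := 0, j := 0)"
  have "tau m = tz i (m i) * (tz j (m j) * tau m0)"
    using tau_split[OF ij(1), of m] tau_split[OF ij(2), of "m(i := 0)"] ij(3) by (simp add: m0_def)
  then have "tau m = tz i (m i) * tz j (m j) * tau m0" by (simp add: mult.assoc)
  then have "U i j * tau m = U i j * tz j (m j) * tz i (m i) * tau m0"
    using tz_commute[OF ij(1,2)] by (simp add: mult.assoc)
  also have "\<dots> = U i j * (tz i (- m j) * tz i (m i)) * tau m0"
  proof -
    have "U i j * tz j (m j) = U i j * tz i (- m j)" using U_pair(4)[OF ij, of "- m j"] by simp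
    then show ?thesis by (simp add: mult.assoc[symmetric])
  qed
  also have "\<dots> = U i j * (tau m0 * tz i (m i - m j))"
    using tz_add[OF ij(1), of "- m j" "m i"] tz_tau[OF ij(1), of "m i - m j" m0] by (simp add: mult.assoc)
  also have "\<dots> = tau m0 * (U i j * tz i (m i - m j))"
    using U_tau[OF ij, of m0] by (simp add: m0_def mult.assoc[symmetric])
  finally have U: "U i j * tau m = tau m0 * (U i j * tz i (m i - m j))" .
  let ?c = "m i - m j"
  have "U i j * x = Zs ks * ((U i j * tau m) * (UP P * g m' \<sigma>))"
    using Zs_commute[OF uword_gens[OF n2 ij], of ks] by (simp add: x(3) U_def mult.assoc[symmetric])
  then have e: "U i j * x = Zs ks * (tau m0 * (U i j * (tz i ?c * (UP P * g m' \<sigma>))))"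
    unfolding U by (simp add: mult.assoc)
  have "inNF (U i j * (tz i ?c * (UP P * g m' \<sigma>)))"
  proof (cases "i \<in> set (ents P)")
    case True
    then show ?thesis using inNF_U_in[OF x(1,2) ij(1,2)] ij(3) by simp
  next
    case iF: False
    show ?thesis
    proof (cases "j \<in> set (ents P)")
      case True
      \<comment> \<open>Only j belongs to a pair, so \<open>U i j\<close> is reversed to make the
        shared strand its first index.\<close>
      have "U i j * tz i ?c = tz j (- 1) * U j i * tz j 1 * tz j (- ?c)"
        using U_pair(4)[OF ij, of ?c] U_pair(6)[of j i] ij by simp
      also have "\<dots> = tz j (- 1) * (U j i * tz j (1 - ?c))"
        using tz_add[OF ij(2), of 1 "- ?c"] by (metis add_uminus_conv_diff mult.assoc)
      finally have "U i j * (tz i ?c * (UP P * g m' \<sigma>)) = tz j (- 1) * (U j i * (tz j (1 - ?c) * (UP P * g m' \<sigma>)))"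
        by (simp add: mult.assoc[symmetric])
      then show ?thesis using inNF_tz[OF ij(2)] inNF_U_in[OF x(1,2) ij(2,1) ij(3) True] by simp
    next
      case False
      have w: "pairing n ((i, j) # P)" using x(1) ij iF False by (simp add: pairing_Cons)
      have "U i j * (tz i ?c * (UP P * g m' \<sigma>)) = U i j * ((UP P * tz i ?c) * g m' \<sigma>)"
        using UP_tz[OF x(1) ij(1) iF] by (simp add: mult.assoc)
      also have "\<dots> = tau (\<lambda>_. 0) * (UP ((i, j) # P) * g (\<lambda>l. dl i ?c l + m' l) \<sigma>)"
        using tz_g[OF ij(1)] by (simp add: UP_Cons mult.assoc)
      finally show ?thesis using inNFI[OF w x(2)] by metis
    qed
  qed
  then show ?thesis unfolding e by (intro inNF_Zs inNF_tau)
qed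

theorem normal_form: "set u \<subseteq> gens n \<Longrightarrow> inNF (ev u)"
proof (induction u)
  case Nil
  have "inNF (tau (\<lambda>_. 0) * (UP [] * g (\<lambda>_. 0) id))" by (intro inNFI permutes_id pairing_Nil)
  then show ?case by (simp add: g_def)
next
  case (Cons x u)
  then have IH: "inNF (ev u)" and x: "x \<in> gens n" by auto
  show ?case
  proof (cases x)
    case (GF i)
    then have "i \<in> {1..n - 1}" using x by (auto simp: gens_def)
    then show ?thesis using inNF_U[of i "Suc i" "ev u"] IH F_U by (auto simp: ev_Cons GF)
  next
    case (GW i)
    then have i: "i \<in> {1..n - 1}" using x by (auto simp: gens_def)
    have "pm (transpose i (Suc i))" by (rule pm_tr) (use i in auto)
    then show ?thesis using inNF_p[OF _ IH] p_w[OF i] by (metis ev_Cons GW)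
  next
    case (GT i)
    then have "i \<in> ix" using x by (auto simp: gens_def)
    then show ?thesis using inNF_tz[OF _ IH, of i 1] by (simp add: ev_Cons GT tz_1)
  next
    case (GTinv i)
    then have "i \<in> ix" using x by (auto simp: gens_def)
    then show ?thesis using inNF_tz[OF _ IH, of i "- 1"] by (simp add: ev_Cons GTinv tz_neg_1)
  qed
qed

end

section \<open>Group elements absorbed by the cups, and uniqueness of the normal form\<close>

lemma arcs_cong: "set P = set P' \<Longrightarrow> arcs P = arcs P'"
  by (simp add: arcs_def)

lemma ents_cong: "set P = set P' \<Longrightarrow> set (ents P) = set (ents P')"
  by (simp add: set_ents)

lemma map_pairs_fixed: "(\<And>x. x \<in> set (ents P) \<Longrightarrow> \<rho> x = x) \<Longrightarrow> map (map_prod \<rho> \<rho>) P = P"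
  by (induction P) auto

text \<open>The stabiliser of the cups: placed below the pairs of \<open>P\<close>, the element
  given by m and \<sigma> leaves the free strands alone and reproduces the cups with their gains.
  The multiples of 2 are the contributions of the twists, as t_i has label 2.\<close>

definition stab :: "nat \<Rightarrow> (nat \<times> nat) list \<Rightarrow> (nat \<Rightarrow> int) \<Rightarrow> (nat \<Rightarrow> nat) \<Rightarrow> bool" where
  "stab n P m \<sigma> \<longleftrightarrow> (\<forall>k\<in>{1..n}. k \<notin> set (ents P) \<longrightarrow> \<sigma> k = k \<and> m k = 0) \<and>
     (\<forall>i j s. (i, j, s) \<in> arcs P \<longrightarrow> (\<sigma> i, \<sigma> j, s + 2 * m (\<sigma> i) - 2 * m (\<sigma> j)) \<in> arcs P)"

lemma stabD1: "stab n P m \<sigma> \<Longrightarrow> k \<in> {1..n} \<Longrightarrow> k \<notin> set (ents P) \<Longrightarrow> \<sigma> k = k \<and> m k = 0"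
  by (simp add: stab_def)

lemma stabD2: "stab n P m \<sigma> \<Longrightarrow> (i, j, s) \<in> arcs P \<Longrightarrow> (\<sigma> i, \<sigma> j, s + 2 * m (\<sigma> i) - 2 * m (\<sigma> j)) \<in> arcs P"
  by (simp add: stab_def)

lemma stab_cong: "set P = set P' \<Longrightarrow> stab n P m \<sigma> = stab n P' m \<sigma>"
  unfolding stab_def using arcs_cong ents_cong by metis

lemma stab_comp:
  assumes p: "\<sigma>1 permutes {1..n}" and s1: "stab n P m1 \<sigma>1" and s2: "stab n P m2 \<sigma>2"
  shows "stab n P (\<lambda>i. m1 i + m2 (pinv \<sigma>1 i)) (\<sigma>1 \<circ> \<sigma>2)"
proof -
  have inv: "pinv \<sigma>1 (\<sigma>1 x) = x" for x using permutes_inverses(2)[OF p] .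
  show ?thesis unfolding stab_def
  proof (intro conjI ballI impI allI)
    fix k assume k: "k \<in> {1..n}" "k \<notin> set (ents P)"
    note a = stabD1[OF s1 k] and b = stabD1[OF s2 k]
    show "(\<sigma>1 \<circ> \<sigma>2) k = k" using a b by simp
    have "pinv \<sigma>1 k = k" using inv[of k] a by simp
    then show "m1 k + m2 (pinv \<sigma>1 k) = 0" using a b by simp
  next
    fix i j s assume "(i, j, s) \<in> arcs P"
    from stabD2[OF s1 stabD2[OF s2 this]]
    have "(\<sigma>1 (\<sigma>2 i), \<sigma>1 (\<sigma>2 j), s + 2 * m2 (\<sigma>2 i) - 2 * m2 (\<sigma>2 j) + 2 * m1 (\<sigma>1 (\<sigma>2 i)) - 2 * m1 (\<sigma>1 (\<sigma>2 j))) \<in> arcs P" .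
    moreover have "s + 2 * m2 (\<sigma>2 i) - 2 * m2 (\<sigma>2 j) + 2 * m1 (\<sigma>1 (\<sigma>2 i)) - 2 * m1 (\<sigma>1 (\<sigma>2 j)) =
      s + 2 * (m1 (\<sigma>1 (\<sigma>2 i)) + m2 (\<sigma>2 i)) - 2 * (m1 (\<sigma>1 (\<sigma>2 j)) + m2 (\<sigma>2 j))" by (simp add: algebra_simps)
    ultimately show "((\<sigma>1 \<circ> \<sigma>2) i, (\<sigma>1 \<circ> \<sigma>2) j,
        s + 2 * (m1 ((\<sigma>1 \<circ> \<sigma>2) i) + m2 (pinv \<sigma>1 ((\<sigma>1 \<circ> \<sigma>2) i))) - 2 * (m1 ((\<sigma>1 \<circ> \<sigma>2) j) + m2 (pinv \<sigma>1 ((\<sigma>1 \<circ> \<sigma>2) j)))) \<in> arcs P"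
      by (simp add: inv)
  qed
qed

context atl_monoid
begin

text \<open>Turning the pair around changes its gain by 2, which one twist at i makes up
  for.\<close>

lemma stab_flip:
  assumes "pairing n ((i, j) # P)"
  shows "stab n ((i, j) # P) (dl i 1) (transpose i j)"
proof -
  have ij: "i \<noteq> j" "i \<notin> set (ents P)" "j \<notin> set (ents P)" using assms by (auto simp: pairing_Cons)
  show ?thesis unfolding stab_def
  proof (intro conjI ballI impI allI)
    fix k l s assume "(k, l, s) \<in> arcs ((i, j) # P)"
    then consider "(k, l, s) = (i, j, 1)" | "(k, l, s) = (j, i, - 1)" | "(k, l, s) \<in> arcs P" by (auto simp: arcs_Cons)
    then show "(transpose i j k, transpose i j l, s + 2 * dl i 1 (transpose i j k) - 2 * dl i 1 (transpose i j l)) \<in> arcs ((i, j) # P)"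
    proof cases
      case 3
      then have "k \<noteq> i" "k \<noteq> j" "l \<noteq> i" "l \<noteq> j" using arcs_ents ij by blast+
      then show ?thesis using 3 by (simp add: arcs_Cons dl_def)
    qed (use ij in \<open>auto simp: arcs_Cons dl_def\<close>)
  qed (auto simp: dl_def)
qed

text \<open>The exchange respects the order of both pairs, so the gains agree without any
  twist.\<close>

lemma stab_swap:
  assumes "pairing n ((i, j) # (k, l) # P)"
  shows "stab n ((i, j) # (k, l) # P) (\<lambda>_. 0) (transpose i k \<circ> transpose j l)"
proof -
  have d: "distinct [i, j, k, l]" "i \<notin> set (ents P)" "j \<notin> set (ents P)" "k \<notin> set (ents P)" "l \<notin> set (ents P)"
    using assms by (auto simp: pairing_Cons)
  let ?t = "transpose i k \<circ> transpose j l"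
  have v: "?t i = k" "?t j = l" "?t k = i" "?t l = j" using d by (auto simp: transpose_def)
  have o: "?t x = x" if "x \<notin> {i, j, k, l}" for x using that by (auto simp: transpose_def)
  show ?thesis unfolding stab_def
  proof (intro conjI ballI impI allI)
    fix x assume "x \<notin> set (ents ((i, j) # (k, l) # P))"
    then show "?t x = x" by (intro o) auto
  next
    fix x y s assume "(x, y, s) \<in> arcs ((i, j) # (k, l) # P)"
    then consider "(x, y, s) = (i, j, 1)" | "(x, y, s) = (j, i, - 1)" | "(x, y, s) = (k, l, 1)" | "(x, y, s) = (l, k, - 1)"
      | "(x, y, s) \<in> arcs P" by (auto simp: arcs_Cons)
    then have "(?t x, ?t y, s) \<in> arcs ((i, j) # (k, l) # P)"
    proof cases
      case 5
      then have "x \<notin> {i, j, k, l}" "y \<notin> {i, j, k, l}" using arcs_ents d by blast+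
      then show ?thesis using 5 o by (simp add: arcs_Cons)
    qed (use v in \<open>auto simp: arcs_Cons simp del: comp_apply\<close>)
    then show "(?t x, ?t y, s + 2 * 0 - 2 * 0) \<in> arcs ((i, j) # (k, l) # P)" by simp
  qed simp
qed

text \<open>The pair lets the twist at i be replaced by the transposition of i and j, which then
  cancels against the given one.\<close>

lemma flip_absorb:
  assumes w: "pairing n ((i, j) # P)"
  shows "UP ((i, j) # P) * g (dl i 1) (transpose i j) = UP ((i, j) # P)"
proof -
  have ij: "i \<in> ix" "j \<in> ix" "i \<noteq> j" "pairing n P" "i \<notin> set (ents P)" "j \<notin> set (ents P)" using w by (auto simp: pairing_Cons)
  have t: "pm (transpose i j)" using pm_tr ij by blast
  have "map (map_prod (transpose i j) (transpose i j)) P = P"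
    by (rule map_pairs_fixed) (use ij in \<open>auto simp: transpose_def\<close>)
  then have c: "UP P * p (transpose i j) = p (transpose i j) * UP P" using p_UP[OF t ij(4)] by simp
  have "UP ((i, j) # P) * g (dl i 1) (transpose i j) = U i j * (UP P * tz i 1) * p (transpose i j)"
    by (simp add: UP_Cons g_def tau_dl[OF ij(1)] mult.assoc)
  also have "\<dots> = (U i j * tz i 1) * (UP P * p (transpose i j))" using UP_tz[OF ij(4,1,5)] by (simp add: mult.assoc)
  also have "\<dots> = U i j * (p (transpose i j) * p (transpose i j)) * UP P"
    unfolding c U_pair(2)[OF ij(1-3), symmetric] by (simp add: mult.assoc)
  finally show ?thesis using tr_tr[OF ij(1,2)] by (simp add: UP_Cons)
qed

lemma swap_absorb:
  assumes w: "pairing n ((i, j) # (k, l) # P)"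
  shows "UP ((i, j) # (k, l) # P) * g (\<lambda>_. 0) (transpose i k \<circ> transpose j l) = UP ((i, j) # (k, l) # P)"
proof -
  have d: "i \<in> ix" "j \<in> ix" "k \<in> ix" "l \<in> ix" "distinct [i, j, k, l]" "pairing n P"
     "i \<notin> set (ents P)" "j \<notin> set (ents P)" "k \<notin> set (ents P)" "l \<notin> set (ents P)"
    using w by (auto simp: pairing_Cons)
  let ?t = "transpose i k \<circ> transpose j l"
  have t: "pm ?t" using permutes_compose[OF pm_tr[OF d(2,4)] pm_tr[OF d(1,3)]] .
  have "map (map_prod ?t ?t) P = P"
    by (rule map_pairs_fixed) (use d in \<open>auto simp: transpose_def\<close>)
  then have c: "UP P * p ?t = p ?t * UP P" using p_UP[OF t d(6)] by simp
  have "UP ((i, j) # (k, l) # P) * g (\<lambda>_. 0) ?t = U i j * U k l * (UP P * p ?t)"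
    by (simp add: UP_Cons g_def mult.assoc)
  also have "\<dots> = (U i j * U k l * p ?t) * UP P" unfolding c by (simp add: mult.assoc)
  finally have e: "UP ((i, j) # (k, l) # P) * g (\<lambda>_. 0) ?t = (U i j * U k l * p ?t) * UP P" .
  show ?thesis unfolding e U_quad(2)[OF d(1-5), symmetric] by (simp add: UP_Cons mult.assoc)
qed

text \<open>A stabilising element that fixes i also fixes j and twists both strands equally. Equal
  twists at the two ends of a cup cancel after one of them has slid to the other end, and what
  remains stabilises the other pairs.\<close>

lemma stab_fixed:
  assumes w: "pairing n ((i, j) # P)" and s: "pm \<sigma>" and st: "stab n ((i, j) # P) m \<sigma>" and f: "\<sigma> i = i"
    and IH: "\<And>m \<sigma>. pm \<sigma> \<Longrightarrow> stab n P m \<sigma> \<Longrightarrow> UP P * g m \<sigma> = UP P"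
  shows "UP ((i, j) # P) * g m \<sigma> = UP ((i, j) # P)"
proof -
  have ij: "i \<in> ix" "j \<in> ix" "i \<noteq> j" "pairing n P" "i \<notin> set (ents P)" "j \<notin> set (ents P)" using w by (auto simp: pairing_Cons)
  have a0: "(i, j, 1) \<in> arcs ((i, j) # P)" by (simp add: arcs_Cons)
  from stabD2[OF st this] have "(i, \<sigma> j, 1 + 2 * m i - 2 * m (\<sigma> j)) \<in> arcs ((i, j) # P)" using f by simp
  from arcs_unique[OF w a0 this] have fj: "\<sigma> j = j" and mm: "m j = m i" by auto
  define m0 where "m0 = m(i := 0, j := 0)"
  have tm: "tau m = tz i (m i) * tz j (m i) * tau m0"
    using tau_split[OF ij(1), of m] tau_split[OF ij(2), of "m(i := 0)"] ij(3) mm by (simp add: m0_def mult.assoc)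
  have "UP ((i, j) # P) * g m \<sigma> = U i j * (UP P * tz i (m i)) * tz j (m i) * g m0 \<sigma>"
    by (simp add: UP_Cons g_def tm mult.assoc)
  also have "\<dots> = U i j * tz i (m i) * (UP P * tz j (m i)) * g m0 \<sigma>"
    unfolding UP_tz[OF ij(4,1,5)] by (simp add: mult.assoc)
  also have "\<dots> = (U i j * tz i (m i)) * tz j (m i) * UP P * g m0 \<sigma>"
    unfolding UP_tz[OF ij(4,2,6)] by (simp add: mult.assoc)
  also have "\<dots> = U i j * (tz j (- m i) * tz j (m i)) * UP P * g m0 \<sigma>"
    unfolding U_pair(4)[OF ij(1-3)] by (simp add: mult.assoc)
  also have "tz j (- m i) * tz j (m i) = 1" using tz_cancel[OF ij(2), of "- m i"] by simp
  finally have e: "UP ((i, j) # P) * g m \<sigma> = U i j * (UP P * g m0 \<sigma>)" by (simp add: mult.assoc)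
  have inj: "\<sigma> x = \<sigma> y \<longleftrightarrow> x = y" for x y using permutes_inj[OF s] by (simp add: inj_eq)
  have "stab n P m0 \<sigma>" unfolding stab_def
  proof (intro conjI ballI impI allI)
    fix k assume k: "k \<in> {1..n}" "k \<notin> set (ents P)"
    show "\<sigma> k = k" using stabD1[OF st k(1)] k(2) f fj by (cases "k = i"; cases "k = j") auto
    show "m0 k = 0" using stabD1[OF st k(1)] k(2) by (cases "k = i"; cases "k = j") (auto simp: m0_def)
  next
    fix x y s' assume xy: "(x, y, s') \<in> arcs P"
    then have ne: "x \<noteq> i" "x \<noteq> j" "y \<noteq> i" "y \<noteq> j" using arcs_ents ij by blast+
    then have ne': "\<sigma> x \<noteq> i" "\<sigma> x \<noteq> j" "\<sigma> y \<noteq> i" "\<sigma> y \<noteq> j" using inj[of x i] inj[of x j] inj[of y i] inj[of y j] f fj by auto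
    have "(x, y, s') \<in> arcs ((i, j) # P)" using xy by (simp add: arcs_Cons)
    from stabD2[OF st this] show "(\<sigma> x, \<sigma> y, s' + 2 * m0 (\<sigma> x) - 2 * m0 (\<sigma> y)) \<in> arcs P"
      using ne' by (auto simp: arcs_Cons m0_def)
  qed
  from IH[OF s this] show ?thesis unfolding e by (simp add: UP_Cons)
qed

lemma stab_step:
  assumes b: "UP P * g mb \<beta> = UP P" "stab n P mb \<beta>" "pm \<beta>" and s: "pm \<sigma>" "stab n P m \<sigma>"
  obtains m' where "UP P * g m \<sigma> = UP P * g m' (\<beta> \<circ> \<sigma>)" "stab n P m' (\<beta> \<circ> \<sigma>)" "pm (\<beta> \<circ> \<sigma>)"
proof
  show "UP P * g m \<sigma> = UP P * g (\<lambda>i. mb i + m (pinv \<beta> i)) (\<beta> \<circ> \<sigma>)"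
    using b(1) g_mult[OF b(3) s(1), of mb m] by (metis mult.assoc)
  show "stab n P (\<lambda>i. mb i + m (pinv \<beta> i)) (\<beta> \<circ> \<sigma>)" using stab_comp[OF b(3,2) s(2)] .
  show "pm (\<beta> \<circ> \<sigma>)" using permutes_compose[OF s(1) b(3)] .
qed

text \<open>The element is multiplied by absorbed ones until it fixes the first pair: an exchange of
  pairs brings the image of i into the pair, and a flip brings it to i. Then the first pair is split
  off.\<close>

lemma stab_absorb:
  "pairing n P \<Longrightarrow> pm \<sigma> \<Longrightarrow> stab n P m \<sigma> \<Longrightarrow> UP P * g m \<sigma> = UP P"
proof (induction "length P" arbitrary: P m \<sigma>)
  case 0
  then have P: "P = []" by simp
  have "\<sigma> k = k" for k using stabD1[OF 0(4), of k] 0(3) by (cases "k \<in> ix") (auto simp: P permutes_def)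
  then have s: "\<sigma> = id" by auto
  have t: "tau m = tau (\<lambda>_. 0)" by (rule tau_cong) (use stabD1[OF 0(4)] P in auto)
  show ?case unfolding P g_def s t p_id tau_zero UP_Nil by (simp only: mult_1_right)
next
  case (Suc q)
  obtain i j P' where P: "P = (i, j) # P'" using Suc.hyps(2) by (cases P) auto
  note w = Suc.prems(1)[unfolded P]
  have ij: "i \<in> ix" "j \<in> ix" "i \<noteq> j" "pairing n P'" "i \<notin> set (ents P')" "j \<notin> set (ents P')" using w by (auto simp: pairing_Cons)
  have IH: "\<And>m \<sigma>. pm \<sigma> \<Longrightarrow> stab n P' m \<sigma> \<Longrightarrow> UP P' * g m \<sigma> = UP P'" using Suc.hyps ij(4) P by simp
  have near: "UP ((i, j) # P') * g m \<sigma> = UP ((i, j) # P')"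
    if s: "pm \<sigma>" "stab n ((i, j) # P') m \<sigma>" and ij': "\<sigma> i = i \<or> \<sigma> i = j" for m \<sigma>
  proof (cases "\<sigma> i = i")
    case True
    then show ?thesis using stab_fixed[OF w s] IH by blast
  next
    case False
    then have sj: "\<sigma> i = j" using ij' by simp
    obtain m' where m': "UP ((i, j) # P') * g m \<sigma> = UP ((i, j) # P') * g m' (transpose i j \<circ> \<sigma>)"
      "stab n ((i, j) # P') m' (transpose i j \<circ> \<sigma>)" "pm (transpose i j \<circ> \<sigma>)"
      using stab_step[OF flip_absorb[OF w] stab_flip[OF w] pm_tr[OF ij(1,2)] s] .
    then show ?thesis using stab_fixed[OF w m'(3,2) _ IH] sj by simp
  qed
  show ?case
  proof (cases "\<sigma> i = i \<or> \<sigma> i = j")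
    case True
    then show ?thesis using near Suc.prems P by simp
  next
    case False
    have "(i, j, 1) \<in> arcs P" by (simp add: P arcs_Cons)
    from stabD2[OF Suc.prems(3) this] obtain s' where "(\<sigma> i, \<sigma> j, s') \<in> arcs P" by blast
    then have "(\<sigma> i, \<sigma> j, s') \<in> arcs P'" using False by (auto simp: P arcs_Cons)
    \<comment> \<open>The image of i may be either end of the other pair. If it is the second end,
      the exchange moves it to j, and the flip in \<open>near\<close> repairs this.\<close>
    then obtain k l where kl: "(k, l) \<in> set P'" "\<sigma> i = k \<or> \<sigma> i = l" by (auto simp: arcs_def)
    obtain R where R: "pairing n ((k, l) # R)" "UP P' = UP ((k, l) # R)" "set P' = insert (k, l) (set R)"
      using front[OF ij(4) kl(1)] .
    have sP: "set P = set ((i, j) # (k, l) # R)" using P R by simp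
    have uP: "UP P = UP ((i, j) # (k, l) # R)" using P R(2) by (simp add: UP_Cons)
    have e: "set (ents P') = set (ents ((k, l) # R))" using R(3) by (intro ents_cong) simp
    have w': "pairing n ((i, j) # (k, l) # R)" using R(1) ij(1-3,5,6) e by (simp add: pairing_Cons)
    have d: "k \<in> ix" "l \<in> ix" "distinct [i, j, k, l]" using w' by (auto simp: pairing_Cons)
    let ?t = "transpose i k \<circ> transpose j l"
    have t: "pm ?t" using permutes_compose[OF pm_tr[OF ij(2) d(2)] pm_tr[OF ij(1) d(1)]] .
    have stP: "stab n ((i, j) # (k, l) # R) m \<sigma>" using stab_cong[OF sP] Suc.prems(3) by simp
    obtain m' where m': "UP ((i, j) # (k, l) # R) * g m \<sigma> = UP ((i, j) # (k, l) # R) * g m' (?t \<circ> \<sigma>)"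
      "stab n ((i, j) # (k, l) # R) m' (?t \<circ> \<sigma>)" "pm (?t \<circ> \<sigma>)"
      using stab_step[OF swap_absorb[OF w'] stab_swap[OF w'] t Suc.prems(2) stP] .
    have "(?t \<circ> \<sigma>) i = i \<or> (?t \<circ> \<sigma>) i = j" using kl(2) d(3) by (auto simp: transpose_def)
    moreover have "stab n ((i, j) # P') m' (?t \<circ> \<sigma>)" using stab_cong[OF sP] m'(2) P by simp
    ultimately have "UP P * g m' (?t \<circ> \<sigma>) = UP P" using near[OF m'(3)] P by simp
    then show ?thesis using m'(1) uP by simp
  qed
qed

text \<open>The counterpart above the caps: equal twists at both ends of a cap cancel by sliding,
  and the twists on free strands pass through.\<close>

lemma tau_absorb:
  "pairing n P \<Longrightarrow> (\<forall>(i, j)\<in>set P. d i = d j) \<Longrightarrow>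
    tau d * UP P = UP P * tau (\<lambda>k. if k \<in> set (ents P) then 0 else d k)"
proof (induction P arbitrary: d)
  case (Cons x P)
  obtain i j where x: "x = (i, j)" by (cases x)
  have ij: "i \<in> ix" "j \<in> ix" "i \<noteq> j" "pairing n P" "i \<notin> set (ents P)" "j \<notin> set (ents P)"
    using Cons.prems(1) by (auto simp: x pairing_Cons)
  have dij: "d j = d i" using Cons.prems(2) by (simp add: x)
  define d0 where "d0 = d(i := 0, j := 0)"
  have "tau d = tz i (d i) * (tz j (d i) * tau d0)"
    using tau_split[OF ij(1), of d] tau_split[OF ij(2), of "d(i := 0)"] ij(3) dij by (simp add: d0_def)
  then have td: "tau d = tau d0 * tz j (d i) * tz i (d i)"
    using tz_tau[OF ij(1)] tz_tau[OF ij(2)] tz_commute[OF ij(1,2)] by (metis mult.assoc)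
  have "tau d * UP (x # P) = tau d0 * tz j (d i) * (tz i (d i) * U i j) * UP P" by (simp add: td x UP_Cons mult.assoc)
  also have "\<dots> = tau d0 * (tz j (d i) * tz j (- d i)) * U i j * UP P"
    unfolding U_pair(5)[OF ij(1-3)] by (simp add: mult.assoc)
  also have "\<dots> = (tau d0 * U i j) * UP P" using tz_cancel[OF ij(2)] by simp
  also have "\<dots> = U i j * (tau d0 * UP P)"
  proof -
    have c: "U i j * tau d0 = tau d0 * U i j" by (rule U_tau[OF ij(1-3)]) (use ij in \<open>auto simp: d0_def\<close>)
    show ?thesis unfolding c[symmetric] by (simp add: mult.assoc)
  qed
  also have "\<dots> = U i j * (UP P * tau (\<lambda>k. if k \<in> set (ents P) then 0 else d0 k))"
  proof -
    have "\<forall>(k, l)\<in>set P. d0 k = d0 l"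
    proof
      fix y assume y: "y \<in> set P"
      obtain k l where kl: "y = (k, l)" by (cases y)
      have "k \<in> set (ents P)" "l \<in> set (ents P)" using y kl by (auto simp: set_ents)
      then show "case y of (k, l) \<Rightarrow> d0 k = d0 l" using Cons.prems(2) y ij kl by (auto simp: d0_def)
    qed
    then show ?thesis using Cons.IH[OF ij(4)] by simp
  qed
  also have "(\<lambda>k. if k \<in> set (ents P) then 0 else d0 k) = (\<lambda>k. if k \<in> set (ents (x # P)) then 0 else d k)"
    by (auto simp: x d0_def)
  finally show ?case by (simp add: x UP_Cons mult.assoc)
qed simp

text \<open>A tangle determines its caps as unordered pairs only. With i < j the set of pairs
  becomes a function of the tangle.\<close>

definition oriented :: "(nat \<times> nat) list \<Rightarrow> bool" where
  "oriented P \<longleftrightarrow> (\<forall>(i, j)\<in>set P. i < j)"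

text \<open>Wrongly ordered pairs are reversed at the price of twists. That \<open>\<mu>\<close>
  vanishes off the pairs lets the next \<open>U i j\<close> commute with \<open>tau \<mu>\<close> in
  the induction.\<close>

lemma orient:
  "pairing n P \<Longrightarrow> \<exists>P' \<mu> \<nu>. pairing n P' \<and> oriented P' \<and> set (ents P') = set (ents P) \<and>
    (\<forall>k. k \<notin> set (ents P) \<longrightarrow> \<mu> k = 0) \<and> UP P = tau \<mu> * (UP P' * tau \<nu>)"
proof (induction P)
  case Nil
  show ?case by (intro exI[of _ "[]"] exI[of _ "\<lambda>_. 0"]) (simp add: oriented_def)
next
  case (Cons x P)
  obtain i j where x: "x = (i, j)" by (cases x)
  have ij: "i \<in> ix" "j \<in> ix" "i \<noteq> j" "pairing n P" "i \<notin> set (ents P)" "j \<notin> set (ents P)"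
    using Cons.prems(1) by (auto simp: x pairing_Cons)
  obtain P' \<mu> \<nu> where P': "pairing n P'" "oriented P'" "set (ents P') = set (ents P)"
    "\<forall>k. k \<notin> set (ents P) \<longrightarrow> \<mu> k = 0" "UP P = tau \<mu> * (UP P' * tau \<nu>)" using Cons.IH[OF ij(4)] by blast
  have mu: "\<mu> i = 0" "\<mu> j = 0" using P'(4) ij by auto
  show ?case
  proof (cases "i < j")
    case True
    have "UP (x # P) = (U i j * tau \<mu>) * (UP P' * tau \<nu>)" by (simp add: x UP_Cons P'(5) mult.assoc)
    also have "\<dots> = tau \<mu> * (UP ((i, j) # P') * tau \<nu>)" using U_tau[OF ij(1-3) mu] by (simp add: UP_Cons mult.assoc)
    finally show ?thesis using P' ij True
      by (intro exI[of _ "(i, j) # P'"] exI[of _ \<mu>] exI[of _ \<nu>]) (auto simp: x pairing_Cons oriented_def)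
  next
    case False
    then have lt: "j < i" using ij(3) by simp
    have "UP (x # P) = tz j (- 1) * U j i * (tz j 1 * tau \<mu>) * (UP P' * tau \<nu>)"
      using U_pair(6)[of j i] ij by (simp add: x UP_Cons P'(5) mult.assoc)
    also have "\<dots> = tz j (- 1) * (U j i * tau \<mu>) * (tz j 1 * UP P') * tau \<nu>"
      using tz_tau[OF ij(2), of 1 \<mu>] by (simp add: mult.assoc)
    also have "\<dots> = (tz j (- 1) * tau \<mu>) * (U j i * UP P' * (tz j 1 * tau \<nu>))"
      unfolding U_tau[OF ij(2,1) ij(3)[symmetric] mu(2,1)] UP_tz[OF P'(1) ij(2) ij(6)[folded P'(3)], symmetric]
      by (simp add: mult.assoc)
    also have "\<dots> = tau (\<lambda>k. dl j (- 1) k + \<mu> k) * (UP ((j, i) # P') * tau (\<lambda>k. dl j 1 k + \<nu> k))"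
      by (simp add: tau_add tau_dl[OF ij(2)] UP_Cons)
    finally show ?thesis using P' ij lt
      by (intro exI[of _ "(j, i) # P'"] exI[of _ "\<lambda>k. dl j (- 1) k + \<mu> k"] exI[of _ "\<lambda>k. dl j 1 k + \<nu> k"])
        (auto simp: x pairing_Cons oriented_def dl_def)
  qed
qed

lemma normal_form_oriented:
  assumes "set u \<subseteq> gens n"
  shows "\<exists>ks m P m' \<sigma>. pairing n P \<and> oriented P \<and> pm \<sigma> \<and> ev u = Zs ks * (tau m * (UP P * g m' \<sigma>))"
proof -
  obtain ks m P m' \<sigma> where x: "pairing n P" "pm \<sigma>" "ev u = Zs ks * (tau m * (UP P * g m' \<sigma>))"
    using normal_form[OF assms] unfolding inNF_def by blast
  obtain P' \<mu> \<nu> where P': "pairing n P'" "oriented P'" "UP P = tau \<mu> * (UP P' * tau \<nu>)" using orient[OF x(1)] by blast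
  have "ev u = Zs ks * (tau m * tau \<mu> * (UP P' * (tau \<nu> * g m' \<sigma>)))" by (simp add: x(3) P'(3) mult.assoc)
  also have "\<dots> = Zs ks * (tau (\<lambda>i. m i + \<mu> i) * (UP P' * g (\<lambda>i. \<nu> i + m' i) \<sigma>))" by (simp add: tau_add tau_g)
  finally show ?thesis using P' x(2) by blast
qed

text \<open>The assumptions \<open>top\<close>, \<open>thr\<close> and \<open>bot\<close> are what
  equality of the tangles says about caps, free strands and cups. The difference of the upper twists
  partly cancels at the caps and partly passes through; after that the two lower group elements
  differ by a stabilising one.\<close>

theorem normal_form_unique:
  assumes P: "pairing n P1" "set P1 = set P2" "distinct P1" "distinct P2" and s: "pm \<sigma>1" "pm \<sigma>2"
    and top: "\<And>i j. (i, j) \<in> set P1 \<Longrightarrow> m1 i - m1 j = m2 i - m2 j"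
    and thr: "\<And>c. c \<in> ix \<Longrightarrow> \<sigma>2 c \<notin> set (ents P1) \<Longrightarrow>
      \<sigma>1 c = \<sigma>2 c \<and> m1 (\<sigma>2 c) + m1' (\<sigma>2 c) = m2 (\<sigma>2 c) + m2' (\<sigma>2 c)"
    and bot: "\<And>c d s. (\<sigma>2 c, \<sigma>2 d, s) \<in> arcs P1 \<Longrightarrow>
      (\<sigma>1 c, \<sigma>1 d, s - 2 * m2' (\<sigma>2 c) + 2 * m2' (\<sigma>2 d) + 2 * m1' (\<sigma>1 c) - 2 * m1' (\<sigma>1 d)) \<in> arcs P1"
  shows "tau m1 * (UP P1 * g m1' \<sigma>1) = tau m2 * (UP P2 * g m2' \<sigma>2)"
proof -
  have "mset P1 = mset P2" using P(2-4) set_eq_iff_mset_eq_distinct by blast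
  then have U12: "UP P2 = UP P1" using UP_reorder[OF P(1)] by simp
  define d where "d k = m1 k - m2 k" for k
  define M where "M k = (if k \<in> set (ents P1) then 0 else d k) + m1' k" for k
  have "tau m1 = tau m2 * tau d" unfolding tau_add[symmetric] by (simp add: d_def)
  then have "tau m1 * (UP P1 * g m1' \<sigma>1) = tau m2 * ((tau d * UP P1) * g m1' \<sigma>1)" by (simp add: mult.assoc)
  also have "tau d * UP P1 = UP P1 * tau (\<lambda>k. if k \<in> set (ents P1) then 0 else d k)"
  proof (rule tau_absorb[OF P(1)], clarify)
    fix i j assume "(i, j) \<in> set P1"
    from top[OF this] show "d i = d j" by (simp add: d_def)
  qed
  finally have "tau m1 * (UP P1 * g m1' \<sigma>1) = tau m2 * (UP P1 * tau (\<lambda>k. if k \<in> set (ents P1) then 0 else d k) * g m1' \<sigma>1)" .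
  then have e1: "tau m1 * (UP P1 * g m1' \<sigma>1) = tau m2 * (UP P1 * g M \<sigma>1)"
  proof -
    have "M = (\<lambda>k. (if k \<in> set (ents P1) then 0 else d k) + m1' k)" by (rule ext) (simp add: M_def)
    then show ?thesis using \<open>tau m1 * (UP P1 * g m1' \<sigma>1) = tau m2 * (UP P1 * tau (\<lambda>k. if k \<in> set (ents P1) then 0 else d k) * g m1' \<sigma>1)\<close>
      by (simp add: mult.assoc tau_g)
  qed
  \<comment> \<open>The pair \<open>mb\<close>, \<open>\<beta>\<close> is the quotient of the lower
    group elements: multiplied by \<open>g m2' \<sigma>2\<close> it gives
    \<open>g M \<sigma>1\<close>.\<close>
  define \<beta> where "\<beta> = \<sigma>1 \<circ> pinv \<sigma>2"
  define mb where "mb k = M k - m2' (pinv \<beta> k)" for k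
  have b: "pm \<beta>" unfolding \<beta>_def using permutes_compose[OF permutes_inv[OF s(2)] s(1)] .
  have bs: "\<beta> (\<sigma>2 c) = \<sigma>1 c" for c unfolding \<beta>_def using permutes_inverses(2)[OF s(2)] by simp
  have bi: "pinv \<beta> (\<sigma>1 c) = \<sigma>2 c" for c using permutes_inverses(2)[OF b, of "\<sigma>2 c"] bs by simp
  have "\<beta> \<circ> \<sigma>2 = \<sigma>1" using bs by auto
  then have "g mb \<beta> * g m2' \<sigma>2 = g M \<sigma>1" using g_mult[OF b s(2), of mb m2'] by (simp add: mb_def)
  moreover have "UP P1 * g mb \<beta> = UP P1"
  proof (rule stab_absorb[OF P(1) b])
    have sur: "\<exists>c. k = \<sigma>2 c" for k using permutes_surj[OF s(2)] by (metis surjD)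
    show "stab n P1 mb \<beta>" unfolding stab_def
    proof (intro conjI ballI impI allI)
      fix k assume k: "k \<in> {1..n}" "k \<notin> set (ents P1)"
      obtain c where c: "k = \<sigma>2 c" using sur by blast
      have "c \<in> ix" using k(1) permutes_in_image[OF s(2)] c by blast
      from thr[OF this] have t: "\<sigma>1 c = \<sigma>2 c" "m1 k + m1' k = m2 k + m2' k" using k(2) c by auto
      then show bk: "\<beta> k = k" using bs c by simp
      have "pinv \<beta> k = k" using bi[of c] t(1) c by simp
      then show "mb k = 0" using t(2) k(2) by (simp add: mb_def M_def d_def)
    next
      fix i j s assume a: "(i, j, s) \<in> arcs P1"
      obtain c d' where c: "i = \<sigma>2 c" "j = \<sigma>2 d'" using sur by metis
      from bot[OF a[unfolded c]] have r: "(\<sigma>1 c, \<sigma>1 d', s - 2 * m2' (\<sigma>2 c) + 2 * m2' (\<sigma>2 d') + 2 * m1' (\<sigma>1 c) - 2 * m1' (\<sigma>1 d')) \<in> arcs P1" .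
      have "M (\<sigma>1 c) = m1' (\<sigma>1 c)" "M (\<sigma>1 d') = m1' (\<sigma>1 d')" using arcs_ents[OF r] by (auto simp: M_def)
      then have E: "s + 2 * mb (\<sigma>1 c) - 2 * mb (\<sigma>1 d') = s - 2 * m2' (\<sigma>2 c) + 2 * m2' (\<sigma>2 d') + 2 * m1' (\<sigma>1 c) - 2 * m1' (\<sigma>1 d')"
        by (simp add: mb_def bi algebra_simps)
      show "(\<beta> i, \<beta> j, s + 2 * mb (\<beta> i) - 2 * mb (\<beta> j)) \<in> arcs P1" unfolding c bs E by (rule r)
    qed
  qed
  ultimately have "UP P1 * g M \<sigma>1 = UP P1 * g m2' \<sigma>2" by (metis mult.assoc)
  then show ?thesis using e1 U12 by simp
qed

end

section \<open>Orbits and first returns\<close>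

definition orb :: "('s \<Rightarrow> 's) \<Rightarrow> 's \<Rightarrow> 's set" where
  "orb f x = range (\<lambda>k. (f ^^ k) x)"

definition recurrent :: "('s \<Rightarrow> 's) \<Rightarrow> 's \<Rightarrow> bool" where
  "recurrent f x \<longleftrightarrow> (\<exists>k>0. (f ^^ k) x = x)"

definition closed_orbits :: "('s \<Rightarrow> 's) \<Rightarrow> 's set \<Rightarrow> 's set set" where
  "closed_orbits f S = {orb f x | x. x \<in> S \<and> recurrent f x}"

definition is_period :: "('s \<Rightarrow> 's) \<Rightarrow> 's \<Rightarrow> nat \<Rightarrow> bool" where
  "is_period f x p \<longleftrightarrow> p > 0 \<and> (f ^^ p) x = x \<and> (\<forall>j. 0 < j \<and> j < p \<longrightarrow> (f ^^ j) x \<noteq> x)"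

lemma funpow_add_apply: "(f ^^ (i + j)) x = (f ^^ i) ((f ^^ j) x)"
  by (simp add: funpow_add)

lemma sum_lessThan_add:
  "(\<Sum>j<m + r. h j) = (\<Sum>j<m. h j) + (\<Sum>j<r. h (j + m :: nat) :: 'b :: comm_monoid_add)"
  by (induction r) (auto simp: ac_simps)

lemma recurrent_period:
  assumes "recurrent f x"
  obtains p where "is_period f x p"
proof -
  define p where "p = (LEAST k. k > 0 \<and> (f ^^ k) x = x)"
  from assms have ex: "\<exists>k. k > 0 \<and> (f ^^ k) x = x" by (auto simp: recurrent_def)
  then have "p > 0 \<and> (f ^^ p) x = x" unfolding p_def by (rule LeastI_ex)
  moreover have "(f ^^ j) x \<noteq> x" if "0 < j" "j < p" for j
    using not_less_Least[of j "\<lambda>k. k > 0 \<and> (f ^^ k) x = x"] that unfolding p_def by blast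
  ultimately show ?thesis using that by (auto simp: is_period_def)
qed

lemma is_period_recurrent: "is_period f x p \<Longrightarrow> recurrent f x"
  by (auto simp: is_period_def recurrent_def)

lemma orb_eq_image:
  assumes "is_period f x p"
  shows "orb f x = (\<lambda>j. (f ^^ j) x) ` {..<p}"
proof -
  have "(f ^^ k) x = (f ^^ (k mod p)) x" "k mod p < p" for k
    using assms by (auto simp: is_period_def funpow_mod_eq)
  then show ?thesis unfolding orb_def by blast
qed

lemma inj_on_period:
  assumes "is_period f x p"
  shows "inj_on (\<lambda>j. (f ^^ j) x) {..<p}"
proof -
  have *: False if "i < j" "j < p" "(f ^^ i) x = (f ^^ j) x" for i j
  proof -
    have "(f ^^ (p - j + i)) x = (f ^^ (p - j + j)) x"
      using that(3) by (simp add: funpow_add)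
    also have "\<dots> = x" using assms that by (simp add: is_period_def)
    finally show False using assms that by (auto simp: is_period_def)
  qed
  show ?thesis
    by (rule inj_onI) (metis "*" lessThan_iff linorder_neqE_nat)
qed

lemma sum_orb:
  assumes "is_period f x p"
  shows "sum h (orb f x) = (\<Sum>j<p. h ((f ^^ j) x))"
  unfolding orb_eq_image[OF assms] using inj_on_period[OF assms]
  by (simp add: sum.reindex)

lemma orb_step: "(f ^^ k) x \<in> orb f x"
  by (auto simp: orb_def)

lemma orb_self: "x \<in> orb f x"
  using orb_step[of 0 f x] by simp

lemma orb_mem:
  assumes "recurrent f x" "y \<in> orb f x"
  shows "recurrent f y" "orb f y = orb f x"
proof -
  obtain p where p: "is_period f x p" using assms(1) by (rule recurrent_period)
  then obtain j where j: "j < p" "y = (f ^^ j) x"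
    using assms(2) orb_eq_image[OF p] by auto
  have return: "(f ^^ (p - j)) y = x"
    using p j by (simp add: is_period_def flip: funpow_add_apply)
  have "(f ^^ p) y = y"
    using p j by (simp add: is_period_def add.commute flip: funpow_add_apply)
      (simp add: funpow_add)
  then show "recurrent f y" using p by (auto simp: recurrent_def is_period_def)
  have "(f ^^ k) y \<in> orb f x" for k using j by (auto simp: orb_def simp flip: funpow_add_apply)
  moreover have "(f ^^ k) x \<in> orb f y" for k
    unfolding return[symmetric] by (auto simp: orb_def simp flip: funpow_add_apply)
  ultimately show "orb f y = orb f x" by (auto simp: orb_def[of f x] orb_def[of f y])
qed

lemma closed_orbits_mem:
  "\<lbrakk>Q \<in> closed_orbits f S; y \<in> Q\<rbrakk> \<Longrightarrow> recurrent f y \<and> Q = orb f y"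
  by (auto simp: closed_orbits_def dest: orb_mem)

lemma closed_orbits_nonempty: "Q \<in> closed_orbits f S \<Longrightarrow> Q \<noteq> {}"
  by (auto simp: closed_orbits_def orb_def)

text \<open>Here \<open>g\<close> is the map induced by \<open>f\<close> on T, with return times
  \<open>k\<close>, and \<open>f\<close> is stuck wherever \<open>g\<close> leaves T. The last
  clause says that the earlier iterates of \<open>g\<close> are met at earlier times; it prevents
  the first return of \<open>f\<close> from skipping one of \<open>g\<close>.\<close>

lemma step_visit:
  assumes step: "\<forall>x\<in>T. (f ^^ k x) (\<iota> x) = \<iota> (g x) \<and> k x > (0::nat) \<and>
      (\<forall>j. 0 < j \<and> j < k x \<longrightarrow> (f ^^ j) (\<iota> x) \<notin> \<iota> ` T) \<and>
      h' x = (\<Sum>j<k x. h ((f ^^ j) (\<iota> x)))"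
    and ex: "\<forall>x\<in>T. g x \<notin> T \<longrightarrow> f (\<iota> (g x)) = \<iota> (g x) \<and> \<iota> (g x) \<notin> \<iota> ` T"
    and "x \<in> T" "(f ^^ q) (\<iota> x) \<in> \<iota> ` T"
  shows "\<exists>i. (f ^^ q) (\<iota> x) = \<iota> ((g ^^ i) x) \<and> (g ^^ i) x \<in> T \<and> (q > 0 \<longrightarrow> i > 0) \<and>
      (\<Sum>j<q. h ((f ^^ j) (\<iota> x))) = (\<Sum>j<i. h' ((g ^^ j) x)) \<and>
      (\<forall>i'<i. \<exists>q'<q. (f ^^ q') (\<iota> x) = \<iota> ((g ^^ i') x) \<and> (i' > 0 \<longrightarrow> q' > 0))"
  using assms(3,4)
proof (induction q arbitrary: x rule: less_induct)
  case (less q)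
  have s: "(f ^^ k x) (\<iota> x) = \<iota> (g x) \<and> k x > 0 \<and>
      (\<forall>j. 0 < j \<and> j < k x \<longrightarrow> (f ^^ j) (\<iota> x) \<notin> \<iota> ` T) \<and>
      h' x = (\<Sum>j<k x. h ((f ^^ j) (\<iota> x)))"
    using step less.prems(1) by blast
  show ?case
  proof (cases "q = 0")
    case True
    then show ?thesis using less.prems by (intro exI[of _ 0]) auto
  next
    case False
    \<comment> \<open>Strictly between the times 0 and \<open>k x\<close> the orbit avoids T, so a
      positive time of a visit is at least \<open>k x\<close>.\<close>
    with s less.prems have qk: "k x \<le> q" by (meson leI neq0_conv)
    define r where "r = q - k x"
    have q: "q = r + k x" using qk by (simp add: r_def)
    have fr: "(f ^^ q) (\<iota> x) = (f ^^ r) (\<iota> (g x))" unfolding q funpow_add_apply using s by simp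
    have gx: "g x \<in> T"
    proof (rule ccontr)
      assume "g x \<notin> T"
      note e = ex[rule_format, OF less.prems(1) this]
      then have "(f ^^ r) (\<iota> (g x)) = \<iota> (g x)" by (induction r) auto
      with e fr less.prems show False by simp
    qed
    from s have rq: "r < q" unfolding q by simp
    from less.IH[OF rq gx] fr less.prems obtain i where
      i: "(f ^^ r) (\<iota> (g x)) = \<iota> ((g ^^ i) (g x))" "(g ^^ i) (g x) \<in> T"
       "(\<Sum>j<r. h ((f ^^ j) (\<iota> (g x)))) = (\<Sum>j<i. h' ((g ^^ j) (g x)))" and
      i': "\<And>i'. i' < i \<Longrightarrow> \<exists>q'<r. (f ^^ q') (\<iota> (g x)) = \<iota> ((g ^^ i') (g x)) \<and> (i' > 0 \<longrightarrow> q' > 0)"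
      by auto
    have gS: "(g ^^ j) (g x) = (g ^^ Suc j) x" for j by (simp add: funpow_swap1)
    show ?thesis
    proof (rule exI[of _ "Suc i"], intro conjI allI impI)
      show "(f ^^ q) (\<iota> x) = \<iota> ((g ^^ Suc i) x)"
        using fr i by (simp_all add: gS del: funpow.simps)
      show "(g ^^ Suc i) x \<in> T"
        using fr i by (simp_all add: gS del: funpow.simps)
      show "0 < Suc i" by simp
      have "(\<Sum>j<q. h ((f ^^ j) (\<iota> x))) =
          (\<Sum>j<k x. h ((f ^^ j) (\<iota> x))) + (\<Sum>j<r. h ((f ^^ (j + k x)) (\<iota> x)))"
        unfolding q by (subst add.commute) (rule sum_lessThan_add)
      also have "\<dots> = h' x + (\<Sum>j<i. h' ((g ^^ j) (g x)))"
        using s i(3) by (simp add: funpow_add_apply)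
      also have "\<dots> = (\<Sum>j<Suc i. h' ((g ^^ j) x))"
        by (simp add: gS sum.lessThan_Suc_shift del: funpow.simps sum.lessThan_Suc)
      finally show "(\<Sum>j<q. h ((f ^^ j) (\<iota> x))) = (\<Sum>j<Suc i. h' ((g ^^ j) x))" .
    next
      fix i' assume "i' < Suc i"
      show "\<exists>q'<q. (f ^^ q') (\<iota> x) = \<iota> ((g ^^ i') x) \<and> (0 < i' \<longrightarrow> 0 < q')"
      proof (cases i')
        case 0
        then show ?thesis using False by (intro exI[of _ 0]) auto
      next
        case (Suc l)
        with \<open>i' < Suc i\<close> i' obtain q' where "q' < r" "(f ^^ q') (\<iota> (g x)) = \<iota> ((g ^^ l) (g x))"
          by (meson Suc_less_eq)
        then show ?thesis using s q Suc
          by (intro exI[of _ "q' + k x"]) (auto simp: funpow_add_apply gS simp del: funpow.simps)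
      qed
    qed
  qed
qed

lemma step_iterate:
  assumes step: "\<forall>x\<in>T. (f ^^ k x) (\<iota> x) = \<iota> (g x) \<and> k x > (0::nat)"
    and "\<And>j. j < i \<Longrightarrow> (g ^^ j) x \<in> T"
  shows "\<exists>q. (f ^^ q) (\<iota> x) = \<iota> ((g ^^ i) x) \<and> (i > 0 \<longrightarrow> q > 0)"
  using assms(2)
proof (induction i)
  case 0
  then show ?case by (intro exI[of _ 0]) auto
next
  case (Suc i)
  then obtain q where q: "(f ^^ q) (\<iota> x) = \<iota> ((g ^^ i) x)" by auto
  show ?case using q step[rule_format, OF Suc.prems[of i]]
    by (intro exI[of _ "k ((g ^^ i) x) + q"]) (auto simp: funpow_add_apply)
qed

text \<open>The closed orbits of a first-return map are the traces of the closed orbits that it meets.\<close>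

lemma prod_closed_orbits_first_return:
  fixes h :: "'s \<Rightarrow> int" and h' :: "'t \<Rightarrow> int"
  assumes step: "\<And>x. x \<in> T \<Longrightarrow> (f ^^ k x) (\<iota> x) = \<iota> (g x) \<and> k x > 0 \<and>
      (\<forall>j. 0 < j \<and> j < k x \<longrightarrow> (f ^^ j) (\<iota> x) \<notin> \<iota> ` T) \<and>
      h' x = (\<Sum>j<k x. h ((f ^^ j) (\<iota> x)))"
    and ex: "\<And>x. \<lbrakk>x \<in> T; g x \<notin> T\<rbrakk> \<Longrightarrow> g (g x) = g x \<and> f (\<iota> (g x)) = \<iota> (g x) \<and> \<iota> (g x) \<notin> \<iota> ` T"
    and inj: "inj_on \<iota> T" and sub: "\<iota> ` T \<subseteq> S"
  shows "(\<Prod>Q\<in>closed_orbits g T. \<zeta> (sum h' Q)) =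
    (\<Prod>Q\<in>{Q \<in> closed_orbits f S. Q \<inter> \<iota> ` T \<noteq> {}}. (\<zeta> (sum h Q) :: 'c :: comm_monoid_mult))"
proof -
  have step0: "\<forall>x\<in>T. (f ^^ k x) (\<iota> x) = \<iota> (g x) \<and> k x > 0" using step by blast
  have ex0: "\<forall>x\<in>T. g x \<notin> T \<longrightarrow> f (\<iota> (g x)) = \<iota> (g x) \<and> \<iota> (g x) \<notin> \<iota> ` T"
    using ex by blast
  have step1: "\<forall>x\<in>T. (f ^^ k x) (\<iota> x) = \<iota> (g x) \<and> k x > 0 \<and>
      (\<forall>j. 0 < j \<and> j < k x \<longrightarrow> (f ^^ j) (\<iota> x) \<notin> \<iota> ` T) \<and>
      h' x = (\<Sum>j<k x. h ((f ^^ j) (\<iota> x)))" using step by blast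
  note visit = step_visit[where f = f and \<iota> = \<iota> and g = g and k = k and T = T and h = h and h' = h', OF step1 ex0]
  \<comment> \<open>Outside T the induced map stands still, so an orbit that leaves T cannot come
    back to its start.\<close>
  have stay: "(g ^^ i) x \<in> T" if "x \<in> T" "recurrent g x" for x i
  proof (induction i)
    case 0
    then show ?case using that by simp
  next
    case (Suc i)
    show ?case
    proof (rule ccontr)
      assume n: "(g ^^ Suc i) x \<notin> T"
      have fixed: "(g ^^ (j + Suc i)) x = (g ^^ Suc i) x" for j
        using ex[OF Suc] n by (induction j) auto
      from that obtain p where p: "is_period g x p" by (auto elim: recurrent_period)
      have "(g ^^ (p * Suc i)) x = x"
        using p funpow_mod_eq[of p g x "p * Suc i"] by (auto simp: is_period_def)
      moreover have "(g ^^ (p * Suc i)) x = (g ^^ Suc i) x"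
      proof -
        have "p * Suc i \<ge> Suc i" using p mult_le_mono1[of 1 p "Suc i"] by (simp add: is_period_def)
        then show ?thesis using fixed[of "p * Suc i - Suc i"] by (metis le_add_diff_inverse2)
      qed
      ultimately show False using n that by simp
    qed
  qed
  have closed: "recurrent f (\<iota> x) \<and> {y \<in> T. \<iota> y \<in> orb f (\<iota> x)} = orb g x \<and>
      sum h (orb f (\<iota> x)) = sum h' (orb g x)" if x: "x \<in> T" "recurrent g x" for x
  proof (intro conjI)
    obtain p where p: "is_period g x p" using x by (auto elim: recurrent_period)
    obtain q where "(f ^^ q) (\<iota> x) = \<iota> ((g ^^ p) x)" "p > 0 \<longrightarrow> q > 0"
      using step_iterate[where f = f and k = k and \<iota> = \<iota> and g = g and T = T and i = p and x = x, OF step0] stay[OF x] by blast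
    then show rec: "recurrent f (\<iota> x)" using p by (auto simp: recurrent_def is_period_def)
    show "{y \<in> T. \<iota> y \<in> orb f (\<iota> x)} = orb g x"
    proof (intro equalityI subsetI)
      fix y assume y: "y \<in> {y \<in> T. \<iota> y \<in> orb f (\<iota> x)}"
      then obtain q where "\<iota> y = (f ^^ q) (\<iota> x)" by (auto simp: orb_def)
      moreover from this have "(f ^^ q) (\<iota> x) \<in> \<iota> ` T" using y by (metis (lifting) image_eqI mem_Collect_eq)
      ultimately obtain i where "\<iota> y = \<iota> ((g ^^ i) x)" "(g ^^ i) x \<in> T"
        using visit[OF x(1), of q] by auto
      then have "y = (g ^^ i) x" using inj y by (auto dest: inj_onD)
      then show "y \<in> orb g x" by (auto simp: orb_def)
    next
      fix y assume "y \<in> orb g x"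
      then obtain i where i: "y = (g ^^ i) x" by (auto simp: orb_def)
      obtain q where "(f ^^ q) (\<iota> x) = \<iota> ((g ^^ i) x)"
        using step_iterate[where f = f and k = k and \<iota> = \<iota> and g = g and T = T and i = i and x = x, OF step0] stay[OF x] by blast
      then show "y \<in> {y \<in> T. \<iota> y \<in> orb f (\<iota> x)}"
        using i stay[OF x] by (auto simp: orb_def) (metis rangeI)
    qed
    obtain P where P: "is_period f (\<iota> x) P" using rec by (rule recurrent_period)
    then have "(f ^^ P) (\<iota> x) \<in> \<iota> ` T" using x by (auto simp: is_period_def)
    from visit[OF x(1) this] P obtain i where
      i: "\<iota> x = \<iota> ((g ^^ i) x)" "(g ^^ i) x \<in> T" "i > 0"
       "(\<Sum>j<P. h ((f ^^ j) (\<iota> x))) = (\<Sum>j<i. h' ((g ^^ j) x))" and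
      i': "\<And>i'. i' < i \<Longrightarrow> \<exists>q'<P. (f ^^ q') (\<iota> x) = \<iota> ((g ^^ i') x) \<and> (i' > 0 \<longrightarrow> q' > 0)"
      by (auto simp: is_period_def)
    \<comment> \<open>The index i belongs to the first return of \<open>f\<close>. It is a return
      time of \<open>g\<close>, hence at least the period p; if p were smaller, \<open>f\<close>
      would have returned earlier by \<open>i'\<close>.\<close>
    have gi: "(g ^^ i) x = x" using i inj x by (metis inj_onD)
    have "\<not> i < p" using gi i(3) p by (auto simp: is_period_def)
    moreover have "\<not> p < i"
    proof
      assume "p < i"
      from i'[OF this] p P show False by (auto simp: is_period_def)
    qed
    ultimately have "i = p" by simp
    then show "sum h (orb f (\<iota> x)) = sum h' (orb g x)"
      using i(4) by (simp add: sum_orb[OF P] sum_orb[OF p])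
  qed
  have return: "recurrent g x" if x: "x \<in> T" and r: "recurrent f (\<iota> x)" for x
  proof -
    obtain P where P: "is_period f (\<iota> x) P" using r by (rule recurrent_period)
    then have "(f ^^ P) (\<iota> x) \<in> \<iota> ` T" using x by (auto simp: is_period_def)
    from visit[OF x(1) this] P obtain i where
      i: "\<iota> x = \<iota> ((g ^^ i) x)" "(g ^^ i) x \<in> T" "i > 0" by (auto simp: is_period_def)
    then have "(g ^^ i) x = x" using inj x by (metis inj_onD)
    then show ?thesis using i by (auto simp: recurrent_def)
  qed
  \<comment> \<open>The trace of an orbit on T. The converse passage takes the
    \<open>f\<close>-orbit of the image of any of its points.\<close>
  define \<Psi> where "\<Psi> Q = {y \<in> T. \<iota> y \<in> Q}" for Q
  have form: "\<exists>x. x \<in> T \<and> recurrent g x \<and> Q = orb f (\<iota> x) \<and> \<Psi> Q = orb g x"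
    if "Q \<in> closed_orbits f S" "Q \<inter> \<iota> ` T \<noteq> {}" for Q
  proof -
    from that obtain x where x: "x \<in> T" "\<iota> x \<in> Q" by auto
    with that closed_orbits_mem have "recurrent f (\<iota> x)" "Q = orb f (\<iota> x)" by fast+
    then show ?thesis using return[of x] closed[of x] x by (auto simp: \<Psi>_def)
  qed
  show ?thesis
  proof (rule sym, rule prod.reindex_bij_witness[where j = \<Psi> and i = "\<lambda>Q'. orb f (\<iota> (SOME x. x \<in> Q'))"])
    fix Q assume Q: "Q \<in> {Q \<in> closed_orbits f S. Q \<inter> \<iota> ` T \<noteq> {}}"
    then obtain x where x: "x \<in> T" "recurrent g x" "Q = orb f (\<iota> x)" "\<Psi> Q = orb g x"
      using form by blast
    have "(SOME x. x \<in> \<Psi> Q) \<in> \<Psi> Q" using x orb_self[of x g] by (metis someI)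
    then have "\<iota> (SOME x. x \<in> \<Psi> Q) \<in> Q" by (simp add: \<Psi>_def)
    moreover have "Q \<in> closed_orbits f S" using Q by simp
    ultimately show "orb f (\<iota> (SOME x. x \<in> \<Psi> Q)) = Q"
      by (metis closed_orbits_mem)
    show "\<Psi> Q \<in> closed_orbits g T" using x by (auto simp: closed_orbits_def)
    show "\<zeta> (sum h' (\<Psi> Q)) = \<zeta> (sum h Q)" using x closed by simp
  next
    fix Q' assume "Q' \<in> closed_orbits g T"
    moreover define x where "x = (SOME x. x \<in> Q')"
    ultimately have xQ: "x \<in> Q'" "Q' \<in> closed_orbits g T"
      using closed_orbits_nonempty by (auto simp: some_in_eq)
    then have r: "recurrent g x" "Q' = orb g x" using closed_orbits_mem by fast+
    from xQ(2) obtain x0 where x0: "x0 \<in> T" "recurrent g x0" "Q' = orb g x0"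
      by (auto simp: closed_orbits_def)
    then have "x \<in> T" using xQ stay by (auto simp: orb_def)
    with r closed[of x] have "\<Psi> (orb f (\<iota> x)) = Q'"
      by (simp add: \<Psi>_def)
    then show "\<Psi> (orb f (\<iota> (SOME x. x \<in> Q'))) = Q'" by (simp only: x_def)
    show "orb f (\<iota> (SOME x. x \<in> Q')) \<in> {Q \<in> closed_orbits f S. Q \<inter> \<iota> ` T \<noteq> {}}"
    proof -
      have "\<iota> x \<in> S" "recurrent f (\<iota> x)" using closed[of x] r \<open>x \<in> T\<close> sub by auto
      then have "orb f (\<iota> x) \<in> closed_orbits f S" by (auto simp: closed_orbits_def)
      moreover have "\<iota> x \<in> orb f (\<iota> x) \<inter> \<iota> ` T" using \<open>x \<in> T\<close> orb_self[of "\<iota> x" f] by simp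
      ultimately show ?thesis unfolding x_def[symmetric] by auto
    qed
  qed
qed

text \<open>Vertices and states are pairs, and quantifiers over them are to stay whole.\<close>

declare split_paired_All [simp del] split_paired_Ex [simp del]

section \<open>Tangles as matchings with antisymmetric gains\<close>

lemma vertices_iff: "(a, b) \<in> vertices n \<longleftrightarrow> (a = 0 \<or> a = 1) \<and> 1 \<le> b \<and> b \<le> n"
  by (auto simp: vertices_def)

lemma finite_vertices: "finite (vertices n)"
  by (simp add: vertices_def)

lemma vless_total:
  "\<lbrakk>u \<in> vertices n; v \<in> vertices n; u \<noteq> v\<rbrakk> \<Longrightarrow> vless u v \<or> vless v u"
  by (cases u; cases v) (auto simp: vertices_iff vless_def)

lemma vless_asym: "vless u v \<Longrightarrow> \<not> vless v u"
  by (auto simp: vless_def)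

definition mate :: "flat_tangle \<Rightarrow> vertex \<Rightarrow> vertex" where
  "mate E u = (THE v. {u, v} \<in> E)"

definition side :: "vertex \<Rightarrow> int" where
  "side u = (if fst u = 0 then 1 else - 1)"

text \<open>Traversing a pair in the two directions contributes opposite gains. With this sign convention
  the label of an arc is, up to the sign given by its starting point, the sum of the gains of its
  steps, without any cumulated parities.\<close>

definition gain :: "arrow_tangle \<Rightarrow> vertex \<Rightarrow> int" where
  "gain F u = (let v = mate (fst F) u in
     if vless u v then side u * snd F {u, v} else - side v * snd F {u, v})"

text \<open>The pairing as an involution without fixed points, the labels as a function that is odd
  under it. The parity clause is the rule that a label is odd exactly if both ends lie on the same
  side.\<close>

definition valid_model :: "nat \<Rightarrow> (vertex \<Rightarrow> vertex) \<Rightarrow> (vertex \<Rightarrow> int) \<Rightarrow> bool" where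
  "valid_model n M \<theta> \<longleftrightarrow> (\<forall>u\<in>vertices n. M u \<in> vertices n \<and> M u \<noteq> u \<and> M (M u) = u \<and>
     \<theta> (M u) = - \<theta> u \<and> odd (\<theta> u + int (fst u) + int (fst (M u))))"

lemma mate_unique:
  assumes "E \<in> flat_tangles n" "u \<in> vertices n"
  shows "\<exists>!v. {u, v} \<in> E"
proof -
  have p: "partition_on (vertices n) E" and c: "\<And>\<alpha>. \<alpha> \<in> E \<Longrightarrow> card \<alpha> = 2"
    using assms by (auto simp: flat_tangles_def)
  obtain \<alpha> where a: "\<alpha> \<in> E" "u \<in> \<alpha>"
    using p assms(2) by (auto simp: partition_on_def)
  obtain x y where "\<alpha> = {x, y}" "x \<noteq> y" using c[OF a(1)] by (auto simp: card_2_iff)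
  then have "\<exists>v. \<alpha> = {u, v}" using a(2) by (metis insertE insert_commute singletonD)
  then obtain v where v: "\<alpha> = {u, v}" by blast
  have "v' = v" if "{u, v'} \<in> E" for v'
  proof -
    have "{u, v'} = \<alpha>"
    proof (rule ccontr)
      assume "{u, v'} \<noteq> \<alpha>"
      then have "{u, v'} \<inter> \<alpha> = {}" using partition_onD2[OF p] that a(1) by (rule disjointD[rotated 3])
      then show False using a(2) by simp
    qed
    moreover have "v' \<noteq> u" using c[OF that] by auto
    ultimately show ?thesis using v by auto
  qed
  moreover have "{u, v} \<in> E" using a v by simp
  ultimately show ?thesis by (rule ex1I[rotated])
qed

lemma mate_props:
  assumes "E \<in> flat_tangles n" "u \<in> vertices n"
  shows "{u, mate E u} \<in> E" "mate E u \<in> vertices n" "mate E u \<noteq> u" "mate E (mate E u) = u"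
    "{u, v} \<in> E \<Longrightarrow> v = mate E u"
proof -
  note u = mate_unique[OF assms]
  show m: "{u, mate E u} \<in> E" unfolding mate_def using u by (rule theI')
  show "{u, v} \<in> E \<Longrightarrow> v = mate E u" using u m by blast
  have p: "partition_on (vertices n) E" and c: "\<And>\<alpha>. \<alpha> \<in> E \<Longrightarrow> card \<alpha> = 2"
    using assms by (auto simp: flat_tangles_def)
  show v: "mate E u \<in> vertices n" using p m by (auto simp: partition_on_def)
  show "mate E u \<noteq> u" using c[OF m] by auto
  have "{mate E u, mate E (mate E u)} \<in> E"
    unfolding mate_def[of E "mate E u"] using mate_unique[OF assms(1) v] by (rule theI')
  moreover have "{mate E u, u} \<in> E" using m by (simp add: insert_commute)
  ultimately show "mate E (mate E u) = u" using mate_unique[OF assms(1) v] by blast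
qed

lemma flat_tangle_eq:
  assumes "E \<in> flat_tangles n"
  shows "E = {{u, mate E u} | u. u \<in> vertices n}"
proof (intro equalityI subsetI)
  fix \<alpha> assume a: "\<alpha> \<in> E"
  have p: "partition_on (vertices n) E" and c: "card \<alpha> = 2"
    using assms a by (auto simp: flat_tangles_def)
  obtain x y where xy: "\<alpha> = {x, y}" "x \<noteq> y" using c by (auto simp: card_2_iff)
  moreover have "x \<in> vertices n" using p a xy by (auto simp: partition_on_def)
  moreover have "y = mate E x" using mate_props(5)[OF assms \<open>x \<in> vertices n\<close>] a xy by blast
  ultimately show "\<alpha> \<in> {{u, mate E u} | u. u \<in> vertices n}" by auto
next
  fix \<alpha> assume "\<alpha> \<in> {{u, mate E u} | u. u \<in> vertices n}"
  then show "\<alpha> \<in> E" using mate_props(1)[OF assms] by auto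
qed

lemma arrow_tangleD:
  assumes "F \<in> arrow_flat_tangles n"
  shows "fst F \<in> flat_tangles n" "snd F \<in> extensional (fst F)"
    "\<And>u v. {u, v} \<in> fst F \<Longrightarrow> odd (snd F {u, v}) \<longleftrightarrow> fst u = fst v"
proof -
  obtain E f where F: "F = (E, f)" by (cases F)
  show "fst F \<in> flat_tangles n" "snd F \<in> extensional (fst F)"
    using assms by (auto simp: arrow_flat_tangles_def)
  fix u v assume uv: "{u, v} \<in> fst F"
  obtain a b c d where [simp]: "u = (a, b)" "v = (c, d)" by (cases u, cases v)
  have "if a = c then odd (f {(a, b), (c, d)}) else even (f {(a, b), (c, d)})"
  proof -
    have "\<forall>a b c d. {(a, b), (c, d)} \<in> E \<longrightarrow>
        (if a = c then odd (f {(a, b), (c, d)}) else even (f {(a, b), (c, d)}))"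
      using assms unfolding arrow_flat_tangles_def F by simp
    then show ?thesis using uv F by (metis \<open>u = (a, b)\<close> \<open>v = (c, d)\<close> fst_conv)
  qed
  then show "odd (snd F {u, v}) \<longleftrightarrow> fst u = fst v" by (auto simp: F split: if_splits)
qed

lemma vertices_fst: "u \<in> vertices n \<Longrightarrow> fst u = 0 \<or> fst u = 1"
  by (auto simp: vertices_def)

lemma valid_model_tangle:
  assumes F: "F \<in> arrow_flat_tangles n"
  shows "valid_model n (mate (fst F)) (gain F)"
  unfolding valid_model_def
proof (intro ballI conjI)
  fix u assume u: "u \<in> vertices n"
  note D = arrow_tangleD[OF F] and P = mate_props[OF arrow_tangleD(1)[OF F] u]
  let ?v = "mate (fst F) u"
  show "?v \<in> vertices n" "?v \<noteq> u" "mate (fst F) ?v = u" by (fact P)+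
  have tot: "vless u ?v \<longleftrightarrow> \<not> vless ?v u"
    using vless_total[OF u P(2)] P(3) vless_asym by metis
  have sw: "{?v, u} = {u, ?v}" by auto
  show "gain F ?v = - gain F u"
    using tot by (auto simp: gain_def Let_def P(4) sw)
  have par: "odd (snd F {u, ?v}) \<longleftrightarrow> fst u = fst ?v" using D(3) P(1) by blast
  have s: "fst u = 0 \<or> fst u = 1" "fst ?v = 0 \<or> fst ?v = 1" using vertices_fst u P(2) by auto
  show "odd (gain F u + int (fst u) + int (fst ?v))"
    using s par by (auto simp: gain_def Let_def side_def)
qed

text \<open>The label of a pair is read off at its smaller end, where gain and label agree up to the
  sign \<open>side\<close>.\<close>

definition tangle_of :: "nat \<Rightarrow> (vertex \<Rightarrow> vertex) \<Rightarrow> (vertex \<Rightarrow> int) \<Rightarrow> arrow_tangle" where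
  "tangle_of n M \<theta> = (let E = {{u, M u} | u. u \<in> vertices n} in
     (E, \<lambda>\<beta>\<in>E. THE l. \<exists>u\<in>vertices n. \<beta> = {u, M u} \<and> vless u (M u) \<and> l = side u * \<theta> u))"

lemma tangle_of_label:
  assumes V: "valid_model n M \<theta>" and that: "u \<in> vertices n" "vless u (M u)"
  shows "snd (tangle_of n M \<theta>) {u, M u} = side u * \<theta> u"
proof -
    have "(THE l. \<exists>u'\<in>vertices n. {u, M u} = {u', M u'} \<and> vless u' (M u') \<and> l = side u' * \<theta> u')
        = side u * \<theta> u"
    proof (rule the_equality)
      fix l assume "\<exists>u'\<in>vertices n. {u, M u} = {u', M u'} \<and> vless u' (M u') \<and> l = side u' * \<theta> u'"
      then obtain u' where u': "{u, M u} = {u', M u'}" "vless u' (M u')" "l = side u' * \<theta> u'" by auto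
      then have "u' = u" using that by (metis doubleton_eq_iff vless_asym)
      then show "l = side u * \<theta> u" using u' by simp
    qed (use that in auto)
    then show ?thesis using that by (auto simp: tangle_of_def Let_def)
qed

lemma tangle_of_props:
  assumes V: "valid_model n M \<theta>"
  shows "tangle_of n M \<theta> \<in> arrow_flat_tangles n"
    "u \<in> vertices n \<Longrightarrow> mate (fst (tangle_of n M \<theta>)) u = M u"
    "u \<in> vertices n \<Longrightarrow> gain (tangle_of n M \<theta>) u = \<theta> u"
proof -
  define E where "E = {{u, M u} | u. u \<in> vertices n}"
  define f where "f = snd (tangle_of n M \<theta>)"
  have T: "tangle_of n M \<theta> = (E, f)" unfolding f_def E_def tangle_of_def Let_def by (simp only: fst_conv snd_conv)
  have m: "M u \<in> vertices n" "M u \<noteq> u" "M (M u) = u" "\<theta> (M u) = - \<theta> u"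
    "odd (\<theta> u + int (fst u) + int (fst (M u)))" if "u \<in> vertices n" for u
    using V that unfolding valid_model_def by blast+
  have f_val: "f {u, M u} = side u * \<theta> u" if "u \<in> vertices n" "vless u (M u)" for u
    using tangle_of_label[OF V that] by (simp add: f_def)
  have f_val': "f {u, M u} = - side (M u) * \<theta> u" if "u \<in> vertices n" "\<not> vless u (M u)" for u
  proof -
    have "vless (M u) (M (M u))" using vless_total[OF that(1) m(1)[OF that(1)]] m that by metis
    from f_val[OF m(1)[OF that(1)] this] show ?thesis using m that by (simp add: insert_commute)
  qed
  have pEi: "partition_on (vertices n) E"
  proof (rule partition_onI)
    show "\<Union> E = vertices n" using m by (auto simp: E_def)
    show "{} \<notin> E" by (auto simp: E_def)
    fix p q assume "p \<in> E" "q \<in> E" "p \<noteq> q"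
    moreover have "p = {x, M x}" if "p \<in> E" "x \<in> p" for p x
      using that m(3) by (auto simp: E_def insert_commute)
    ultimately show "disjnt p q" by (metis disjnt_iff)
  qed
  moreover have c: "card p = 2" if "p \<in> E" for p using that m(2) by (auto simp: E_def card_2_iff)
  ultimately have EF: "E \<in> flat_tangles n" by (auto simp: flat_tangles_def)
  have mate: "mate E u = M u" if "u \<in> vertices n" for u
  proof -
    have "{u, M u} \<in> E" using that unfolding E_def by blast
    then show ?thesis using mate_props(5)[OF EF that] by metis
  qed
  have g: "gain (E, f) u = \<theta> u" if "u \<in> vertices n" for u
    using f_val[OF that] f_val'[OF that] by (auto simp: gain_def Let_def mate[OF that] side_def)
  have par: "odd (f {u, v}) \<longleftrightarrow> fst u = fst v" if "{u, v} \<in> E" for u v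
  proof -
    have u: "u \<in> vertices n" "v = M u" 
    proof -
      show "u \<in> vertices n" using that pEi by (auto simp: partition_on_def)
      then show "v = M u" using mate mate_props(5)[OF EF _ that] by simp
    qed
    have "odd (f {u, v}) \<longleftrightarrow> odd (\<theta> u)"
      using f_val[OF u(1)] f_val'[OF u(1)] u(2) by (cases "vless u (M u)") (auto simp: side_def)
    then show ?thesis using m(5)[OF u(1)] vertices_fst[OF u(1)] vertices_fst[OF m(1)[OF u(1)]] u(2) by auto
  qed
  have "f \<in> extensional E" by (simp add: f_def tangle_of_def Let_def E_def)
  moreover have "\<forall>a b c d. {(a, b), (c, d)} \<in> E \<longrightarrow>
      (if a = c then odd (f {(a, b), (c, d)}) else even (f {(a, b), (c, d)}))"
  proof (intro allI impI)
    fix a b c d assume "{(a, b), (c, d)} \<in> E"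
    from par[OF this] show "if a = c then odd (f {(a, b), (c, d)}) else even (f {(a, b), (c, d)})"
      by auto
  qed
  ultimately show "tangle_of n M \<theta> \<in> arrow_flat_tangles n"
    using EF unfolding T arrow_flat_tangles_def by simp
  show "u \<in> vertices n \<Longrightarrow> mate (fst (tangle_of n M \<theta>)) u = M u"
    "u \<in> vertices n \<Longrightarrow> gain (tangle_of n M \<theta>) u = \<theta> u"
    using mate g by (auto simp: T)
qed

lemma arrow_tangle_eqI:
  assumes F: "F \<in> arrow_flat_tangles n" "F' \<in> arrow_flat_tangles n"
    and m: "\<And>u. u \<in> vertices n \<Longrightarrow> mate (fst F) u = mate (fst F') u"
    and g: "\<And>u. u \<in> vertices n \<Longrightarrow> gain F u = gain F' u"
  shows "F = F'"
proof (rule prod_eqI)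
  note D = arrow_tangleD[OF F(1)] and D' = arrow_tangleD[OF F(2)]
  show e: "fst F = fst F'"
  proof -
    have "{{u, mate (fst F) u} | u. u \<in> vertices n} = {{u, mate (fst F') u} | u. u \<in> vertices n}"
      using m by (intro Collect_cong ex_cong1) auto
    then show ?thesis using flat_tangle_eq[OF D(1)] flat_tangle_eq[OF D'(1)] by simp
  qed
  show "snd F = snd F'"
  proof (rule extensionalityI[OF D(2)])
    show "snd F' \<in> extensional (fst F)" using D' e by simp
    fix \<alpha> assume "\<alpha> \<in> fst F"
    then have "\<alpha> \<in> {{u, mate (fst F) u} | u. u \<in> vertices n}"
      by (rule equalityD1[OF flat_tangle_eq[OF D(1)], THEN subsetD])
    then obtain u where u: "u \<in> vertices n" "\<alpha> = {u, mate (fst F) u}" by blast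
    have "side u \<noteq> 0" "side (mate (fst F) u) \<noteq> 0" by (auto simp: side_def)
    then show "snd F \<alpha> = snd F' \<alpha>"
      using g[OF u(1)] m[OF u(1)] u(2) by (auto simp: gain_def Let_def split: if_splits)
  qed
qed

section \<open>Stacks of tangles\<close>

type_synonym state = "int \<times> vertex"

text \<open>A state \<open>(k, u)\<close> is a particle at the vertex \<open>u\<close> of the \<open>k\<close>-th layer of a stack of tangles, about to
  traverse the pair of \<open>u\<close>. The layers \<open>-1\<close> and \<open>length Fs\<close> are reached when it leaves the stack.\<close>

definition turn :: "state \<Rightarrow> state" where
  "turn x = (if fst (snd x) = 0 then (fst x - 1, (1, snd (snd x))) else (fst x + 1, (0, snd (snd x))))"

definition inside :: "nat \<Rightarrow> arrow_tangle list \<Rightarrow> state set" where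
  "inside n Fs = {x. 0 \<le> fst x \<and> fst x < int (length Fs) \<and> snd x \<in> vertices n}"

definition cross :: "arrow_tangle list \<Rightarrow> state \<Rightarrow> state" where
  "cross Fs x = (fst x, mate (fst (Fs ! nat (fst x))) (snd x))"

text \<open>The particle crosses its pair and passes to the glued vertex of the next layer. States
  outside are fixed, so that iteration is total and a particle that has left stays where it
  left.\<close>

definition nxt :: "nat \<Rightarrow> arrow_tangle list \<Rightarrow> state \<Rightarrow> state" where
  "nxt n Fs x = (if x \<in> inside n Fs then turn (cross Fs x) else x)"

definition sg :: "arrow_tangle list \<Rightarrow> state \<Rightarrow> int" where
  "sg Fs x = gain (Fs ! nat (fst x)) (snd x)"

text \<open>The state of leaving at v is written \<open>turn (entry Fs v)\<close>: reversal of time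
  exchanges entering and leaving.\<close>

definition entry :: "arrow_tangle list \<Rightarrow> vertex \<Rightarrow> state" where
  "entry Fs u = (if fst u = 0 then (0, u) else (int (length Fs) - 1, u))"

lemma fst_turn_side: "fst (snd (turn x)) = (if fst (snd x) = 0 then 1 else 0)"
  by (simp add: turn_def)

lemma turn_turn: "snd x \<in> vertices n \<Longrightarrow> turn (turn x) = x"
  by (cases x; cases "snd x") (auto simp: turn_def vertices_iff)

lemma turn_neq: "turn x \<noteq> x"
  by (cases x) (auto simp: turn_def)

lemma snd_turn: "snd x \<in> vertices n \<Longrightarrow> snd (turn x) \<in> vertices n"
  by (cases x; cases "snd x") (auto simp: turn_def vertices_iff)

lemma finite_inside: "finite (inside n Fs)"
proof (rule finite_subset)
  show "inside n Fs \<subseteq> {0..<int (length Fs)} \<times> vertices n" by (auto simp: inside_def)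
qed (simp add: finite_vertices)

lemma insideD: "x \<in> inside n Fs \<Longrightarrow> snd x \<in> vertices n"
  by (simp add: inside_def)

lemma turn_entry_notin: "u \<in> vertices n \<Longrightarrow> turn (entry Fs u) \<notin> inside n Fs"
  by (cases u) (auto simp: turn_def entry_def inside_def vertices_iff)

lemma snd_entry [simp]: "snd (entry Fs u) = u"
  by (simp add: entry_def)

lemma turn_entry_inj:
  "\<lbrakk>u \<in> vertices n; v \<in> vertices n; turn (entry Fs u) = turn (entry Fs v)\<rbrakk> \<Longrightarrow> u = v"
  by (metis snd_entry turn_turn)

lemma leave_inside:
  assumes "x \<in> inside n Fs" "turn x \<notin> inside n Fs"
  shows "x = entry Fs (snd x)"
  using assms by (cases x; cases "snd x") (auto simp: turn_def inside_def vertices_iff entry_def)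

locale stack =
  fixes n :: nat and Fs :: "arrow_tangle list"
  assumes Fs: "set Fs \<subseteq> arrow_flat_tangles n" and nonempty: "Fs \<noteq> []"
begin

lemma entry_inside: "u \<in> vertices n \<Longrightarrow> entry Fs u \<in> inside n Fs"
  using nonempty by (auto simp: entry_def inside_def)

lemma cross_props:
  assumes "x \<in> inside n Fs"
  shows "cross Fs x \<in> inside n Fs" "cross Fs (cross Fs x) = x" "cross Fs x \<noteq> x"
    "sg Fs (cross Fs x) = - sg Fs x"
    "odd (sg Fs x + int (fst (snd x)) + int (fst (snd (cross Fs x))))"
proof -
  have "nat (fst x) < length Fs" using assms by (auto simp: inside_def)
  then have "Fs ! nat (fst x) \<in> arrow_flat_tangles n" using Fs nth_mem by blast
  from valid_model_tangle[OF this] assms show "cross Fs x \<in> inside n Fs" "cross Fs (cross Fs x) = x"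
    "cross Fs x \<noteq> x" "sg Fs (cross Fs x) = - sg Fs x"
    "odd (sg Fs x + int (fst (snd x)) + int (fst (snd (cross Fs x))))"
    unfolding valid_model_def inside_def cross_def sg_def by (auto simp: prod_eq_iff)
qed

lemma nxt_inside: "x \<in> inside n Fs \<Longrightarrow> nxt n Fs x = turn (cross Fs x)"
  by (simp add: nxt_def)

lemma turn_nxt: "x \<in> inside n Fs \<Longrightarrow> turn (nxt n Fs x) = cross Fs x"
  using nxt_inside turn_turn cross_props(1) insideD by metis

lemma nxt_turn_nxt: "x \<in> inside n Fs \<Longrightarrow> nxt n Fs (turn (nxt n Fs x)) = turn x"
  using turn_nxt nxt_inside cross_props by metis

lemma nxt_inj:
  assumes "x \<in> inside n Fs" "y \<in> inside n Fs" "nxt n Fs x = nxt n Fs y"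
  shows "x = y"
  by (metis assms cross_props(2) turn_nxt)

lemma nxt_not_entry:
  assumes "x \<in> inside n Fs" "u \<in> vertices n"
  shows "nxt n Fs x \<noteq> entry Fs u"
  using turn_nxt[OF assms(1)] cross_props(1)[OF assms(1)] turn_entry_notin[OF assms(2)] by metis

lemma snd_nxt: "snd x \<in> vertices n \<Longrightarrow> snd (nxt n Fs x) \<in> vertices n"
  by (simp add: nxt_def) (metis cross_props(1) insideD snd_turn)

lemma exit_form:
  assumes "x \<in> inside n Fs" "nxt n Fs x \<notin> inside n Fs"
  shows "nxt n Fs x = turn (entry Fs (snd (cross Fs x)))"
proof -
  have "cross Fs x = entry Fs (snd (cross Fs x))"
    using assms cross_props(1)[OF assms(1)] by (intro leave_inside) (auto simp: nxt_inside)
  then show ?thesis using assms by (simp add: nxt_inside)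
qed

lemma nxt_pow_fixed: "x \<notin> inside n Fs \<Longrightarrow> (nxt n Fs ^^ k) x = x"
  by (induction k) (auto simp: nxt_def)

lemma pow_inj_back:
  assumes "\<And>l. (nxt n Fs ^^ l) x \<in> inside n Fs" "(nxt n Fs ^^ (i + d)) x = (nxt n Fs ^^ i) x"
  shows "(nxt n Fs ^^ d) x = x"
  using assms(2)
proof (induction i)
  case (Suc i)
  then show ?case using nxt_inj[OF assms(1) assms(1), of "i + d" i] by simp
qed simp

text \<open>Among finitely many states a step that is injective inside would have to return to the
  start, but an entry has no predecessor inside.\<close>

lemma run_ends:
  assumes "u \<in> vertices n"
  shows "\<exists>k. (nxt n Fs ^^ k) (entry Fs u) \<notin> inside n Fs"
proof (rule ccontr)
  assume "\<nexists>k. (nxt n Fs ^^ k) (entry Fs u) \<notin> inside n Fs"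
  then have I: "(nxt n Fs ^^ k) (entry Fs u) \<in> inside n Fs" for k by blast
  then have "\<not> inj (\<lambda>k. (nxt n Fs ^^ k) (entry Fs u))"
    using finite_inside[of n Fs] by (metis (no_types, lifting) finite_imageD finite_subset image_subsetI infinite_UNIV_nat)
  then obtain i j where "i < j" "(nxt n Fs ^^ j) (entry Fs u) = (nxt n Fs ^^ i) (entry Fs u)"
    unfolding inj_def by (metis linorder_neqE_nat)
  then have "(nxt n Fs ^^ (j - i)) (entry Fs u) = entry Fs u"
    using pow_inj_back[OF I, of i "j - i"] by simp
  moreover obtain d where "j - i = Suc d" using \<open>i < j\<close> by (metis Suc_diff_Suc)
  ultimately show False using nxt_not_entry[OF I assms, of d] by simp
qed

definition is_run :: "vertex \<Rightarrow> nat \<Rightarrow> vertex \<Rightarrow> bool" where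
  "is_run u k v \<longleftrightarrow> v \<in> vertices n \<and> (\<forall>j<k. (nxt n Fs ^^ j) (entry Fs u) \<in> inside n Fs) \<and>
     (nxt n Fs ^^ k) (entry Fs u) = turn (entry Fs v)"

lemma run_exists:
  assumes "u \<in> vertices n"
  shows "\<exists>k v. is_run u k v"
proof -
  define k where "k = (LEAST k. (nxt n Fs ^^ k) (entry Fs u) \<notin> inside n Fs)"
  have k: "(nxt n Fs ^^ k) (entry Fs u) \<notin> inside n Fs"
    unfolding k_def using run_ends[OF assms] by (rule LeastI_ex)
  have j: "(nxt n Fs ^^ j) (entry Fs u) \<in> inside n Fs" if "j < k" for j
    using not_less_Least that unfolding k_def by blast
  obtain l where l: "k = Suc l" using k entry_inside[OF assms] by (cases k) auto
  then have "(nxt n Fs ^^ k) (entry Fs u) =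
      turn (entry Fs (snd (cross Fs ((nxt n Fs ^^ l) (entry Fs u)))))"
    using exit_form[OF j[of l]] k by simp
  then show ?thesis using j l cross_props(1)[OF j[of l]] insideD unfolding is_run_def by blast
qed

lemma run_unique:
  assumes "is_run u k v" "is_run u k' v'" "u \<in> vertices n"
  shows "k = k'" "v = v'"
proof -
  have "\<not> k < k'" "\<not> k' < k"
    using assms turn_entry_notin unfolding is_run_def by metis+
  then show "k = k'" by simp
  then show "v = v'" using assms turn_entry_inj unfolding is_run_def by metis
qed

text \<open>Time reversal: both \<open>turn\<close> and \<open>cross\<close> are involutions, so
  \<open>turn\<close> conjugates a step to its inverse.\<close>

lemma reverse_pow:
  assumes "\<And>j. j < k \<Longrightarrow> (nxt n Fs ^^ j) x \<in> inside n Fs" "j \<le> k"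
  shows "(nxt n Fs ^^ j) (turn ((nxt n Fs ^^ k) x)) = turn ((nxt n Fs ^^ (k - j)) x)"
  using assms(2)
proof (induction j)
  case (Suc j)
  then have "k - j = Suc (k - Suc j)" by simp
  then show ?case using Suc nxt_turn_nxt[OF assms(1)[of "k - Suc j"]] by simp
qed simp

text \<open>The middle of a path that equals its own reversal would be fixed by \<open>turn\<close>
  if the length is even and by \<open>cross\<close> if it is odd. Neither has fixed points.\<close>

lemma no_self_reverse:
  assumes "\<And>j. j < k \<Longrightarrow> (nxt n Fs ^^ j) x \<in> inside n Fs"
  shows "turn ((nxt n Fs ^^ k) x) \<noteq> x"
proof
  assume "turn ((nxt n Fs ^^ k) x) = x"
  then have r: "(nxt n Fs ^^ j) x = turn ((nxt n Fs ^^ (k - j)) x)" if "j \<le> k" for j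
    using reverse_pow[OF assms that] by simp
  show False
  proof (cases "even k")
    case True
    then obtain i where "k = i + i" by (metis mult_2 evenE)
    then show False using r[of i] turn_neq by (metis add_diff_cancel_left' le_add1)
  next
    case False
    then obtain i where i: "k = Suc (i + i)" by (metis mult_2 oddE Suc_eq_plus1)
    then have "(nxt n Fs ^^ i) x = turn (nxt n Fs ((nxt n Fs ^^ i) x))" using r[of i] by simp
    then show False using turn_nxt cross_props(3) assms[of i] i by (metis less_Suc_eq le_add1 le_less_trans lessI)
  qed
qed

lemma run_reverse:
  assumes "is_run u k v" "u \<in> vertices n"
  shows "is_run v k u" "v \<noteq> u"
    "(\<Sum>j<k. sg Fs ((nxt n Fs ^^ j) (entry Fs v))) = - (\<Sum>j<k. sg Fs ((nxt n Fs ^^ j) (entry Fs u)))"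
proof -
  have I: "\<And>j. j < k \<Longrightarrow> (nxt n Fs ^^ j) (entry Fs u) \<in> inside n Fs"
    and e: "(nxt n Fs ^^ k) (entry Fs u) = turn (entry Fs v)" and v: "v \<in> vertices n"
    using assms by (auto simp: is_run_def)
  have te: "turn ((nxt n Fs ^^ k) (entry Fs u)) = entry Fs v"
    using e turn_turn[of "entry Fs v" n] v by simp
  then have r: "(nxt n Fs ^^ j) (entry Fs v) = turn ((nxt n Fs ^^ (k - j)) (entry Fs u))" if "j \<le> k" for j
    using reverse_pow[OF I that] by simp
  have c: "(nxt n Fs ^^ j) (entry Fs v) = cross Fs ((nxt n Fs ^^ (k - Suc j)) (entry Fs u))" if "j < k" for j
  proof -
    have "k - j = Suc (k - Suc j)" using that by simp
    then show ?thesis using r[of j] that turn_nxt[OF I[of "k - Suc j"]] by simp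
  qed
  show "is_run v k u" unfolding is_run_def using assms(2) c r[of k] cross_props(1) I by auto
  show "v \<noteq> u" using no_self_reverse[OF I] te by metis
  have "(\<Sum>j<k. sg Fs ((nxt n Fs ^^ j) (entry Fs v))) = (\<Sum>j<k. - sg Fs ((nxt n Fs ^^ (k - Suc j)) (entry Fs u)))"
    using c cross_props(4) I by (intro sum.cong) auto
  also have "\<dots> = (\<Sum>j<k. - sg Fs ((nxt n Fs ^^ j) (entry Fs u)))"
    by (rule sum.nat_diff_reindex)
  finally show "(\<Sum>j<k. sg Fs ((nxt n Fs ^^ j) (entry Fs v))) = - (\<Sum>j<k. sg Fs ((nxt n Fs ^^ j) (entry Fs u)))"
    by (simp add: sum_negf)
qed

text \<open>Modulo 2 a gain is one more than the sum of the two sides it joins, and passing to the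
  next layer changes the side, so the parities telescope.\<close>

lemma parity_pow:
  assumes "\<And>j. j < k \<Longrightarrow> (nxt n Fs ^^ j) x \<in> inside n Fs" "snd x \<in> vertices n"
  shows "even ((\<Sum>j<k. sg Fs ((nxt n Fs ^^ j) x)) + int (fst (snd x)) + int (fst (snd ((nxt n Fs ^^ k) x))))"
  using assms(1)
proof (induction k)
  case (Suc k)
  let ?y = "(nxt n Fs ^^ k) x"
  have y: "?y \<in> inside n Fs" using Suc.prems by simp
  note o = cross_props(5)[OF y]
  have "fst (snd (cross Fs ?y)) = 0 \<or> fst (snd (cross Fs ?y)) = 1"
    using cross_props(1)[OF y] insideD vertices_fst by blast
  then have "int (fst (snd (nxt n Fs ?y))) = 1 - int (fst (snd (cross Fs ?y)))"
    by (auto simp: nxt_inside[OF y] fst_turn_side)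
  then show ?case using o Suc by simp presburger
qed simp

definition run_end :: "vertex \<Rightarrow> vertex" where
  "run_end u = (THE v. \<exists>k. is_run u k v)"

definition run_gain :: "vertex \<Rightarrow> int" where
  "run_gain u = (THE s. \<exists>k v. is_run u k v \<and> s = (\<Sum>j<k. sg Fs ((nxt n Fs ^^ j) (entry Fs u))))"

lemma run_values:
  assumes "is_run u k v" "u \<in> vertices n"
  shows "run_end u = v" "run_gain u = (\<Sum>j<k. sg Fs ((nxt n Fs ^^ j) (entry Fs u)))"
  unfolding run_end_def run_gain_def
  by (rule the_equality, use assms run_unique in metis, use assms run_unique in metis)+

lemma valid_model_run: "valid_model n run_end run_gain"
  unfolding valid_model_def
proof (intro ballI)
  fix u assume u: "u \<in> vertices n"
  obtain k v where r: "is_run u k v" using run_exists[OF u] by blast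
  then have v: "v \<in> vertices n" by (simp add: is_run_def)
  note R = run_reverse[OF r u] and V = run_values[OF r u]
  have V': "run_end v = u" "run_gain v = - run_gain u"
    using run_values[OF R(1) v] R(3) V(2) by simp_all
  have "even (run_gain u + int (fst u) + int (fst (snd (turn (entry Fs v)))))"
    using parity_pow[of k "entry Fs u"] r u unfolding is_run_def V(2) by simp
  moreover have "fst v = 0 \<or> fst v = 1" using v vertices_fst by blast
  ultimately have "odd (run_gain u + int (fst u) + int (fst v))"
    by (auto simp: fst_turn_side)
  then show "run_end u \<in> vertices n \<and> run_end u \<noteq> u \<and> run_end (run_end u) = u \<and>
     run_gain (run_end u) = - run_gain u \<and> odd (run_gain u + int (fst u) + int (fst (run_end u)))"
    using V V' v R(2) by simp
qed

lemma recurrent_inside: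
  assumes "x \<in> inside n Fs" "recurrent (nxt n Fs) x"
  shows "(nxt n Fs ^^ j) x \<in> inside n Fs"
proof (rule ccontr)
  assume a: "(nxt n Fs ^^ j) x \<notin> inside n Fs"
  obtain p where p: "p > 0" "(nxt n Fs ^^ p) x = x" using assms(2) by (auto simp: recurrent_def)
  have "p * j \<ge> j" using p mult_le_mono1[of 1 p j] by simp
  then have "(nxt n Fs ^^ (p * j)) x = (nxt n Fs ^^ j) x"
    using nxt_pow_fixed[OF a, of "p * j - j"] by (metis funpow_add_apply le_add_diff_inverse2)
  moreover have "(nxt n Fs ^^ (p * j)) x = x"
    using funpow_mod_eq[OF p(2), of "p * j"] by simp
  ultimately show False using a assms by simp
qed

text \<open>A closed orbit and its reversal are different orbits, which is why orbits count each
  cycle twice. On a closed orbit the step is a bijection, so that \<open>turn\<close> and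
  \<open>cross\<close> have the same image, and an entry cannot occur for want of a
  predecessor.\<close>

lemma turn_image_orbit:
  assumes Q: "Q \<in> closed_orbits (nxt n Fs) (inside n Fs)"
  shows "Q \<subseteq> inside n Fs" "turn ` Q \<in> closed_orbits (nxt n Fs) (inside n Fs)"
    "sum (sg Fs) (turn ` Q) = - sum (sg Fs) Q"
    "x \<in> Q \<Longrightarrow> turn x \<notin> Q" "u \<in> vertices n \<Longrightarrow> entry Fs u \<notin> Q"
proof -
  obtain x where x: "x \<in> inside n Fs" "recurrent (nxt n Fs) x" "Q = orb (nxt n Fs) x"
    using Q by (auto simp: closed_orbits_def)
  note I = recurrent_inside[OF x(1,2)]
  show QI: "Q \<subseteq> inside n Fs" using I x(3) by (auto simp: orb_def)
  obtain p where p: "is_period (nxt n Fs) x p" using x by (auto elim: recurrent_period)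
  then have p': "p > 0" "(nxt n Fs ^^ p) x = x" by (auto simp: is_period_def)
  have r: "(nxt n Fs ^^ j) (turn x) = turn ((nxt n Fs ^^ (p - j)) x)" if "j \<le> p" for j
    using reverse_pow[of p x j] I that p' by simp
  have rec: "recurrent (nxt n Fs) (turn x)" using r[of p] p' by (auto simp: recurrent_def)
  have Qi: "Q = (\<lambda>j. (nxt n Fs ^^ j) x) ` {..<p}" using x(3) orb_eq_image[OF p] by simp
  have nQ: "nxt n Fs ` Q = Q"
  proof -
    have "nxt n Fs y \<in> Q" if "y \<in> Q" for y
      using that x(3) by (auto simp: orb_def) (metis comp_apply funpow.simps(2) rangeI)
    moreover have "inj_on (nxt n Fs) Q" using nxt_inj QI by (meson inj_onI subsetD)
    moreover have "finite Q" using QI finite_inside finite_subset by blast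
    ultimately show ?thesis by (simp add: endo_inj_surj image_subset_iff)
  qed
  have tc: "turn ` Q = cross Fs ` Q"
  proof -
    have "turn ` Q = turn ` (nxt n Fs ` Q)" using nQ by simp
    also have "\<dots> = cross Fs ` Q" unfolding image_image using turn_nxt QI by (intro image_cong) auto
    finally show ?thesis .
  qed
  have tin: "turn x \<in> inside n Fs" 
  proof -
    have "x \<in> Q" using x(3) orb_self by simp
    then have "turn x \<in> cross Fs ` Q" using tc by (metis imageI)
    then show ?thesis using cross_props(1) QI by (metis imageE subsetD)
  qed
  have "orb (nxt n Fs) (turn x) = turn ` Q"
  proof (intro equalityI subsetI)
    fix y assume "y \<in> orb (nxt n Fs) (turn x)"
    then obtain k where "y = (nxt n Fs ^^ k) (turn x)" by (auto simp: orb_def)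
    moreover have "(nxt n Fs ^^ k) (turn x) = (nxt n Fs ^^ (k mod p)) (turn x)"
      using r[of p] p' by (simp add: funpow_mod_eq)
    moreover have "k mod p \<le> p" using p' by (simp add: less_imp_le)
    ultimately show "y \<in> turn ` Q" using r[of "k mod p"] x(3) by (auto simp: orb_def)
  next
    fix y assume "y \<in> turn ` Q"
    then obtain j where j: "j < p" "y = turn ((nxt n Fs ^^ j) x)" using Qi by auto
    then have "y = (nxt n Fs ^^ (p - j)) (turn x)" using r[of "p - j"] by simp
    then show "y \<in> orb (nxt n Fs) (turn x)" by (auto simp: orb_def)
  qed
  then show "turn ` Q \<in> closed_orbits (nxt n Fs) (inside n Fs)"
    using tin rec by (auto simp: closed_orbits_def)
  have "inj_on (cross Fs) Q" using cross_props(2) QI by (metis inj_onI subsetD)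
  then have "sum (sg Fs) (turn ` Q) = (\<Sum>y\<in>Q. sg Fs (cross Fs y))"
    unfolding tc by (simp add: sum.reindex)
  also have "\<dots> = - sum (sg Fs) Q" using cross_props(4) QI by (simp add: sum_negf subset_iff)
  finally show "sum (sg Fs) (turn ` Q) = - sum (sg Fs) Q" .
  show "turn y \<notin> Q" if y: "y \<in> Q" for y
  proof
    assume "turn y \<in> Q"
    moreover have ry: "recurrent (nxt n Fs) y" "orb (nxt n Fs) y = Q" using orb_mem[OF x(2), of y] x(3) y by simp_all
    ultimately obtain k where k: "turn y = (nxt n Fs ^^ k) y" by (auto simp: orb_def)
    have "turn (turn y) = y" using turn_turn insideD QI y by blast
    then show False using no_self_reverse[of k y] k recurrent_inside[OF _ ry(1)] QI y by auto
  qed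
  show "entry Fs v \<notin> Q" if v: "v \<in> vertices n" for v
  proof
    assume "entry Fs v \<in> Q"
    then obtain y where "y \<in> Q" "nxt n Fs y = entry Fs v" using nQ by (metis imageE)
    then show False using nxt_not_entry QI v by blast
  qed
qed

end

section \<open>Arcs and cycles of two tangles as orbits of the stack with two layers\<close>

definition stepof :: "arrow_tangle list \<Rightarrow> state \<Rightarrow> step" where
  "stepof Fs x = (if fst x = 0 then Left_Factor else Right_Factor, snd x, snd (cross Fs x))"

definition stateof :: "step \<Rightarrow> state" where
  "stateof s = (case fac s of Left_Factor \<Rightarrow> 0 | Right_Factor \<Rightarrow> 1, src s)"

definition path :: "nat \<Rightarrow> arrow_tangle list \<Rightarrow> state \<Rightarrow> nat \<Rightarrow> step list" where
  "path n Fs x k = map (\<lambda>j. stepof Fs ((nxt n Fs ^^ j) x)) [0..<k]"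

lemma length_path [simp]: "length (path n Fs x k) = k"
  by (simp add: path_def)

lemma nth_path [simp]: "j < k \<Longrightarrow> path n Fs x k ! j = stepof Fs ((nxt n Fs ^^ j) x)"
  by (simp add: path_def)

lemma side_turn: "snd x \<in> vertices n \<Longrightarrow> side (snd (turn x)) = - side (snd x)"
  by (auto simp: side_def turn_def)

lemma side_square [simp]: "side u * side u = 1"
  by (simp add: side_def)

lemma pair_parity_eq:
  assumes "u \<in> vertices n" "v \<in> vertices n"
  shows "pair_parity {u, v} = - (side u * side v)"
proof -
  have "(\<exists>a b d. {u, v} = {(a, b), (a, d)}) \<longleftrightarrow> fst u = fst v"
    by (cases u; cases v) (auto simp: doubleton_eq_iff)
  moreover have "fst u = 0 \<or> fst u = 1" "fst v = 0 \<or> fst v = 1" using assms vertices_fst by auto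
  ultimately show ?thesis by (auto simp: pair_parity_def side_def)
qed

locale two_stack =
  fixes n :: nat and F F' :: arrow_tangle
  assumes F: "F \<in> arrow_flat_tangles n" "F' \<in> arrow_flat_tangles n"
begin

sublocale stack n "[F, F']"
  by unfold_locales (use F in auto)

abbreviation "In \<equiv> inside n [F, F']"
abbreviation "N \<equiv> nxt n [F, F']"

lemma stateof_stepof: "x \<in> In \<Longrightarrow> stateof (stepof [F, F'] x) = x"
  by (cases x) (auto simp: stateof_def stepof_def inside_def)

lemma inside_cases: "x \<in> In \<Longrightarrow> fst x = 0 \<or> fst x = 1"
  by (auto simp: inside_def)

lemma step_iff:
  "is_step (fst F) (fst F') s \<longleftrightarrow> stateof s \<in> In \<and> stepof [F, F'] (stateof s) = s"
proof -
  have V: "{u, v} \<in> fst G \<longleftrightarrow> u \<in> vertices n \<and> mate (fst G) u = v" if "G \<in> arrow_flat_tangles n" for G u v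
  proof -
    note E = arrow_tangleD(1)[OF that]
    have "u \<in> vertices n" if "{u, v} \<in> fst G"
      using E that by (auto simp: flat_tangles_def partition_on_def)
    then show ?thesis using mate_props(1,5)[OF E] by metis
  qed
  obtain k u v where s: "s = (k, u, v)" by (cases s)
  show ?thesis
    by (cases k) (auto simp: s is_step_def stateof_def stepof_def cross_def inside_def V F)
qed

text \<open>A step ends on the side opposite to the one where the next step starts, so its parity is
  the product of the sides of two consecutive states. The cumulated parity therefore telescopes to
  the side of the starting state times a factor that depends on the step alone, and this factor is
  built into \<open>gain\<close>.\<close>

lemma label_path:
  assumes I: "\<And>j. j < k \<Longrightarrow> (N ^^ j) x \<in> In"
  shows "total_label (snd F) (snd F') (path n [F, F'] x k) =
    side (snd x) * (\<Sum>j<k. sg [F, F'] ((N ^^ j) x))"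
proof -
  let ?y = "\<lambda>j. (N ^^ j) x"
  let ?p = "path n [F, F'] x k"
  have pp: "pair_parity {src (?p ! j), tgt (?p ! j)} = side (snd (?y j)) * side (snd (?y (Suc j)))" if "j < k" for j
  proof -
    have y: "?y j \<in> In" using I that by simp
    have c: "cross [F, F'] (?y j) \<in> In" using cross_props(1)[OF y] .
    have "pair_parity {snd (?y j), snd (cross [F, F'] (?y j))} = - (side (snd (?y j)) * side (snd (cross [F, F'] (?y j))))"
      using pair_parity_eq insideD y c by blast
    moreover have "side (snd (?y (Suc j))) = - side (snd (cross [F, F'] (?y j)))"
      using nxt_inside[OF y] side_turn[OF insideD[OF c]] by simp
    ultimately show ?thesis using that by (simp add: stepof_def del: funpow.simps)
  qed
  have prod: "(\<Prod>j<i. pair_parity {src (?p ! j), tgt (?p ! j)}) = side (snd x) * side (snd (?y i))" if "i \<le> k" for i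
    using that
  proof (induction i)
    case (Suc i)
    have "(\<Prod>j<Suc i. pair_parity {src (?p ! j), tgt (?p ! j)}) =
       side (snd x) * side (snd (?y i)) * (side (snd (?y i)) * side (snd (?y (Suc i))))"
      using Suc pp[of i] by (simp del: funpow.simps)
    also have "\<dots> = side (snd x) * (side (snd (?y i)) * side (snd (?y i))) * side (snd (?y (Suc i)))"
      by (simp only: mult.assoc)
    finally show ?case by simp
  qed simp
  have "cum_parity ?p i * (case fac (?p ! i) of Left_Factor \<Rightarrow> snd F | Right_Factor \<Rightarrow> snd F') {src (?p ! i), tgt (?p ! i)}
      = side (snd x) * sg [F, F'] (?y i)" if i: "i < k" for i
  proof -
    have y: "?y i \<in> In" using I i by simp
    let ?u = "snd (?y i)" and ?v = "snd (cross [F, F'] (?y i))"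
    let ?G = "[F, F'] ! nat (fst (?y i))"
    have lab: "(case fac (?p ! i) of Left_Factor \<Rightarrow> snd F | Right_Factor \<Rightarrow> snd F') = snd ?G"
      using inside_cases[OF y] i by (auto simp: stepof_def)
    have v: "?v = mate (fst ?G) ?u" by (simp add: cross_def)
    have st: "src (?p ! i) = ?u" "tgt (?p ! i) = ?v" using i by (simp_all add: stepof_def)
    show ?thesis
    proof (cases "vless ?u ?v")
      case True
      then have "cum_parity ?p i = side (snd x) * side ?u"
        unfolding cum_parity_def st using prod[of i] i by simp
      moreover have "sg [F, F'] (?y i) = side ?u * snd ?G {?u, ?v}"
        using True by (simp add: sg_def gain_def v Let_def)
      ultimately show ?thesis by (simp add: lab st)
    next
      case False
      \<comment> \<open>Against the order the product includes the step itself, so the side of the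
        next state appears. It is minus the side of the end of the step, in accordance with the
        second case of \<open>gain\<close>.\<close>
      then have "cum_parity ?p i = side (snd x) * side (snd (?y (Suc i)))"
        unfolding cum_parity_def st using prod[of "Suc i"] i by (simp del: funpow.simps)
      also have "side (snd (?y (Suc i))) = - side ?v"
        using nxt_inside[OF y] side_turn[OF insideD[OF cross_props(1)[OF y]]] by simp
      finally have "cum_parity ?p i = side (snd x) * - side ?v" .
      moreover have "sg [F, F'] (?y i) = - side ?v * snd ?G {?u, ?v}"
        using False by (simp add: sg_def gain_def v Let_def)
      ultimately show ?thesis by (simp add: lab st)
    qed
  qed
  then show ?thesis unfolding total_label_def by (simp add: sum_distrib_left)
qed

lemma link_iff:
  assumes "is_step (fst F) (fst F') s" "is_step (fst F) (fst F') s'"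
  shows "stateof s' = N (stateof s) \<longleftrightarrow> snd (tgt s) = snd (src s') \<and>
    (fac s = Left_Factor \<longrightarrow> fst (tgt s) = 1 \<and> fac s' = Right_Factor \<and> fst (src s') = 0) \<and>
    (fac s = Right_Factor \<longrightarrow> fst (tgt s) = 0 \<and> fac s' = Left_Factor \<and> fst (src s') = 1)"
proof -
  have s: "stateof s \<in> In" "stepof [F, F'] (stateof s) = s" and s': "stateof s' \<in> In"
    using assms step_iff by auto
  have c: "cross [F, F'] (stateof s) = (fst (stateof s), tgt s)"
    using s(2) by (auto simp: stepof_def cross_def prod_eq_iff)
  have "tgt s \<in> vertices n" using cross_props(1)[OF s(1)] c insideD by fastforce
  then show ?thesis unfolding nxt_inside[OF s(1)] c
    using s' vertices_fst[of "tgt s" n]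
    by (cases "fac s"; cases "fac s'") (auto simp: stateof_def turn_def inside_def prod_eq_iff)
qed

lemma list_path:
  assumes "\<forall>s \<in> set \<alpha>. is_step (fst F) (fst F') s" "\<alpha> \<noteq> []"
    and "\<forall>i. Suc i < length \<alpha> \<longrightarrow> stateof (\<alpha> ! Suc i) = N (stateof (\<alpha> ! i))"
  shows "j < length \<alpha> \<Longrightarrow> stateof (\<alpha> ! j) = (N ^^ j) (stateof (hd \<alpha>))"
    and "\<alpha> = path n [F, F'] (stateof (hd \<alpha>)) (length \<alpha>)"
proof -
  show *: "stateof (\<alpha> ! j) = (N ^^ j) (stateof (hd \<alpha>))" if "j < length \<alpha>" for j
    using that
  proof (induction j)
    case 0
    then show ?case using assms(2) by (simp add: hd_conv_nth)
  next
    case (Suc j)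
    then show ?case using assms(3) by simp
  qed
  show "\<alpha> = path n [F, F'] (stateof (hd \<alpha>)) (length \<alpha>)"
  proof (rule nth_equalityI)
    fix i assume "i < length \<alpha>"
    then show "\<alpha> ! i = path n [F, F'] (stateof (hd \<alpha>)) (length \<alpha>) ! i"
      using *[of i] assms(1) step_iff nth_mem by (metis nth_path)
  qed simp
qed

lemma path_steps:
  assumes "\<forall>j<k. (N ^^ j) x \<in> In"
  shows "s \<in> set (path n [F, F'] x k) \<Longrightarrow> is_step (fst F) (fst F') s"
    "j < k \<Longrightarrow> stateof (path n [F, F'] x k ! j) = (N ^^ j) x"
  using assms by (auto simp: path_def step_iff stateof_stepof)

text \<open>A run can be traversed in both directions; the condition \<open>vless u v\<close> on an
  arc selects one of them.\<close>

lemma arc_iff: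
  "is_arc (fst F) (fst F') \<alpha> \<longleftrightarrow>
    (\<exists>u k v. u \<in> vertices n \<and> is_run u k v \<and> vless u v \<and> \<alpha> = path n [F, F'] (entry [F, F'] u) k)"
proof
  assume a: "is_arc (fst F) (fst F') \<alpha>"
  have st: "\<And>s. s \<in> set \<alpha> \<Longrightarrow> is_step (fst F) (fst F') s" and ne: "\<alpha> \<noteq> []"
    using a by (auto simp: is_arc_def)
  have lk: "stateof (\<alpha> ! Suc i) = N (stateof (\<alpha> ! i))" if "Suc i < length \<alpha>" for i
    using a that link_iff[OF st st, of "\<alpha> ! i" "\<alpha> ! Suc i"] unfolding is_arc_def by (simp add: Suc_lessD)
  have "\<forall>s \<in> set \<alpha>. is_step (fst F) (fst F') s"
    "\<forall>i. Suc i < length \<alpha> \<longrightarrow> stateof (\<alpha> ! Suc i) = N (stateof (\<alpha> ! i))" using st lk by blast+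
  note P = list_path[OF this(1) ne this(2)]
  let ?u = "src (hd \<alpha>)" and ?v = "tgt (last \<alpha>)" and ?k = "length \<alpha>"
  have hd: "stateof (hd \<alpha>) \<in> In" using st ne step_iff by simp
  have u: "?u \<in> vertices n" using insideD[OF hd] by (simp add: stateof_def)
  have e: "stateof (hd \<alpha>) = entry [F, F'] ?u"
    using a unfolding is_arc_def stateof_def entry_def by (auto split: factor.splits)
  have lst: "stateof (last \<alpha>) \<in> In" "stepof [F, F'] (stateof (last \<alpha>)) = last \<alpha>"
    using st ne step_iff by simp_all
  then have c: "cross [F, F'] (stateof (last \<alpha>)) = (fst (stateof (last \<alpha>)), ?v)"
    by (metis cross_def fst_conv prod.collapse snd_conv stepof_def)
  have v: "?v \<in> vertices n" using cross_props(1)[OF lst(1)] c insideD by fastforce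
  have ev: "(fst (stateof (last \<alpha>)), ?v) = entry [F, F'] ?v"
    using a unfolding is_arc_def stateof_def entry_def by (auto split: factor.splits)
  obtain m where m: "?k = Suc m" using ne by (cases \<alpha>) auto
  have "(N ^^ ?k) (stateof (hd \<alpha>)) = N (stateof (last \<alpha>))"
    using P(1)[of m] ne m by (simp add: last_conv_nth)
  then have "(N ^^ ?k) (entry [F, F'] ?u) = turn (entry [F, F'] ?v)"
    using nxt_inside[OF lst(1)] c ev e by simp
  moreover have "(N ^^ j) (entry [F, F'] ?u) \<in> In" if "j < ?k" for j
    using P(1)[OF that] e st step_iff that nth_mem by metis
  ultimately have "is_run ?u ?k ?v" using v by (simp add: is_run_def)
  moreover have "vless ?u ?v" using a by (simp add: is_arc_def)
  ultimately show "\<exists>u k v. u \<in> vertices n \<and> is_run u k v \<and> vless u v \<and> \<alpha> = path n [F, F'] (entry [F, F'] u) k"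
    using P(2) e u by metis
next
  assume "\<exists>u k v. u \<in> vertices n \<and> is_run u k v \<and> vless u v \<and> \<alpha> = path n [F, F'] (entry [F, F'] u) k"
  then obtain u k v where u: "u \<in> vertices n" and r: "is_run u k v" and l: "vless u v"
    and a: "\<alpha> = path n [F, F'] (entry [F, F'] u) k" by blast
  have I: "\<And>j. j < k \<Longrightarrow> (N ^^ j) (entry [F, F'] u) \<in> In"
    and e: "(N ^^ k) (entry [F, F'] u) = turn (entry [F, F'] v)" and v: "v \<in> vertices n"
    using r by (auto simp: is_run_def)
  have k0: "k > 0" using r turn_entry_notin[OF v, of "[F, F']"] entry_inside[OF u] unfolding is_run_def
    by (metis funpow_0 gr0I)
  then obtain l where l': "k = Suc l" by (cases k) auto
  have "\<forall>j<k. (N ^^ j) (entry [F, F'] u) \<in> In" using I by blast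
  note st = path_steps[OF this]
  have ne: "\<alpha> \<noteq> []" using a k0 by (metis length_0_conv length_path less_numeral_extra(3))
  have hd: "hd \<alpha> = stepof [F, F'] (entry [F, F'] u)" using a ne k0 by (simp add: hd_conv_nth)
  have last: "last \<alpha> = stepof [F, F'] ((N ^^ l) (entry [F, F'] u))"
    using a ne l' by (simp add: last_conv_nth)
  have yl: "(N ^^ l) (entry [F, F'] u) \<in> In" using I l' by simp
  have cl: "cross [F, F'] ((N ^^ l) (entry [F, F'] u)) = entry [F, F'] v"
    using e l' turn_nxt[OF yl] turn_turn[of "entry [F, F'] v" n] v by simp
  then have fl: "fst ((N ^^ l) (entry [F, F'] u)) = fst (entry [F, F'] v)" by (metis cross_def fst_conv)
  show "is_arc (fst F) (fst F') \<alpha>"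
    unfolding is_arc_def
  proof (intro conjI ballI allI impI)
    show "\<alpha> \<noteq> []" by (fact ne)
    show "is_step (fst F) (fst F') s" if "s \<in> set \<alpha>" for s using st(1) that a by simp
    show "fst (src (hd \<alpha>)) = (case fac (hd \<alpha>) of Left_Factor \<Rightarrow> 0 | Right_Factor \<Rightarrow> 1)"
      using vertices_fst[OF u] by (auto simp: hd stepof_def entry_def)
    show "fst (tgt (last \<alpha>)) = (case fac (last \<alpha>) of Left_Factor \<Rightarrow> 0 | Right_Factor \<Rightarrow> 1)"
      using vertices_fst[OF v] by (auto simp: last stepof_def fl cl) (auto simp: entry_def)
    show "vless (src (hd \<alpha>)) (tgt (last \<alpha>))" using l by (simp add: hd last stepof_def cl)
  next
    fix i assume i: "Suc i < length \<alpha>"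
    have m: "\<alpha> ! i \<in> set \<alpha>" "\<alpha> ! Suc i \<in> set \<alpha>" using i by auto
    have "stateof (\<alpha> ! Suc i) = N (stateof (\<alpha> ! i))" using i st(2)[of i] st(2)[of "Suc i"] a by simp
    note L = iffD1[OF link_iff[OF st(1)[OF m(1)[unfolded a]] st(1)[OF m(2)[unfolded a]]], folded a, OF this]
    show "snd (tgt (\<alpha> ! i)) = snd (src (\<alpha> ! Suc i))" using L by blast
    show "fac (\<alpha> ! i) = Left_Factor \<Longrightarrow> fst (tgt (\<alpha> ! i)) = 1" "fac (\<alpha> ! i) = Left_Factor \<Longrightarrow> fac (\<alpha> ! Suc i) = Right_Factor"
      "fac (\<alpha> ! i) = Left_Factor \<Longrightarrow> fst (src (\<alpha> ! Suc i)) = 0" using L by blast+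
    show "fac (\<alpha> ! i) = Right_Factor \<Longrightarrow> fst (tgt (\<alpha> ! i)) = 0" "fac (\<alpha> ! i) = Right_Factor \<Longrightarrow> fac (\<alpha> ! Suc i) = Left_Factor"
      "fac (\<alpha> ! i) = Right_Factor \<Longrightarrow> fst (src (\<alpha> ! Suc i)) = 1" using L by blast+
  qed
qed

lemma boundary_path:
  assumes "u \<in> vertices n" "is_run u k v"
  shows "boundary (path n [F, F'] (entry [F, F'] u) k) = {u, v}"
proof -
  have I: "\<And>j. j < k \<Longrightarrow> (N ^^ j) (entry [F, F'] u) \<in> In"
    and e: "(N ^^ k) (entry [F, F'] u) = turn (entry [F, F'] v)" and v: "v \<in> vertices n"
    using assms by (auto simp: is_run_def)
  have k0: "k > 0" using assms turn_entry_notin[OF v, of "[F, F']"] entry_inside[OF assms(1)] unfolding is_run_def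
    by (metis funpow_0 gr0I)
  then obtain l where l: "k = Suc l" by (cases k) auto
  have yl: "(N ^^ l) (entry [F, F'] u) \<in> In" using I l by simp
  have cl: "cross [F, F'] ((N ^^ l) (entry [F, F'] u)) = entry [F, F'] v"
    using e l turn_nxt[OF yl] turn_turn[of "entry [F, F'] v" n] v by simp
  have ne: "path n [F, F'] (entry [F, F'] u) k \<noteq> []" using k0 by (metis length_0_conv length_path less_numeral_extra(3))
  show ?thesis unfolding boundary_def using ne k0 l
    by (simp add: hd_conv_nth last_conv_nth stepof_def cl)
qed

lemma run_end_exists: "u \<in> vertices n \<Longrightarrow> \<exists>k. is_run u k (run_end u)"
  using run_exists run_values(1) by blast

lemma flat_star_eq: "flat_star (fst F) (fst F') = {{u, run_end u} | u. u \<in> vertices n}"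
proof (intro equalityI subsetI)
  fix \<beta> assume "\<beta> \<in> flat_star (fst F) (fst F')"
  then obtain \<alpha> where "is_arc (fst F) (fst F') \<alpha>" "\<beta> = boundary \<alpha>" by (auto simp: flat_star_def)
  then obtain u k v where "u \<in> vertices n" "is_run u k v" "\<beta> = {u, v}"
    using arc_iff boundary_path by metis
  then show "\<beta> \<in> {{u, run_end u} | u. u \<in> vertices n}" using run_values(1) by blast
next
  fix \<beta> assume "\<beta> \<in> {{u, run_end u} | u. u \<in> vertices n}"
  then obtain u where u: "u \<in> vertices n" "\<beta> = {u, run_end u}" by blast
  have "\<exists>u'. u' \<in> vertices n \<and> \<beta> = {u', run_end u'} \<and> vless u' (run_end u')"
  proof (cases "vless u (run_end u)")
    case False
    have r: "run_end u \<in> vertices n" "run_end u \<noteq> u" "run_end (run_end u) = u"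
      using valid_model_run u unfolding valid_model_def by blast+
    then have "vless (run_end u) u" using u(1) vless_total[of u n "run_end u"] False by metis
    then show ?thesis using r u(2) by (intro exI[of _ "run_end u"]) (simp add: insert_commute)
  qed (use u in metis)
  then obtain u' k where "u' \<in> vertices n" "\<beta> = {u', run_end u'}" "vless u' (run_end u')" "is_run u' k (run_end u')"
    using run_end_exists by metis
  then have "is_arc (fst F) (fst F') (path n [F, F'] (entry [F, F'] u') k)"
    "\<beta> = boundary (path n [F, F'] (entry [F, F'] u') k)"
    using arc_iff boundary_path by metis+
  then show "\<beta> \<in> flat_star (fst F) (fst F')" by (auto simp: flat_star_def)
qed

text \<open>The description operator in \<open>arrow_star\<close> is harmless: the smaller vertex of
  the boundary is the start of the arc, and a run is determined by its start.\<close>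

lemma arrow_star_eq: "arrow_star F F' = tangle_of n run_end run_gain"
proof (rule prod_eqI)
  have fs: "fst (tangle_of n run_end run_gain) = flat_star (fst F) (fst F')"
    by (simp add: tangle_of_def Let_def flat_star_eq)
  show "fst (arrow_star F F') = fst (tangle_of n run_end run_gain)"
    by (simp add: fs) (simp add: arrow_star_def split: prod.splits)
  have s: "snd (arrow_star F F') = (\<lambda>\<beta> \<in> flat_star (fst F) (fst F'). total_label (snd F) (snd F')
      (THE \<alpha>. is_arc (fst F) (fst F') \<alpha> \<and> boundary \<alpha> = \<beta>))"
    by (simp add: arrow_star_def split: prod.splits)
  show "snd (arrow_star F F') = snd (tangle_of n run_end run_gain)"
  proof (rule extensionalityI[where A = "flat_star (fst F) (fst F')"])
    show "snd (arrow_star F F') \<in> extensional (flat_star (fst F) (fst F'))" by (simp add: s)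
    show "snd (tangle_of n run_end run_gain) \<in> extensional (flat_star (fst F) (fst F'))"
      unfolding fs[symmetric] by (simp add: tangle_of_def Let_def)
    fix \<beta> assume b: "\<beta> \<in> flat_star (fst F) (fst F')"
    then obtain \<alpha> where a: "is_arc (fst F) (fst F') \<alpha>" "\<beta> = boundary \<alpha>" by (auto simp: flat_star_def)
    then obtain u k v where r: "u \<in> vertices n" "is_run u k v" "vless u v" "\<alpha> = path n [F, F'] (entry [F, F'] u) k" "\<beta> = {u, v}"
      using arc_iff boundary_path by metis
    have "(THE \<alpha>. is_arc (fst F) (fst F') \<alpha> \<and> boundary \<alpha> = \<beta>) = \<alpha>"
    proof (rule the_equality)
      fix \<alpha>' assume a': "is_arc (fst F) (fst F') \<alpha>' \<and> boundary \<alpha>' = \<beta>"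
      then obtain u' k' v' where r': "u' \<in> vertices n" "is_run u' k' v'" "vless u' v'" "\<alpha>' = path n [F, F'] (entry [F, F'] u') k'"
        "\<beta> = {u', v'}"
        using arc_iff boundary_path by metis
      have "u' = u" using r(3,5) r'(3,5) vless_asym by (metis doubleton_eq_iff)
      then show "\<alpha>' = \<alpha>" using r r' run_unique by metis
    qed (use a in auto)
    then have "snd (arrow_star F F') \<beta> = total_label (snd F) (snd F') \<alpha>" using b by (simp add: s)
    also have "\<dots> = side u * run_gain u"
      using label_path[of k "entry [F, F'] u"] r run_values(2)[OF r(2,1)] by (simp add: is_run_def)
    also have "\<dots> = snd (tangle_of n run_end run_gain) \<beta>"
      using tangle_of_label[OF valid_model_run r(1)] r run_values(1)[OF r(2,1)] by simp
    finally show "snd (arrow_star F F') \<beta> = snd (tangle_of n run_end run_gain) \<beta>" .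
  qed
qed

lemma arrow_star_props:
  "arrow_star F F' \<in> arrow_flat_tangles n"
  "is_run u k v \<Longrightarrow> u \<in> vertices n \<Longrightarrow> mate (fst (arrow_star F F')) u = v"
  "is_run u k v \<Longrightarrow> u \<in> vertices n \<Longrightarrow>
    gain (arrow_star F F') u = (\<Sum>j<k. sg [F, F'] ((N ^^ j) (entry [F, F'] u)))"
  unfolding arrow_star_eq using tangle_of_props[OF valid_model_run] run_values by auto

end

definition zeta :: "int \<Rightarrow> coeff_ring" where
  "zeta s = z (nat (\<bar>s\<bar> div 2))"

lemma zeta_uminus [simp]: "zeta (- s) = zeta s"
  by (simp add: zeta_def)

text \<open>Taken over all closed orbits, hence a square. In this way no direction or starting point
  of a cycle has to be chosen in stacks with more than two layers.\<close>

definition orbit_weight :: "nat \<Rightarrow> arrow_tangle list \<Rightarrow> coeff_ring" where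
  "orbit_weight n Fs = (\<Prod>Q\<in>closed_orbits (nxt n Fs) (inside n Fs). zeta (sum (sg Fs) Q))"

lemma finite_closed_orbits: "finite S \<Longrightarrow> finite (closed_orbits f S)"
  by (rule finite_subset[of _ "orb f ` S"]) (auto simp: closed_orbits_def)

lemma snd_snd_turn [simp]: "snd (snd (turn x)) = snd (snd x)"
  by (simp add: turn_def)

context two_stack
begin

text \<open>That the first column is strictly the least rules out an early return, so the length of
  the cycle is the exact period.\<close>

lemma cycle_imp:
  assumes c: "is_cycle (fst F) (fst F') \<gamma>"
  shows "\<exists>b p. (0, (1, b)) \<in> In \<and> is_period N (0, (1, b)) p \<and>
    (\<forall>y\<in>orb N (0, (1, b)). b \<le> snd (snd y)) \<and> \<gamma> = path n [F, F'] (0, (1, b)) p"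
proof -
  have st: "\<forall>s\<in>set \<gamma>. is_step (fst F) (fst F') s" and ne: "\<gamma> \<noteq> []" and ev: "even (length \<gamma>)"
    and lastc: "snd (tgt (last \<gamma>)) = snd (src (hd \<gamma>))"
    using c by (auto simp: is_cycle_def)
  have alt: "if even i then fac (\<gamma> ! i) = Left_Factor \<and> fst (src (\<gamma> ! i)) = 1 \<and> fst (tgt (\<gamma> ! i)) = 1
        else fac (\<gamma> ! i) = Right_Factor \<and> fst (src (\<gamma> ! i)) = 0 \<and> fst (tgt (\<gamma> ! i)) = 0" if "i < length \<gamma>" for i
    using c that unfolding is_cycle_def by blast
  have lnk: "snd (tgt (\<gamma> ! i)) = snd (src (\<gamma> ! Suc i)) \<and> snd (src (hd \<gamma>)) < snd (tgt (\<gamma> ! i))"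
    if "Suc i < length \<gamma>" for i using c that unfolding is_cycle_def by blast
  have lk: "\<forall>i. Suc i < length \<gamma> \<longrightarrow> stateof (\<gamma> ! Suc i) = N (stateof (\<gamma> ! i))"
  proof (intro allI impI)
    fix i assume i: "Suc i < length \<gamma>"
    then have "is_step (fst F) (fst F') (\<gamma> ! i)" "is_step (fst F) (fst F') (\<gamma> ! Suc i)" using st by auto
    from link_iff[OF this] show "stateof (\<gamma> ! Suc i) = N (stateof (\<gamma> ! i))"
      using alt[of i] alt[of "Suc i"] lnk[OF i] i by (cases "even i") auto
  qed
  note P = list_path[OF st ne lk]
  define b where "b = snd (src (hd \<gamma>))"
  define p where "p = length \<gamma>"
  have p0: "p > 0" using ne by (simp add: p_def)
  have x: "stateof (hd \<gamma>) = (0, (1, b))"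
    using alt[of 0] ne by (auto simp: stateof_def b_def hd_conv_nth prod_eq_iff)
  have xin: "(0, (1, b)) \<in> In" using st ne step_iff x by (metis hd_in_set)
  obtain m where m: "p = Suc m" using p0 by (cases p) auto
  have lst: "last \<gamma> = \<gamma> ! m" using ne m by (simp add: last_conv_nth p_def)
  have mlt: "m < length \<gamma>" using m unfolding p_def by simp
  have "odd m" using ev m p_def by simp
  then have am: "fac (\<gamma> ! m) = Right_Factor" "fst (tgt (\<gamma> ! m)) = 0" using alt[OF mlt] by auto
  have ym: "stateof (\<gamma> ! m) \<in> In" "stepof [F, F'] (stateof (\<gamma> ! m)) = \<gamma> ! m"
    using st step_iff nth_mem[OF mlt] by blast+
  have "N (stateof (\<gamma> ! m)) = turn (fst (stateof (\<gamma> ! m)), tgt (\<gamma> ! m))"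
    using nxt_inside[OF ym(1)] ym(2) by (metis cross_def fst_conv prod.collapse snd_conv stepof_def)
  also have "\<dots> = (0, (1, b))" using am lastc by (simp add: stateof_def turn_def lst b_def)
  finally have per: "(N ^^ p) (0, (1, b)) = (0, (1, b))"
    using P(1)[OF mlt] m x by simp
  have col: "b < snd (snd ((N ^^ j) (0, (1, b))))" if j: "0 < j" "j < p" for j
  proof -
    obtain i where i: "j = Suc i" using j by (cases j) auto
    have "(N ^^ j) (0, (1, b)) = stateof (\<gamma> ! j)" using P(1)[of j] j x unfolding p_def by simp
    then show ?thesis using lnk[of i] i j unfolding p_def by (simp add: stateof_def b_def)
  qed
  have isp: "is_period N (0, (1, b)) p"
    unfolding is_period_def
  proof (intro conjI allI impI)
    fix j assume "0 < j \<and> j < p"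
    then show "(N ^^ j) (0, (1, b)) \<noteq> (0, (1, b))" using col[of j] by force
  qed (use p0 per in auto)
  have "b \<le> snd (snd y)" if yo: "y \<in> orb N (0, (1, b))" for y
  proof -
    obtain j where "j < p" "y = (N ^^ j) (0, (1, b))" using yo unfolding orb_eq_image[OF isp] by blast
    then show ?thesis using col[of j] by (cases "j = 0") auto
  qed
  moreover have "\<gamma> = path n [F, F'] (0, (1, b)) p" using P(2) unfolding x p_def .
  ultimately show ?thesis using xin isp by blast
qed

lemma cycle_if:
  assumes xin: "(0, (1, b)) \<in> In" and isp: "is_period N (0, (1, b)) p"
    and mn: "\<forall>y\<in>orb N (0, (1, b)). b \<le> snd (snd y)"
  shows "is_cycle (fst F) (fst F') (path n [F, F'] (0, (1, b)) p)"
proof -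
  let ?x = "(0, (1, b)) :: state" and ?p = "path n [F, F'] (0, (1, b)) p"
  have rec: "recurrent N ?x" using isp by (rule is_period_recurrent)
  note I = recurrent_inside[OF xin rec]
  have Q: "orb N ?x \<in> closed_orbits N In" using xin rec by (auto simp: closed_orbits_def)
  have p: "p > 0" "(N ^^ p) ?x = ?x" "\<And>j. 0 < j \<Longrightarrow> j < p \<Longrightarrow> (N ^^ j) ?x \<noteq> ?x"
    using isp by (auto simp: is_period_def)
  have ct: "cross [F, F'] ((N ^^ j) ?x) = turn ((N ^^ Suc j) ?x)" for j
    using turn_nxt[OF I[of j]] by simp
  have alt: "fst ((N ^^ j) ?x) = (if even j then 0 else 1) \<and> fst (snd ((N ^^ j) ?x)) = (if even j then 1 else 0)" for j
  proof (induction j)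
    case (Suc j)
    have "fst (cross [F, F'] ((N ^^ j) ?x)) = fst ((N ^^ j) ?x)" by (simp add: cross_def)
    then show ?case using Suc ct[of j] inside_cases[OF I[of "Suc j"]] vertices_fst[OF insideD[OF I[of "Suc j"]]]
      by (cases "even j") (auto simp: turn_def split: if_splits)
  qed simp
  have tg: "tgt (?p ! j) = snd (turn ((N ^^ Suc j) ?x))" if "j < p" for j
    using that ct[of j] by (simp add: stepof_def)
  have sr: "src (?p ! j) = snd ((N ^^ j) ?x)" if "j < p" for j using that by (simp add: stepof_def)
  have evp: "even p" using alt[of p] unfolding p(2) by (simp split: if_splits)
  have ne: "?p \<noteq> []" using p(1) by (simp add: path_def)
  have hd: "hd ?p = ?p ! 0" using ne by (simp add: hd_conv_nth)
  obtain m where m: "p = Suc m" using p(1) by (cases p) auto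
  have lst: "last ?p = ?p ! m" using ne m by (simp add: last_conv_nth)
  show ?thesis
    unfolding is_cycle_def length_path
  proof (intro conjI ballI allI impI)
    show "?p \<noteq> []" "even p" by (fact ne evp)+
    show "is_step (fst F) (fst F') s" if "s \<in> set ?p" for s using path_steps(1)[OF _ that] I by blast
    show "snd (tgt (last ?p)) = snd (src (hd ?p))"
    proof -
      have mp: "m < p" "Suc m = p" using m by auto
      show ?thesis unfolding lst hd tg[OF mp(1)] sr[OF p(1)] mp(2) p(2) by (simp add: turn_def)
    qed
  next
    fix i assume "i < p"
    then show "if even i
        then fac (?p ! i) = Left_Factor \<and> fst (src (?p ! i)) = 1 \<and> fst (tgt (?p ! i)) = 1
        else fac (?p ! i) = Right_Factor \<and> fst (src (?p ! i)) = 0 \<and> fst (tgt (?p ! i)) = 0"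
      using tg[of i] sr[of i] alt[of i] alt[of "Suc i"]
      by (auto simp: fst_turn_side simp del: funpow.simps nth_path) (auto simp: stepof_def)
  next
    fix i assume i: "Suc i < p"
    show "snd (tgt (?p ! i)) = snd (src (?p ! Suc i))"
      using tg[of i] sr[of "Suc i"] i by (simp del: funpow.simps nth_path)
    have o: "(N ^^ Suc i) ?x \<in> orb N ?x" by (rule orb_step)
    \<comment> \<open>A second visit to column b would be the starting state, too early for the
      period, or its reversal, which lies on the reversed orbit.\<close>
    have "snd (snd ((N ^^ Suc i) ?x)) \<noteq> b"
    proof
      assume e: "snd (snd ((N ^^ Suc i) ?x)) = b"
      show False
      proof (cases "even (Suc i)")
        case True
        then have "(N ^^ Suc i) ?x = ?x" using alt[of "Suc i"] e by (auto simp: prod_eq_iff simp del: funpow.simps)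
        then show False using p(3)[of "Suc i"] i by blast
      next
        case False
        then have "(N ^^ Suc i) ?x = turn ?x" using alt[of "Suc i"] e by (auto simp: turn_def prod_eq_iff simp del: funpow.simps)
        then show False using turn_image_orbit(4)[OF Q orb_self] o by metis
      qed
    qed
    moreover have "b \<le> snd (snd ((N ^^ Suc i) ?x))" using mn o by blast
    ultimately show "snd (src (hd ?p)) < snd (tgt (?p ! i))"
      unfolding hd tg[OF Suc_lessD[OF i]] sr[OF p(1)] by simp
  qed
qed

text \<open>The direction in which a cycle is listed: from its least column it sets out through the
  left factor. Reversal turns these orbits into \<open>right_orbits\<close>.\<close>

definition left_orbits where
  "left_orbits = {Q \<in> closed_orbits N In. \<exists>b. (0, (1, b)) \<in> Q \<and> (\<forall>y\<in>Q. b \<le> snd (snd y))}"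

definition right_orbits where
  "right_orbits = {Q \<in> closed_orbits N In. \<exists>b. (1, (0, b)) \<in> Q \<and> (\<forall>y\<in>Q. b \<le> snd (snd y))}"

lemma cycle_coeff_left: "cycle_coeff F F' = (\<Prod>Q\<in>left_orbits. zeta (sum (sg [F, F']) Q))"
proof -
  let ?h = "\<lambda>\<gamma>. orb N (stateof (hd \<gamma>))"
  let ?C = "{\<gamma>. is_cycle (fst F) (fst F') \<gamma>}"
  have hd: "stateof (hd (path n [F, F'] x p)) = x" if "x \<in> In" "is_period N x p" for x p
  proof -
    have "p > 0" using that by (simp add: is_period_def)
    then have "path n [F, F'] x p \<noteq> []" by (metis length_0_conv length_path less_numeral_extra(3))
    then show ?thesis using \<open>p > 0\<close> stateof_stepof[OF that(1)] by (simp add: hd_conv_nth)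
  qed
  have img: "left_orbits = ?h ` ?C"
  proof (intro equalityI subsetI)
    fix Q assume "Q \<in> left_orbits"
    then obtain b where Q: "Q \<in> closed_orbits N In" "(0, (1, b)) \<in> Q" "\<forall>y\<in>Q. b \<le> snd (snd y)"
      by (auto simp: left_orbits_def)
    then have r: "recurrent N (0, (1, b))" "Q = orb N (0, (1, b))" using closed_orbits_mem by metis+
    have i: "(0, (1, b)) \<in> In" using turn_image_orbit(1)[OF Q(1)] Q(2) by blast
    obtain p where p: "is_period N (0, (1, b)) p" using r by (auto elim: recurrent_period)
    have "is_cycle (fst F) (fst F') (path n [F, F'] (0, (1, b)) p)" using cycle_if[OF i p] Q(3) r(2) by simp
    moreover have "?h (path n [F, F'] (0, (1, b)) p) = Q" using hd[OF i p] r by simp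
    ultimately show "Q \<in> ?h ` ?C" by blast
  next
    fix Q assume "Q \<in> ?h ` ?C"
    then obtain \<gamma> where g: "is_cycle (fst F) (fst F') \<gamma>" "Q = ?h \<gamma>" by blast
    then obtain b p where b: "(0, (1, b)) \<in> In" "is_period N (0, (1, b)) p"
      "\<forall>y\<in>orb N (0, (1, b)). b \<le> snd (snd y)" "\<gamma> = path n [F, F'] (0, (1, b)) p" using cycle_imp by blast
    have "Q = orb N (0, (1, b))" using g b hd[OF b(1,2)] by simp
    moreover have "orb N (0, (1, b)) \<in> closed_orbits N In"
      using b is_period_recurrent[OF b(2)] by (auto simp: closed_orbits_def)
    moreover have "(0, (1, b)) \<in> orb N (0, (1, b))" by (rule orb_self)
    ultimately show "Q \<in> left_orbits" using b(3) unfolding left_orbits_def by blast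
  qed
  have inj: "inj_on ?h ?C"
  proof (rule inj_onI)
    fix \<gamma> \<gamma>' assume g: "\<gamma> \<in> ?C" "\<gamma>' \<in> ?C" and e: "?h \<gamma> = ?h \<gamma>'"
    obtain b p where b: "(0, (1, b)) \<in> In" "is_period N (0, (1, b)) p"
      "\<forall>y\<in>orb N (0, (1, b)). b \<le> snd (snd y)" "\<gamma> = path n [F, F'] (0, (1, b)) p"
      using cycle_imp[of \<gamma>] g by blast
    obtain b' p' where
      b': "(0, (1, b')) \<in> In" "is_period N (0, (1, b')) p'"
      "\<forall>y\<in>orb N (0, (1, b')). b' \<le> snd (snd y)" "\<gamma>' = path n [F, F'] (0, (1, b')) p'"
      using cycle_imp[of \<gamma>'] g by blast
    have "orb N (0, (1, b)) = orb N (0, (1, b'))" using e unfolding b(4) b'(4) hd[OF b(1,2)] hd[OF b'(1,2)] .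
    then have mem: "(0, (1, b)) \<in> orb N (0, (1, b'))" "(0, (1, b')) \<in> orb N (0, (1, b))"
      using orb_self by metis+
    have "b = b'" using bspec[OF b(3) mem(2)] bspec[OF b'(3) mem(1)] by simp
    moreover from this have "p = p'" using b(2) b'(2) unfolding is_period_def by (metis linorder_neqE_nat)
    ultimately show "\<gamma> = \<gamma>'" unfolding b(4) b'(4) by simp
  qed
  have "zeta (sum (sg [F, F']) (?h \<gamma>)) = z (nat (\<bar>total_label (snd F) (snd F') \<gamma>\<bar> div 2))" if g: "\<gamma> \<in> ?C" for \<gamma>
  proof -
    obtain b p where b: "(0, (1, b)) \<in> In" "is_period N (0, (1, b)) p" "\<gamma> = path n [F, F'] (0, (1, b)) p"
      using cycle_imp g by blast
    have "total_label (snd F) (snd F') \<gamma> = - (\<Sum>j<p. sg [F, F'] ((N ^^ j) (0, (1, b))))"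
      unfolding b(3) by (subst label_path) (use recurrent_inside[OF b(1) is_period_recurrent[OF b(2)]] in \<open>auto simp: side_def\<close>)
    then show ?thesis unfolding b(3) hd[OF b(1,2)] sum_orb[OF b(2)] zeta_def by simp
  qed
  then have "(\<Prod>\<gamma>\<in>?C. z (nat (\<bar>total_label (snd F) (snd F') \<gamma>\<bar> div 2))) = (\<Prod>\<gamma>\<in>?C. zeta (sum (sg [F, F']) (?h \<gamma>)))"
    by (intro prod.cong) auto
  also have "\<dots> = (\<Prod>Q\<in>left_orbits. zeta (sum (sg [F, F']) Q))"
    unfolding img by (simp add: prod.reindex[OF inj])
  finally show ?thesis by (simp add: cycle_coeff_def case_prod_unfold)
qed

text \<open>The map \<open>turn\<close> exchanges the two classes of orbits and changes only the
  sign of the sums, which \<open>zeta\<close> ignores. An orbit in both classes would contain a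
  state and its reversal.\<close>

lemma cycle_coeff_square: "cycle_coeff F F' * cycle_coeff F F' = orbit_weight n [F, F']"
proof -
  let ?C = "closed_orbits N In"
  have un: "?C = left_orbits \<union> right_orbits"
  proof (intro equalityI subsetI)
    fix Q assume Q: "Q \<in> ?C"
    obtain y where y: "y \<in> Q" "\<forall>y'\<in>Q. snd (snd y) \<le> snd (snd y')"
      using closed_orbits_nonempty[OF Q] ex_has_least_nat[of "\<lambda>y. y \<in> Q" _ "\<lambda>y. snd (snd y)"] by blast
    have yI: "y \<in> In" using turn_image_orbit(1)[OF Q] y by blast
    \<comment> \<open>The states on the outer line of either layer are entries, so a closed orbit
      stays on the line where the two factors are glued.\<close>
    have "y \<noteq> entry [F, F'] (snd y)" using turn_image_orbit(5)[OF Q insideD[OF yI]] y by metis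
    then have "y = (0, (1, snd (snd y))) \<or> y = (1, (0, snd (snd y)))"
      using inside_cases[OF yI] vertices_fst[OF insideD[OF yI]] by (auto simp: entry_def prod_eq_iff)
    then show "Q \<in> left_orbits \<union> right_orbits"
    proof
      assume "y = (0, (1, snd (snd y)))"
      then have "(0, (1, snd (snd y))) \<in> Q" using y(1) by metis
      then have "Q \<in> left_orbits" unfolding left_orbits_def using Q y(2) by blast
      then show ?thesis ..
    next
      assume "y = (1, (0, snd (snd y)))"
      then have "(1, (0, snd (snd y))) \<in> Q" using y(1) by metis
      then have "Q \<in> right_orbits" unfolding right_orbits_def using Q y(2) by blast
      then show ?thesis ..
    qed
  qed (auto simp: left_orbits_def right_orbits_def)
  have disj: "left_orbits \<inter> right_orbits = {}"
  proof (rule equals0I)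
    fix Q assume "Q \<in> left_orbits \<inter> right_orbits"
    then obtain b b' where Q: "Q \<in> ?C" "(0, (1, b)) \<in> Q" "\<forall>y\<in>Q. b \<le> snd (snd y)" "(1, (0, b')) \<in> Q" "\<forall>y\<in>Q. b' \<le> snd (snd y)"
      by (auto simp: left_orbits_def right_orbits_def)
    have "b = b'" using bspec[OF Q(3,4)] bspec[OF Q(5,2)] by simp
    moreover have "turn (0, (1, b)) = (1, (0, b))" by (simp add: turn_def)
    ultimately show False using turn_image_orbit(4)[OF Q(1,2)] Q(4) by simp
  qed
  have tt: "turn ` (turn ` Q) = Q" if "Q \<in> ?C" for Q
  proof -
    have "turn (turn y) = y" if "y \<in> Q" for y
      using turn_turn insideD turn_image_orbit(1)[OF \<open>Q \<in> ?C\<close>] that by blast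
    then show ?thesis by (simp add: image_image)
  qed
  have lr: "turn ` Q \<in> right_orbits" if L: "Q \<in> left_orbits" for Q
  proof -
    obtain b where Q: "Q \<in> ?C" "(0, (1, b)) \<in> Q" "\<forall>y\<in>Q. b \<le> snd (snd y)" using L by (auto simp: left_orbits_def)
    have "turn (0, (1, b)) = (1, (0, b))" by (simp add: turn_def)
    then have "(1, (0, b)) \<in> turn ` Q" using Q(2) by (metis imageI)
    then show ?thesis using Q turn_image_orbit(2)[OF Q(1)] unfolding right_orbits_def by auto
  qed
  have rl: "turn ` Q \<in> left_orbits" if L: "Q \<in> right_orbits" for Q
  proof -
    obtain b where Q: "Q \<in> ?C" "(1, (0, b)) \<in> Q" "\<forall>y\<in>Q. b \<le> snd (snd y)" using L by (auto simp: right_orbits_def)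
    have "turn (1, (0, b)) = (0, (1, b))" by (simp add: turn_def)
    then have "(0, (1, b)) \<in> turn ` Q" using Q(2) by (metis imageI)
    then show ?thesis using Q turn_image_orbit(2)[OF Q(1)] unfolding left_orbits_def by auto
  qed
  have "(\<Prod>Q\<in>right_orbits. zeta (sum (sg [F, F']) Q)) = (\<Prod>Q\<in>left_orbits. zeta (sum (sg [F, F']) Q))"
    by (rule prod.reindex_bij_witness[where i = "image turn" and j = "image turn"])
      (use lr rl tt turn_image_orbit(3) in \<open>auto simp: un\<close>)
  moreover have "finite ?C" by (intro finite_closed_orbits finite_inside)
  ultimately show ?thesis
    unfolding orbit_weight_def cycle_coeff_left un
    using disj by (subst prod.union_disjoint) (auto simp: un)
qed

end

definition is_monomial :: "coeff_ring \<Rightarrow> bool" where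
  "is_monomial c \<longleftrightarrow> (\<exists>a. c = Poly_Mapping.single a 1)"

lemma is_monomial_1: "is_monomial 1"
  unfolding is_monomial_def by (metis single_one)

lemma is_monomial_mult: "is_monomial c \<Longrightarrow> is_monomial d \<Longrightarrow> is_monomial (c * d)"
  unfolding is_monomial_def by (metis mult_single mult_1)

lemma is_monomial_z: "is_monomial (z k)"
  unfolding is_monomial_def z_def by blast

lemma is_monomial_prod: "(\<And>x. x \<in> A \<Longrightarrow> is_monomial (f x)) \<Longrightarrow> is_monomial (prod f A)"
  by (induction A rule: infinite_finite_induct) (auto intro: is_monomial_1 is_monomial_mult)

lemma is_monomial_cycle_coeff: "is_monomial (cycle_coeff F F')"
  unfolding cycle_coeff_def by (auto intro!: is_monomial_prod is_monomial_z split: prod.splits)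

text \<open>Squaring doubles the exponents, which are natural numbers, and the coefficient 1 leaves
  no choice of sign.\<close>

lemma is_monomial_square_cancel:
  assumes "is_monomial c" "is_monomial d" "c * c = d * d"
  shows "c = d"
proof -
  obtain a b where ab: "c = Poly_Mapping.single a 1" "d = Poly_Mapping.single b 1"
    using assms by (auto simp: is_monomial_def)
  have "Poly_Mapping.single (a + a) (1 :: int) = Poly_Mapping.single (b + b) 1"
    using assms(3) by (simp add: ab mult_single)
  then have "a + a = b + b"
    by (metis lookup_single_eq lookup_single_not_eq one_neq_zero)
  then have "Poly_Mapping.lookup (a + a) k = Poly_Mapping.lookup (b + b) k" for k by simp
  then have "Poly_Mapping.lookup a k + Poly_Mapping.lookup a k = Poly_Mapping.lookup b k + Poly_Mapping.lookup b k" for k by (simp add: lookup_add)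
  then have "Poly_Mapping.lookup a k = Poly_Mapping.lookup b k" for k by (metis add_self_div_2)
  then have "a = b" by (rule poly_mapping_eqI)
  then show ?thesis using ab by simp
qed

section \<open>Replacing two neighbouring layers by their product\<close>

lemma step_iterate_sum:
  fixes h :: "'s \<Rightarrow> int" and h' :: "'t \<Rightarrow> int"
  assumes step: "\<forall>x\<in>T. \<exists>k. (f ^^ k) (\<iota> x) = \<iota> (g x) \<and> (\<forall>j<k. (f ^^ j) (\<iota> x) \<in> S) \<and>
      h' x = (\<Sum>j<k. h ((f ^^ j) (\<iota> x)))"
    and "\<forall>j<i. (g ^^ j) x \<in> T"
  shows "\<exists>q. (f ^^ q) (\<iota> x) = \<iota> ((g ^^ i) x) \<and> (\<forall>j<q. (f ^^ j) (\<iota> x) \<in> S) \<and>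
     (\<Sum>j<i. h' ((g ^^ j) x)) = (\<Sum>j<q. h ((f ^^ j) (\<iota> x)))"
  using assms(2)
proof (induction i)
  case 0
  then show ?case by (intro exI[of _ 0]) auto
next
  case (Suc i)
  then obtain q where q: "(f ^^ q) (\<iota> x) = \<iota> ((g ^^ i) x)" "\<forall>j<q. (f ^^ j) (\<iota> x) \<in> S"
     "(\<Sum>j<i. h' ((g ^^ j) x)) = (\<Sum>j<q. h ((f ^^ j) (\<iota> x)))" by auto
  have "(g ^^ i) x \<in> T" using Suc.prems by simp
  then obtain k where k: "(f ^^ k) (\<iota> ((g ^^ i) x)) = \<iota> (g ((g ^^ i) x))" "\<forall>j<k. (f ^^ j) (\<iota> ((g ^^ i) x)) \<in> S"
      "h' ((g ^^ i) x) = (\<Sum>j<k. h ((f ^^ j) (\<iota> ((g ^^ i) x))))" using step by blast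
  have shift: "(f ^^ (j + q)) (\<iota> x) = (f ^^ j) (\<iota> ((g ^^ i) x))" for j
    by (simp add: funpow_add_apply q(1))
  show ?case
  proof (intro exI[of _ "q + k"] conjI allI impI)
    show "(f ^^ (q + k)) (\<iota> x) = \<iota> ((g ^^ Suc i) x)" using shift[of k] k(1) by (simp add: add.commute)
    fix j assume j: "j < q + k"
    show "(f ^^ j) (\<iota> x) \<in> S"
    proof (cases "j < q")
      case False
      then show ?thesis using shift[of "j - q"] k(2) j by simp
    qed (use q in blast)
  next
    show "(\<Sum>j<Suc i. h' ((g ^^ j) x)) = (\<Sum>j<q + k. h ((f ^^ j) (\<iota> x)))"
      using q(3) k(3) by (simp add: sum_lessThan_add shift)
  qed
qed

definition shift :: "nat \<Rightarrow> state \<Rightarrow> state" where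
  "shift a x = (fst x + int a, snd x)"

text \<open>Compares a stack with a product in layer a to the stack with its two factors: the top
  vertices of the product belong to the first factor, its bottom vertices to the second, and the
  layers below move down by one.\<close>

definition expand :: "nat \<Rightarrow> state \<Rightarrow> state" where
  "expand a x = (if fst x < int a then x
     else if fst x = int a then (if fst (snd x) = 0 then x else (fst x + 1, snd x))
     else (fst x + 1, snd x))"

lemma turn_shift: "turn (shift a x) = shift a (turn x)"
  by (simp add: turn_def shift_def)

lemma inj_shift: "inj (shift a)"
  by (auto simp: inj_def shift_def prod_eq_iff)

locale merge_stack =
  fixes n :: nat and Ls Rs :: "arrow_tangle list" and G H :: arrow_tangle
  assumes Ls: "set Ls \<subseteq> arrow_flat_tangles n" and Rs: "set Rs \<subseteq> arrow_flat_tangles n"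
    and GH: "G \<in> arrow_flat_tangles n" "H \<in> arrow_flat_tangles n"
begin

abbreviation "L2 \<equiv> Ls @ arrow_star G H # Rs"
abbreviation "L3 \<equiv> Ls @ G # H # Rs"
abbreviation "a \<equiv> length Ls"

sublocale P: two_stack n G H by unfold_locales (use GH in auto)
sublocale S2: stack n L2 by unfold_locales (use Ls Rs P.arrow_star_props(1) in auto)
sublocale S3: stack n L3 by unfold_locales (use Ls Rs GH in auto)

lemma shift_inside: "x \<in> inside n [G, H] \<Longrightarrow> shift a x \<in> inside n L3"
  by (auto simp: inside_def shift_def)

lemma nth_L3_mid: "0 \<le> k \<Longrightarrow> k < 2 \<Longrightarrow> L3 ! nat (k + int a) = [G, H] ! nat k"
proof -
  assume "0 \<le> k" "k < 2"
  then have "k = 0 \<or> k = 1" by auto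
  then show ?thesis by (auto simp: nth_append nat_add_distrib)
qed

lemma shift_props:
  assumes "x \<in> inside n [G, H]"
  shows "nxt n L3 (shift a x) = shift a (nxt n [G, H] x)" "sg L3 (shift a x) = sg [G, H] x"
proof -
  have k: "0 \<le> fst x" "fst x < 2" using assms by (auto simp: inside_def)
  note nth = nth_L3_mid[OF k]
  have "cross L3 (shift a x) = shift a (cross [G, H] x)"
    using nth by (simp add: cross_def shift_def)
  then show "nxt n L3 (shift a x) = shift a (nxt n [G, H] x)"
    using assms shift_inside[OF assms] by (simp add: nxt_def turn_shift)
  show "sg L3 (shift a x) = sg [G, H] x" using nth by (simp add: sg_def shift_def)
qed

lemma shift_pow:
  "\<forall>i<j. (nxt n [G, H] ^^ i) x \<in> inside n [G, H] \<Longrightarrow>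
    (nxt n L3 ^^ j) (shift a x) = shift a ((nxt n [G, H] ^^ j) x)"
proof (induction j)
  case (Suc j)
  then have "(nxt n [G, H] ^^ j) x \<in> inside n [G, H]" by simp
  then show ?case using Suc shift_props(1) by simp
qed simp

lemma expand_inside: "x \<in> inside n L2 \<Longrightarrow> expand a x \<in> inside n L3"
  by (auto simp: inside_def expand_def)

lemma expand_outside: "x \<notin> inside n L2 \<Longrightarrow> snd x \<in> vertices n \<Longrightarrow> expand a x \<notin> inside n L3"
  by (auto simp: inside_def expand_def split: if_splits)

lemma inj_expand: "inj (expand a)"
  by (rule injI) (auto simp: expand_def prod_eq_iff split: if_splits)

lemma expand_mid: "fst x = int a \<Longrightarrow> expand a x = shift a (entry [G, H] (snd x))"
  by (cases x) (auto simp: expand_def shift_def entry_def)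

lemma expand_meets_shift:
  assumes "y \<in> inside n [G, H]" "shift a y \<in> expand a ` inside n L2"
  shows "\<exists>u\<in>vertices n. y = entry [G, H] u"
proof -
  obtain x where x: "x \<in> inside n L2" "shift a y = expand a x" using assms by auto
  have y: "fst y = 0 \<or> fst y = 1" using assms(1) by (auto simp: inside_def)
  have "snd x = snd y" using x(2) by (auto simp: shift_def expand_def prod_eq_iff split: if_splits)
  moreover have "fst x = int a"
    using x(2) y by (auto simp: shift_def expand_def prod_eq_iff split: if_splits)
  ultimately have "shift a y = shift a (entry [G, H] (snd y))" using x(2) expand_mid by simp
  then have "y = entry [G, H] (snd y)" using inj_shift by (auto dest: injD)
  then show ?thesis using insideD[OF assms(1)] by blast
qed

lemma not_expand:
  assumes "x \<in> inside n L3" "x \<notin> expand a ` inside n L2"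
  shows "\<exists>y\<in>inside n [G, H]. x = shift a y"
proof -
  have "int a \<le> fst x"
  proof (rule ccontr)
    assume "\<not> int a \<le> fst x"
    then have "expand a x = x" "x \<in> inside n L2" using assms(1) by (auto simp: expand_def inside_def)
    then show False using assms(2) by (metis imageI)
  qed
  moreover have "fst x < int a + 2"
  proof (rule ccontr)
    assume "\<not> fst x < int a + 2"
    then have "expand a (fst x - 1, snd x) = x" "(fst x - 1, snd x) \<in> inside n L2"
      using assms(1) by (auto simp: expand_def inside_def)
    then show False using assms(2) by (metis imageI)
  qed
  ultimately show ?thesis using assms(1)
    by (intro bexI[of _ "(fst x - int a, snd x)"]) (auto simp: shift_def inside_def)
qed

text \<open>A step through the product is a whole run through its two factors. Strictly inside, this
  run meets no entry, hence no point in the image of \<open>expand\<close>. In every other layer a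
  step remains a single step.\<close>

lemma step_expand:
  assumes x: "x \<in> inside n L2"
  shows "\<exists>k>0. (nxt n L3 ^^ k) (expand a x) = expand a (nxt n L2 x) \<and>
    (\<forall>j. 0 < j \<and> j < k \<longrightarrow> (nxt n L3 ^^ j) (expand a x) \<notin> expand a ` inside n L2) \<and>
    (\<forall>j<k. (nxt n L3 ^^ j) (expand a x) \<in> inside n L3) \<and>
    sg L2 x = (\<Sum>j<k. sg L3 ((nxt n L3 ^^ j) (expand a x)))"
proof (cases "fst x = int a")
  case True
  let ?u = "snd x"
  have u: "?u \<in> vertices n" using x insideD by blast
  obtain k v where r: "P.is_run ?u k v" using P.run_exists[OF u] by blast
  have I: "\<forall>j<k. (nxt n [G, H] ^^ j) (entry [G, H] ?u) \<in> inside n [G, H]"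
    and e: "(nxt n [G, H] ^^ k) (entry [G, H] ?u) = turn (entry [G, H] v)" and v: "v \<in> vertices n"
    using r by (auto simp: P.is_run_def)
  have k0: "k > 0" using e turn_entry_notin[OF v, of "[G, H]"] P.entry_inside[OF u]
    by (metis funpow_0 gr0I)
  have L2a: "L2 ! nat (fst x) = arrow_star G H" using True by (simp add: nth_append)
  have pw: "(nxt n L3 ^^ j) (expand a x) = shift a ((nxt n [G, H] ^^ j) (entry [G, H] ?u))" if "j \<le> k" for j
    unfolding expand_mid[OF True] using shift_pow[of j "entry [G, H] ?u"] I that by auto
  show ?thesis
  proof (rule exI[of _ k], intro conjI allI impI)
    show "k > 0" by (fact k0)
    have m: "mate (fst (arrow_star G H)) ?u = v" using P.arrow_star_props(2)[OF r u] .
    have c: "cross L2 x = (int a, v)" using L2a m True by (simp add: cross_def)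
    then have "nxt n L2 x = turn (int a, v)" using x by (simp add: nxt_def)
    moreover have "expand a (turn (int a, v)) = shift a (turn (entry [G, H] v))"
      using vertices_fst[OF v] by (auto simp: expand_def shift_def turn_def entry_def)
    ultimately show "(nxt n L3 ^^ k) (expand a x) = expand a (nxt n L2 x)" using pw[of k] e by simp
  next
    fix j assume j: "0 < j \<and> j < k"
    show "(nxt n L3 ^^ j) (expand a x) \<notin> expand a ` inside n L2"
    proof
      assume "(nxt n L3 ^^ j) (expand a x) \<in> expand a ` inside n L2"
      then have "shift a ((nxt n [G, H] ^^ j) (entry [G, H] ?u)) \<in> expand a ` inside n L2"
        using pw[of j] j by simp
      then obtain u' where u': "u' \<in> vertices n" "(nxt n [G, H] ^^ j) (entry [G, H] ?u) = entry [G, H] u'"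
        using expand_meets_shift I j by blast
      obtain i where i: "j = Suc i" using j by (cases j) auto
      have "(nxt n [G, H] ^^ i) (entry [G, H] ?u) \<in> inside n [G, H]" using I j i by simp
      from P.nxt_not_entry[OF this u'(1)] show False using u'(2) i by simp
    qed
  next
    fix j assume "j < k"
    then show "(nxt n L3 ^^ j) (expand a x) \<in> inside n L3" using pw[of j] I shift_inside by simp
  next
    have "sg L2 x = gain (arrow_star G H) ?u" unfolding sg_def L2a ..
    also have "\<dots> = (\<Sum>j<k. sg [G, H] ((nxt n [G, H] ^^ j) (entry [G, H] ?u)))"
      using P.arrow_star_props(3)[OF r u] .
    also have "\<dots> = (\<Sum>j<k. sg L3 ((nxt n L3 ^^ j) (expand a x)))"
      using pw I shift_props(2) by (intro sum.cong) auto
    finally show "sg L2 x = (\<Sum>j<k. sg L3 ((nxt n L3 ^^ j) (expand a x)))" .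
  qed
next
  case False
  have fe: "fst (expand a x) = (if fst x < int a then fst x else fst x + 1)" "snd (expand a x) = snd x"
    using False by (auto simp: expand_def)
  have nth: "L3 ! nat (fst (expand a x)) = L2 ! nat (fst x)"
  proof (cases "fst x < int a")
    case True
    then show ?thesis using fe x by (auto simp: nth_append inside_def nat_less_iff)
  next
    case F: False
    then obtain m where m: "fst x = int a + 1 + int m" using False
      by (metis add.assoc linorder_not_less zero_le_imp_eq_int zle_iff_zadd zless_iff_Suc_zadd less_le add.commute of_nat_Suc)
    then have "nat (fst x) = a + Suc m" "nat (fst (expand a x)) = a + Suc (Suc m)" using fe F by auto
    then show ?thesis by (simp add: nth_append)
  qed
  have xe: "expand a x \<in> inside n L3" using expand_inside[OF x] .
  have cx: "cross L3 (expand a x) = (fst (expand a x), snd (cross L2 x))" "fst (cross L2 x) = fst x"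
    unfolding cross_def nth using fe by auto
  have v: "fst (snd (cross L2 x)) = 0 \<or> fst (snd (cross L2 x)) = 1"
    using S2.cross_props(1)[OF x] insideD vertices_fst by blast
  have "turn (fst (expand a x), snd (cross L2 x)) = expand a (turn (cross L2 x))"
    using v fe False cx(2) by (auto simp: turn_def expand_def split: if_splits)
  then have "nxt n L3 (expand a x) = expand a (nxt n L2 x)"
    using x xe by (simp add: nxt_def cx)
  moreover have "sg L2 x = sg L3 (expand a x)" unfolding sg_def nth fe(2) ..
  ultimately show ?thesis using xe by (intro exI[of _ 1]) auto
qed

lemma nxt_L2_outside:
  assumes "x \<in> inside n L2" "nxt n L2 x \<notin> inside n L2"
  shows "expand a (nxt n L2 x) \<notin> inside n L3"
  using expand_outside[OF assms(2)] S2.snd_nxt insideD[OF assms(1)] by blast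

text \<open>Through \<open>expand\<close> the short stack is the first-return system of the long
  one.\<close>

lemma weight_meeting:
  "(\<Prod>Q\<in>{Q \<in> closed_orbits (nxt n L3) (inside n L3). Q \<inter> expand a ` inside n L2 \<noteq> {}}. zeta (sum (sg L3) Q))
    = orbit_weight n L2"
proof -
  obtain k where k: "\<And>x. x \<in> inside n L2 \<Longrightarrow> k x > (0::nat) \<and> (nxt n L3 ^^ k x) (expand a x) = expand a (nxt n L2 x) \<and>
    (\<forall>j. 0 < j \<and> j < k x \<longrightarrow> (nxt n L3 ^^ j) (expand a x) \<notin> expand a ` inside n L2) \<and>
    sg L2 x = (\<Sum>j<k x. sg L3 ((nxt n L3 ^^ j) (expand a x)))"
    using step_expand by metis
  show ?thesis unfolding orbit_weight_def
  proof (rule prod_closed_orbits_first_return[symmetric, where k = k])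
    fix x assume x: "x \<in> inside n L2"
    show "(nxt n L3 ^^ k x) (expand a x) = expand a (nxt n L2 x) \<and> k x > 0 \<and>
      (\<forall>j. 0 < j \<and> j < k x \<longrightarrow> (nxt n L3 ^^ j) (expand a x) \<notin> expand a ` inside n L2) \<and>
      sg L2 x = (\<Sum>j<k x. sg L3 ((nxt n L3 ^^ j) (expand a x)))" using k[OF x] by blast
    assume o: "nxt n L2 x \<notin> inside n L2"
    have "expand a (nxt n L2 x) \<notin> inside n L3" using nxt_L2_outside[OF x o] .
    moreover from this have "expand a (nxt n L2 x) \<notin> expand a ` inside n L2"
      by (rule contra_subsetD[rotated]) (rule image_subsetI, rule expand_inside)
    moreover have "nxt n L y = y" if "y \<notin> inside n L" for L y using that by (simp add: nxt_def)
    ultimately show "nxt n L2 (nxt n L2 x) = nxt n L2 x \<and>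
        nxt n L3 (expand a (nxt n L2 x)) = expand a (nxt n L2 x) \<and> expand a (nxt n L2 x) \<notin> expand a ` inside n L2"
      using o by blast
  next
    show "inj_on (expand a) (inside n L2)" using inj_expand inj_on_subset by blast
    show "expand a ` inside n L2 \<subseteq> inside n L3" using expand_inside by blast
  qed
qed

text \<open>An orbit off the image of \<open>expand\<close> never passes an outer vertex of the two
  factors, so it is a shifted closed orbit of these two layers alone.\<close>

lemma weight_missing:
  "(\<Prod>Q\<in>{Q \<in> closed_orbits (nxt n L3) (inside n L3). Q \<inter> expand a ` inside n L2 = {}}. zeta (sum (sg L3) Q))
    = orbit_weight n [G, H]"
proof -
  let ?C = "closed_orbits (nxt n [G, H]) (inside n [G, H])"
  have img: "{Q \<in> closed_orbits (nxt n L3) (inside n L3). Q \<inter> expand a ` inside n L2 = {}} = (\<lambda>Q. shift a ` Q) ` ?C"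
  proof (intro equalityI subsetI)
    fix Q assume "Q \<in> {Q \<in> closed_orbits (nxt n L3) (inside n L3). Q \<inter> expand a ` inside n L2 = {}}"
    then have Q: "Q \<in> closed_orbits (nxt n L3) (inside n L3)" "Q \<inter> expand a ` inside n L2 = {}" by auto
    then obtain x where x: "x \<in> inside n L3" "recurrent (nxt n L3) x" "Q = orb (nxt n L3) x"
      by (auto simp: closed_orbits_def)
    have sh: "\<exists>y\<in>inside n [G, H]. x' = shift a y" if x': "x' \<in> Q" for x'
      using not_expand S3.turn_image_orbit(1)[OF Q(1)] Q(2) x' by blast
    obtain y where y: "y \<in> inside n [G, H]" "x = shift a y" 
    proof -
      have "x \<in> Q" using x(3) orb_self by simp
      then show ?thesis using sh that by blast
    qed
    have I: "(nxt n [G, H] ^^ j) y \<in> inside n [G, H] \<and> (nxt n L3 ^^ j) x = shift a ((nxt n [G, H] ^^ j) y)" for j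
    proof (induction j)
      case (Suc j)
      then have e: "(nxt n L3 ^^ Suc j) x = shift a ((nxt n [G, H] ^^ Suc j) y)" using shift_props(1) by simp
      moreover have "(nxt n L3 ^^ Suc j) x \<in> Q" using x(3) orb_step[of "Suc j" "nxt n L3" x] by simp
      then obtain y' where "y' \<in> inside n [G, H]" "(nxt n L3 ^^ Suc j) x = shift a y'" using sh by blast
      ultimately have "(nxt n [G, H] ^^ Suc j) y \<in> inside n [G, H]" using injD[OF inj_shift] by metis
      then show ?case using e by blast
    qed (use y in simp)
    have "orb (nxt n L3) x = shift a ` orb (nxt n [G, H]) y"
      unfolding orb_def image_image using I by auto
    moreover have "recurrent (nxt n [G, H]) y"
      using x(2) I y unfolding recurrent_def by (metis injD inj_shift)
    ultimately show "Q \<in> (\<lambda>Q. shift a ` Q) ` ?C" using x(3) y unfolding closed_orbits_def by blast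
  next
    fix Q assume "Q \<in> (\<lambda>Q. shift a ` Q) ` ?C"
    then obtain Q' where Q': "Q' \<in> ?C" "Q = shift a ` Q'" by blast
    then obtain y where y: "y \<in> inside n [G, H]" "recurrent (nxt n [G, H]) y" "Q' = orb (nxt n [G, H]) y"
      by (auto simp: closed_orbits_def)
    have pw: "(nxt n L3 ^^ j) (shift a y) = shift a ((nxt n [G, H] ^^ j) y)" for j
      using shift_pow P.recurrent_inside[OF y(1,2)] by blast
    have "recurrent (nxt n L3) (shift a y)" using y(2) pw unfolding recurrent_def by metis
    moreover have "orb (nxt n L3) (shift a y) = Q" unfolding Q'(2) y(3) orb_def image_image pw ..
    ultimately have "Q \<in> closed_orbits (nxt n L3) (inside n L3)"
      using shift_inside[OF y(1)] unfolding closed_orbits_def by blast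
    moreover have "Q \<inter> expand a ` inside n L2 = {}"
    proof (rule equals0I)
      fix x assume x: "x \<in> Q \<inter> expand a ` inside n L2"
      then obtain y' where y': "y' \<in> Q'" "x = shift a y'" using Q'(2) by blast
      then have "y' \<in> inside n [G, H]" using P.turn_image_orbit(1)[OF Q'(1)] by blast
      then obtain u where "u \<in> vertices n" "y' = entry [G, H] u" using expand_meets_shift[of y'] x unfolding y'(2) by blast
      then show False using P.turn_image_orbit(5)[OF Q'(1)] y'(1) by blast
    qed
    ultimately show "Q \<in> {Q \<in> closed_orbits (nxt n L3) (inside n L3). Q \<inter> expand a ` inside n L2 = {}}" by blast
  qed
  have s: "sum (sg L3) (shift a ` Q) = sum (sg [G, H]) Q" if Q: "Q \<in> ?C" for Q
  proof -
    have "inj_on (shift a) Q" using inj_shift inj_on_subset by blast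
    then have "sum (sg L3) (shift a ` Q) = (\<Sum>y\<in>Q. sg L3 (shift a y))" by (simp add: sum.reindex)
    also have "\<dots> = sum (sg [G, H]) Q"
      using P.turn_image_orbit(1)[OF Q] shift_props(2) by (intro sum.cong) auto
    finally show ?thesis .
  qed
  have inj: "inj_on (\<lambda>Q. shift a ` Q) ?C"
    using inj_shift by (metis inj_image_eq_iff inj_onI)
  show ?thesis unfolding img orbit_weight_def by (simp add: prod.reindex[OF inj] s)
qed

lemma weight_merge: "orbit_weight n [G, H] * orbit_weight n L2 = orbit_weight n L3"
proof -
  let ?C = "closed_orbits (nxt n L3) (inside n L3)" and ?T = "expand a ` inside n L2"
  have "?C = {Q \<in> ?C. Q \<inter> ?T = {}} \<union> {Q \<in> ?C. Q \<inter> ?T \<noteq> {}}" by blast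
  moreover have "finite ?C" by (intro finite_closed_orbits finite_inside)
  ultimately have "orbit_weight n L3 = (\<Prod>Q\<in>{Q \<in> ?C. Q \<inter> ?T = {}}. zeta (sum (sg L3) Q)) *
      (\<Prod>Q\<in>{Q \<in> ?C. Q \<inter> ?T \<noteq> {}}. zeta (sum (sg L3) Q))"
    unfolding orbit_weight_def
    by (subst prod.union_disjoint[symmetric]) (auto intro: prod.cong)
  then show ?thesis by (simp add: weight_meeting weight_missing)
qed

lemma run_merge:
  assumes u: "u \<in> vertices n"
  shows "S2.run_end u = S3.run_end u" "S2.run_gain u = S3.run_gain u"
proof -
  obtain k v where r: "S2.is_run u k v" using S2.run_exists[OF u] by blast
  then have v: "v \<in> vertices n" and I: "\<forall>j<k. (nxt n L2 ^^ j) (entry L2 u) \<in> inside n L2"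
    and e: "(nxt n L2 ^^ k) (entry L2 u) = turn (entry L2 v)" by (auto simp: S2.is_run_def)
  have ent: "expand a (entry L2 w) = entry L3 w" "expand a (turn (entry L2 w)) = turn (entry L3 w)"
    if "w \<in> vertices n" for w
    using vertices_fst[OF that] by (auto simp: expand_def entry_def turn_def)
  have "\<forall>x\<in>inside n L2. \<exists>k. (nxt n L3 ^^ k) (expand a x) = expand a (nxt n L2 x) \<and>
      (\<forall>j<k. (nxt n L3 ^^ j) (expand a x) \<in> inside n L3) \<and> sg L2 x = (\<Sum>j<k. sg L3 ((nxt n L3 ^^ j) (expand a x)))"
    using step_expand by blast
  from step_iterate_sum[OF this I] obtain q where
    q: "(nxt n L3 ^^ q) (entry L3 u) = turn (entry L3 v)" "\<forall>j<q. (nxt n L3 ^^ j) (entry L3 u) \<in> inside n L3"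
      "(\<Sum>j<k. sg L2 ((nxt n L2 ^^ j) (entry L2 u))) = (\<Sum>j<q. sg L3 ((nxt n L3 ^^ j) (entry L3 u)))"
    unfolding e ent[OF u] ent[OF v] by blast
  then have r3: "S3.is_run u q v" using v by (simp add: S3.is_run_def)
  show "S2.run_end u = S3.run_end u" "S2.run_gain u = S3.run_gain u"
    using S2.run_values[OF r u] S3.run_values[OF r3 u] q(3) by simp_all
qed

end

theorem arrow_star_closed:
  "\<lbrakk>F \<in> arrow_flat_tangles n; F' \<in> arrow_flat_tangles n\<rbrakk> \<Longrightarrow> arrow_star F F' \<in> arrow_flat_tangles n"
  using two_stack.arrow_star_props(1) two_stack.intro by blast

text \<open>Both bracketings are compared with the stack of all three factors. For the coefficients
  this gives equal squares, and monomials with coefficient 1 have unique square roots.\<close>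

lemma arrow_star_assoc:
  assumes A: "F \<in> arrow_flat_tangles n" "F' \<in> arrow_flat_tangles n" "F'' \<in> arrow_flat_tangles n"
  shows "arrow_star (arrow_star F F') F'' = arrow_star F (arrow_star F' F'')"
    "cycle_coeff F F' * cycle_coeff (arrow_star F F') F'' = cycle_coeff F' F'' * cycle_coeff F (arrow_star F' F'')"
proof -
  interpret l: merge_stack n "[]" "[F'']" F F' by unfold_locales (use A in auto)
  interpret r: merge_stack n "[F]" "[]" F' F'' by unfold_locales (use A in auto)
  interpret L: two_stack n "arrow_star F F'" F'' by unfold_locales (use A arrow_star_closed in auto)
  interpret R: two_stack n F "arrow_star F' F''" by unfold_locales (use A arrow_star_closed in auto)
  have e: "L.run_end u = R.run_end u" "L.run_gain u = R.run_gain u" if "u \<in> vertices n" for u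
    using l.run_merge[OF that] r.run_merge[OF that] by simp_all
  show "arrow_star (arrow_star F F') F'' = arrow_star F (arrow_star F' F'')"
  proof (rule arrow_tangle_eqI)
    show "arrow_star (arrow_star F F') F'' \<in> arrow_flat_tangles n" "arrow_star F (arrow_star F' F'') \<in> arrow_flat_tangles n"
      by (fact L.arrow_star_props(1) R.arrow_star_props(1))+
    fix u assume u: "u \<in> vertices n"
    show "mate (fst (arrow_star (arrow_star F F') F'')) u = mate (fst (arrow_star F (arrow_star F' F''))) u"
      "gain (arrow_star (arrow_star F F') F'') u = gain (arrow_star F (arrow_star F' F'')) u"
      unfolding L.arrow_star_eq R.arrow_star_eq
      using tangle_of_props(2,3)[OF L.valid_model_run u] tangle_of_props(2,3)[OF R.valid_model_run u] e[OF u] by simp_all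
  qed
  let ?c = "cycle_coeff F F' * cycle_coeff (arrow_star F F') F''"
  let ?d = "cycle_coeff F' F'' * cycle_coeff F (arrow_star F' F'')"
  have "?c * ?c = (cycle_coeff F F' * cycle_coeff F F') * (cycle_coeff (arrow_star F F') F'' * cycle_coeff (arrow_star F F') F'')"
    by (simp only: ac_simps)
  also have "\<dots> = orbit_weight n [F, F', F'']"
    using l.P.cycle_coeff_square L.cycle_coeff_square l.weight_merge by simp
  also have "\<dots> = (cycle_coeff F' F'' * cycle_coeff F' F'') * (cycle_coeff F (arrow_star F' F'') * cycle_coeff F (arrow_star F' F''))"
    using r.P.cycle_coeff_square R.cycle_coeff_square r.weight_merge by simp
  also have "\<dots> = ?d * ?d" by (simp only: ac_simps)
  finally show "?c = ?d"
    by (rule is_monomial_square_cancel[rotated 2]) (intro is_monomial_mult is_monomial_cycle_coeff)+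
qed

section \<open>Explicit products with the generators and with the unit\<close>

context two_stack
begin

text \<open>In contrast to \<open>is_run\<close> the path may start at any state, so that a product
  can be computed step by step backwards from the exit.\<close>

definition reach :: "state \<Rightarrow> vertex \<Rightarrow> int \<Rightarrow> bool" where
  "reach x v s \<longleftrightarrow> (\<exists>k. v \<in> vertices n \<and> (\<forall>j<k. (N ^^ j) x \<in> In) \<and> (N ^^ k) x = turn (entry [F, F'] v) \<and>
     s = (\<Sum>j<k. sg [F, F'] ((N ^^ j) x)))"

lemma reach_step:
  assumes "x \<in> In" "reach (N x) v s"
  shows "reach x v (sg [F, F'] x + s)"
proof -
  obtain k where k: "v \<in> vertices n" "\<forall>j<k. (N ^^ j) (N x) \<in> In" "(N ^^ k) (N x) = turn (entry [F, F'] v)"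
     "s = (\<Sum>j<k. sg [F, F'] ((N ^^ j) (N x)))" using assms(2) by (auto simp: reach_def)
  have S: "(N ^^ Suc j) x = (N ^^ j) (N x)" for j by (simp add: funpow_swap1)
  show ?thesis unfolding reach_def
  proof (intro exI[of _ "Suc k"] conjI allI impI)
    fix j assume "j < Suc k"
    then show "(N ^^ j) x \<in> In" using assms(1) k(2) S by (cases j) auto
  next
    show "sg [F, F'] x + s = (\<Sum>j<Suc k. sg [F, F'] ((N ^^ j) x))"
      unfolding sum.lessThan_Suc_shift S k(4) by simp
  qed (use k S in auto)
qed

lemma reach_exit:
  assumes "x \<in> In" "N x = turn (entry [F, F'] v)" "v \<in> vertices n"
  shows "reach x v (sg [F, F'] x)"
  unfolding reach_def using assms by (intro exI[of _ 1]) auto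

lemma In_iff: "(k, u) \<in> In \<longleftrightarrow> (k = 0 \<or> k = 1) \<and> u \<in> vertices n"
  by (auto simp: inside_def)

lemma sg_simps: "sg [F, F'] (0, u) = gain F u" "sg [F, F'] (1, u) = gain F' u"
  by (simp_all add: sg_def)

lemma N_simps: "u \<in> vertices n \<Longrightarrow> N (0, u) = turn (0, mate (fst F) u)"
   "u \<in> vertices n \<Longrightarrow> N (1, u) = turn (1, mate (fst F') u)"
  by (simp_all add: nxt_def In_iff cross_def)

lemma mate_in: "u \<in> vertices n \<Longrightarrow> mate (fst F) u \<in> vertices n" "u \<in> vertices n \<Longrightarrow> mate (fst F') u \<in> vertices n"
  using mate_props(2) arrow_tangleD(1) F by auto

lemma reach_up_exit:
  "\<lbrakk>u \<in> vertices n; mate (fst F) u = (0, c)\<rbrakk> \<Longrightarrow> reach (0, u) (0, c) (gain F u)"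
  using reach_exit[of "(0, u)" "(0, c)"] mate_in(1)[of u] by (simp add: In_iff N_simps entry_def sg_simps)

lemma reach_down_exit:
  "\<lbrakk>u \<in> vertices n; mate (fst F') u = (1, c)\<rbrakk> \<Longrightarrow> reach (1, u) (1, c) (gain F' u)"
  using reach_exit[of "(1, u)" "(1, c)"] mate_in(2)[of u] by (simp add: In_iff N_simps entry_def sg_simps)

lemma reach_down:
  "\<lbrakk>u \<in> vertices n; mate (fst F) u = (1, c); reach (1, (0, c)) v s\<rbrakk> \<Longrightarrow> reach (0, u) v (gain F u + s)"
  using reach_step[of "(0, u)"] by (simp add: In_iff N_simps turn_def sg_simps)

lemma reach_up:
  "\<lbrakk>u \<in> vertices n; mate (fst F') u = (0, c); reach (0, (1, c)) v s\<rbrakk> \<Longrightarrow> reach (1, u) v (gain F' u + s)"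
  using reach_step[of "(1, u)"] by (simp add: In_iff N_simps turn_def sg_simps)

lemma reach_star:
  assumes "u \<in> vertices n" "reach (of_nat (fst u), u) v s"
  shows "mate (fst (arrow_star F F')) u = v" "gain (arrow_star F F') u = s"
proof -
  have "entry [F, F'] u = (of_nat (fst u), u)" using vertices_fst[OF assms(1)] by (auto simp: entry_def)
  then obtain k where "is_run u k v" "s = (\<Sum>j<k. sg [F, F'] ((N ^^ j) (entry [F, F'] u)))"
    using assms(2) unfolding reach_def is_run_def by auto
  then show "mate (fst (arrow_star F F')) u = v" "gain (arrow_star F F') u = s"
    using arrow_star_props(2,3) assms(1) by auto
qed

text \<open>Serves to exclude cycles: there is none if the left factor has no pair of bottom
  vertices or the right factor no pair of top vertices.\<close>

lemma cycle_first:
  assumes "is_cycle (fst F) (fst F') \<gamma>"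
  shows "\<exists>b c. (1, b) \<in> vertices n \<and> mate (fst F) (1, b) = (1, c)"
    "\<exists>b c. (0, b) \<in> vertices n \<and> mate (fst F') (0, b) = (0, c)"
proof -
  have len: "0 < length \<gamma>" "1 < length \<gamma>" using assms by (auto simp: is_cycle_def) (metis One_nat_def Suc_lessI length_greater_0_conv odd_one)
  have st: "is_step (fst F) (fst F') (\<gamma> ! i)" if "i < length \<gamma>" for i using assms that by (auto simp: is_cycle_def)
  have a: "fac (\<gamma> ! 0) = Left_Factor \<and> fst (src (\<gamma> ! 0)) = 1 \<and> fst (tgt (\<gamma> ! 0)) = 1"
    using assms len(1) unfolding is_cycle_def by (metis even_zero)
  have b: "fac (\<gamma> ! 1) = Right_Factor \<and> fst (src (\<gamma> ! 1)) = 0 \<and> fst (tgt (\<gamma> ! 1)) = 0"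
    using assms len(2) unfolding is_cycle_def by (metis odd_one)
  have s: "snd (cross [F, F'] (stateof (\<gamma> ! i))) = tgt (\<gamma> ! i)" "src (\<gamma> ! i) \<in> vertices n" if "i < length \<gamma>" for i
    using st[OF that] unfolding step_iff by (metis snd_conv stepof_def, metis insideD snd_conv stateof_def)
  have "mate (fst F) (src (\<gamma> ! 0)) = tgt (\<gamma> ! 0)"
    using s(1)[OF len(1)] a by (simp add: cross_def stateof_def)
  then show "\<exists>b c. (1, b) \<in> vertices n \<and> mate (fst F) (1, b) = (1, c)"
    using s(2)[OF len(1)] a by (metis prod.collapse)
  have "mate (fst F') (src (\<gamma> ! 1)) = tgt (\<gamma> ! 1)"
    using s(1)[OF len(2)] b by (simp add: cross_def stateof_def)
  then show "\<exists>b c. (0, b) \<in> vertices n \<and> mate (fst F') (0, b) = (0, c)"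
    using s(2)[OF len(2)] b by (metis prod.collapse)
qed

lemma cycle_coeff_no_cycle: "\<nexists>\<gamma>. is_cycle (fst F) (fst F') \<gamma> \<Longrightarrow> cycle_coeff F F' = 1"
proof -
  assume "\<nexists>\<gamma>. is_cycle (fst F) (fst F') \<gamma>"
  then have "Collect (is_cycle (fst F) (fst F')) = {}" by blast
  then show ?thesis unfolding cycle_coeff_def case_prod_unfold fst_conv snd_conv by (simp only: prod.empty)
qed

end

lemma tangle_of_eqI:
  assumes V: "valid_model n M \<theta>" and E: "E = {{u, M u} | u. u \<in> vertices n}" and f: "f \<in> extensional E"
    and lab: "\<And>u. u \<in> vertices n \<Longrightarrow> vless u (M u) \<Longrightarrow> f {u, M u} = side u * \<theta> u"
  shows "(E, f) = tangle_of n M \<theta>"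
proof (rule prod_eqI)
  show e: "fst (E, f) = fst (tangle_of n M \<theta>)" by (simp add: E tangle_of_def Let_def)
  show "snd (E, f) = snd (tangle_of n M \<theta>)"
  proof (rule extensionalityI[where A = E])
    show "snd (E, f) \<in> extensional E" using f by simp
    show "snd (tangle_of n M \<theta>) \<in> extensional E" using arrow_tangleD(2)[OF tangle_of_props(1)[OF V]] e by simp
    fix \<beta> :: "vertex set" assume "\<beta> \<in> E"
    then obtain u where u: "u \<in> vertices n" "\<beta> = {u, M u}" unfolding E by blast
    have m: "M u \<in> vertices n" "M u \<noteq> u" "M (M u) = u" using V u(1) unfolding valid_model_def by blast+
    show "snd (E, f) \<beta> = snd (tangle_of n M \<theta>) \<beta>"
    proof (cases "vless u (M u)")
      case True
      then show ?thesis using lab[OF u(1)] tangle_of_label[OF V u(1)] u(2) by simp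
    next
      case False
      then have l: "vless (M u) (M (M u))" using vless_total[OF u(1) m(1)] m by metis
      have "\<beta> = {M u, M (M u)}" using u(2) m by (simp add: insert_commute)
      then show ?thesis using lab[OF m(1) l] tangle_of_label[OF V m(1) l] by simp
    qed
  qed
qed

definition lift :: "(nat \<Rightarrow> nat) \<Rightarrow> vertex \<Rightarrow> vertex" where
  "lift \<sigma> u = (if fst u = 0 then (0, \<sigma> (snd u)) else u)"

definition through_mate :: "(nat \<Rightarrow> nat) \<Rightarrow> vertex \<Rightarrow> vertex" where
  "through_mate s u = (1 - fst u, s (snd u))"

definition through_gain :: "(nat \<Rightarrow> int) \<Rightarrow> vertex \<Rightarrow> int" where
  "through_gain m u = (if fst u = 0 then m (snd u) else - m (snd u))"

lemma through_valid:
  assumes "s permutes {1..n}" "\<And>i. s (s i) = i" "\<And>i. even (m i)" "\<And>i. m (s i) = m i"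
  shows "valid_model n (through_mate s) (through_gain m)"
  unfolding valid_model_def
proof (intro ballI)
  fix u assume u: "u \<in> vertices n"
  obtain a b where ab: "u = (a, b)" by (cases u)
  have b: "b \<in> {1..n}" and a: "a = 0 \<or> a = 1" using u ab by (auto simp: vertices_iff)
  have "s b \<in> {1..n}" using permutes_in_image[OF assms(1)] b by blast
  then show "through_mate s u \<in> vertices n \<and> through_mate s u \<noteq> u \<and> through_mate s (through_mate s u) = u \<and>
     through_gain m (through_mate s u) = - through_gain m u \<and>
     odd (through_gain m u + int (fst u) + int (fst (through_mate s u)))"
    using a assms(2-4) by (auto simp: ab through_mate_def through_gain_def vertices_iff)
qed

lemma through_tangle_eq:
  assumes s: "s permutes {1..n}" "\<And>i. s (s i) = i" "\<And>i. even (m i)" "\<And>i. m (s i) = m i"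
    and E: "E = {{(0, i), (1, s i)} | i. i \<in> {1..n}}" and f: "f \<in> extensional E"
    and lab: "\<And>i. i \<in> {1..n} \<Longrightarrow> f {(0, i), (1, s i)} = m i"
  shows "(E, f) = tangle_of n (through_mate s) (through_gain m)"
proof (rule tangle_of_eqI[OF _ _ f])
  show "valid_model n (through_mate s) (through_gain m)" using s by (intro through_valid)
  show "E = {{u, through_mate s u} | u. u \<in> vertices n}"
  proof (intro equalityI subsetI)
    fix \<beta> :: "vertex set" assume "\<beta> \<in> E"
    then obtain i where i: "i \<in> {1..n}" "\<beta> = {(0, i), (1, s i)}" unfolding E by blast
    then have "(0, i) \<in> vertices n" "\<beta> = {(0, i), through_mate s (0, i)}" by (auto simp: vertices_iff through_mate_def)
    then show "\<beta> \<in> {{u, through_mate s u} | u. u \<in> vertices n}" by blast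
  next
    fix \<beta> :: "vertex set" assume "\<beta> \<in> {{u, through_mate s u} | u. u \<in> vertices n}"
    then obtain w where w: "w \<in> vertices n" "\<beta> = {w, through_mate s w}" by blast
    obtain a b where "w = (a, b)" by (cases w)
    with w have u: "(a, b) \<in> vertices n" "\<beta> = {(a, b), through_mate s (a, b)}" by auto
    then have b: "b \<in> {1..n}" and a: "a = 0 \<or> a = 1" by (auto simp: vertices_iff)
    have sb: "s b \<in> {1..n}" using permutes_in_image[OF s(1)] b by blast
    from a show "\<beta> \<in> E"
    proof
      assume "a = 0"
      then have "\<beta> = {(0, b), (1, s b)}" using u(2) by (simp add: through_mate_def)
      then show ?thesis unfolding E using b by blast
    next
      assume "a = 1"
      then have "\<beta> = {(0, s b), (1, s (s b))}" using u(2) s(2) by (simp add: through_mate_def insert_commute)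
      then show ?thesis unfolding E using sb by blast
    qed
  qed
  fix u assume u: "u \<in> vertices n" "vless u (through_mate s u)"
  obtain a b where ab: "u = (a, b)" by (cases u)
  have "a = 0" using u by (auto simp: ab vertices_iff vless_def through_mate_def)
  then show "f {u, through_mate s u} = side u * through_gain m u"
    using lab[of b] u(1) by (auto simp: ab vertices_iff through_mate_def side_def through_gain_def)
qed

lemma transpose_permutes_adj: "(i :: nat) \<in> {1..n - 1} \<Longrightarrow> transpose i (i + 1) permutes {1..n}"
  by (rule permutes_swap_id) auto

lemma id_tangle_eq: "id_tangle n = tangle_of n (through_mate id) (through_gain (\<lambda>_. 0))"
  unfolding id_tangle_def
  by (rule through_tangle_eq) (auto simp: id_pairs_def permutes_id)

lemma t_tangle_eq:
  "t_tangle n j \<epsilon> = tangle_of n (through_mate id) (through_gain (\<lambda>i. if i = j then 2 * \<epsilon> else 0))"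
  unfolding t_tangle_def
  by (rule through_tangle_eq) (auto simp: id_pairs_def permutes_id doubleton_eq_iff)

lemma w_tangle_eq:
  assumes i: "i \<in> {1..n - 1}"
  shows "w_tangle n i = tangle_of n (through_mate (transpose i (i + 1))) (through_gain (\<lambda>_. 0))"
  unfolding w_tangle_def Let_def
proof (rule through_tangle_eq)
  let ?E = "{{(0, i), (1, i + 1)}, {(0, i + 1), (1, i)}} \<union> id_pairs ({1..n} - {i, i + 1})"
  show "transpose i (i + 1) permutes {1..n}" using transpose_permutes_adj[OF i] .
  show E: "?E = {{(0, k), (1, transpose i (i + 1) k)} |k. k \<in> {1..n}}"
  proof (intro equalityI subsetI)
    fix \<beta> :: "vertex set" assume "\<beta> \<in> ?E"
    then consider "\<beta> = {(0, i), (1, i + 1)}" | "\<beta> = {(0, i + 1), (1, i)}"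
      | k where "k \<in> {1..n}" "k \<noteq> i" "k \<noteq> i + 1" "\<beta> = {(0, k), (1, k)}" by (auto simp: id_pairs_def)
    then have "\<exists>k. k \<in> {1..n} \<and> \<beta> = {(0, k), (1, transpose i (i + 1) k)}"
    proof cases
      case 1
      then show ?thesis using i by (intro exI[of _ i]) auto
    next
      case 2
      then show ?thesis using i by (intro exI[of _ "i + 1"]) auto
    next
      case (3 k)
      then show ?thesis by (intro exI[of _ k]) auto
    qed
    then show "\<beta> \<in> {{(0, k), (1, transpose i (i + 1) k)} |k. k \<in> {1..n}}" by blast
  next
    fix \<beta> :: "vertex set" assume "\<beta> \<in> {{(0, k), (1, transpose i (i + 1) k)} |k. k \<in> {1..n}}"
    then obtain k where k: "k \<in> {1..n}" "\<beta> = {(0, k), (1, transpose i (i + 1) k)}" by blast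
    show "\<beta> \<in> ?E"
      using k by (cases "k = i"; cases "k = i + 1") (auto simp: id_pairs_def)
  qed
  fix k assume "k \<in> {1..n}"
  then have "{(0, k), (1, transpose i (i + 1) k)} \<in> ?E" unfolding E by blast
  then show "(\<lambda>\<alpha>\<in>?E. 0) {(0, k), (1, transpose i (i + 1) k)} = 0" by simp
qed auto

definition cap_mate :: "nat \<Rightarrow> vertex \<Rightarrow> vertex" where
  "cap_mate i u = (if snd u = i then (fst u, i + 1) else if snd u = i + 1 then (fst u, i) else (1 - fst u, snd u))"

definition cap_gain :: "nat \<Rightarrow> vertex \<Rightarrow> int" where
  "cap_gain i u = (if snd u = i then 1 else if snd u = i + 1 then -1 else 0)"

lemma F_tangle_eq:
  assumes i: "i \<in> {1..n - 1}"
  shows "valid_model n (cap_mate i) (cap_gain i)" "F_tangle n i = tangle_of n (cap_mate i) (cap_gain i)"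
proof -
  show V: "valid_model n (cap_mate i) (cap_gain i)"
    unfolding valid_model_def
  proof (intro ballI)
    fix u assume u: "u \<in> vertices n"
    obtain a b where ab: "u = (a, b)" by (cases u)
    have "1 \<le> b" "b \<le> n" "a = 0 \<or> a = 1" using u ab by (auto simp: vertices_iff)
    then show "cap_mate i u \<in> vertices n \<and> cap_mate i u \<noteq> u \<and> cap_mate i (cap_mate i u) = u \<and>
       cap_gain i (cap_mate i u) = - cap_gain i u \<and> odd (cap_gain i u + int (fst u) + int (fst (cap_mate i u)))"
      using i by (auto simp: ab cap_mate_def cap_gain_def vertices_iff)
  qed
  let ?C = "{{(0, i), (0, i + 1)}, {(1, i), (1, i + 1)}} :: vertex set set"
  let ?E = "?C \<union> id_pairs ({1..n} - {i, i + 1})"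
  have E: "?E = {{u, cap_mate i u} | u. u \<in> vertices n}"
  proof (intro equalityI subsetI)
    fix \<beta> :: "vertex set" assume "\<beta> \<in> ?E"
    then consider "\<beta> = {(0, i), (0, i + 1)}" | "\<beta> = {(1, i), (1, i + 1)}"
      | k where "k \<in> {1..n}" "k \<noteq> i" "k \<noteq> i + 1" "\<beta> = {(0, k), (1, k)}" by (auto simp: id_pairs_def)
    then have "\<exists>u. u \<in> vertices n \<and> \<beta> = {u, cap_mate i u}"
    proof cases
      case 1
      then show ?thesis using i by (intro exI[of _ "(0, i)"]) (auto simp: vertices_iff cap_mate_def)
    next
      case 2
      then show ?thesis using i by (intro exI[of _ "(1, i)"]) (auto simp: vertices_iff cap_mate_def)
    next
      case (3 k)
      then show ?thesis by (intro exI[of _ "(0, k)"]) (auto simp: vertices_iff cap_mate_def)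
    qed
    then show "\<beta> \<in> {{u, cap_mate i u} | u. u \<in> vertices n}" by blast
  next
    fix \<beta> :: "vertex set" assume "\<beta> \<in> {{u, cap_mate i u} | u. u \<in> vertices n}"
    then obtain w where w: "w \<in> vertices n" "\<beta> = {w, cap_mate i w}" by blast
    obtain a b where "w = (a, b)" by (cases w)
    with w have u: "(a, b) \<in> vertices n" "\<beta> = {(a, b), cap_mate i (a, b)}" by auto
    then have "1 \<le> b" "b \<le> n" "a = 0 \<or> a = 1" by (auto simp: vertices_iff)
    then show "\<beta> \<in> ?E" unfolding u(2)
      by (auto simp: cap_mate_def id_pairs_def doubleton_eq_iff)
  qed
  show "F_tangle n i = tangle_of n (cap_mate i) (cap_gain i)"
    unfolding F_tangle_def Let_def
  proof (rule tangle_of_eqI[OF V E])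
    fix u assume u: "u \<in> vertices n" "vless u (cap_mate i u)"
    obtain a b where ab: "u = (a, b)" by (cases u)
    have a: "a = 0 \<or> a = 1" using u ab by (auto simp: vertices_iff)
    have "{u, cap_mate i u} \<in> ?E" unfolding E using u(1) by blast
    then have "(\<lambda>\<alpha>\<in>?E. if \<alpha> \<in> ?C then 1 else 0) {u, cap_mate i u} = (if {u, cap_mate i u} \<in> ?C then 1 else (0::int))"
      by simp
    also have "\<dots> = side u * cap_gain i u"
      using a u(2) by (auto simp: ab cap_mate_def cap_gain_def side_def vless_def doubleton_eq_iff split: if_splits)
    finally show "(\<lambda>\<alpha>\<in>?E. if \<alpha> \<in> ?C then 1 else 0) {u, cap_mate i u} = side u * cap_gain i u" .
  qed simp
qed

text \<open>Sides and columns are written with the numeral 1, which the simplifier is to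
  keep.\<close>

declare One_nat_def [simp del]

definition top_part :: "(nat \<Rightarrow> int) \<Rightarrow> vertex \<Rightarrow> int" where
  "top_part m u = (if fst u = 0 then m (snd u) else 0)"

text \<open>The particle crosses the upper layer only on its way in and on its way out, as that
  layer has no pair of bottom vertices. The twists therefore contribute at the two ends of a strand,
  and no cycle arises.\<close>

lemma through_star:
  assumes s: "s permutes {1..n}" "\<And>i. s (s i) = i" "\<And>i. even (m i)" "\<And>i. m (s i) = m i"
    and G: "G \<in> arrow_flat_tangles n" and u: "u \<in> vertices n"
  defines "F \<equiv> tangle_of n (through_mate s) (through_gain m)"
  shows "mate (fst (arrow_star F G)) u = lift s (mate (fst G) (lift s u))"
    "gain (arrow_star F G) u = top_part m u + gain G (lift s u) - top_part m (mate (fst G) (lift s u))"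
    "cycle_coeff F G = 1"
proof -
  have V: "valid_model n (through_mate s) (through_gain m)" by (rule through_valid) (use s in auto)
  have F: "F \<in> arrow_flat_tangles n" unfolding F_def by (rule tangle_of_props(1)[OF V])
  have Fm: "mate (fst F) v = through_mate s v" "gain F v = through_gain m v" if "v \<in> vertices n" for v
    unfolding F_def using tangle_of_props(2,3)[OF V that] by auto
  interpret two_stack n F G by unfold_locales (use F G in auto)
  have low: "reach (1, w) (lift s (mate (fst G) w)) (gain G w - top_part m (mate (fst G) w))" if w: "w \<in> vertices n" for w
  proof -
    obtain a b where ab: "mate (fst G) w = (a, b)" by (cases "mate (fst G) w")
    have V': "(a, b) \<in> vertices n" using mate_in(2)[OF w] ab by simp
    show ?thesis
    proof (cases "a = 0")
      case True
      have b: "(1, b) \<in> vertices n" using V' by (simp add: vertices_iff)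
      have "reach (0, (1, b)) (0, s b) (gain F (1, b))"
        by (rule reach_up_exit[OF b]) (simp add: Fm[OF b] through_mate_def)
      then have "reach (1, w) (0, s b) (gain G w + gain F (1, b))"
        using reach_up[OF w] ab True by blast
      then show ?thesis using True by (simp add: ab lift_def top_part_def Fm[OF b] through_gain_def)
    next
      case False
      then have a: "a = 1" using V' by (simp add: vertices_iff)
      show ?thesis using reach_down_exit[OF w] ab a by (simp add: lift_def top_part_def)
    qed
  qed
  have ls: "lift s u \<in> vertices n"
    using u permutes_in_image[OF s(1)] by (cases u) (auto simp: lift_def vertices_iff)
  have "reach (of_nat (fst u), u) (lift s (mate (fst G) (lift s u)))
     (top_part m u + gain G (lift s u) - top_part m (mate (fst G) (lift s u)))"
  proof (cases "fst u = 0")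
    case True
    then have "mate (fst F) u = (1, s (snd u))" "lift s u = (0, s (snd u))" using Fm[OF u] by (auto simp: through_mate_def lift_def)
    then have "reach (0, u) (lift s (mate (fst G) (lift s u)))
       (gain F u + (gain G (lift s u) - top_part m (mate (fst G) (lift s u))))"
      using reach_down[OF u] low[OF ls] by simp
    moreover have "gain F u = top_part m u" using Fm(2)[OF u] True by (simp add: top_part_def through_gain_def)
    ultimately show ?thesis using True by (simp only: add_diff_eq of_nat_0)
  next
    case False
    then have "fst u = 1" "lift s u = u" using vertices_fst[OF u] by (auto simp: lift_def)
    then show ?thesis using low[OF ls] by (simp add: top_part_def)
  qed
  then show "mate (fst (arrow_star F G)) u = lift s (mate (fst G) (lift s u))"
    "gain (arrow_star F G) u = top_part m u + gain G (lift s u) - top_part m (mate (fst G) (lift s u))"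
    using reach_star[OF u] by auto
  have "\<nexists>\<gamma>. is_cycle (fst F) (fst G) \<gamma>"
  proof
    assume "\<exists>\<gamma>. is_cycle (fst F) (fst G) \<gamma>"
    then obtain b c where "(1, b) \<in> vertices n" "mate (fst F) (1, b) = (1, c)" using cycle_first(1) by blast
    then show False using Fm(1)[of "(1, b)"] by (simp add: through_mate_def)
  qed
  then show "cycle_coeff F G = 1" by (rule cycle_coeff_no_cycle)
qed

lemma star_id:
  assumes F: "F \<in> arrow_flat_tangles n"
  shows "arrow_star F (id_tangle n) = F" "cycle_coeff F (id_tangle n) = 1" "id_tangle n \<in> arrow_flat_tangles n"
proof -
  have V: "valid_model n (through_mate id) (through_gain (\<lambda>_. 0))" by (rule through_valid) (auto simp: permutes_id)
  show G: "id_tangle n \<in> arrow_flat_tangles n" unfolding id_tangle_eq by (rule tangle_of_props(1)[OF V])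
  have Gm: "mate (fst (id_tangle n)) v = (1 - fst v, snd v)" "gain (id_tangle n) v = 0" if "v \<in> vertices n" for v
    unfolding id_tangle_eq using tangle_of_props(2,3)[OF V that] by (auto simp: through_mate_def through_gain_def)
  interpret two_stack n F "id_tangle n" by unfold_locales (use F G in auto)
  have top: "reach (0, w) (mate (fst F) w) (gain F w)" if w: "w \<in> vertices n" for w
  proof -
    obtain a b where ab: "mate (fst F) w = (a, b)" by (cases "mate (fst F) w")
    have V': "(a, b) \<in> vertices n" using mate_in(1)[OF w] ab by simp
    show ?thesis
    proof (cases "a = 0")
      case True
      then show ?thesis using reach_up_exit[OF w] ab by simp
    next
      case False
      then have a: "a = 1" using V' by (simp add: vertices_iff)
      have b: "(0, b) \<in> vertices n" using V' by (simp add: vertices_iff)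
      have "reach (1, (0, b)) (1, b) (gain (id_tangle n) (0, b))"
        by (rule reach_down_exit[OF b]) (simp add: Gm[OF b])
      from reach_down[OF w _ this] show ?thesis using ab a Gm(2)[OF b] by simp
    qed
  qed
  have r: "reach (of_nat (fst u), u) (mate (fst F) u) (gain F u)" if u: "u \<in> vertices n" for u
  proof (cases "fst u = 0")
    case True
    then show ?thesis using top[OF u] by simp
  next
    case False
    then have u1: "fst u = 1" using vertices_fst[OF u] by auto
    then have "mate (fst (id_tangle n)) u = (0, snd u)" "(1, snd u) = u" using Gm(1)[OF u] by (auto simp: prod_eq_iff)
    then show ?thesis using reach_up[OF u, of "snd u"] top[OF u] u1 Gm(2)[OF u] by simp
  qed
  show "arrow_star F (id_tangle n) = F"
  proof (rule arrow_tangle_eqI[OF arrow_star_props(1) assms])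
    fix u assume u: "u \<in> vertices n"
    show "mate (fst (arrow_star F (id_tangle n))) u = mate (fst F) u" "gain (arrow_star F (id_tangle n)) u = gain F u"
      using reach_star[OF u r[OF u]] .
  qed
  have "\<nexists>\<gamma>. is_cycle (fst F) (fst (id_tangle n)) \<gamma>"
  proof
    assume "\<exists>\<gamma>. is_cycle (fst F) (fst (id_tangle n)) \<gamma>"
    then obtain b c where "(0, b) \<in> vertices n" "mate (fst (id_tangle n)) (0, b) = (0, c)" using cycle_first(2) by blast
    then show False using Gm(1)[of "(0, b)"] by simp
  qed
  then show "cycle_coeff F (id_tangle n) = 1" by (rule cycle_coeff_no_cycle)
qed

text \<open>The pairing of a product with F_i on the left: the cap takes the top vertices i and i +
  1, and the cup joins the two strands of the other factor that ended there.\<close>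

definition cut_mate :: "nat \<Rightarrow> (vertex \<Rightarrow> vertex) \<Rightarrow> vertex \<Rightarrow> vertex" where
  "cut_mate i M u = (if u = (0, i) then (0, i + 1) else if u = (0, i + 1) then (0, i)
     else if M u = (0, i) then M (0, i + 1) else if M u = (0, i + 1) then M (0, i) else M u)"

definition cut_gain :: "nat \<Rightarrow> (vertex \<Rightarrow> vertex) \<Rightarrow> (vertex \<Rightarrow> int) \<Rightarrow> vertex \<Rightarrow> int" where
  "cut_gain i M \<theta> u = (if u = (0, i) then 1 else if u = (0, i + 1) then - 1
     else if M u = (0, i) then \<theta> u + 1 + \<theta> (0, i + 1)
     else if M u = (0, i + 1) then \<theta> u - 1 + \<theta> (0, i) else \<theta> u)"

text \<open>A strand arriving at one end of the cup of F_i continues in G from the other end. A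
  cycle has only this one cup to run through, so it arises exactly if G joins the two ends, and it
  then consists of two steps.\<close>

lemma F_star:
  assumes i: "i \<in> {1..n - 1}" and G: "G \<in> arrow_flat_tangles n"
  shows "u \<in> vertices n \<Longrightarrow> mate (fst (arrow_star (F_tangle n i) G)) u = cut_mate i (mate (fst G)) u"
    "u \<in> vertices n \<Longrightarrow> gain (arrow_star (F_tangle n i) G) u = cut_gain i (mate (fst G)) (gain G) u"
    "cycle_coeff (F_tangle n i) G = (if mate (fst G) (0, i) = (0, i + 1) then zeta (1 + gain G (0, i + 1)) else 1)"
proof -
  note V = F_tangle_eq(1)[OF i]
  define F where "F = F_tangle n i"
  have FA: "F \<in> arrow_flat_tangles n" unfolding F_def F_tangle_eq(2)[OF i] by (rule tangle_of_props(1)[OF V])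
  have Fm: "mate (fst F) v = cap_mate i v" "gain F v = cap_gain i v" if "v \<in> vertices n" for v
    unfolding F_def F_tangle_eq(2)[OF i] using tangle_of_props(2,3)[OF V that] by auto
  interpret two_stack n F G by unfold_locales (use FA G in auto)
  have VG: "valid_model n (mate (fst G)) (gain G)" using valid_model_tangle[OF G] .
  have vi: "(0, i) \<in> vertices n" "(0, i + 1) \<in> vertices n" "(1, i) \<in> vertices n" "(1, i + 1) \<in> vertices n"
    using i by (auto simp: vertices_iff)
  note Gi = mate_props(4)[OF arrow_tangleD(1)[OF G]]
  have plain: "reach (1, w) (mate (fst G) w) (gain G w)"
    if w: "w \<in> vertices n" "mate (fst G) w \<noteq> (0, i)" "mate (fst G) w \<noteq> (0, i + 1)" for w
  proof -
    obtain a b where ab: "mate (fst G) w = (a, b)" by (cases "mate (fst G) w")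
    have V': "(a, b) \<in> vertices n" using mate_in(2)[OF w(1)] ab by simp
    show ?thesis
    proof (cases "a = 0")
      case True
      have b: "(1, b) \<in> vertices n" using V' by (simp add: vertices_iff)
      have "b \<noteq> i" "b \<noteq> i + 1" using w ab True by auto
      then have mb: "mate (fst F) (1, b) = (0, b)" "gain F (1, b) = 0"
        using Fm[OF b] by (auto simp: cap_mate_def cap_gain_def)
      then show ?thesis using reach_up[OF w(1) _ reach_up_exit[OF b mb(1)]] ab True by simp
    next
      case False
      then have a: "a = 1" using V' by (simp add: vertices_iff)
      show ?thesis using reach_down_exit[OF w(1)] ab a by simp
    qed
  qed
  have low: "reach (1, u) (cut_mate i (mate (fst G)) u) (cut_gain i (mate (fst G)) (gain G) u)"
    if u: "u \<in> vertices n" "u \<noteq> (0, i)" "u \<noteq> (0, i + 1)" for u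
  proof -
    let ?M = "mate (fst G)"
    consider "?M u = (0, i)" | "?M u = (0, i + 1)" | "?M u \<noteq> (0, i)" "?M u \<noteq> (0, i + 1)" by blast
    then show ?thesis
    proof cases
      case 1
      \<comment> \<open>The continuation does not come back to the cup, since (0, i) is already
        matched with u.\<close>
      have n1: "?M (0, i + 1) \<noteq> (0, i)" using Gi[OF vi(2)] Gi[OF u(1)] 1 u(3) by metis
      have n2: "?M (0, i + 1) \<noteq> (0, i + 1)" using mate_props(3)[OF arrow_tangleD(1)[OF G] vi(2)] .
      have "reach (0, (1, i)) (?M (0, i + 1)) (gain F (1, i) + gain G (0, i + 1))"
        by (rule reach_down[OF vi(3) _ plain[OF vi(2) n1 n2]]) (simp add: Fm[OF vi(3)] cap_mate_def)
      from reach_up[OF u(1) 1 this] show ?thesis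
        using u 1 Fm(2)[OF vi(3)] by (simp add: cut_mate_def cut_gain_def cap_gain_def add.assoc)
    next
      case 2
      have n1: "?M (0, i) \<noteq> (0, i + 1)" using Gi[OF vi(1)] Gi[OF u(1)] 2 u(2) by metis
      have n2: "?M (0, i) \<noteq> (0, i)" using mate_props(3)[OF arrow_tangleD(1)[OF G] vi(1)] .
      have "reach (0, (1, i + 1)) (?M (0, i)) (gain F (1, i + 1) + gain G (0, i))"
        by (rule reach_down[OF vi(4) _ plain[OF vi(1) n2 n1]]) (simp add: Fm[OF vi(4)] cap_mate_def)
      from reach_up[OF u(1) 2 this] show ?thesis
        using u 2 Fm(2)[OF vi(4)] by (simp add: cut_mate_def cut_gain_def cap_gain_def algebra_simps)
    next
      case 3
      then show ?thesis using plain[OF u(1)] u by (simp add: cut_mate_def cut_gain_def)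
    qed
  qed
  have r: "reach (of_nat (fst u), u) (cut_mate i (mate (fst G)) u) (cut_gain i (mate (fst G)) (gain G) u)"
    if u: "u \<in> vertices n" for u
  proof (cases "fst u = 0")
    case True
    then obtain b where b: "u = (0, b)" by (cases u) auto
    show ?thesis
    proof (cases "b = i \<or> b = i + 1")
      case True
      have "mate (fst F) u = (0, if b = i then i + 1 else i)" using True Fm(1)[OF u] by (auto simp: b cap_mate_def)
      from reach_up_exit[OF u this] show ?thesis
        using True Fm(2)[OF u] by (auto simp: b cut_mate_def cut_gain_def cap_gain_def)
    next
      case False
      then have "mate (fst F) u = (1, b)" "gain F u = 0" using Fm[OF u] by (auto simp: b cap_mate_def cap_gain_def)
      then show ?thesis using reach_down[OF u, of b] low[OF u] False by (simp add: b)
    qed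
  next
    case False
    then have "fst u = 1" using vertices_fst[OF u] by auto
    then show ?thesis using low[OF u] by fastforce
  qed
  show "u \<in> vertices n \<Longrightarrow> mate (fst (arrow_star (F_tangle n i) G)) u = cut_mate i (mate (fst G)) u"
    "u \<in> vertices n \<Longrightarrow> gain (arrow_star (F_tangle n i) G) u = cut_gain i (mate (fst G)) (gain G) u"
    using reach_star(1)[OF _ r] reach_star(2)[OF _ r] unfolding F_def by blast+
  have N1: "N (0, (1, i)) = (1, (0, i + 1))" "N (0, (1, i + 1)) = (1, (0, i))"
    using N_simps(1)[OF vi(3)] N_simps(1)[OF vi(4)] Fm(1)[OF vi(3)] Fm(1)[OF vi(4)] by (simp_all add: cap_mate_def turn_def)
  have low_state: "b = i \<or> b = i + 1" if "(0, (1, b)) \<in> In" "N (0, (1, b)) \<in> In" for b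
  proof (rule ccontr)
    assume nb: "\<not> (b = i \<or> b = i + 1)"
    have bv: "(1, b) \<in> vertices n" using that(1) In_iff by simp
    have "N (0, (1, b)) = turn (0, (0, b))" using N_simps(1)[OF bv] Fm(1)[OF bv] nb by (simp add: cap_mate_def)
    then show False using that(2) In_iff by (simp add: turn_def)
  qed
  have cyc: "is_cycle (fst F) (fst G) \<gamma> \<longleftrightarrow> mate (fst G) (0, i + 1) = (0, i) \<and> \<gamma> = path n [F, G] (0, (1, i)) 2" for \<gamma>
  proof
    assume "is_cycle (fst F) (fst G) \<gamma>"
    then obtain b p where b: "(0, (1, b)) \<in> In" "is_period N (0, (1, b)) p"
      "\<forall>y\<in>orb N (0, (1, b)). b \<le> snd (snd y)" "\<gamma> = path n [F, G] (0, (1, b)) p" using cycle_imp by blast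
    note I = recurrent_inside[OF b(1) is_period_recurrent[OF b(2)]]
    have i1: "N (0, (1, b)) \<in> In" using I[of "Suc 0"] by simp
    have "N (0, (1, b)) \<in> orb N (0, (1, b))" using orb_step[of "Suc 0" N "(0, (1, b))"] by simp
    then have "b \<le> snd (snd (N (0, (1, b))))" using b(3) by blast
    \<comment> \<open>A cycle starts at its least column, and the cup leads from i + 1 to i.\<close>
    then have bi: "b = i" using low_state[OF b(1) i1] N1(2) by auto
    have i2: "N (1, (0, i + 1)) \<in> In" using I[of 2] N1(1) unfolding bi by (simp add: numeral_2_eq_2)
    obtain a d where ad: "mate (fst G) (0, i + 1) = (a, d)" by (cases "mate (fst G) (0, i + 1)")
    have adv: "(a, d) \<in> vertices n" using mate_in(2)[OF vi(2)] ad by simp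
    have N2: "N (1, (0, i + 1)) = turn (1, (a, d))" using N_simps(2)[OF vi(2)] ad by simp
    have "a = 0" using i2 adv In_iff unfolding N2 by (auto simp: turn_def vertices_iff split: if_splits)
    then have N2': "N (1, (0, i + 1)) = (0, (1, d))" using N2 by (simp add: turn_def)
    have "N (0, (1, d)) \<in> In" using I[of 3] N1(1) N2' unfolding bi by (simp add: numeral_3_eq_3)
    then have "d = i \<or> d = i + 1" using low_state i2 N2' by metis
    moreover have "(a, d) \<noteq> (0, i + 1)" using mate_props(3)[OF arrow_tangleD(1)[OF G] vi(2)] ad by simp
    ultimately have d: "d = i" using \<open>a = 0\<close> by auto
    have two: "(N ^^ 2) (0, (1, i)) = (0, (1, i))" using N1(1) N2' d by (simp add: numeral_2_eq_2)
    have "p = 2"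
    proof -
      have "p > 0" "(N ^^ p) (0, (1, i)) = (0, (1, i))" "\<And>j. 0 < j \<Longrightarrow> j < p \<Longrightarrow> (N ^^ j) (0, (1, i)) \<noteq> (0, (1, i))"
        using b(2) unfolding bi is_period_def by auto
      moreover have "p \<noteq> Suc 0"
      proof
        assume "p = Suc 0"
        then show False using \<open>(N ^^ p) (0, (1, i)) = (0, (1, i))\<close> N1(1) by simp
      qed
      moreover have "\<not> 2 < p" using calculation(3)[of 2] two by auto
      ultimately show ?thesis by linarith
    qed
    then show "mate (fst G) (0, i + 1) = (0, i) \<and> \<gamma> = path n [F, G] (0, (1, i)) 2"
      using ad \<open>a = 0\<close> d b(4) bi by simp
  next
    assume a: "mate (fst G) (0, i + 1) = (0, i) \<and> \<gamma> = path n [F, G] (0, (1, i)) 2"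
    have N2: "N (1, (0, i + 1)) = (0, (1, i))" using N_simps(2)[OF vi(2)] a by (simp add: turn_def)
    have per: "is_period N (0, (1, i)) 2" unfolding is_period_def
    proof (intro conjI allI impI)
      show "(N ^^ 2) (0, (1, i)) = (0, (1, i))" using N1(1) N2 by (simp add: numeral_2_eq_2)
      fix j :: nat assume "0 < j \<and> j < 2"
      then have "j = Suc 0" by auto
      then show "(N ^^ j) (0, (1, i)) \<noteq> (0, (1, i))" using N1(1) by simp
    qed simp
    have "\<forall>y\<in>orb N (0, (1, i)). i \<le> snd (snd y)"
    proof
      fix y assume "y \<in> orb N (0, (1, i))"
      then obtain j where "j < 2" "y = (N ^^ j) (0, (1, i))" unfolding orb_eq_image[OF per] by blast
      then have "y = (0, (1, i)) \<or> y = N (0, (1, i))" by (cases j) (auto simp: less_Suc_eq numeral_2_eq_2)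
      then show "i \<le> snd (snd y)" using N1(1) by auto
    qed
    then show "is_cycle (fst F) (fst G) \<gamma>" using cycle_if[OF _ per] vi(3) In_iff a by simp
  qed
  have sw: "mate (fst G) (0, i) = (0, i + 1) \<longleftrightarrow> mate (fst G) (0, i + 1) = (0, i)" using Gi[OF vi(1)] Gi[OF vi(2)] by metis
  show "cycle_coeff (F_tangle n i) G = (if mate (fst G) (0, i) = (0, i + 1) then zeta (1 + gain G (0, i + 1)) else 1)"
  proof (cases "mate (fst G) (0, i + 1) = (0, i)")
    case False
    then have "cycle_coeff F G = 1" using cyc by (intro cycle_coeff_no_cycle) blast
    then show ?thesis using False sw by (simp add: F_def)
  next
    case True
    then have C: "Collect (is_cycle (fst F) (fst G)) = {path n [F, G] (0, (1, i)) 2}" using cyc by blast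
    have "total_label (snd F) (snd G) (path n [F, G] (0, (1, i)) 2) = side (snd (0 :: int, (1, i))) * (\<Sum>j<2. sg [F, G] ((N ^^ j) (0, (1, i))))"
    proof (rule label_path)
      fix j :: nat assume "j < 2"
      then have "j = 0 \<or> j = Suc 0" by auto
      then show "(N ^^ j) (0, (1, i)) \<in> In" using N1(1) vi In_iff by auto
    qed
    \<comment> \<open>The sign is the side of the starting vertex, a bottom vertex;
      \<open>zeta\<close> does not see it.\<close>
    also have "\<dots> = - (1 + gain G (0, i + 1))"
      using N1(1) Fm(2)[OF vi(3)] by (simp add: numeral_2_eq_2 side_def sg_simps cap_gain_def)
    finally have "z (nat (\<bar>total_label (snd F) (snd G) (path n [F, G] (0, (1, i)) 2)\<bar> div 2)) = zeta (- (1 + gain G (0, i + 1)))"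
      by (simp only: zeta_def)
    then have "cycle_coeff F G = zeta (1 + gain G (0, i + 1))"
      unfolding cycle_coeff_def case_prod_unfold fst_conv snd_conv C by (simp only: prod.insert prod.empty finite.emptyI zeta_uminus) simp
    then show ?thesis using True sw by (simp add: F_def)
  qed
qed

section \<open>Words as tangles\<close>

fun wtangle :: "nat \<Rightarrow> gen list \<Rightarrow> arrow_tangle" where
  "wtangle n [] = id_tangle n"
| "wtangle n (x # u) = arrow_star (gen_tangle n x) (wtangle n u)"

fun wcoef :: "nat \<Rightarrow> gen list \<Rightarrow> coeff_ring" where
  "wcoef n [] = 1"
| "wcoef n (x # u) = cycle_coeff (gen_tangle n x) (wtangle n u) * wcoef n u"

text \<open>The action of a generator from the left, as a formula on total functions that does not
  mention n. Words are thus evaluated by simplification, and the result is meaningful on the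
  vertices.\<close>

fun gen_mate :: "gen \<Rightarrow> (vertex \<Rightarrow> vertex) \<Rightarrow> vertex \<Rightarrow> vertex" where
  "gen_mate (GF i) M = cut_mate i M"
| "gen_mate (GW i) M = (\<lambda>v. lift (transpose i (i + 1)) (M (lift (transpose i (i + 1)) v)))"
| "gen_mate (GT j) M = M"
| "gen_mate (GTinv j) M = M"

fun gen_gain :: "gen \<Rightarrow> (vertex \<Rightarrow> vertex) \<Rightarrow> (vertex \<Rightarrow> int) \<Rightarrow> vertex \<Rightarrow> int" where
  "gen_gain (GF i) M \<theta> = cut_gain i M \<theta>"
| "gen_gain (GW i) M \<theta> = (\<lambda>v. \<theta> (lift (transpose i (i + 1)) v))"
| "gen_gain (GT j) M \<theta> = (\<lambda>v. (if v = (0, j) then 2 else 0) + \<theta> v - (if M v = (0, j) then 2 else 0))"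
| "gen_gain (GTinv j) M \<theta> = (\<lambda>v. (if v = (0, j) then - 2 else 0) + \<theta> v - (if M v = (0, j) then - 2 else 0))"

fun gen_coeff :: "gen \<Rightarrow> (vertex \<Rightarrow> vertex) \<Rightarrow> (vertex \<Rightarrow> int) \<Rightarrow> coeff_ring" where
  "gen_coeff (GF i) M \<theta> = (if M (0, i) = (0, i + 1) then zeta (1 + \<theta> (0, i + 1)) else 1)"
| "gen_coeff _ M \<theta> = 1"

fun wmate :: "gen list \<Rightarrow> vertex \<Rightarrow> vertex" where
  "wmate [] = through_mate id"
| "wmate (x # u) = gen_mate x (wmate u)"

fun wgain :: "gen list \<Rightarrow> vertex \<Rightarrow> int" where
  "wgain [] = (\<lambda>_. 0)"
| "wgain (x # u) = gen_gain x (wmate u) (wgain u)"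

fun wloop :: "gen list \<Rightarrow> coeff_ring" where
  "wloop [] = 1"
| "wloop (x # u) = gen_coeff x (wmate u) (wgain u) * wloop u"

lemma gen_tangle_in: "x \<in> gens n \<Longrightarrow> gen_tangle n x \<in> arrow_flat_tangles n"
proof (cases x)
  case (GF i)
  assume "x \<in> gens n"
  then have "i \<in> {1..n - 1}" using GF by (auto simp: gens_def)
  then show ?thesis using F_tangle_eq tangle_of_props(1) GF by simp
next
  case (GW i)
  assume "x \<in> gens n"
  then have i: "i \<in> {1..n - 1}" using GW by (auto simp: gens_def)
  have "valid_model n (through_mate (transpose i (i + 1))) (through_gain (\<lambda>_. 0))"
    by (rule through_valid) (use transpose_permutes_adj[OF i] in auto)
  then show ?thesis using w_tangle_eq[OF i] tangle_of_props(1) GW by simp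
next
  case (GT j)
  have "valid_model n (through_mate id) (through_gain (\<lambda>i. if i = j then 2 * 1 else 0))"
    by (rule through_valid) (auto simp: permutes_id)
  then show ?thesis unfolding GT gen_tangle.simps t_tangle_eq by (rule tangle_of_props(1))
next
  case (GTinv j)
  have "valid_model n (through_mate id) (through_gain (\<lambda>i. if i = j then 2 * - 1 else 0))"
    by (rule through_valid) (auto simp: permutes_id)
  then show ?thesis unfolding GTinv gen_tangle.simps t_tangle_eq by (rule tangle_of_props(1))
qed

lemma gen_star:
  assumes x: "x \<in> gens n" and G: "G \<in> arrow_flat_tangles n"
  shows "u \<in> vertices n \<Longrightarrow> mate (fst (arrow_star (gen_tangle n x) G)) u = gen_mate x (mate (fst G)) u"
    "u \<in> vertices n \<Longrightarrow> gain (arrow_star (gen_tangle n x) G) u = gen_gain x (mate (fst G)) (gain G) u"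
    "cycle_coeff (gen_tangle n x) G = gen_coeff x (mate (fst G)) (gain G)"
proof -
  have "(u \<in> vertices n \<longrightarrow> mate (fst (arrow_star (gen_tangle n x) G)) u = gen_mate x (mate (fst G)) u \<and>
     gain (arrow_star (gen_tangle n x) G) u = gen_gain x (mate (fst G)) (gain G) u) \<and>
     cycle_coeff (gen_tangle n x) G = gen_coeff x (mate (fst G)) (gain G)" for u
  proof (cases x)
    case (GF i)
    then have "i \<in> {1..n - 1}" using x by (auto simp: gens_def)
    from F_star[OF this G] show ?thesis by (simp add: GF)
  next
    case (GW i)
    then have i: "i \<in> {1..n - 1}" using x by (auto simp: gens_def)
    note T = through_star[of "transpose i (i + 1)" n "\<lambda>_. 0" G, OF transpose_permutes_adj[OF i] _ _ _ G]
    have n0: "(0, i) \<in> vertices n" using i by (auto simp: vertices_iff)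
    show ?thesis using T(1,2) T(3)[OF _ _ _ n0]
      by (auto simp: GW w_tangle_eq[OF i] top_part_def)
  next
    case (GT j)
    then have j: "(0, j) \<in> vertices n" using x by (auto simp: gens_def vertices_iff)
    note T = through_star[of id n "\<lambda>i. if i = j then 2 * 1 else 0" G, OF permutes_id _ _ _ G]
    have l: "lift id v = v" for v by (auto simp: lift_def prod_eq_iff)
    show ?thesis using T(1,2) T(3)[OF _ _ _ j]
      by (auto simp: GT t_tangle_eq top_part_def l prod_eq_iff)
  next
    case (GTinv j)
    then have j: "(0, j) \<in> vertices n" using x by (auto simp: gens_def vertices_iff)
    note T = through_star[of id n "\<lambda>i. if i = j then 2 * - 1 else 0" G, OF permutes_id _ _ _ G]
    have l: "lift id v = v" for v by (auto simp: lift_def prod_eq_iff)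
    show ?thesis using T(1,2) T(3)[OF _ _ _ j]
      by (auto simp: GTinv t_tangle_eq top_part_def l prod_eq_iff)
  qed
  then show "u \<in> vertices n \<Longrightarrow> mate (fst (arrow_star (gen_tangle n x) G)) u = gen_mate x (mate (fst G)) u"
    "u \<in> vertices n \<Longrightarrow> gain (arrow_star (gen_tangle n x) G) u = gen_gain x (mate (fst G)) (gain G) u"
    "cycle_coeff (gen_tangle n x) G = gen_coeff x (mate (fst G)) (gain G)" by blast+
qed

text \<open>The formulas and the actual tangle agree on the vertices only, so the action of a
  generator must depend on these values alone.\<close>

lemma gen_cong:
  assumes x: "x \<in> gens n" and M: "\<And>u. u \<in> vertices n \<Longrightarrow> M u \<in> vertices n \<and> M u = M' u \<and> \<theta> u = \<theta>' u"
  shows "u \<in> vertices n \<Longrightarrow> gen_mate x M u = gen_mate x M' u"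
    "u \<in> vertices n \<Longrightarrow> gen_gain x M \<theta> u = gen_gain x M' \<theta>' u"
    "gen_coeff x M \<theta> = gen_coeff x M' \<theta>'"
proof -
  have "(u \<in> vertices n \<longrightarrow> gen_mate x M u = gen_mate x M' u \<and> gen_gain x M \<theta> u = gen_gain x M' \<theta>' u) \<and>
    gen_coeff x M \<theta> = gen_coeff x M' \<theta>'" for u
  proof (cases x)
    case (GF i)
    then have "(0, i) \<in> vertices n" "(0, i + 1) \<in> vertices n" using x by (auto simp: gens_def vertices_iff)
    then show ?thesis using M by (simp add: GF cut_mate_def cut_gain_def)
  next
    case (GW i)
    then have i: "i \<in> {1..n - 1}" using x by (auto simp: gens_def)
    have "lift (transpose i (i + 1)) u \<in> vertices n" if "u \<in> vertices n"
      using that permutes_in_image[OF transpose_permutes_adj[OF i]] by (cases u) (auto simp: lift_def vertices_iff)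
    then show ?thesis using M by (simp add: GW)
  qed (use M in auto)
  then show "u \<in> vertices n \<Longrightarrow> gen_mate x M u = gen_mate x M' u"
    "u \<in> vertices n \<Longrightarrow> gen_gain x M \<theta> u = gen_gain x M' \<theta>' u"
    "gen_coeff x M \<theta> = gen_coeff x M' \<theta>'" by blast+
qed

lemma wtangle_model:
  assumes "set u \<subseteq> gens n"
  shows "wtangle n u \<in> arrow_flat_tangles n"
    "v \<in> vertices n \<Longrightarrow> mate (fst (wtangle n u)) v = wmate u v"
    "v \<in> vertices n \<Longrightarrow> gain (wtangle n u) v = wgain u v"
    "wcoef n u = wloop u"
proof -
  have "wtangle n u \<in> arrow_flat_tangles n \<and> (\<forall>v\<in>vertices n. mate (fst (wtangle n u)) v = wmate u v \<and> gain (wtangle n u) v = wgain u v) \<and> wcoef n u = wloop u"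
    using assms
  proof (induction u)
    case Nil
    have V: "valid_model n (through_mate id) (through_gain (\<lambda>_. 0))" by (rule through_valid) (auto simp: permutes_id)
    show ?case unfolding wtangle.simps id_tangle_eq using tangle_of_props[OF V] by (simp add: through_gain_def)
  next
    case (Cons x u)
    then have x: "x \<in> gens n" and IH: "wtangle n u \<in> arrow_flat_tangles n" "\<forall>v\<in>vertices n. mate (fst (wtangle n u)) v = wmate u v \<and> gain (wtangle n u) v = wgain u v"
      "wcoef n u = wloop u" by auto
    have M: "\<And>v. v \<in> vertices n \<Longrightarrow> mate (fst (wtangle n u)) v \<in> vertices n \<and> mate (fst (wtangle n u)) v = wmate u v \<and> gain (wtangle n u) v = wgain u v"
      using IH(2) mate_props(2)[OF arrow_tangleD(1)[OF IH(1)]] by blast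
    show ?case
      using arrow_star_closed[OF gen_tangle_in[OF x] IH(1)] gen_star[OF x IH(1)] gen_cong[OF x M] IH(3) by simp
  qed
  then show "wtangle n u \<in> arrow_flat_tangles n"
    "v \<in> vertices n \<Longrightarrow> mate (fst (wtangle n u)) v = wmate u v"
    "v \<in> vertices n \<Longrightarrow> gain (wtangle n u) v = wgain u v"
    "wcoef n u = wloop u" by blast+
qed

lemma wtangle_eqI:
  assumes "set u \<subseteq> gens n" "set u' \<subseteq> gens n"
    "\<And>a b. (a, b) \<in> vertices n \<Longrightarrow> wmate u (a, b) = wmate u' (a, b) \<and> wgain u (a, b) = wgain u' (a, b)"
  shows "wtangle n u = wtangle n u'"
proof (rule arrow_tangle_eqI[OF wtangle_model(1)[OF assms(1)] wtangle_model(1)[OF assms(2)]])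
  fix v assume v: "v \<in> vertices n"
  obtain a b where ab: "v = (a, b)" by (cases v)
  show "mate (fst (wtangle n u)) v = mate (fst (wtangle n u')) v" "gain (wtangle n u) v = gain (wtangle n u') v"
    using wtangle_model(2,3)[OF assms(1) v] wtangle_model(2,3)[OF assms(2) v] assms(3)[of a b] v ab by auto
qed

lemma wmate_tpow [simp]: "wmate (t_power j k @ u) = wmate u"
proof -
  have "wmate (replicate q (GT j) @ u) = wmate u" "wmate (replicate q (GTinv j) @ u) = wmate u" for q by (induction q) auto
  then show ?thesis by (simp add: t_power_def)
qed

lemma wgain_tpow: "wgain (t_power j k @ u) v = (if v = (0, j) then 2 * k else 0) + wgain u v - (if wmate u v = (0, j) then 2 * k else 0)"
proof -
  have M: "wmate (replicate q (GT j) @ u) = wmate u" "wmate (replicate q (GTinv j) @ u) = wmate u" for q by (induction q) auto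
  have "wgain (replicate q (GT j) @ u) v = (if v = (0, j) then 2 * int q else 0) + wgain u v - (if wmate u v = (0, j) then 2 * int q else 0)"
    "wgain (replicate q (GTinv j) @ u) v = (if v = (0, j) then - 2 * int q else 0) + wgain u v - (if wmate u v = (0, j) then - 2 * int q else 0)" for q
    by (induction q) (auto simp: M)
  then show ?thesis by (auto simp: t_power_def)
qed

lemma wloop_tpow [simp]: "wloop (t_power j k @ u) = wloop u"
proof -
  have "wloop (replicate q (GT j) @ u) = wloop u" "wloop (replicate q (GTinv j) @ u) = wloop u" for q by (induction q) auto
  then show ?thesis by (simp add: t_power_def)
qed

lemma set_tpow: "j \<in> {1..n} \<Longrightarrow> set (t_power j k) \<subseteq> gens n"
  by (auto simp: t_power_def gens_def)

lemmas word_simps = lift_def through_mate_def cut_mate_def cut_gain_def transpose_apply_other vertices_iff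

section \<open>The relations hold for tangles\<close>

definition weq :: "nat \<Rightarrow> gen list \<Rightarrow> gen list \<Rightarrow> bool" where
  "weq n u u' \<longleftrightarrow> set u \<subseteq> gens n \<and> set u' \<subseteq> gens n \<and> wtangle n u = wtangle n u' \<and> wcoef n u = wcoef n u'"

text \<open>Reduces an equation of words to closed formulas at the two vertices of each column. For
  most of the relations a case distinction over the columns touched by the generators then
  suffices.\<close>

lemma weqI:
  assumes "set u \<subseteq> gens n" "set u' \<subseteq> gens n"
    "\<And>b. \<lbrakk>1 \<le> b; b \<le> n\<rbrakk> \<Longrightarrow> wmate u (0, b) = wmate u' (0, b) \<and> wgain u (0, b) = wgain u' (0, b) \<and>
      wmate u (1, b) = wmate u' (1, b) \<and> wgain u (1, b) = wgain u' (1, b)" "wloop u = wloop u'"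
  shows "weq n u u'"
proof -
  have "wtangle n u = wtangle n u'" by (rule wtangle_eqI[OF assms(1,2)]) (use assms(3) in \<open>auto simp: vertices_iff\<close>)
  then show ?thesis unfolding weq_def using assms(1,2,4) wtangle_model(4) by metis
qed

lemma weq_t_tinv:
  assumes i: "i \<in> {1..n}"
  shows "weq n [GT i, GTinv i] []"
proof (rule weqI)
  show "set [GT i, GTinv i] \<subseteq> gens n" "set [] \<subseteq> gens n" using assms by (auto simp: gens_def)
  show "wloop [GT i, GTinv i] = wloop []"  by (simp add: word_simps)
  fix b :: nat
  show "wmate [GT i, GTinv i] (0, b) = wmate [] (0, b) \<and> wgain [GT i, GTinv i] (0, b) = wgain [] (0, b) \<and>
      wmate [GT i, GTinv i] (1, b) = wmate [] (1, b) \<and> wgain [GT i, GTinv i] (1, b) = wgain [] (1, b)"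
     by (cases "b = i"; simp add: word_simps)
qed

lemma weq_tinv_t:
  assumes i: "i \<in> {1..n}"
  shows "weq n [GTinv i, GT i] []"
proof (rule weqI)
  show "set [GTinv i, GT i] \<subseteq> gens n" "set [] \<subseteq> gens n" using assms by (auto simp: gens_def)
  show "wloop [GTinv i, GT i] = wloop []"  by (simp add: word_simps)
  fix b :: nat
  show "wmate [GTinv i, GT i] (0, b) = wmate [] (0, b) \<and> wgain [GTinv i, GT i] (0, b) = wgain [] (0, b) \<and>
      wmate [GTinv i, GT i] (1, b) = wmate [] (1, b) \<and> wgain [GTinv i, GT i] (1, b) = wgain [] (1, b)"
     by (cases "b = i"; simp add: word_simps)
qed

lemma weq_t_t:
  assumes i: "i \<in> {1..n}" "j \<in> {1..n}" "i < j"
  shows "weq n [GT i, GT j] [GT j, GT i]"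
proof (rule weqI)
  show "set [GT i, GT j] \<subseteq> gens n" "set [GT j, GT i] \<subseteq> gens n" using assms by (auto simp: gens_def)
  show "wloop [GT i, GT j] = wloop [GT j, GT i]"  by (simp add: word_simps)
  fix b :: nat
  show "wmate [GT i, GT j] (0, b) = wmate [GT j, GT i] (0, b) \<and> wgain [GT i, GT j] (0, b) = wgain [GT j, GT i] (0, b) \<and>
      wmate [GT i, GT j] (1, b) = wmate [GT j, GT i] (1, b) \<and> wgain [GT i, GT j] (1, b) = wgain [GT j, GT i] (1, b)"
     by (cases "b = i"; cases "b = j"; simp add: word_simps)
qed

lemma weq_w_w:
  assumes i: "i \<in> {1..n - 1}"
  shows "weq n [GW i, GW i] []"
proof (rule weqI)
  show "set [GW i, GW i] \<subseteq> gens n" "set [] \<subseteq> gens n" using assms by (auto simp: gens_def)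
  show "wloop [GW i, GW i] = wloop []"  by (simp add: word_simps)
  fix b :: nat
  show "wmate [GW i, GW i] (0, b) = wmate [] (0, b) \<and> wgain [GW i, GW i] (0, b) = wgain [] (0, b) \<and>
      wmate [GW i, GW i] (1, b) = wmate [] (1, b) \<and> wgain [GW i, GW i] (1, b) = wgain [] (1, b)"
     by (cases "b = i"; cases "b = i + 1"; simp add: word_simps)
qed

lemma weq_w_far:
  assumes i: "i \<in> {1..n - 1}" "j \<in> {1..n - 1}" "\<bar>int i - int j\<bar> \<ge> 2"
  shows "weq n [GW i, GW j] [GW j, GW i]"
proof (rule weqI)
  have ne: "i \<noteq> j" "i \<noteq> j + 1" "j \<noteq> i + 1" using assms(3) by auto
  show "set [GW i, GW j] \<subseteq> gens n" "set [GW j, GW i] \<subseteq> gens n" using assms by (auto simp: gens_def)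
  show "wloop [GW i, GW j] = wloop [GW j, GW i]" using ne by (simp add: word_simps)
  fix b :: nat
  show "wmate [GW i, GW j] (0, b) = wmate [GW j, GW i] (0, b) \<and> wgain [GW i, GW j] (0, b) = wgain [GW j, GW i] (0, b) \<and>
      wmate [GW i, GW j] (1, b) = wmate [GW j, GW i] (1, b) \<and> wgain [GW i, GW j] (1, b) = wgain [GW j, GW i] (1, b)"
    using ne by (cases "b = i"; cases "b = i + 1"; cases "b = j"; cases "b = j + 1"; simp add: word_simps)
qed

lemma weq_w_t:
  assumes i: "i \<in> {1..n - 1}"
  shows "weq n [GW i, GT i] [GT (i + 1), GW i]"
proof (rule weqI)
  show "set [GW i, GT i] \<subseteq> gens n" "set [GT (i + 1), GW i] \<subseteq> gens n" using assms by (auto simp: gens_def)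
  show "wloop [GW i, GT i] = wloop [GT (i + 1), GW i]"  by (simp add: word_simps)
  fix b :: nat
  show "wmate [GW i, GT i] (0, b) = wmate [GT (i + 1), GW i] (0, b) \<and> wgain [GW i, GT i] (0, b) = wgain [GT (i + 1), GW i] (0, b) \<and>
      wmate [GW i, GT i] (1, b) = wmate [GT (i + 1), GW i] (1, b) \<and> wgain [GW i, GT i] (1, b) = wgain [GT (i + 1), GW i] (1, b)"
     by (cases "b = i"; cases "b = i + 1"; simp add: word_simps)
qed

lemma weq_w_t_Suc:
  assumes i: "i \<in> {1..n - 1}"
  shows "weq n [GW i, GT (i + 1)] [GT i, GW i]"
proof (rule weqI)
  show "set [GW i, GT (i + 1)] \<subseteq> gens n" "set [GT i, GW i] \<subseteq> gens n" using assms by (auto simp: gens_def)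
  show "wloop [GW i, GT (i + 1)] = wloop [GT i, GW i]"  by (simp add: word_simps)
  fix b :: nat
  show "wmate [GW i, GT (i + 1)] (0, b) = wmate [GT i, GW i] (0, b) \<and> wgain [GW i, GT (i + 1)] (0, b) = wgain [GT i, GW i] (0, b) \<and>
      wmate [GW i, GT (i + 1)] (1, b) = wmate [GT i, GW i] (1, b) \<and> wgain [GW i, GT (i + 1)] (1, b) = wgain [GT i, GW i] (1, b)"
     by (cases "b = i"; cases "b = i + 1"; simp add: word_simps)
qed

lemma weq_w_t_far:
  assumes i: "i \<in> {1..n - 1}" "j \<in> {1..n}" "j \<noteq> i" "j \<noteq> i + 1"
  shows "weq n [GW i, GT j] [GT j, GW i]"
proof (rule weqI)
  note ne = assms(3,4)
  show "set [GW i, GT j] \<subseteq> gens n" "set [GT j, GW i] \<subseteq> gens n" using assms by (auto simp: gens_def)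
  show "wloop [GW i, GT j] = wloop [GT j, GW i]" using ne by (simp add: word_simps)
  fix b :: nat
  show "wmate [GW i, GT j] (0, b) = wmate [GT j, GW i] (0, b) \<and> wgain [GW i, GT j] (0, b) = wgain [GT j, GW i] (0, b) \<and>
      wmate [GW i, GT j] (1, b) = wmate [GT j, GW i] (1, b) \<and> wgain [GW i, GT j] (1, b) = wgain [GT j, GW i] (1, b)"
    using ne by (cases "b = i"; cases "b = i + 1"; cases "b = j"; simp add: word_simps)
qed

lemma weq_F_w:
  assumes i: "i \<in> {1..n - 1}"
  shows "weq n [GF i, GW i] [GF i, GT i]"
proof (rule weqI)
  show "set [GF i, GW i] \<subseteq> gens n" "set [GF i, GT i] \<subseteq> gens n" using assms by (auto simp: gens_def)
  show "wloop [GF i, GW i] = wloop [GF i, GT i]"  by (simp add: word_simps)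
  fix b :: nat
  show "wmate [GF i, GW i] (0, b) = wmate [GF i, GT i] (0, b) \<and> wgain [GF i, GW i] (0, b) = wgain [GF i, GT i] (0, b) \<and>
      wmate [GF i, GW i] (1, b) = wmate [GF i, GT i] (1, b) \<and> wgain [GF i, GW i] (1, b) = wgain [GF i, GT i] (1, b)"
     by (cases "b = i"; cases "b = i + 1"; simp add: word_simps)
qed

lemma weq_F_t:
  assumes i: "i \<in> {1..n - 1}"
  shows "weq n [GF i, GT i] [GF i, GTinv (i + 1)]"
proof (rule weqI)
  show "set [GF i, GT i] \<subseteq> gens n" "set [GF i, GTinv (i + 1)] \<subseteq> gens n" using assms by (auto simp: gens_def)
  show "wloop [GF i, GT i] = wloop [GF i, GTinv (i + 1)]"  by (simp add: word_simps)
  fix b :: nat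
  show "wmate [GF i, GT i] (0, b) = wmate [GF i, GTinv (i + 1)] (0, b) \<and> wgain [GF i, GT i] (0, b) = wgain [GF i, GTinv (i + 1)] (0, b) \<and>
      wmate [GF i, GT i] (1, b) = wmate [GF i, GTinv (i + 1)] (1, b) \<and> wgain [GF i, GT i] (1, b) = wgain [GF i, GTinv (i + 1)] (1, b)"
     by (cases "b = i"; cases "b = i + 1"; simp add: word_simps)
qed

lemma weq_w_F:
  assumes i: "i \<in> {1..n - 1}"
  shows "weq n [GW i, GF i] [GTinv i, GF i]"
proof (rule weqI)
  show "set [GW i, GF i] \<subseteq> gens n" "set [GTinv i, GF i] \<subseteq> gens n" using assms by (auto simp: gens_def)
  show "wloop [GW i, GF i] = wloop [GTinv i, GF i]"  by (simp add: word_simps)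
  fix b :: nat
  show "wmate [GW i, GF i] (0, b) = wmate [GTinv i, GF i] (0, b) \<and> wgain [GW i, GF i] (0, b) = wgain [GTinv i, GF i] (0, b) \<and>
      wmate [GW i, GF i] (1, b) = wmate [GTinv i, GF i] (1, b) \<and> wgain [GW i, GF i] (1, b) = wgain [GTinv i, GF i] (1, b)"
     by (cases "b = i"; cases "b = i + 1"; simp add: word_simps)
qed

lemma weq_t_F:
  assumes i: "i \<in> {1..n - 1}"
  shows "weq n [GTinv i, GF i] [GT (i + 1), GF i]"
proof (rule weqI)
  show "set [GTinv i, GF i] \<subseteq> gens n" "set [GT (i + 1), GF i] \<subseteq> gens n" using assms by (auto simp: gens_def)
  show "wloop [GTinv i, GF i] = wloop [GT (i + 1), GF i]"  by (simp add: word_simps)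
  fix b :: nat
  show "wmate [GTinv i, GF i] (0, b) = wmate [GT (i + 1), GF i] (0, b) \<and> wgain [GTinv i, GF i] (0, b) = wgain [GT (i + 1), GF i] (0, b) \<and>
      wmate [GTinv i, GF i] (1, b) = wmate [GT (i + 1), GF i] (1, b) \<and> wgain [GTinv i, GF i] (1, b) = wgain [GT (i + 1), GF i] (1, b)"
     by (cases "b = i"; cases "b = i + 1"; simp add: word_simps)
qed

lemma weq_F_far:
  assumes i: "i \<in> {1..n - 1}" "j \<in> {1..n - 1}" "\<bar>int i - int j\<bar> \<ge> 2"
  shows "weq n [GF i, GF j] [GF j, GF i]"
proof (rule weqI)
  have ne: "i \<noteq> j" "i \<noteq> j + 1" "j \<noteq> i + 1" using assms(3) by auto
  show "set [GF i, GF j] \<subseteq> gens n" "set [GF j, GF i] \<subseteq> gens n" using assms by (auto simp: gens_def)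
  show "wloop [GF i, GF j] = wloop [GF j, GF i]" using ne by (simp add: word_simps)
  fix b :: nat
  show "wmate [GF i, GF j] (0, b) = wmate [GF j, GF i] (0, b) \<and> wgain [GF i, GF j] (0, b) = wgain [GF j, GF i] (0, b) \<and>
      wmate [GF i, GF j] (1, b) = wmate [GF j, GF i] (1, b) \<and> wgain [GF i, GF j] (1, b) = wgain [GF j, GF i] (1, b)"
    using ne by (cases "b = i"; cases "b = i + 1"; cases "b = j"; cases "b = j + 1"; simp add: word_simps)
qed

lemma weq_F_w_far:
  assumes i: "i \<in> {1..n - 1}" "j \<in> {1..n - 1}" "\<bar>int i - int j\<bar> \<ge> 2"
  shows "weq n [GF i, GW j] [GW j, GF i]"
proof (rule weqI)
  have ne: "i \<noteq> j" "i \<noteq> j + 1" "j \<noteq> i + 1" using assms(3) by auto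
  show "set [GF i, GW j] \<subseteq> gens n" "set [GW j, GF i] \<subseteq> gens n" using assms by (auto simp: gens_def)
  show "wloop [GF i, GW j] = wloop [GW j, GF i]" using ne by (simp add: word_simps)
  fix b :: nat
  show "wmate [GF i, GW j] (0, b) = wmate [GW j, GF i] (0, b) \<and> wgain [GF i, GW j] (0, b) = wgain [GW j, GF i] (0, b) \<and>
      wmate [GF i, GW j] (1, b) = wmate [GW j, GF i] (1, b) \<and> wgain [GF i, GW j] (1, b) = wgain [GW j, GF i] (1, b)"
    using ne by (cases "b = i"; cases "b = i + 1"; cases "b = j"; cases "b = j + 1"; simp add: word_simps)
qed

lemma weq_F_t_far:
  assumes i: "i \<in> {1..n - 1}" "j \<in> {1..n}" "j \<noteq> i" "j \<noteq> i + 1"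
  shows "weq n [GF i, GT j] [GT j, GF i]"
proof (rule weqI)
  note ne = assms(3,4)
  show "set [GF i, GT j] \<subseteq> gens n" "set [GT j, GF i] \<subseteq> gens n" using assms by (auto simp: gens_def)
  show "wloop [GF i, GT j] = wloop [GT j, GF i]" using ne by (simp add: word_simps)
  fix b :: nat
  show "wmate [GF i, GT j] (0, b) = wmate [GT j, GF i] (0, b) \<and> wgain [GF i, GT j] (0, b) = wgain [GT j, GF i] (0, b) \<and>
      wmate [GF i, GT j] (1, b) = wmate [GT j, GF i] (1, b) \<and> wgain [GF i, GT j] (1, b) = wgain [GT j, GF i] (1, b)"
    using ne by (cases "b = i"; cases "b = i + 1"; cases "b = j"; simp add: word_simps)
qed

lemma weq_F_w_F:
  assumes i: "i \<in> {1..n - 1}" "i + 1 \<in> {1..n - 1}"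
  shows "weq n [GF i, GW (i + 1), GF i] [GF i]"
proof (rule weqI)
  show "set [GF i, GW (i + 1), GF i] \<subseteq> gens n" "set [GF i] \<subseteq> gens n" using assms by (auto simp: gens_def)
  show "wloop [GF i, GW (i + 1), GF i] = wloop [GF i]"  by (simp add: word_simps)
  fix b :: nat
  show "wmate [GF i, GW (i + 1), GF i] (0, b) = wmate [GF i] (0, b) \<and> wgain [GF i, GW (i + 1), GF i] (0, b) = wgain [GF i] (0, b) \<and>
      wmate [GF i, GW (i + 1), GF i] (1, b) = wmate [GF i] (1, b) \<and> wgain [GF i, GW (i + 1), GF i] (1, b) = wgain [GF i] (1, b)"
     by (cases "b = i"; cases "b = i + 1"; cases "b = i + 1 + 1"; simp add: word_simps)
qed

lemma weq_F_w_F':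
  assumes i: "i \<in> {1..n - 1}" "i + 1 \<in> {1..n - 1}"
  shows "weq n [GF (i + 1), GW i, GF (i + 1)] [GF (i + 1)]"
proof (rule weqI)
  show "set [GF (i + 1), GW i, GF (i + 1)] \<subseteq> gens n" "set [GF (i + 1)] \<subseteq> gens n" using assms by (auto simp: gens_def)
  show "wloop [GF (i + 1), GW i, GF (i + 1)] = wloop [GF (i + 1)]"  by (simp add: word_simps)
  fix b :: nat
  show "wmate [GF (i + 1), GW i, GF (i + 1)] (0, b) = wmate [GF (i + 1)] (0, b) \<and> wgain [GF (i + 1), GW i, GF (i + 1)] (0, b) = wgain [GF (i + 1)] (0, b) \<and>
      wmate [GF (i + 1), GW i, GF (i + 1)] (1, b) = wmate [GF (i + 1)] (1, b) \<and> wgain [GF (i + 1), GW i, GF (i + 1)] (1, b) = wgain [GF (i + 1)] (1, b)"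
     by (cases "b = i"; cases "b = i + 1"; cases "b = i + 1 + 1"; simp add: word_simps)
qed

lemma lift_lift: "lift \<sigma> (lift \<rho> v) = lift (\<sigma> \<circ> \<rho>) v"
  by (simp add: lift_def)

lemma word_W:
  "wmate (map GW ws @ u) v = lift (perm ws) (wmate u (lift (perm (rev ws)) v))"
  "wgain (map GW ws @ u) v = wgain u (lift (perm (rev ws)) v)" "wloop (map GW ws @ u) = wloop u"
proof -
  have "(\<forall>v. wmate (map GW ws @ u) v = lift (perm ws) (wmate u (lift (perm (rev ws)) v)) \<and>
      wgain (map GW ws @ u) v = wgain u (lift (perm (rev ws)) v)) \<and> wloop (map GW ws @ u) = wloop u"
  proof (induction ws)
    case Nil
    have "lift id w = w" for w by (auto simp: lift_def prod_eq_iff)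
    then show ?case unfolding list.map rev.simps perm_Nil append_Nil by (simp only: simp_thms)
  next
    case (Cons i ws)
    have r: "perm (rev (i # ws)) = perm (rev ws) \<circ> transpose i (i + 1)" by (simp add: perm_append perm_Cons Suc_eq_plus1)
    have c: "perm (i # ws) = transpose i (i + 1) \<circ> perm ws" by (simp add: perm_Cons Suc_eq_plus1)
    show ?case using Cons unfolding r c lift_lift[symmetric] by simp
  qed
  then show "wmate (map GW ws @ u) v = lift (perm ws) (wmate u (lift (perm (rev ws)) v))"
    "wgain (map GW ws @ u) v = wgain u (lift (perm (rev ws)) v)" "wloop (map GW ws @ u) = wloop u" by blast+
qed

text \<open>The form of \<open>cut_mate\<close> for conjugates of F_1, whose strands need be neither
  adjacent nor in increasing order.\<close>

definition cut2_mate :: "nat \<Rightarrow> nat \<Rightarrow> (vertex \<Rightarrow> vertex) \<Rightarrow> vertex \<Rightarrow> vertex" where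
  "cut2_mate i j M u = (if u = (0, i) then (0, j) else if u = (0, j) then (0, i)
     else if M u = (0, i) then M (0, j) else if M u = (0, j) then M (0, i) else M u)"

definition cut2_gain :: "nat \<Rightarrow> nat \<Rightarrow> (vertex \<Rightarrow> vertex) \<Rightarrow> (vertex \<Rightarrow> int) \<Rightarrow> vertex \<Rightarrow> int" where
  "cut2_gain i j M \<theta> u = (if u = (0, i) then 1 else if u = (0, j) then - 1
     else if M u = (0, i) then \<theta> u + 1 + \<theta> (0, j)
     else if M u = (0, j) then \<theta> u - 1 + \<theta> (0, i) else \<theta> u)"

lemma cut_cut2: "cut_mate i = cut2_mate i (i + 1)" "cut_gain i = cut2_gain i (i + 1)"
  by (simp_all add: fun_eq_iff cut_mate_def cut2_mate_def cut_gain_def cut2_gain_def)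

text \<open>Cutting is compatible with renaming the top vertices, the only ones that
  \<open>lift\<close> moves. Conjugating F_1 therefore just renames the two strands that are
  cut.\<close>

lemma cut2_conj:
  assumes qp: "\<And>c. q (p c) = c" "\<And>c. p (q c) = c"
  shows "cut2_mate (p x) (p y) (\<lambda>v. lift p (T (lift q v))) v = lift p (cut2_mate x y T (lift q v))"
    "cut2_gain (p x) (p y) (\<lambda>v. lift p (T (lift q v))) (\<lambda>v. \<theta> (lift q v)) v = cut2_gain x y T \<theta> (lift q v)"
proof -
  have qi: "q c = x \<longleftrightarrow> c = p x" for c x using qp by metis
  have pi: "p c = p x \<longleftrightarrow> c = x" for c x using qp(1) by metis
  have a: "lift q v = (0, x) \<longleftrightarrow> v = (0, p x)" for x by (cases v) (simp add: lift_def qi)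
  have b: "lift p w = (0, p x) \<longleftrightarrow> w = (0, x)" for w x by (cases w) (simp add: lift_def pi)
  have c: "lift q (0, p x) = (0, x)" "lift p (0, x) = (0, p x)" for x by (simp_all add: lift_def qp)
  show "cut2_mate (p x) (p y) (\<lambda>v. lift p (T (lift q v))) v = lift p (cut2_mate x y T (lift q v))"
    unfolding cut2_mate_def a b c by (simp only: c if_distrib[of "lift p"])
  show "cut2_gain (p x) (p y) (\<lambda>v. lift p (T (lift q v))) (\<lambda>v. \<theta> (lift q v)) v = cut2_gain x y T \<theta> (lift q v)"
    unfolding cut2_gain_def a b c ..
qed

lemma perm_rev: "perm (rev ws) (perm ws c) = c" "perm ws (perm (rev ws) c) = c"
proof -
  have "perm (rev us) (perm us c) = c" for us c by (induction us arbitrary: c) (auto simp: perm_append perm_Cons)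
  from this[of ws] this[of "rev ws"] show "perm (rev ws) (perm ws c) = c" "perm ws (perm (rev ws) c) = c" by simp_all
qed

text \<open>Words in the w_i act through their permutations, for which the braid relation is already
  available.\<close>

lemma weq_w_braid:
  assumes i: "i \<in> {1..n - 1}" "i + 1 \<in> {1..n - 1}"
  shows "weq n [GW i, GW (i + 1), GW i] [GW (i + 1), GW i, GW (i + 1)]"
proof -
  have "perm_model.W [i, Suc i, i] = perm_model.W [Suc i, i, Suc i]"
    using perm_model.braid[of i "Suc (Suc i)"] i by (simp add: perm_model.W_Cons perm_model.W_Nil mult.assoc)
  then have p: "perm [i, i + 1, i] = perm [i + 1, i, i + 1]" by (metis app_W Suc_eq_plus1)
  show ?thesis
  proof (rule weqI)
    show "set [GW i, GW (i + 1), GW i] \<subseteq> gens n" "set [GW (i + 1), GW i, GW (i + 1)] \<subseteq> gens n"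
      using assms by (auto simp: gens_def)
    have "wmate [GW i, GW (i + 1), GW i] v = wmate [GW (i + 1), GW i, GW (i + 1)] v \<and>
        wgain [GW i, GW (i + 1), GW i] v = wgain [GW (i + 1), GW i, GW (i + 1)] v" for v
      using word_W(1)[of "[i, i + 1, i]" "[]" v] word_W(1)[of "[i + 1, i, i + 1]" "[]" v]
        word_W(2)[of "[i, i + 1, i]" "[]" v] word_W(2)[of "[i + 1, i, i + 1]" "[]" v] p
      by (simp del: wmate.simps wgain.simps)
    then show "wmate [GW i, GW (i + 1), GW i] (0, b) = wmate [GW (i + 1), GW i, GW (i + 1)] (0, b) \<and>
        wgain [GW i, GW (i + 1), GW i] (0, b) = wgain [GW (i + 1), GW i, GW (i + 1)] (0, b) \<and>
        wmate [GW i, GW (i + 1), GW i] (1, b) = wmate [GW (i + 1), GW i, GW (i + 1)] (1, b) \<and>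
        wgain [GW i, GW (i + 1), GW i] (1, b) = wgain [GW (i + 1), GW i, GW (i + 1)] (1, b)" for b by blast
    show "wloop [GW i, GW (i + 1), GW i] = wloop [GW (i + 1), GW i, GW (i + 1)]" by simp
  qed
qed

text \<open>The left word renames the cut of the identity at i, the right word cuts the renamed
  identity at i + 1. Compatibility of cutting with renaming identifies the two.\<close>

lemma weq_w_w_F:
  assumes i: "i \<in> {1..n - 1}" "i + 1 \<in> {1..n - 1}"
  shows "weq n [GW i, GW (i + 1), GF i] [GF (i + 1), GW i, GW (i + 1)]"
proof -
  let ?p = "perm [i, i + 1]" and ?q = "perm [i + 1, i]"
  have vals: "?p (i) = i + 1" "?p (i + 1) = i + 1 + 1" by (simp_all add: perm_Cons transpose_def)
  have inv: "\<And>c. ?q (?p c) = c" "\<And>c. ?p (?q c) = c" using perm_rev[of "[i, i + 1]"] by auto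
  have M: "wmate (map GW [i, i + 1] @ u) v = lift ?p (wmate u (lift ?q v))" "wgain (map GW [i, i + 1] @ u) v = wgain u (lift ?q v)" for u v
    using word_W(1,2)[of "[i, i + 1]" u v] by (simp_all del: wmate.simps wgain.simps)
  have L: "wmate [GW i, GW (i + 1), GF i] v = lift ?p (cut_mate i (through_mate id) (lift ?q v))"
      "wgain [GW i, GW (i + 1), GF i] v = cut_gain i (through_mate id) (\<lambda>_. 0) (lift ?q v)" for v
    using M[of "[GF i]" v] by simp_all
  have M0: "wmate [GW i, GW (i + 1)] = (\<lambda>v. lift ?p (through_mate id (lift ?q v)))" "wgain [GW i, GW (i + 1)] = (\<lambda>_. 0)"
    using M[of "[]"] by (auto simp: fun_eq_iff)
  have R: "wmate [GF (i + 1), GW i, GW (i + 1)] v = cut_mate (i + 1) (\<lambda>v. lift ?p (through_mate id (lift ?q v))) v"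
      "wgain [GF (i + 1), GW i, GW (i + 1)] v = cut_gain (i + 1) (\<lambda>v. lift ?p (through_mate id (lift ?q v))) (\<lambda>_. 0) v" for v
    unfolding M0[symmetric] by simp_all
  show ?thesis
  proof (rule weqI)
    show "set [GW i, GW (i + 1), GF i] \<subseteq> gens n" "set [GF (i + 1), GW i, GW (i + 1)] \<subseteq> gens n"
      using assms by (auto simp: gens_def)
    show "wloop [GW i, GW (i + 1), GF i] = wloop [GF (i + 1), GW i, GW (i + 1)]"
      by (simp add: word_simps)
    fix b :: nat
    show "wmate [GW i, GW (i + 1), GF i] (0, b) = wmate [GF (i + 1), GW i, GW (i + 1)] (0, b) \<and> wgain [GW i, GW (i + 1), GF i] (0, b) = wgain [GF (i + 1), GW i, GW (i + 1)] (0, b) \<and>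
        wmate [GW i, GW (i + 1), GF i] (1, b) = wmate [GF (i + 1), GW i, GW (i + 1)] (1, b) \<and> wgain [GW i, GW (i + 1), GF i] (1, b) = wgain [GF (i + 1), GW i, GW (i + 1)] (1, b)"
      unfolding L R cut_cut2
      using cut2_conj[of ?q ?p "i" "i + 1" "through_mate id", OF inv]
        cut2_conj(2)[of ?q ?p "i" "i + 1" "through_mate id" "\<lambda>_. 0", OF inv] unfolding vals by simp
  qed
qed

lemma weq_w_w_F':
  assumes i: "i \<in> {1..n - 1}" "i + 1 \<in> {1..n - 1}"
  shows "weq n [GW (i + 1), GW i, GF (i + 1)] [GF i, GW (i + 1), GW i]"
proof -
  let ?p = "perm [i + 1, i]" and ?q = "perm [i, i + 1]"
  have vals: "?p (i + 1) = i" "?p (i + 1 + 1) = i + 1" by (simp_all add: perm_Cons transpose_def)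
  have inv: "\<And>c. ?q (?p c) = c" "\<And>c. ?p (?q c) = c" using perm_rev[of "[i + 1, i]"] by auto
  have M: "wmate (map GW [i + 1, i] @ u) v = lift ?p (wmate u (lift ?q v))" "wgain (map GW [i + 1, i] @ u) v = wgain u (lift ?q v)" for u v
    using word_W(1,2)[of "[i + 1, i]" u v] by (simp_all del: wmate.simps wgain.simps)
  have L: "wmate [GW (i + 1), GW i, GF (i + 1)] v = lift ?p (cut_mate (i + 1) (through_mate id) (lift ?q v))"
      "wgain [GW (i + 1), GW i, GF (i + 1)] v = cut_gain (i + 1) (through_mate id) (\<lambda>_. 0) (lift ?q v)" for v
    using M[of "[GF (i + 1)]" v] by simp_all
  have M0: "wmate [GW (i + 1), GW i] = (\<lambda>v. lift ?p (through_mate id (lift ?q v)))" "wgain [GW (i + 1), GW i] = (\<lambda>_. 0)"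
    using M[of "[]"] by (auto simp: fun_eq_iff)
  have R: "wmate [GF i, GW (i + 1), GW i] v = cut_mate i (\<lambda>v. lift ?p (through_mate id (lift ?q v))) v"
      "wgain [GF i, GW (i + 1), GW i] v = cut_gain i (\<lambda>v. lift ?p (through_mate id (lift ?q v))) (\<lambda>_. 0) v" for v
    unfolding M0[symmetric] by simp_all
  show ?thesis
  proof (rule weqI)
    show "set [GW (i + 1), GW i, GF (i + 1)] \<subseteq> gens n" "set [GF i, GW (i + 1), GW i] \<subseteq> gens n"
      using assms by (auto simp: gens_def)
    show "wloop [GW (i + 1), GW i, GF (i + 1)] = wloop [GF i, GW (i + 1), GW i]"
      by (simp add: word_simps)
    fix b :: nat
    show "wmate [GW (i + 1), GW i, GF (i + 1)] (0, b) = wmate [GF i, GW (i + 1), GW i] (0, b) \<and> wgain [GW (i + 1), GW i, GF (i + 1)] (0, b) = wgain [GF i, GW (i + 1), GW i] (0, b) \<and>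
        wmate [GW (i + 1), GW i, GF (i + 1)] (1, b) = wmate [GF i, GW (i + 1), GW i] (1, b) \<and> wgain [GW (i + 1), GW i, GF (i + 1)] (1, b) = wgain [GF i, GW (i + 1), GW i] (1, b)"
      unfolding L R cut_cut2
      using cut2_conj[of ?q ?p "i + 1" "i + 1 + 1" "through_mate id", OF inv]
        cut2_conj(2)[of ?q ?p "i + 1" "i + 1 + 1" "through_mate id" "\<lambda>_. 0", OF inv] unfolding vals by simp
  qed
qed

text \<open>The twists above F_i turn the gain from (0, i + 1) to (0, i) into -1 - 2m, and the cup
  adds 1. The loop has total gain -2m, half of whose absolute value is the index of z.\<close>

lemma word_relation_loop:
  assumes i: "i \<in> {1..n - 1}"
  shows "wtangle n ([GF i] @ t_power i m @ [GF i]) = wtangle n [GF i]"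
    "wcoef n ([GF i] @ t_power i m @ [GF i]) = z (nat \<bar>m\<bar>) * wcoef n [GF i]"
proof -
  have "i \<in> {1..n}" using i by auto
  then have s: "set ([GF i] @ t_power i m @ [GF i]) \<subseteq> gens n" "set [GF i] \<subseteq> gens n" using set_tpow[of i n m] i by (auto simp: gens_def)
  show "wtangle n ([GF i] @ t_power i m @ [GF i]) = wtangle n [GF i]"
    by (rule wtangle_eqI[OF s]) (auto simp: wgain_tpow word_simps)
  have "zeta (- 2 * m) = z (nat \<bar>m\<bar>)" by (simp add: zeta_def abs_mult)
  then show "wcoef n ([GF i] @ t_power i m @ [GF i]) = z (nat \<bar>m\<bar>) * wcoef n [GF i]"
    unfolding wtangle_model(4)[OF s(1)] wtangle_model(4)[OF s(2)] by (simp add: wgain_tpow word_simps)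
qed

lemma word_tword:
  "wmate (tword n m @ u) = wmate u"
  "wgain (tword n m @ u) v = (if fst v = 0 \<and> snd v \<in> {1..n} then 2 * m (snd v) else 0) + wgain u v
     - (if fst (wmate u v) = 0 \<and> snd (wmate u v) \<in> {1..n} then 2 * m (snd (wmate u v)) else 0)"
  "wloop (tword n m @ u) = wloop u"
proof -
  let ?w = "\<lambda>is. concat (map (\<lambda>i. t_power i (m i)) is) @ u"
  have M: "wmate (?w is) = wmate u \<and> wloop (?w is) = wloop u" for "is" by (induction "is") auto
  have "distinct is \<Longrightarrow> wgain (?w is) v = (if fst v = 0 \<and> snd v \<in> set is then 2 * m (snd v) else 0) + wgain u v
     - (if fst (wmate u v) = 0 \<and> snd (wmate u v) \<in> set is then 2 * m (snd (wmate u v)) else 0)" for "is"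
  proof (induction "is")
    case (Cons i "is")
    have "wgain (?w (i # is)) v = (if v = (0, i) then 2 * m i else 0) + wgain (?w is) v - (if wmate u v = (0, i) then 2 * m i else 0)"
      using M[of "is"] by (simp add: wgain_tpow)
    then show ?case using Cons by (auto simp: prod_eq_iff)
  qed simp
  from this[of "[1..<Suc n]"] M[of "[1..<Suc n]"] show "wmate (tword n m @ u) = wmate u"
    "wgain (tword n m @ u) v = (if fst v = 0 \<and> snd v \<in> {1..n} then 2 * m (snd v) else 0) + wgain u v
     - (if fst (wmate u v) = 0 \<and> snd (wmate u v) \<in> {1..n} then 2 * m (snd (wmate u v)) else 0)"
    "wloop (tword n m @ u) = wloop u"
    unfolding tword_def by (auto simp: less_Suc_eq_le)
qed

lemma word_wword:
  assumes s: "\<sigma> permutes {1..n}"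
  shows "wmate (wword n \<sigma> @ u) v = lift \<sigma> (wmate u (lift (pinv \<sigma>) v))"
    "wgain (wword n \<sigma> @ u) v = wgain u (lift (pinv \<sigma>) v)" "wloop (wword n \<sigma> @ u) = wloop u"
proof -
  obtain ws where ws: "perm ws = \<sigma>" "wword n \<sigma> = map GW ws" using wword_ex[OF s] by blast
  have "perm (rev ws) = pinv \<sigma>"
  proof
    fix c show "perm (rev ws) c = pinv \<sigma> c"
      using perm_rev(2)[of ws c] permutes_inverses(2)[OF s, of "perm (rev ws) c"] ws(1) by simp
  qed
  then show "wmate (wword n \<sigma> @ u) v = lift \<sigma> (wmate u (lift (pinv \<sigma>) v))"
    "wgain (wword n \<sigma> @ u) v = wgain u (lift (pinv \<sigma>) v)" "wloop (wword n \<sigma> @ u) = wloop u"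
    using word_W[of ws u] ws by simp_all
qed

text \<open>Compatibility of cutting with renaming eliminates the permutation chosen in
  \<open>uword\<close>.\<close>

lemma word_uword:
  assumes ij: "i \<in> {1..n}" "j \<in> {1..n}" "i \<noteq> j"
  shows "wmate (uword n i j @ u) v = cut2_mate i j (wmate u) v"
    "wgain (uword n i j @ u) v = cut2_gain i j (wmate u) (wgain u) v"
    "wloop (uword n i j @ u) = (if wmate u (0, i) = (0, j) then zeta (1 + wgain u (0, j)) else 1) * wloop u"
proof -
  obtain \<pi> where pi: "\<pi> permutes {1..n}" "\<pi> 1 = i" "\<pi> 2 = j" "uword n i j = wword n \<pi> @ [GF 1] @ wword n (pinv \<pi>)"
    using uword_ex[OF ij] by blast
  note p' = permutes_inv[OF pi(1)]
  have pp: "pinv (pinv \<pi>) = \<pi>" using permutes_inv_inv[OF pi(1)] .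
  have inv: "\<And>c. pinv \<pi> (\<pi> c) = c" "\<And>c. \<pi> (pinv \<pi> c) = c" using permutes_inverses[OF pi(1)] by auto
  have ll: "lift \<pi> (lift (pinv \<pi>) w) = w" for w by (auto simp: lift_def inv prod_eq_iff)
  let ?T = "\<lambda>w. lift (pinv \<pi>) (wmate u (lift \<pi> w))" and ?\<theta> = "\<lambda>w. wgain u (lift \<pi> w)"
  have T: "wmate (wword n (pinv \<pi>) @ u) = ?T" "wgain (wword n (pinv \<pi>) @ u) = ?\<theta>" "wloop (wword n (pinv \<pi>) @ u) = wloop u"
    using word_wword[OF p', of u] by (auto simp: pp)
  have two: "1 + 1 = (2 :: nat)" by simp
  have "wmate (uword n i j @ u) v = lift \<pi> (cut_mate 1 ?T (lift (pinv \<pi>) v))"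
    unfolding pi(4) append_assoc word_wword[OF pi(1)] by (simp add: T)
  also have "\<dots> = cut2_mate i j (\<lambda>v. lift \<pi> (?T (lift (pinv \<pi>) v))) v"
    using cut2_conj(1)[of "pinv \<pi>" \<pi> 1 2 ?T v] inv pi(2,3) unfolding cut_cut2 two by simp
  finally show "wmate (uword n i j @ u) v = cut2_mate i j (wmate u) v" by (simp add: ll)
  have "wgain (uword n i j @ u) v = cut_gain 1 ?T ?\<theta> (lift (pinv \<pi>) v)"
    unfolding pi(4) append_assoc word_wword[OF pi(1)] by (simp add: T)
  also have "\<dots> = cut2_gain i j (\<lambda>v. lift \<pi> (?T (lift (pinv \<pi>) v))) (\<lambda>v. ?\<theta> (lift (pinv \<pi>) v)) v"
    using cut2_conj(2)[of "pinv \<pi>" \<pi> 1 2 ?T ?\<theta> v] inv pi(2,3) unfolding cut_cut2 two by simp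
  finally show "wgain (uword n i j @ u) v = cut2_gain i j (wmate u) (wgain u) v" by (simp add: ll)
  have l1: "lift \<pi> (0, 1) = (0, i)" "lift \<pi> (0, 2) = (0, j)" using pi by (simp_all add: lift_def)
  have l2: "lift (pinv \<pi>) w = (0, 2) \<longleftrightarrow> w = (0, j)" for w
  proof -
    have "lift (pinv \<pi>) w = (0, 2) \<longleftrightarrow> lift \<pi> (lift (pinv \<pi>) w) = (0, j)"
    proof
      assume "lift \<pi> (lift (pinv \<pi>) w) = (0, j)"
      then have "w = (0, j)" using ll by simp
      then show "lift (pinv \<pi>) w = (0, 2)" using inv(1)[of 2] pi(3) by (simp add: lift_def)
    qed (simp add: l1)
    then show ?thesis using ll by simp
  qed
  show "wloop (uword n i j @ u) = (if wmate u (0, i) = (0, j) then zeta (1 + wgain u (0, j)) else 1) * wloop u"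
    unfolding pi(4) append_assoc word_wword[OF pi(1)] using l2 by (simp add: T l1 two)
qed

section \<open>Words in normal form and their tangles\<close>

definition data_word :: "nat \<Rightarrow> (nat \<times> nat) list \<Rightarrow> (nat \<Rightarrow> int) \<Rightarrow> (nat \<Rightarrow> nat) \<Rightarrow> gen list" where
  "data_word n P m \<sigma> = upword n P @ tword n m @ wword n \<sigma>"

text \<open>By induction on the pairs: a new pair meets two strands that are still free, so no loop
  closes; its cap is added at the top, and its cup joins the bottom ends of the two strands.\<close>

lemma data_word_sem:
  assumes s: "\<sigma> permutes {1..n}"
  shows "pairing n P \<Longrightarrow> wloop (data_word n P m \<sigma>) = 1 \<and>
    (\<forall>c\<in>{1..n}. c \<notin> set (ents P) \<longrightarrow> wmate (data_word n P m \<sigma>) (0, c) = (1, pinv \<sigma> c) \<and> wgain (data_word n P m \<sigma>) (0, c) = 2 * m c) \<and>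
    (\<forall>c d t. (c, d, t) \<in> arcs P \<longrightarrow> wmate (data_word n P m \<sigma>) (0, c) = (0, d) \<and> wgain (data_word n P m \<sigma>) (0, c) = t) \<and>
    (\<forall>b\<in>{1..n}. \<sigma> b \<notin> set (ents P) \<longrightarrow> wmate (data_word n P m \<sigma>) (1, b) = (0, \<sigma> b) \<and> wgain (data_word n P m \<sigma>) (1, b) = - 2 * m (\<sigma> b)) \<and>
    (\<forall>b\<in>{1..n}. \<forall>d t. (\<sigma> b, d, t) \<in> arcs P \<longrightarrow> wmate (data_word n P m \<sigma>) (1, b) = (1, pinv \<sigma> d) \<and>
       wgain (data_word n P m \<sigma>) (1, b) = - 2 * m (\<sigma> b) + t + 2 * m d)"
proof (induction P)
  case Nil
  have W: "wmate (wword n \<sigma>) v = lift \<sigma> (through_mate id (lift (pinv \<sigma>) v))" "wgain (wword n \<sigma>) v = 0" "wloop (wword n \<sigma>) = 1" for v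
    using word_wword[OF s, of "[]"] by simp_all
  have r: "\<sigma> b \<in> {1..n} \<longleftrightarrow> b \<in> {1..n}" for b using permutes_in_image[OF s] .
  show ?case
    unfolding data_word_def upword_def using word_tword[of n m "wword n \<sigma>"] r
    by (simp add: W lift_def through_mate_def)
next
  case (Cons x P)
  obtain i j where x: "x = (i, j)" by (cases x)
  have ij: "i \<in> {1..n}" "j \<in> {1..n}" "i \<noteq> j" "pairing n P" "i \<notin> set (ents P)" "j \<notin> set (ents P)"
    using Cons.prems(1) by (auto simp: x pairing_Cons)
  let ?u = "data_word n P m \<sigma>"
  have w: "data_word n (x # P) m \<sigma> = uword n i j @ ?u" by (simp add: x data_word_def upword_def)
  note U = word_uword[OF ij(1-3), of ?u]
  from Cons.IH[OF ij(4)] have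
    C: "wloop ?u = 1" and T: "\<And>c. c \<in> {1..n} \<Longrightarrow> c \<notin> set (ents P) \<Longrightarrow> wmate ?u (0, c) = (1, pinv \<sigma> c) \<and> wgain ?u (0, c) = 2 * m c"
    and A: "\<And>c d t. (c, d, t) \<in> arcs P \<Longrightarrow> wmate ?u (0, c) = (0, d) \<and> wgain ?u (0, c) = t"
    and B: "\<And>b. b \<in> {1..n} \<Longrightarrow> \<sigma> b \<notin> set (ents P) \<Longrightarrow> wmate ?u (1, b) = (0, \<sigma> b) \<and> wgain ?u (1, b) = - 2 * m (\<sigma> b)"
    and D: "\<And>b d t. b \<in> {1..n} \<Longrightarrow> (\<sigma> b, d, t) \<in> arcs P \<Longrightarrow> wmate ?u (1, b) = (1, pinv \<sigma> d) \<and> wgain ?u (1, b) = - 2 * m (\<sigma> b) + t + 2 * m d"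
    by blast+
  note Ti = T[OF ij(1,5)] and Tj = T[OF ij(2,6)]
  show ?case unfolding w
  proof (intro conjI ballI allI impI)
    show "wloop (uword n i j @ ?u) = 1" using U(3) C Ti by simp
  next
    fix c assume "c \<in> {1..n}" "c \<notin> set (ents (x # P))"
    then show "wmate (uword n i j @ ?u) (0, c) = (1, pinv \<sigma> c)" "wgain (uword n i j @ ?u) (0, c) = 2 * m c"
      using T[of c] by (auto simp: U(1,2) x cut2_mate_def cut2_gain_def)
  next
    fix c d t assume "(c, d, t) \<in> arcs (x # P)"
    then consider "(c, d, t) = (i, j, 1)" | "(c, d, t) = (j, i, - 1)" | "(c, d, t) \<in> arcs P" by (auto simp: x arcs_Cons)
    then have "wmate (uword n i j @ ?u) (0, c) = (0, d) \<and> wgain (uword n i j @ ?u) (0, c) = t"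
    proof cases
      case 3
      then have "c \<noteq> i" "c \<noteq> j" "d \<noteq> i" "d \<noteq> j" using arcs_ents ij by blast+
      then show ?thesis using A[OF 3] by (simp add: U(1,2) cut2_mate_def cut2_gain_def)
    qed (use ij in \<open>auto simp: U(1,2) cut2_mate_def cut2_gain_def\<close>)
    then show "wmate (uword n i j @ ?u) (0, c) = (0, d)" "wgain (uword n i j @ ?u) (0, c) = t" by auto
  next
    fix b assume b: "b \<in> {1..n}" "\<sigma> b \<notin> set (ents (x # P))"
    then show "wmate (uword n i j @ ?u) (1, b) = (0, \<sigma> b)" "wgain (uword n i j @ ?u) (1, b) = - 2 * m (\<sigma> b)"
      using B[of b] by (auto simp: U(1,2) x cut2_mate_def cut2_gain_def)
  next
    fix b d t assume b: "b \<in> {1..n}" and "(\<sigma> b, d, t) \<in> arcs (x # P)"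
    then consider "(\<sigma> b, d, t) = (i, j, 1)" | "(\<sigma> b, d, t) = (j, i, - 1)" | "(\<sigma> b, d, t) \<in> arcs P" by (auto simp: x arcs_Cons)
    then have "wmate (uword n i j @ ?u) (1, b) = (1, pinv \<sigma> d) \<and> wgain (uword n i j @ ?u) (1, b) = - 2 * m (\<sigma> b) + t + 2 * m d"
    proof cases
      case 1
      then show ?thesis using B[OF b] Tj ij by (simp add: U(1,2) cut2_mate_def cut2_gain_def)
    next
      case 2
      then show ?thesis using B[OF b] Ti ij by (simp add: U(1,2) cut2_mate_def cut2_gain_def)
    next
      case 3
      then show ?thesis using D[OF b 3] by (simp add: U(1,2) cut2_mate_def cut2_gain_def)
    qed
    then show "wmate (uword n i j @ ?u) (1, b) = (1, pinv \<sigma> d)" "wgain (uword n i j @ ?u) (1, b) = - 2 * m (\<sigma> b) + t + 2 * m d" by auto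
  qed
qed

lemma data_word_values:
  fixes m m' :: "nat \<Rightarrow> int"
  assumes s: "\<sigma> permutes {1..n}" and P: "pairing n P"
  defines "w \<equiv> tword n m @ data_word n P m' \<sigma>"
  shows "wloop w = 1"
    "c \<in> {1..n} \<Longrightarrow> c \<notin> set (ents P) \<Longrightarrow> wmate w (0, c) = (1, pinv \<sigma> c) \<and> wgain w (0, c) = 2 * m c + 2 * m' c"
    "(c, d, t) \<in> arcs P \<Longrightarrow> wmate w (0, c) = (0, d) \<and> wgain w (0, c) = t + 2 * m c - 2 * m d"
    "b \<in> {1..n} \<Longrightarrow> \<sigma> b \<notin> set (ents P) \<Longrightarrow> wmate w (1, b) = (0, \<sigma> b) \<and> wgain w (1, b) = - 2 * m (\<sigma> b) - 2 * m' (\<sigma> b)"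
    "b \<in> {1..n} \<Longrightarrow> (\<sigma> b, d, t) \<in> arcs P \<Longrightarrow> wmate w (1, b) = (1, pinv \<sigma> d) \<and> wgain w (1, b) = - 2 * m' (\<sigma> b) + t + 2 * m' d"
proof -
  note S = data_word_sem[OF s P, of m']
  note T = word_tword[of n m "data_word n P m' \<sigma>", folded w_def]
  have r: "\<sigma> b \<in> {1..n} \<longleftrightarrow> b \<in> {1..n}" for b using permutes_in_image[OF s] .
  have e: "x \<in> set (ents P) \<Longrightarrow> x \<in> {1..n}" for x using P by (auto simp: pairing_def)
  show "wloop w = 1" using S T(3) by simp
  show "wmate w (0, c) = (1, pinv \<sigma> c) \<and> wgain w (0, c) = 2 * m c + 2 * m' c" if "c \<in> {1..n}" "c \<notin> set (ents P)" for c
    using S T(1) T(2)[of "(0, c)"] that by simp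
  show "wmate w (0, c) = (0, d) \<and> wgain w (0, c) = t + 2 * m c - 2 * m d" if a: "(c, d, t) \<in> arcs P" for c d t
  proof -
    have "c \<in> {1..n}" "d \<in> {1..n}" using arcs_ents[OF a] e by blast+
    moreover have "wmate (data_word n P m' \<sigma>) (0, c) = (0, d) \<and> wgain (data_word n P m' \<sigma>) (0, c) = t" using S a by blast
    ultimately show ?thesis using T(1) T(2)[of "(0, c)"] by simp
  qed
  show "wmate w (1, b) = (0, \<sigma> b) \<and> wgain w (1, b) = - 2 * m (\<sigma> b) - 2 * m' (\<sigma> b)" if "b \<in> {1..n}" "\<sigma> b \<notin> set (ents P)" for b
  proof -
    have "wmate (data_word n P m' \<sigma>) (1, b) = (0, \<sigma> b) \<and> wgain (data_word n P m' \<sigma>) (1, b) = - 2 * m' (\<sigma> b)" using S that by blast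
    moreover have "\<sigma> b \<in> {1..n}" using r that by blast
    ultimately show ?thesis using T(1) T(2)[of "(1, b)"] by simp
  qed
  show "wmate w (1, b) = (1, pinv \<sigma> d) \<and> wgain w (1, b) = - 2 * m' (\<sigma> b) + t + 2 * m' d" if "b \<in> {1..n}" "(\<sigma> b, d, t) \<in> arcs P" for b d t
  proof -
    have "wmate (data_word n P m' \<sigma>) (1, b) = (1, pinv \<sigma> d) \<and> wgain (data_word n P m' \<sigma>) (1, b) = - 2 * m' (\<sigma> b) + t + 2 * m' d" using S that by blast
    then show ?thesis using T(1) T(2)[of "(1, b)"] by simp
  qed
qed

lemma pairing_distinct: "pairing n P \<Longrightarrow> distinct P"
proof (induction P)
  case (Cons x P)
  obtain i j where x: "x = (i, j)" by (cases x)
  show ?case using Cons by (auto simp: x pairing_Cons set_ents)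
qed simp

context atl_monoid
begin

lemma data_word_ev: "ev (tword n m @ data_word n P m' \<sigma>) = tau m * (UP P * g m' \<sigma>)"
  by (simp add: data_word_def ev_append tau_def UP_def g_def p_def mult.assoc)

lemma data_word_gens: "pairing n P \<Longrightarrow> pm \<sigma> \<Longrightarrow> set (tword n m @ data_word n P m' \<sigma>) \<subseteq> gens n"
  using tword_gens upword_gens wword_gens by (simp add: data_word_def)

text \<open>Comparing the matchings and gains of the two words vertex by vertex gives the same set
  of pairs and the three conditions of \<open>normal_form_unique\<close>.\<close>

theorem data_words_equal:
  assumes P: "pairing n P1" "pairing n P2" "oriented P1" "oriented P2" and s: "pm \<sigma>1" "pm \<sigma>2"
    and eq: "wtangle n (tword n m1 @ data_word n P1 m1' \<sigma>1) = wtangle n (tword n m2 @ data_word n P2 m2' \<sigma>2)"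
  shows "ev (tword n m1 @ data_word n P1 m1' \<sigma>1) = ev (tword n m2 @ data_word n P2 m2' \<sigma>2)"
proof -
  let ?w1 = "tword n m1 @ data_word n P1 m1' \<sigma>1" and ?w2 = "tword n m2 @ data_word n P2 m2' \<sigma>2"
  note V1 = data_word_values[where m = m1 and m' = m1', OF s(1) P(1)] and V2 = data_word_values[where m = m2 and m' = m2', OF s(2) P(2)]
  have E: "wmate ?w1 v = wmate ?w2 v" "wgain ?w1 v = wgain ?w2 v" if v: "v \<in> vertices n" for v
    using wtangle_model(2,3)[OF data_word_gens[where m = m1 and m' = m1', OF P(1) s(1)] v] wtangle_model(2,3)[OF data_word_gens[where m = m2 and m' = m2', OF P(2) s(2)] v] eq
    by simp_all
  have E0: "wmate ?w1 (0, c) = wmate ?w2 (0, c)" "wgain ?w1 (0, c) = wgain ?w2 (0, c)"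
    "wmate ?w1 (1, c) = wmate ?w2 (1, c)" "wgain ?w1 (1, c) = wgain ?w2 (1, c)" if "c \<in> ix" for c
    using E[of "(0, c)"] E[of "(1, c)"] that by (auto simp: vertices_iff)
  have e: "x \<in> ix" if "x \<in> set (ents P1) \<or> x \<in> set (ents P2)" for x using P that by (auto simp: pairing_def)
  \<comment> \<open>In an oriented system the sign of an arc is determined by which end is smaller.
    Equal caps therefore have equal signs, and equality of gains becomes equality of the differences
    of twists.\<close>
  have sgn: "t = (if i < j then 1 else - 1) \<and> (i < j \<longrightarrow> (i, j) \<in> set P)" if "oriented P" "(i, j, t) \<in> arcs P" for P i j t
    using that by (auto simp: oriented_def arcs_def)
  have a12: "\<exists>t'. (c, d, t') \<in> arcs P2 \<and> t + 2 * m1 c - 2 * m1 d = t' + 2 * m2 c - 2 * m2 d" if a: "(c, d, t) \<in> arcs P1" for c d t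
  proof -
    have c: "c \<in> ix" using arcs_ents[OF a] e by blast
    have "wmate ?w2 (0, c) = (0, d)" "wgain ?w2 (0, c) = t + 2 * m1 c - 2 * m1 d" using V1(3)[OF a] E0[OF c] by auto
    moreover have "c \<in> set (ents P2)" using V2(2)[OF c] \<open>wmate ?w2 (0, c) = (0, d)\<close> by auto
    then obtain d' t' where t': "(c, d', t') \<in> arcs P2" using ents_arcs by blast
    ultimately show ?thesis using V2(3)[OF t'] by auto
  qed
  have a21: "\<exists>t'. (c, d, t') \<in> arcs P1" if a: "(c, d, t) \<in> arcs P2" for c d t
  proof -
    have c: "c \<in> ix" using arcs_ents[OF a] e by blast
    have "wmate ?w1 (0, c) = (0, d)" using V2(3)[OF a] E0[OF c] by auto
    moreover have "c \<in> set (ents P1)" using V1(2)[OF c] \<open>wmate ?w1 (0, c) = (0, d)\<close> by auto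
    then obtain d' t' where t': "(c, d', t') \<in> arcs P1" using ents_arcs by blast
    ultimately show ?thesis using V1(3)[OF t'] by auto
  qed
  have in_arcs: "(i, j, 1) \<in> arcs P" if "(i, j) \<in> set P" for i j P using that by (auto simp: arcs_def)
  have lt: "i < j" if "oriented P" "(i, j) \<in> set P" for i j P using that by (auto simp: oriented_def)
  have top: "(i, j) \<in> set P2 \<and> m1 i - m1 j = m2 i - m2 j" if "(i, j) \<in> set P1" for i j
    using a12[OF in_arcs[OF that]] sgn[OF P(4)] lt[OF P(3) that] by fastforce
  have "(i, j) \<in> set P1" if "(i, j) \<in> set P2" for i j
    using a21[OF in_arcs[OF that]] sgn[OF P(3)] lt[OF P(4) that] by fastforce
  then have sP: "set P1 = set P2" using top by auto
  have aP: "arcs P2 = arcs P1" "set (ents P2) = set (ents P1)" using arcs_cong[OF sP] ents_cong[OF sP] by auto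
  show ?thesis unfolding data_word_ev
  proof (rule normal_form_unique[OF P(1) sP pairing_distinct[OF P(1)] pairing_distinct[OF P(2)] s])
    show "m1 i - m1 j = m2 i - m2 j" if "(i, j) \<in> set P1" for i j using top[OF that] by blast
  next
    fix c assume c: "c \<in> ix" "\<sigma>2 c \<notin> set (ents P1)"
    then have v2: "wmate ?w2 (1, c) = (0, \<sigma>2 c)" "wgain ?w2 (1, c) = - 2 * m2 (\<sigma>2 c) - 2 * m2' (\<sigma>2 c)" using V2(4)[OF c(1)] aP by auto
    have n1: "\<sigma>1 c \<notin> set (ents P1)"
    proof
      assume "\<sigma>1 c \<in> set (ents P1)"
      then obtain d t where "(\<sigma>1 c, d, t) \<in> arcs P1" using ents_arcs by blast
      from V1(5)[OF c(1) this] show False using v2(1) E0(3)[OF c(1)] by simp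
    qed
    show "\<sigma>1 c = \<sigma>2 c \<and> m1 (\<sigma>2 c) + m1' (\<sigma>2 c) = m2 (\<sigma>2 c) + m2' (\<sigma>2 c)"
      using V1(4)[OF c(1) n1] v2 E0(3,4)[OF c(1)] by auto
  next
    fix c d t assume a: "(\<sigma>2 c, \<sigma>2 d, t) \<in> arcs P1"
    have c: "c \<in> ix" using arcs_ents[OF a] e permutes_in_image[OF s(2)] by blast
    have v2: "wmate ?w2 (1, c) = (1, d)" "wgain ?w2 (1, c) = - 2 * m2' (\<sigma>2 c) + t + 2 * m2' (\<sigma>2 d)"
      using V2(5)[OF c, of "\<sigma>2 d" t] a aP permutes_inverses(2)[OF s(2)] by auto
    have "\<sigma>1 c \<in> set (ents P1)" using V1(4)[OF c] v2(1) E0(3)[OF c] by auto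
    then obtain y t1 where y: "(\<sigma>1 c, y, t1) \<in> arcs P1" using ents_arcs by blast
    note v1 = V1(5)[OF c y]
    have "pinv \<sigma>1 y = d" using v1 v2(1) E0(3)[OF c] by simp
    then have yd: "y = \<sigma>1 d" using permutes_inverses(1)[OF s(1), of y] by simp
    have "t1 = t - 2 * m2' (\<sigma>2 c) + 2 * m2' (\<sigma>2 d) + 2 * m1' (\<sigma>1 c) - 2 * m1' (\<sigma>1 d)"
      using v1 v2(2) E0(4)[OF c] yd by simp
    then show "(\<sigma>1 c, \<sigma>1 d, t - 2 * m2' (\<sigma>2 c) + 2 * m2' (\<sigma>2 d) + 2 * m1' (\<sigma>1 c) - 2 * m1' (\<sigma>1 d)) \<in> arcs P1"
      using y yd by simp
  qed
qed

end

section \<open>Every tangle is the value of a word with coefficient 1\<close>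

lemma tangle_word_base:
  assumes F: "F \<in> arrow_flat_tangles n" and no_cap: "\<And>c. c \<in> {1..n} \<Longrightarrow> fst (mate (fst F) (0, c)) = 1"
  shows "\<exists>u. set u \<subseteq> gens n \<and> wtangle n u = F \<and> wcoef n u = 1"
proof -
  note V = valid_model_tangle[OF F]
  let ?M = "mate (fst F)" and ?\<theta> = "gain F"
  have M: "?M u \<in> vertices n" "?M (?M u) = u" "?\<theta> (?M u) = - ?\<theta> u" "odd (?\<theta> u + int (fst u) + int (fst (?M u)))"
    if "u \<in> vertices n" for u using V that unfolding valid_model_def by blast+
  have v: "(0, c) \<in> vertices n" "(1, c) \<in> vertices n" if "c \<in> {1..n}" for c using that by (auto simp: vertices_iff)
  \<comment> \<open>Without caps the top vertices are joined to distinct bottom vertices, by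
    counting to all of them. The tangle is then a permutation, and its even gains are
    twists.\<close>
  define \<kappa> where "\<kappa> c = snd (?M (0, c))" for c
  have k: "?M (0, c) = (1, \<kappa> c)" "\<kappa> c \<in> {1..n}" if c: "c \<in> {1..n}" for c
  proof -
    show e: "?M (0, c) = (1, \<kappa> c)" using no_cap[OF c] by (simp add: \<kappa>_def prod_eq_iff)
    show "\<kappa> c \<in> {1..n}" using M(1)[OF v(1)[OF c]] unfolding e by (simp add: vertices_iff)
  qed
  have k': "?M (1, \<kappa> c) = (0, c)" if c: "c \<in> {1..n}" for c using M(2)[OF v(1)[OF c]] k(1)[OF c] by simp
  have inj: "inj_on \<kappa> {1..n}"
  proof (rule inj_onI)
    fix x y assume xy: "x \<in> {1..n}" "y \<in> {1..n}" "\<kappa> x = \<kappa> y"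
    show "x = y" using k'[OF xy(1)] k'[OF xy(2)] unfolding xy(3) by simp
  qed
  then have sur: "\<kappa> ` {1..n} = {1..n}" using k(2) by (intro endo_inj_surj) auto
  define \<sigma> where "\<sigma> b = (if b \<in> {1..n} then snd (?M (1, b)) else b)" for b
  have s: "?M (1, b) = (0, \<sigma> b)" "\<sigma> b \<in> {1..n}" if b: "b \<in> {1..n}" for b
  proof -
    obtain c where c: "c \<in> {1..n}" "b = \<kappa> c" using sur b by (metis imageE)
    show "?M (1, b) = (0, \<sigma> b)" "\<sigma> b \<in> {1..n}" using k'[OF c(1)] c b by (auto simp: \<sigma>_def)
  qed
  have sk: "\<sigma> (\<kappa> c) = c" if "c \<in> {1..n}" for c using k'[OF that] k(2)[OF that] by (simp add: \<sigma>_def)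
  have ks: "\<kappa> (\<sigma> b) = b" if "b \<in> {1..n}" for b using M(2)[OF v(2)[OF that]] s(1)[OF that] by (simp add: \<kappa>_def)
  have perm: "\<sigma> permutes {1..n}"
  proof (rule bij_imp_permutes)
    show "bij_betw \<sigma> {1..n} {1..n}" by (rule bij_betwI[where g = \<kappa>]) (use s k sk ks in auto)
    show "\<sigma> x = x" if "x \<notin> {1..n}" for x using that unfolding \<sigma>_def by (rule if_not_P)
  qed
  have pv: "pinv \<sigma> c = \<kappa> c" if "c \<in> {1..n}" for c using permutes_inverses(2)[OF perm, of "\<kappa> c"] sk[OF that] by simp
  define m where "m c = ?\<theta> (0, c) div 2" for c
  have m2: "2 * m c = ?\<theta> (0, c)" if c: "c \<in> {1..n}" for c
    using M(4)[OF v(1)[OF c]] k(1)[OF c] by (auto simp: m_def)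
  let ?u = "tword n m @ data_word n [] (\<lambda>_. 0) \<sigma>"
  have g: "set ?u \<subseteq> gens n" using tword_gens wword_gens[OF perm] by (auto simp: data_word_def upword_def)
  note W = data_word_values[where P = "[]" and m = m and m' = "\<lambda>_. 0", OF perm pairing_Nil]
  have "wtangle n ?u = F"
  proof (rule arrow_tangle_eqI[OF wtangle_model(1)[OF g] F])
    fix w assume w: "w \<in> vertices n"
    obtain x b where xb: "w = (x, b)" by (cases w)
    have b: "b \<in> {1..n}" and x: "x = 0 \<or> x = 1" using w xb by (auto simp: vertices_iff)
    have "wmate ?u w = ?M w \<and> wgain ?u w = ?\<theta> w"
    proof (cases "x = 0")
      case True
      then show ?thesis using W(2)[OF b] pv[OF b] k(1)[OF b] m2[OF b] by (simp add: xb)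
    next
      case False
      then have x1: "x = 1" using x by simp
      have "?\<theta> (1, b) = - ?\<theta> (0, \<sigma> b)" using M(3)[OF v(2)[OF b]] s(1)[OF b] by simp
      then show ?thesis using W(4)[OF b] s[OF b] m2[OF s(2)[OF b]] by (simp add: xb x1)
    qed
    then show "mate (fst (wtangle n ?u)) w = ?M w" "gain (wtangle n ?u) w = ?\<theta> w" using wtangle_model(2,3)[OF g w] by auto
  qed
  then show ?thesis using g W(1) wtangle_model(4)[OF g] by metis
qed

text \<open>Induction on the number of capped top vertices. A cap at i, j and a cup at k, l are
  opened and reconnected to strands from i to k and from j to l. The word \<open>uword n i j\<close>
  on top restores cap and cup without closing a loop, and a power of t_i corrects the gain of the
  cap.\<close>

lemma tangle_word:
  assumes n2: "n \<ge> 2"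
  shows "F \<in> arrow_flat_tangles n \<Longrightarrow> \<exists>u. set u \<subseteq> gens n \<and> wtangle n u = F \<and> wcoef n u = 1"
proof (induction "card {c \<in> {1..n}. fst (mate (fst F) (0, c)) = 0}" arbitrary: F rule: less_induct)
  case less
  note F = less.prems
  note V = valid_model_tangle[OF F]
  let ?M = "mate (fst F)" and ?\<theta> = "gain F"
  have M: "?M u \<in> vertices n" "?M u \<noteq> u" "?M (?M u) = u" "?\<theta> (?M u) = - ?\<theta> u" "odd (?\<theta> u + int (fst u) + int (fst (?M u)))"
    if "u \<in> vertices n" for u using V that unfolding valid_model_def by blast+
  have v: "(0, c) \<in> vertices n" "(1, c) \<in> vertices n" if "c \<in> {1..n}" for c using that by (auto simp: vertices_iff)
  show ?case
  proof (cases "\<exists>i\<in>{1..n}. fst (?M (0, i)) = 0")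
    case False
    have "fst (?M (0, c)) = 1" if c: "c \<in> {1..n}" for c
      using False c vertices_fst[OF M(1)[OF v(1)[OF c]]] by blast
    then show ?thesis using tangle_word_base[OF F] by blast
  next
    case True
    then obtain i j where i: "i \<in> {1..n}" "?M (0, i) = (0, j)" by (metis prod.collapse)
    have j: "j \<in> {1..n}" "j \<noteq> i" "?M (0, j) = (0, i)"
      using M(1-3)[OF v(1)[OF i(1)]] i(2) by (auto simp: vertices_iff)
    \<comment> \<open>Without a cup the bottom vertices would be joined to distinct top vertices,
      hence to all of them, including the capped i.\<close>
    have "\<exists>k\<in>{1..n}. fst (?M (1, k)) = 1"
    proof (rule ccontr)
      assume "\<not> ?thesis"
      then have b: "fst (?M (1, b)) = 0" if "b \<in> {1..n}" for b using vertices_fst[OF M(1)[OF v(2)[OF that]]] that by blast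
      define \<kappa> where "\<kappa> b = snd (?M (1, b))" for b
      have k: "?M (1, b) = (0, \<kappa> b)" "\<kappa> b \<in> {1..n}" if bn: "b \<in> {1..n}" for b
      proof -
        show e: "?M (1, b) = (0, \<kappa> b)" using b[OF bn] by (simp add: \<kappa>_def prod_eq_iff)
        show "\<kappa> b \<in> {1..n}" using M(1)[OF v(2)[OF bn]] unfolding e by (simp add: vertices_iff)
      qed
      have k': "?M (0, \<kappa> b) = (1, b)" if "b \<in> {1..n}" for b using M(3)[OF v(2)[OF that]] k(1)[OF that] by simp
      have "inj_on \<kappa> {1..n}"
      proof (rule inj_onI)
        fix x y assume xy: "x \<in> {1..n}" "y \<in> {1..n}" "\<kappa> x = \<kappa> y"
        show "x = y" using k'[OF xy(1)] k'[OF xy(2)] unfolding xy(3) by simp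
      qed
      then have "\<kappa> ` {1..n} = {1..n}" using k(2) by (intro endo_inj_surj) auto
      then obtain b' where "b' \<in> {1..n}" "i = \<kappa> b'" using i(1) by (metis imageE)
      then show False using k'[of b'] i(2) by simp
    qed
    then obtain k l where k: "k \<in> {1..n}" "?M (1, k) = (1, l)" by (metis prod.collapse)
    have l: "l \<in> {1..n}" "l \<noteq> k" "?M (1, l) = (1, k)"
      using M(1-3)[OF v(2)[OF k(1)]] k(2) by (auto simp: vertices_iff)
    define M' where "M' u = (if u = (0, i) then (1, k) else if u = (1, k) then (0, i)
       else if u = (0, j) then (1, l) else if u = (1, l) then (0, j) else ?M u)" for u
    \<comment> \<open>The restored cup runs from k to i, through the cup of \<open>U i j\<close>
      with gain 1, and from j to l with gain 0. The gain between k and i is chosen to make the total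
      the old one.\<close>
    define \<theta>' where "\<theta>' u = (if u = (0, i) then 1 - ?\<theta> (1, k) else if u = (1, k) then ?\<theta> (1, k) - 1
       else if u = (0, j) then 0 else if u = (1, l) then 0 else ?\<theta> u)" for u
    have o: "?M u \<noteq> (0, i) \<and> ?M u \<noteq> (0, j) \<and> ?M u \<noteq> (1, k) \<and> ?M u \<noteq> (1, l)"
      if u: "u \<in> vertices n" "u \<noteq> (0, i)" "u \<noteq> (0, j)" "u \<noteq> (1, k)" "u \<noteq> (1, l)" for u
      using M(3)[OF u(1)] u i(2) j(3) k(2) l(3) by metis
    have tk: "odd (?\<theta> (1, k))" using M(5)[OF v(2)[OF k(1)]] k(2) by simp
    have V': "valid_model n M' \<theta>'"
      unfolding valid_model_def
    proof
      fix u assume u: "u \<in> vertices n"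
      consider "u = (0, i)" | "u = (0, j)" | "u = (1, k)" | "u = (1, l)"
        | "u \<noteq> (0, i)" "u \<noteq> (0, j)" "u \<noteq> (1, k)" "u \<noteq> (1, l)" by blast
      then show "M' u \<in> vertices n \<and> M' u \<noteq> u \<and> M' (M' u) = u \<and> \<theta>' (M' u) = - \<theta>' u \<and>
          odd (\<theta>' u + int (fst u) + int (fst (M' u)))"
      proof cases
        case 5
        then have "M' u = ?M u" "M' (?M u) = u" "\<theta>' u = ?\<theta> u" "\<theta>' (?M u) = ?\<theta> (?M u)"
          using o[OF u] M(3)[OF u] by (auto simp: M'_def \<theta>'_def)
        then show ?thesis using M[OF u] by simp
      qed (use v i(1) j(1,2) k(1) l(1,2) tk in \<open>auto simp: M'_def \<theta>'_def\<close>)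
    qed
    define F' where "F' = tangle_of n M' \<theta>'"
    have F': "F' \<in> arrow_flat_tangles n" "\<And>u. u \<in> vertices n \<Longrightarrow> mate (fst F') u = M' u" "\<And>u. u \<in> vertices n \<Longrightarrow> gain F' u = \<theta>' u"
      unfolding F'_def using tangle_of_props[OF V'] by auto
    have "{c \<in> {1..n}. fst (mate (fst F') (0, c)) = 0} \<subset> {c \<in> {1..n}. fst (?M (0, c)) = 0}"
    proof
      show "{c \<in> {1..n}. fst (mate (fst F') (0, c)) = 0} \<subseteq> {c \<in> {1..n}. fst (?M (0, c)) = 0}"
      proof
        fix c assume "c \<in> {c \<in> {1..n}. fst (mate (fst F') (0, c)) = 0}"
        then have c: "c \<in> {1..n}" "fst (M' (0, c)) = 0" using F'(2)[of "(0, c)"] v by auto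
        then show "c \<in> {c \<in> {1..n}. fst (?M (0, c)) = 0}" by (auto simp: M'_def split: if_splits)
      qed
      have "i \<notin> {c \<in> {1..n}. fst (mate (fst F') (0, c)) = 0}" using F'(2)[OF v(1)[OF i(1)]] by (simp add: M'_def)
      moreover have "i \<in> {c \<in> {1..n}. fst (?M (0, c)) = 0}" using i by simp
      ultimately show "{c \<in> {1..n}. fst (mate (fst F') (0, c)) = 0} \<noteq> {c \<in> {1..n}. fst (?M (0, c)) = 0}" by blast
    qed
    then have "card {c \<in> {1..n}. fst (mate (fst F') (0, c)) = 0} < card {c \<in> {1..n}. fst (?M (0, c)) = 0}"
      by (intro psubset_card_mono) auto
    from less.hyps[OF this F'(1)] obtain u' where u': "set u' \<subseteq> gens n" "wtangle n u' = F'" "wcoef n u' = 1" by blast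
    have MG: "wmate u' w = M' w" "wgain u' w = \<theta>' w" if "w \<in> vertices n" for w
      using wtangle_model(2,3)[OF u'(1) that] F'(2,3)[OF that] u'(2) by auto
    \<comment> \<open>The cap of \<open>U i j\<close> has gain 1 and every t_i adds 2; the old gain
      is odd, since a cap joins vertices of the same side.\<close>
    define a where "a = (?\<theta> (0, i) - 1) div 2"
    have a2: "2 * a = ?\<theta> (0, i) - 1" using M(5)[OF v(1)[OF i(1)]] i(2) by (auto simp: a_def)
    let ?u = "t_power i a @ uword n i j @ u'"
    have g: "set ?u \<subseteq> gens n" using set_tpow[OF i(1)] uword_gens[OF n2 i(1) j(1)] j(2) u'(1) by auto
    note U = word_uword[OF i(1) j(1) j(2)[symmetric], of u']
    have "wtangle n ?u = F"
    proof (rule arrow_tangle_eqI[OF wtangle_model(1)[OF g] F])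
      fix w assume w: "w \<in> vertices n"
      have Mi: "M' (0, i) = (1, k)" "M' (0, j) = (1, l)" "\<theta>' (0, i) = 1 - ?\<theta> (1, k)" "\<theta>' (0, j) = 0"
        using j(2) by (auto simp: M'_def \<theta>'_def)
      have cm: "wmate ?u w = cut2_mate i j (wmate u') w" by (simp add: U)
      have cg: "wgain ?u w = (if w = (0, i) then 2 * a else 0) + cut2_gain i j (wmate u') (wgain u') w
          - (if cut2_mate i j (wmate u') w = (0, i) then 2 * a else 0)" by (simp add: wgain_tpow U)
      note MGi = MG[OF v(1)[OF i(1)]] MG[OF v(1)[OF j(1)]]
      consider "w = (0, i)" | "w = (0, j)" | "w = (1, k)" | "w = (1, l)"
        | "w \<noteq> (0, i)" "w \<noteq> (0, j)" "w \<noteq> (1, k)" "w \<noteq> (1, l)" by blast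
      then have "wmate ?u w = ?M w \<and> wgain ?u w = ?\<theta> w"
      proof cases
        case 1
        then show ?thesis unfolding cm cg using i(2) j(2) a2 by (simp add: cut2_mate_def cut2_gain_def)
      next
        case 2
        then have "?\<theta> w = - ?\<theta> (0, i)" using M(4)[OF v(1)[OF i(1)]] i(2) by simp
        then show ?thesis unfolding cm cg using 2 j(2,3) a2 by (simp add: cut2_mate_def cut2_gain_def)
      next
        case 3
        then show ?thesis unfolding cm cg using MG[OF w] MGi Mi k(2) by (simp add: cut2_mate_def cut2_gain_def M'_def \<theta>'_def)
      next
        case 4
        have "?\<theta> (1, l) = - ?\<theta> (1, k)" using M(4)[OF v(2)[OF k(1)]] k(2) by simp
        then show ?thesis unfolding cm cg using 4 MG[OF w] MGi Mi l(2,3) j(2) by (simp add: cut2_mate_def cut2_gain_def M'_def \<theta>'_def)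
      next
        case 5
        then have "wmate u' w = ?M w" "wgain u' w = ?\<theta> w" using MG[OF w] by (auto simp: M'_def \<theta>'_def)
        then show ?thesis unfolding cm cg using 5 o[OF w] by (simp add: cut2_mate_def cut2_gain_def)
      qed
      then show "mate (fst (wtangle n ?u)) w = ?M w" "gain (wtangle n ?u) w = ?\<theta> w" using wtangle_model(2,3)[OF g w] by auto
    qed
    moreover have "wcoef n ?u = 1"
    proof -
      have "wmate u' (0, i) = (1, k)" using MG[OF v(1)[OF i(1)]] by (simp add: M'_def)
      then have "wloop ?u = wloop u'" by (simp add: U)
      then show ?thesis using wtangle_model(4)[OF g] wtangle_model(4)[OF u'(1)] u'(3) by simp
    qed
    ultimately show ?thesis using g by blast
  qed
qed

section \<open>Free modules and the algebras based on them\<close>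

lemma lookup_scale: "Poly_Mapping.lookup (scale c x) k = c * Poly_Mapping.lookup x k"
  unfolding scale_def by transfer (simp add: when_def)

lemma scale_add: "scale c (x + y) = scale c x + scale c y"
  by (rule poly_mapping_eqI) (simp add: lookup_scale lookup_add distrib_left)

lemma scale_add_left: "scale (c + d) x = scale c x + scale d x"
  by (rule poly_mapping_eqI) (simp add: lookup_scale lookup_add distrib_right)

lemma scale_scale: "scale c (scale d x) = scale (c * d) x"
  by (rule poly_mapping_eqI) (simp add: lookup_scale mult.assoc)

lemma scale_one [simp]: "scale 1 x = x"
  by (rule poly_mapping_eqI) (simp add: lookup_scale)

lemma scale_zero [simp]: "scale 0 x = 0" "scale c 0 = 0"
  by (rule poly_mapping_eqI, simp add: lookup_scale)+

lemma scale_single: "scale c (Poly_Mapping.single k d) = Poly_Mapping.single k (c * d)"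
  by (rule poly_mapping_eqI) (simp add: lookup_scale lookup_single when_def)

lemma scale_minus_one: "scale (- 1) x = - x"
  by (rule poly_mapping_eqI) (simp add: lookup_scale)

lemma keys_scale: "Poly_Mapping.keys (scale c x) \<subseteq> Poly_Mapping.keys x"
  by (auto simp: in_keys_iff lookup_scale)

lemma scale_sum: "scale c (sum f S) = (\<Sum>x\<in>S. scale c (f x))"
  by (induction S rule: infinite_finite_induct) (auto simp: scale_add)

definition linear_map :: "(('k \<Rightarrow>\<^sub>0 'r::comm_ring_1) \<Rightarrow> ('l \<Rightarrow>\<^sub>0 'r)) \<Rightarrow> bool" where
  "linear_map h \<longleftrightarrow> (\<forall>x y. h (x + y) = h x + h y) \<and> (\<forall>c x. h (scale c x) = scale c (h x))"

lemma linear_mapD: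
  assumes "linear_map h"
  shows "h (x + y) = h x + h y" "h (scale c x) = scale c (h x)" "h 0 = 0" "h (- x) = - h x" "h (x - y) = h x - h y"
proof -
  show a: "h (x + y) = h x + h y" "h (scale c x) = scale c (h x)" for x y c
    using assms by (auto simp: linear_map_def)
  show "h 0 = 0" using a(2)[of 0 0] by simp
  show m: "h (- x) = - h x" for x using a(2)[of "- 1" x] by (simp add: scale_minus_one)
  show "h (x - y) = h x - h y" using a(1)[of x "- y"] m[of y] by simp
qed

lemma linear_map_sum: "linear_map h \<Longrightarrow> h (sum f S) = (\<Sum>x\<in>S. h (f x))"
  by (induction S rule: infinite_finite_induct) (auto simp: linear_mapD)

lemma linear_map_comp: "linear_map f \<Longrightarrow> linear_map h \<Longrightarrow> linear_map (\<lambda>x. f (h x))"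
  by (simp add: linear_map_def)

lemma linear_map_id: "linear_map (\<lambda>x. x)"
  by (simp add: linear_map_def)

lemma linear_map_diff: "linear_map f \<Longrightarrow> linear_map h \<Longrightarrow> linear_map (\<lambda>x. f x - h x)"
  unfolding linear_map_def
  by (auto intro!: poly_mapping_eqI simp: lookup_scale lookup_minus lookup_add algebra_simps)

text \<open>The linear extension of a function given on the basis.\<close>

definition lin :: "('k \<Rightarrow> ('l \<Rightarrow>\<^sub>0 'r)) \<Rightarrow> ('k \<Rightarrow>\<^sub>0 'r) \<Rightarrow> ('l \<Rightarrow>\<^sub>0 'r::comm_ring_1)" where
  "lin f x = (\<Sum>u\<in>Poly_Mapping.keys x. scale (Poly_Mapping.lookup x u) (f u))"

lemma lin_superset:
  assumes "finite S" "Poly_Mapping.keys x \<subseteq> S"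
  shows "lin f x = (\<Sum>u\<in>S. scale (Poly_Mapping.lookup x u) (f u))"
  unfolding lin_def using assms by (intro sum.mono_neutral_left) (auto simp: in_keys_iff)

lemma linear_map_lin: "linear_map (lin f)"
  unfolding linear_map_def
proof (intro conjI allI)
  fix x y :: "'a \<Rightarrow>\<^sub>0 'b"
  let ?S = "Poly_Mapping.keys x \<union> Poly_Mapping.keys y"
  have "lin f (x + y) = (\<Sum>u\<in>?S. scale (Poly_Mapping.lookup (x + y) u) (f u))"
    by (rule lin_superset) (use keys_add[of x y] in auto)
  also have "\<dots> = (\<Sum>u\<in>?S. scale (Poly_Mapping.lookup x u) (f u)) + (\<Sum>u\<in>?S. scale (Poly_Mapping.lookup y u) (f u))"
    by (simp add: lookup_add scale_add_left sum.distrib)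
  also have "\<dots> = lin f x + lin f y" by (subst (1 2) lin_superset[of ?S]) auto
  finally show "lin f (x + y) = lin f x + lin f y" .
next
  fix c and x :: "'a \<Rightarrow>\<^sub>0 'b"
  have "lin f (scale c x) = (\<Sum>u\<in>Poly_Mapping.keys x. scale (Poly_Mapping.lookup (scale c x) u) (f u))"
    by (rule lin_superset) (auto dest: subsetD[OF keys_scale])
  then show "lin f (scale c x) = scale c (lin f x)" by (simp add: lin_def scale_sum scale_scale lookup_scale)
qed

lemma linear_map_lin_param:
  assumes "\<And>u. linear_map (f u)"
  shows "linear_map (\<lambda>y. lin (\<lambda>u. f u y) x)"
  unfolding linear_map_def lin_def
  by (auto simp: linear_mapD[OF assms] scale_add sum.distrib scale_sum scale_scale mult.commute)

lemma lin_single [simp]: "lin f (Poly_Mapping.single u c) = scale c (f u)"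
proof -
  have "lin f (Poly_Mapping.single u c) = (\<Sum>v\<in>{u}. scale (Poly_Mapping.lookup (Poly_Mapping.single u c) v) (f v))"
    by (rule lin_superset) (auto split: if_splits)
  then show ?thesis by simp
qed

lemma word_expansion: "x = lin (\<lambda>u. Poly_Mapping.single u 1) x"
proof (rule poly_mapping_eqI)
  fix k
  have "Poly_Mapping.lookup (lin (\<lambda>u. Poly_Mapping.single u 1) x) k =
      (\<Sum>u\<in>Poly_Mapping.keys x. if u = k then Poly_Mapping.lookup x k else 0)"
    unfolding lin_def lookup_sum by (rule sum.cong) (auto simp: lookup_scale lookup_single when_def)
  also have "\<dots> = Poly_Mapping.lookup x k" by (auto simp: in_keys_iff)
  finally show "Poly_Mapping.lookup x k = Poly_Mapping.lookup (lin (\<lambda>u. Poly_Mapping.single u 1) x) k" by simp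
qed

lemma linear_map_lin_eq: "linear_map h \<Longrightarrow> h x = lin (\<lambda>u. h (Poly_Mapping.single u 1)) x"
  by (subst word_expansion) (simp add: lin_def linear_map_sum linear_mapD)

lemma linear_maps_agree:
  assumes "linear_map f" "linear_map h"
    and "\<And>u. u \<in> Poly_Mapping.keys x \<Longrightarrow> f (Poly_Mapping.single u 1) = h (Poly_Mapping.single u 1)"
  shows "f x = h x"
  unfolding linear_map_lin_eq[OF assms(1), of x] linear_map_lin_eq[OF assms(2), of x]
  by (simp add: lin_def assms(3))

lemma keys_lin:
  assumes "\<And>u. u \<in> Poly_Mapping.keys x \<Longrightarrow> Poly_Mapping.keys (f u) \<subseteq> B"
  shows "Poly_Mapping.keys (lin f x) \<subseteq> B"
proof -
  have "Poly_Mapping.keys (lin f x) \<subseteq> (\<Union>u\<in>Poly_Mapping.keys x. Poly_Mapping.keys (scale (Poly_Mapping.lookup x u) (f u)))"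
    unfolding lin_def by (rule keys_sum)
  then show ?thesis using subsetD[OF keys_scale] subsetD[OF assms] by fastforce
qed

definition bmul :: "('k \<Rightarrow> 'k \<Rightarrow> ('k \<Rightarrow>\<^sub>0 'r)) \<Rightarrow> ('k \<Rightarrow>\<^sub>0 'r) \<Rightarrow> ('k \<Rightarrow>\<^sub>0 'r) \<Rightarrow> ('k \<Rightarrow>\<^sub>0 'r::comm_ring_1)" where
  "bmul m x y = lin (\<lambda>u. lin (m u) y) x"

lemma based_algebra_simps [simp]:
  "carrier (based_algebra B m e) = {x. Poly_Mapping.keys x \<subseteq> B}"
  "monoid.mult (based_algebra B m e) = bmul m"
  "one (based_algebra B m e) = Poly_Mapping.single e 1"
  "ring.zero (based_algebra B m e) = 0"
  "add (based_algebra B m e) = (+)"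
  "module.smult (based_algebra B m e) = scale"
  by (auto simp: based_algebra_def bmul_def lin_def scale_sum scale_scale fun_eq_iff)

lemma linear_map_bmul: "linear_map (\<lambda>x. bmul m x y)" "linear_map (bmul m x)"
  unfolding bmul_def using linear_map_lin linear_map_lin_param[of "\<lambda>u. lin (m u)"] linear_map_lin by auto

lemmas bmul_linear = linear_mapD[OF linear_map_bmul(1)] linear_mapD[OF linear_map_bmul(2)]

lemma bmul_single: "bmul m (Poly_Mapping.single u a) (Poly_Mapping.single v b) = scale (a * b) (m u v)"
  by (simp add: bmul_def scale_scale)

abbreviation basis :: "'k \<Rightarrow> ('k \<Rightarrow>\<^sub>0 'r::comm_ring_1)" where "basis u \<equiv> Poly_Mapping.single u 1"

text \<open>The monoid algebra twisted by the 2-cocycle \<open>c\<close>. Tangles are the case where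
  the cocycle records the cycles, words the case where it is 1.\<close>

locale twisted_monoid =
  fixes B :: "'k set" and s :: "'k \<Rightarrow> 'k \<Rightarrow> 'k" and c :: "'k \<Rightarrow> 'k \<Rightarrow> 'r::comm_ring_1" and e :: 'k
  assumes unit_in: "e \<in> B" and closed: "\<lbrakk>u \<in> B; v \<in> B\<rbrakk> \<Longrightarrow> s u v \<in> B"
    and assoc: "\<lbrakk>u \<in> B; v \<in> B; w \<in> B\<rbrakk> \<Longrightarrow> s (s u v) w = s u (s v w)"
    and cocycle: "\<lbrakk>u \<in> B; v \<in> B; w \<in> B\<rbrakk> \<Longrightarrow> c u v * c (s u v) w = c v w * c u (s v w)"
    and left_unit: "u \<in> B \<Longrightarrow> s e u = u" "u \<in> B \<Longrightarrow> c e u = 1"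
    and right_unit: "u \<in> B \<Longrightarrow> s u e = u" "u \<in> B \<Longrightarrow> c u e = 1"
begin

abbreviation tmul :: "('k \<Rightarrow>\<^sub>0 'r) \<Rightarrow> ('k \<Rightarrow>\<^sub>0 'r) \<Rightarrow> ('k \<Rightarrow>\<^sub>0 'r)" where
  "tmul \<equiv> bmul (\<lambda>u v. Poly_Mapping.single (s u v) (c u v))"

lemma tmul_closed:
  assumes "Poly_Mapping.keys x \<subseteq> B" "Poly_Mapping.keys y \<subseteq> B"
  shows "Poly_Mapping.keys (tmul x y) \<subseteq> B"
  unfolding bmul_def using assms by (intro keys_lin) (auto intro: closed split: if_splits)

text \<open>Both sides are linear in each argument, so basis elements may be inserted one argument
  at a time; for these the claim is associativity of \<open>s\<close> together with the cocycle
  identity.\<close>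

lemma tmul_assoc:
  assumes xyw: "Poly_Mapping.keys x \<subseteq> B" "Poly_Mapping.keys y \<subseteq> B" "Poly_Mapping.keys w \<subseteq> B"
  shows "tmul (tmul x y) w = tmul x (tmul y w)"
proof -
  have 1: "tmul (tmul (basis a) (basis b)) (basis d) = tmul (basis a) (tmul (basis b) (basis d))"
    if "a \<in> B" "b \<in> B" "d \<in> B" for a b d
    using that by (simp add: bmul_single scale_single assoc cocycle)
  have 2: "tmul (tmul (basis a) (basis b)) w = tmul (basis a) (tmul (basis b) w)" if ab: "a \<in> B" "b \<in> B" for a b
    by (rule linear_maps_agree[of _ _ w])
      (use 1 ab xyw(3) in \<open>auto intro: linear_map_bmul linear_map_comp[OF linear_map_bmul(2) linear_map_bmul(2)]\<close>)
  have 3: "tmul (tmul (basis a) y) w = tmul (basis a) (tmul y w)" if a: "a \<in> B" for a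
    by (rule linear_maps_agree[of "\<lambda>y. tmul (tmul (basis a) y) w" "\<lambda>y. tmul (basis a) (tmul y w)" y])
      (use 2 a xyw(2) in \<open>auto intro: linear_map_comp[OF linear_map_bmul(1) linear_map_bmul(2)]
        linear_map_comp[OF linear_map_bmul(2) linear_map_bmul(1)]\<close>)
  show ?thesis
    by (rule linear_maps_agree[of "\<lambda>x. tmul (tmul x y) w" "\<lambda>x. tmul x (tmul y w)" x])
      (use 3 xyw(1) in \<open>auto intro: linear_map_bmul linear_map_comp[OF linear_map_bmul(1) linear_map_bmul(1)]\<close>)
qed

lemma tmul_unit:
  assumes x: "Poly_Mapping.keys x \<subseteq> B"
  shows "tmul (basis e) x = x" "tmul x (basis e) = x"
proof -
  show "tmul (basis e) x = x"
    by (rule linear_maps_agree[of "tmul (basis e)" "\<lambda>x. x" x])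
      (use x in \<open>auto simp: bmul_single left_unit intro: linear_map_bmul linear_map_id\<close>)
  show "tmul x (basis e) = x"
    by (rule linear_maps_agree[of "\<lambda>x. tmul x (basis e)" "\<lambda>x. x" x])
      (use x in \<open>auto simp: bmul_single right_unit intro: linear_map_bmul linear_map_id\<close>)
qed

lemma assoc_algebra: "assoc_algebra (ring_of_type_algebra :: 'r ring) (based_algebra B (\<lambda>u v. Poly_Mapping.single (s u v) (c u v)) e)"
  (is "assoc_algebra ?R ?A")
proof -
  have R: "carrier ?R = UNIV" "add ?R = (+)" "monoid.mult ?R = times" "one ?R = 1"
    by (simp_all add: ring_of_type_algebra_def)
  have keys_plus: "Poly_Mapping.keys (x + y) \<subseteq> B" if "Poly_Mapping.keys x \<subseteq> B" "Poly_Mapping.keys y \<subseteq> B" for x y :: "'k \<Rightarrow>\<^sub>0 'r"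
    using keys_add[of x y] that by blast
  have ab: "abelian_group ?A"
  proof (rule abelian_groupI)
    fix x assume "x \<in> carrier ?A"
    then show "\<exists>y\<in>carrier ?A. y \<oplus>\<^bsub>?A\<^esub> x = \<zero>\<^bsub>?A\<^esub>" by (intro bexI[of _ "- x"]) auto
  qed (auto simp: keys_plus add.assoc add.commute subsetD[OF keys_plus])
  have mon: "monoid ?A"
    by (rule monoidI) (use unit_in in \<open>auto simp: tmul_assoc tmul_unit dest: subsetD[OF tmul_closed]\<close>)
  have ring: "ring ?A" by (rule ringI[OF ab mon]) (auto simp: bmul_linear)
  have module: "module ?R ?A"
    by (rule moduleI[OF cring_from_type_algebra ab])
      (auto simp: R scale_add scale_add_left scale_scale dest: subsetD[OF keys_scale])
  show ?thesis
    by (rule assoc_algebra.intro[OF module ring]) (unfold_locales, auto simp: bmul_linear)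
qed

end

lemma free_algebra_twisted: "twisted_monoid (lists S) (@) (\<lambda>u v. 1 :: 'r::comm_ring_1) []"
  by unfold_locales auto

section \<open>The action of an algebra on a quotient\<close>

text \<open>Left multiplication on the cosets of a two-sided ideal turns congruences into equations in
  a monoid.\<close>

locale ring_quotient =
  fixes C :: "'a::ab_group_add set" and mul :: "'a \<Rightarrow> 'a \<Rightarrow> 'a" and e :: 'a and I :: "'a set"
  assumes mul_closed: "\<lbrakk>x \<in> C; y \<in> C\<rbrakk> \<Longrightarrow> mul x y \<in> C" and e_in: "e \<in> C"
    and mul_assoc: "\<lbrakk>x \<in> C; y \<in> C; w \<in> C\<rbrakk> \<Longrightarrow> mul (mul x y) w = mul x (mul y w)"
    and mul_e: "x \<in> C \<Longrightarrow> mul e x = x" "x \<in> C \<Longrightarrow> mul x e = x"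
    and mul_diff: "mul (x - y) w = mul x w - mul y w" "mul w (x - y) = mul w x - mul w y"
    and I_zero: "0 \<in> I" and I_diff: "\<lbrakk>x \<in> I; y \<in> I\<rbrakk> \<Longrightarrow> x - y \<in> I"
    and I_mul: "\<lbrakk>x \<in> I; y \<in> C\<rbrakk> \<Longrightarrow> mul x y \<in> I" "\<lbrakk>x \<in> I; y \<in> C\<rbrakk> \<Longrightarrow> mul y x \<in> I"
begin

definition coset :: "'a \<Rightarrow> 'a set" where
  "coset b = {y \<in> C. y - b \<in> I}"

lemma I_minus: "x - y \<in> I \<Longrightarrow> y - x \<in> I"
  using I_diff[OF I_zero, of "x - y"] by simp

lemma I_trans: "x - y \<in> I \<Longrightarrow> y - w \<in> I \<Longrightarrow> x - w \<in> I"
proof -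
  assume "x - y \<in> I" "y - w \<in> I"
  then have "(x - y) - (w - y) \<in> I" using I_diff I_minus by blast
  then show "x - w \<in> I" by (simp only: diff_diff_eq2 diff_add_cancel)
qed

lemma coset_eq_iff: "a \<in> C \<Longrightarrow> b \<in> C \<Longrightarrow> coset a = coset b \<longleftrightarrow> a - b \<in> I"
proof
  assume a: "a \<in> C" "coset a = coset b"
  have "a \<in> coset a" using a(1) I_zero by (simp add: coset_def)
  then have "a \<in> coset b" unfolding a(2) .
  then show "a - b \<in> I" by (simp add: coset_def)
next
  assume ab: "a - b \<in> I"
  have "y - a \<in> I \<longleftrightarrow> y - b \<in> I" for y
    using I_trans[of y a b, OF _ ab] I_trans[of y b a, OF _ I_minus[OF ab]] by (rule iffI)
  then show "coset a = coset b" by (simp add: coset_def)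
qed

text \<open>Off the cosets the operator is the identity, so that the unit acts as 1 on the whole
  type of sets. The choice of a representative does not matter, as I absorbs multiplication from the
  left.\<close>

definition act :: "'a \<Rightarrow> 'a set endo" where
  "act a = Endo (\<lambda>q. if \<exists>b\<in>C. q = coset b then coset (mul a (SOME b. b \<in> C \<and> q = coset b)) else q)"

lemma app_act:
  assumes ab: "a \<in> C" "b \<in> C"
  shows "app (act a) (coset b) = coset (mul a b)"
proof -
  let ?b = "SOME b'. b' \<in> C \<and> coset b = coset b'"
  have b': "?b \<in> C" "coset b = coset ?b" using someI_ex[of "\<lambda>b'. b' \<in> C \<and> coset b = coset b'"] ab by blast+
  then have "?b - b \<in> I" using coset_eq_iff ab by blast
  then have "mul a ?b - mul a b \<in> I" using I_mul(2)[of "?b - b" a] ab by (simp add: mul_diff)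
  then have "coset (mul a ?b) = coset (mul a b)" using coset_eq_iff mul_closed ab b' by blast
  then show ?thesis using ab by (auto simp: act_def)
qed

lemma app_act_other: "\<not> (\<exists>b\<in>C. q = coset b) \<Longrightarrow> app (act a) q = q"
  by (simp add: act_def)

lemma act_one: "act e = 1"
proof (rule endo_eqI, rule ext)
  fix q show "app (act e) q = app 1 q"
    using app_act[OF e_in] app_act_other[of q e] mul_e by (cases "\<exists>b\<in>C. q = coset b") (auto simp: app_one)
qed

lemma act_mult:
  assumes ab: "a \<in> C" "b \<in> C"
  shows "act a * act b = act (mul a b)"
proof (rule endo_eqI, rule ext)
  fix q show "app (act a * act b) q = app (act (mul a b)) q"
  proof (cases "\<exists>d\<in>C. q = coset d")
    case True
    then obtain d where "d \<in> C" "q = coset d" by blast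
    then show ?thesis using ab by (simp add: app_times app_act mul_closed mul_assoc)
  next
    case False
    then show ?thesis using app_act_other by (simp add: app_times)
  qed
qed

text \<open>Modulo I the action is faithful, since an element is recovered up to I from its effect
  on the coset of the unit.\<close>

lemma act_eq_iff:
  assumes ab: "a \<in> C" "b \<in> C"
  shows "act a = act b \<longleftrightarrow> a - b \<in> I"
proof
  assume "act a = act b"
  then have "coset (mul a e) = coset (mul b e)" using app_act[OF _ e_in] ab by metis
  then show "a - b \<in> I" using ab coset_eq_iff by (simp add: mul_e)
next
  assume I: "a - b \<in> I"
  show "act a = act b"
  proof (rule endo_eqI, rule ext)
    fix q show "app (act a) q = app (act b) q"
    proof (cases "\<exists>d\<in>C. q = coset d")
      case True
      then obtain d where d: "d \<in> C" "q = coset d" by blast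
      then have "mul a d - mul b d \<in> I" using I_mul(1)[OF I d(1)] by (simp add: mul_diff)
      then show ?thesis using d ab app_act coset_eq_iff mul_closed by metis
    next
      case False
      then show ?thesis using app_act_other by simp
    qed
  qed
qed

end

lemma id_star:
  assumes n: "1 \<le> n" and G: "G \<in> arrow_flat_tangles n"
  shows "arrow_star (id_tangle n) G = G" "cycle_coeff (id_tangle n) G = 1"
proof -
  note T = through_star[of id n "\<lambda>_. 0" G, OF permutes_id _ _ _ G]
  have l: "lift id v = v" for v by (auto simp: lift_def prod_eq_iff)
  have "(0, 1) \<in> vertices n" using n by (auto simp: vertices_iff)
  from T(3)[OF _ _ _ this] show "cycle_coeff (id_tangle n) G = 1" by (simp add: id_tangle_eq)
  show "arrow_star (id_tangle n) G = G"
  proof (rule arrow_tangle_eqI[OF arrow_star_closed[OF star_id(3)[OF G] G] G])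
    fix v assume v: "v \<in> vertices n"
    show "mate (fst (arrow_star (id_tangle n) G)) v = mate (fst G) v" using T(1)[OF _ _ _ v] by (simp add: id_tangle_eq l)
    show "gain (arrow_star (id_tangle n) G) v = gain G v" using T(2)[OF _ _ _ v] by (simp add: id_tangle_eq l top_part_def)
  qed
qed

lemma ATL_twisted:
  assumes n: "1 \<le> n"
  shows "twisted_monoid (arrow_flat_tangles n) arrow_star cycle_coeff (id_tangle n)"
proof
  have "valid_model n (through_mate id) (through_gain (\<lambda>_. 0))" by (rule through_valid) (auto simp: permutes_id)
  then show "id_tangle n \<in> arrow_flat_tangles n" unfolding id_tangle_eq by (rule tangle_of_props(1))
qed (use arrow_star_closed arrow_star_assoc id_star[OF n] star_id in auto)

text \<open>Letter by letter from associativity; the cocycle identity accounts for the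
  scalars.\<close>

lemma wtangle_append:
  assumes n: "1 \<le> n" and "set u \<subseteq> gens n" "set v \<subseteq> gens n"
  shows "wtangle n (u @ v) = arrow_star (wtangle n u) (wtangle n v) \<and>
    wcoef n (u @ v) = wcoef n u * wcoef n v * cycle_coeff (wtangle n u) (wtangle n v)"
  using assms(2)
proof (induction u)
  case Nil
  then show ?case using id_star[OF n wtangle_model(1)[OF assms(3)]] by simp
next
  case (Cons x u)
  then have x: "gen_tangle n x \<in> arrow_flat_tangles n" and u: "set u \<subseteq> gens n" using gen_tangle_in by auto
  note A = arrow_star_assoc[OF x wtangle_model(1)[OF u] wtangle_model(1)[OF assms(3)]]
  have IH: "wtangle n (u @ v) = arrow_star (wtangle n u) (wtangle n v)"
    "wcoef n (u @ v) = wcoef n u * wcoef n v * cycle_coeff (wtangle n u) (wtangle n v)" using Cons.IH[OF u] by auto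
  have "wcoef n ((x # u) @ v) = wcoef n u * wcoef n v * (cycle_coeff (wtangle n u) (wtangle n v) *
      cycle_coeff (gen_tangle n x) (arrow_star (wtangle n u) (wtangle n v)))" by (simp add: IH mult_ac)
  also have "\<dots> = wcoef n (x # u) * wcoef n v * cycle_coeff (wtangle n (x # u)) (wtangle n v)"
    unfolding A(2)[symmetric] by (simp add: mult_ac)
  finally show ?case using IH(1) A(1) by simp
qed

section \<open>The presentation\<close>

definition diagram :: "nat \<Rightarrow> (gen list \<Rightarrow>\<^sub>0 coeff_ring) \<Rightarrow> (arrow_tangle \<Rightarrow>\<^sub>0 coeff_ring)" where
  "diagram n = lin (\<lambda>u. Poly_Mapping.single (wtangle n u) (wcoef n u))"

abbreviation free_alg :: "nat \<Rightarrow> (coeff_ring, gen list \<Rightarrow>\<^sub>0 coeff_ring) module" where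
  "free_alg n \<equiv> free_algebra (gens n)"

abbreviation fmul :: "(gen list \<Rightarrow>\<^sub>0 coeff_ring) \<Rightarrow> (gen list \<Rightarrow>\<^sub>0 coeff_ring) \<Rightarrow> (gen list \<Rightarrow>\<^sub>0 coeff_ring)" where
  "fmul \<equiv> bmul (\<lambda>u v. Poly_Mapping.single (u @ v) 1)"

definition rel_ideal :: "nat \<Rightarrow> (gen list \<Rightarrow>\<^sub>0 coeff_ring) set" where
  "rel_ideal n = genideal (free_alg n) {l - r | l r. (l, r) \<in> relations n}"

lemma free_alg_simps:
  "carrier (free_alg n) = {x. Poly_Mapping.keys x \<subseteq> lists (gens n)}"
  "monoid.mult (free_alg n) = fmul" "one (free_alg n) = word []" "ring.zero (free_alg n) = 0"
  "add (free_alg n) = (+)" "module.smult (free_alg n) = scale"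
  by (simp_all add: free_algebra_def)

lemma fmul_word: "fmul (word u) (word v) = word (u @ v)"
  by (simp add: bmul_single)

lemma diagram_word: "diagram n (word u) = Poly_Mapping.single (wtangle n u) (wcoef n u)"
  by (simp add: diagram_def)

lemma diagram_single: "diagram n (Poly_Mapping.single u c) = Poly_Mapping.single (wtangle n u) (c * wcoef n u)"
  by (simp add: diagram_def scale_single)

lemma linear_map_diagram: "linear_map (diagram n)"
  unfolding diagram_def by (rule linear_map_lin)

lemma diagram_mult:
  assumes n: "1 \<le> n" and x: "Poly_Mapping.keys x \<subseteq> lists (gens n)" and y: "Poly_Mapping.keys y \<subseteq> lists (gens n)"
  shows "diagram n (fmul x y) =
    bmul (\<lambda>F F'. Poly_Mapping.single (arrow_star F F') (cycle_coeff F F')) (diagram n x) (diagram n y)"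
    (is "_ = ?mul (diagram n x) (diagram n y)")
proof -
  have 1: "diagram n (fmul (word u) (word v)) = ?mul (diagram n (word u)) (diagram n (word v))"
    if "u \<in> lists (gens n)" "v \<in> lists (gens n)" for u v
    using wtangle_append[OF n, of u v] that by (simp add: fmul_word diagram_word bmul_single scale_single lists_eq_set)
  have 2: "diagram n (fmul (word u) y) = ?mul (diagram n (word u)) (diagram n y)" if u: "u \<in> lists (gens n)" for u
  proof (rule linear_maps_agree[of "\<lambda>y. diagram n (fmul (word u) y)"])
    show "linear_map (\<lambda>y. diagram n (fmul (word u) y))" by (rule linear_map_comp[OF linear_map_diagram linear_map_bmul(2)])
    show "linear_map (\<lambda>y. ?mul (diagram n (word u)) (diagram n y))" by (rule linear_map_comp[OF linear_map_bmul(2) linear_map_diagram])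
  qed (use 1 u y in blast)
  show ?thesis
  proof (rule linear_maps_agree[of "\<lambda>x. diagram n (fmul x y)"])
    show "linear_map (\<lambda>x. diagram n (fmul x y))" by (rule linear_map_comp[OF linear_map_diagram linear_map_bmul(1)])
    show "linear_map (\<lambda>x. ?mul (diagram n x) (diagram n y))" by (rule linear_map_comp[OF linear_map_bmul(1) linear_map_diagram])
  qed (use 2 x in blast)
qed

lemma diagram_closed:
  assumes "Poly_Mapping.keys x \<subseteq> lists (gens n)"
  shows "Poly_Mapping.keys (diagram n x) \<subseteq> arrow_flat_tangles n"
  unfolding diagram_def
proof (rule keys_lin)
  fix u assume "u \<in> Poly_Mapping.keys x"
  then have "wtangle n u \<in> arrow_flat_tangles n" using assms wtangle_model(1) by (auto simp: lists_eq_set)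
  then show "Poly_Mapping.keys (Poly_Mapping.single (wtangle n u) (wcoef n u)) \<subseteq> arrow_flat_tangles n" by simp
qed

lemma diagram_hom:
  assumes n: "1 \<le> n"
  shows "diagram n \<in> algebra_hom ring_of_type_algebra (free_alg n) (ATL n)" "diagram n \<in> ring_hom (free_alg n) (ATL n)"
proof -
  show 1: "diagram n \<in> ring_hom (free_alg n) (ATL n)"
    by (rule ring_hom_memI)
      (use diagram_closed diagram_mult[OF n] in \<open>auto simp: free_alg_simps ATL_def linear_mapD[OF linear_map_diagram] diagram_word\<close>)
  show "diagram n \<in> algebra_hom ring_of_type_algebra (free_alg n) (ATL n)"
    unfolding algebra_hom_def using 1 by (auto simp: free_alg_simps ATL_def linear_mapD[OF linear_map_diagram])
qed

definition sound_pair :: "nat \<Rightarrow> (gen list \<Rightarrow>\<^sub>0 coeff_ring) \<Rightarrow> (gen list \<Rightarrow>\<^sub>0 coeff_ring) \<Rightarrow> bool" where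
  "sound_pair n l r \<longleftrightarrow> Poly_Mapping.keys l \<subseteq> lists (gens n) \<and> Poly_Mapping.keys r \<subseteq> lists (gens n) \<and> diagram n l = diagram n r"

lemma weq_sound: "weq n u u' \<Longrightarrow> sound_pair n (word u) (word u')"
  by (auto simp: weq_def sound_pair_def diagram_word lists_eq_set)

text \<open>Only the loop relation carries a scalar; all the others equate two words. Those with
  indices at distance 1 are split according to which index is larger.\<close>

lemma relations_sound: "(l, r) \<in> relations n \<Longrightarrow> sound_pair n l r"
proof (induction rule: relations.induct)
  case (F_t_F i m)
  have g: "GF i \<in> gens n" "set (t_power i m) \<subseteq> gens n" using F_t_F by (auto simp: gens_def t_power_def)
  note R = word_relation_loop[OF F_t_F, of m]
  have "diagram n (word ([GF i] @ t_power i m @ [GF i])) = diagram n (scale (z (nat \<bar>m\<bar>)) (word [GF i]))"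
    unfolding linear_mapD(2)[OF linear_map_diagram, of n "z (nat \<bar>m\<bar>)" "word [GF i]"]
    unfolding diagram_word R scale_single ..
  then show ?case unfolding sound_pair_def using g by (auto simp: lists_eq_set dest: subsetD[OF keys_scale])
next
  case (w_braid i j)
  then consider "j = i + 1" | "i = j + 1" by linarith
  then show ?case
  proof cases
    case 2
    then show ?thesis using weq_sound[OF weq_w_braid[of j n]] w_braid by (simp add: sound_pair_def)
  qed (use weq_sound[OF weq_w_braid[of i n]] w_braid in simp)
next
  case (F_w_F i j)
  then consider "j = i + 1" | "i = j + 1" by linarith
  then show ?case
    by cases (use weq_sound[OF weq_F_w_F[of i n]] weq_sound[OF weq_F_w_F'[of j n]] F_w_F in simp_all)
next
  case (w_w_F i j)
  then consider "j = i + 1" | "i = j + 1" by linarith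
  then show ?case
    by cases (use weq_sound[OF weq_w_w_F[of i n]] weq_sound[OF weq_w_w_F'[of j n]] w_w_F in simp_all)
qed (intro weq_sound weq_t_tinv weq_tinv_t weq_t_t weq_w_w weq_w_far weq_w_t weq_w_t_Suc weq_w_t_far weq_F_w weq_F_t
  weq_w_F weq_t_F weq_F_far weq_F_w_far weq_F_t_far; assumption)+

lemma algebra_rings:
  assumes n: "1 \<le> n"
  shows "ring (free_alg n)" "ring (ATL n)" "assoc_algebra ring_of_type_algebra (ATL n)"
proof -
  show A: "assoc_algebra ring_of_type_algebra (ATL n)"
    unfolding ATL_def by (rule twisted_monoid.assoc_algebra[OF ATL_twisted[OF n]])
  then show "ring (ATL n)" by (simp add: assoc_algebra_def)
  have "assoc_algebra ring_of_type_algebra (free_alg n)"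
    unfolding free_algebra_def by (rule twisted_monoid.assoc_algebra[OF free_algebra_twisted])
  then show "ring (free_alg n)" by (simp add: assoc_algebra_def)
qed

lemma rel_ideal_ideal:
  assumes n: "1 \<le> n"
  shows "ideal (rel_ideal n) (free_alg n)"
proof -
  interpret ring "free_alg n" by (rule algebra_rings(1)[OF n])
  show ?thesis unfolding rel_ideal_def
  proof (rule genideal_ideal, safe)
    fix l r assume "(l, r) \<in> relations n"
    then show "l - r \<in> carrier (free_alg n)"
      using relations_sound keys_diff[of l r] by (fastforce simp: sound_pair_def free_alg_simps)
  qed
qed

lemma relations_kernel:
  assumes "(l, r) \<in> relations n"
  shows "l - r \<in> a_kernel (free_alg n) (ATL n) (diagram n)"
proof -
  have s: "sound_pair n l r" using assms by (rule relations_sound)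
  then have "Poly_Mapping.keys (l - r) \<subseteq> lists (gens n)" using keys_diff[of l r] unfolding sound_pair_def by blast
  moreover have "diagram n (l - r) = 0"
    using s unfolding linear_mapD(5)[OF linear_map_diagram] sound_pair_def by simp
  ultimately show ?thesis unfolding a_kernel_def' free_alg_simps ATL_def based_algebra_simps by simp
qed

lemma rel_ideal_kernel:
  assumes n: "1 \<le> n"
  shows "rel_ideal n \<subseteq> a_kernel (free_alg n) (ATL n) (diagram n)"
proof -
  have h: "ring_hom_ring (free_alg n) (ATL n) (diagram n)"
    by (rule ring_hom_ringI2[OF algebra_rings(1,2)[OF n] diagram_hom(2)[OF n]])
  have "{l - r | l r. (l, r) \<in> relations n} \<subseteq> a_kernel (free_alg n) (ATL n) (diagram n)"
    using relations_kernel by blast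
  then show ?thesis unfolding rel_ideal_def
    by (rule ring.genideal_minimal[OF algebra_rings(1)[OF n] ring_hom_ring.kernel_is_ideal[OF h]])
qed

text \<open>Multiples of the empty word act as scalars. Hence an ideal of the underlying ring is
  also closed under scaling.\<close>

lemma fmul_scalar:
  assumes x: "Poly_Mapping.keys x \<subseteq> lists (gens n)"
  shows "fmul (Poly_Mapping.single [] c) x = scale c x" "fmul x (Poly_Mapping.single [] c) = scale c x"
proof -
  interpret T: twisted_monoid "lists (gens n)" "(@)" "\<lambda>u v. 1 :: coeff_ring" "[]" by (rule free_algebra_twisted)
  have s: "Poly_Mapping.single [] c = scale c (word [])" by (simp add: scale_single)
  show "fmul (Poly_Mapping.single [] c) x = scale c x" "fmul x (Poly_Mapping.single [] c) = scale c x"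
    unfolding s bmul_linear using T.tmul_unit[OF x] by simp_all
qed

lemma rel_ideal_closed:
  assumes n: "1 \<le> n"
  shows "0 \<in> rel_ideal n" "\<lbrakk>x \<in> rel_ideal n; y \<in> rel_ideal n\<rbrakk> \<Longrightarrow> x + y \<in> rel_ideal n"
    "x \<in> rel_ideal n \<Longrightarrow> scale c x \<in> rel_ideal n" "\<lbrakk>x \<in> rel_ideal n; y \<in> rel_ideal n\<rbrakk> \<Longrightarrow> x - y \<in> rel_ideal n"
    "\<lbrakk>x \<in> rel_ideal n; y \<in> carrier (free_alg n)\<rbrakk> \<Longrightarrow> fmul x y \<in> rel_ideal n"
    "\<lbrakk>x \<in> rel_ideal n; y \<in> carrier (free_alg n)\<rbrakk> \<Longrightarrow> fmul y x \<in> rel_ideal n"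
proof -
  have i: "ideal (rel_ideal n) (free_alg n)" by (rule rel_ideal_ideal[OF n])
  note ad = ideal.axioms(1)[OF i]
  show "0 \<in> rel_ideal n" using additive_subgroup.zero_closed[OF ad] by (simp add: free_alg_simps)
  show a: "x + y \<in> rel_ideal n" if "x \<in> rel_ideal n" "y \<in> rel_ideal n" for x y
    using additive_subgroup.a_closed[OF ad that] by (simp add: free_alg_simps)
  show "fmul x y \<in> rel_ideal n" if "x \<in> rel_ideal n" "y \<in> carrier (free_alg n)" for x y
    using ideal.I_r_closed[OF i that] by (simp add: free_alg_simps)
  show l: "fmul y x \<in> rel_ideal n" if "x \<in> rel_ideal n" "y \<in> carrier (free_alg n)" for x y
    using ideal.I_l_closed[OF i that] by (simp add: free_alg_simps)
  show s: "scale c x \<in> rel_ideal n" if x: "x \<in> rel_ideal n" for x c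
  proof -
    have "x \<in> carrier (free_alg n)" using x by (rule additive_subgroup.a_Hcarr[OF ad])
    then have "Poly_Mapping.keys x \<subseteq> lists (gens n)" by (simp add: free_alg_simps)
    from fmul_scalar(1)[OF this, of c] show ?thesis using l[OF x, of "Poly_Mapping.single [] c"] by (auto simp: free_alg_simps)
  qed
  show "x - y \<in> rel_ideal n" if "x \<in> rel_ideal n" "y \<in> rel_ideal n" for x y
    using a[OF that(1) s[OF that(2), of "- 1"]] by (simp add: scale_minus_one)
qed

context
  fixes n :: nat
  assumes n2: "n \<ge> 2"
begin

interpretation Q: ring_quotient "carrier (free_alg n)" fmul "word []" "rel_ideal n"
proof -
  interpret T: twisted_monoid "lists (gens n)" "(@)" "\<lambda>u v. 1 :: coeff_ring" "[]" by (rule free_algebra_twisted)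
  have n: "1 \<le> n" using n2 by simp
  show "ring_quotient (carrier (free_alg n)) fmul (word []) (rel_ideal n)"
    by unfold_locales (use T.tmul_closed T.tmul_assoc T.tmul_unit rel_ideal_closed[OF n] in
      \<open>auto simp: free_alg_simps bmul_linear\<close>)
qed

abbreviation opr :: "gen \<Rightarrow> (gen list \<Rightarrow>\<^sub>0 coeff_ring) set endo" where
  "opr x \<equiv> Q.act (word [x])"

abbreviation zop :: "nat \<Rightarrow> (gen list \<Rightarrow>\<^sub>0 coeff_ring) set endo" where
  "zop k \<equiv> Q.act (Poly_Mapping.single [] (z k))"

lemma in_carrier [simp]:
  "set u \<subseteq> gens n \<Longrightarrow> Poly_Mapping.single u c \<in> carrier (free_alg n)"
  by (simp add: free_alg_simps lists_eq_set)

lemma act_word: "set u \<subseteq> gens n \<Longrightarrow> prod_list (map opr u) = Q.act (word u)"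
proof (induction u)
  case (Cons x u)
  then have "opr x * Q.act (word u) = Q.act (fmul (word [x]) (word u))" by (intro Q.act_mult in_carrier) auto
  then show ?case using Cons by (simp add: fmul_word)
qed (simp add: Q.act_one)

lemma act_scalar:
  assumes "set u \<subseteq> gens n"
  shows "Q.act (Poly_Mapping.single [] c) * Q.act (Poly_Mapping.single u d) = Q.act (Poly_Mapping.single u (c * d))"
    "Q.act (Poly_Mapping.single u d) * Q.act (Poly_Mapping.single [] c) = Q.act (Poly_Mapping.single u (c * d))"
  using assms Q.act_mult[of "Poly_Mapping.single [] c" "Poly_Mapping.single u d"]
    Q.act_mult[of "Poly_Mapping.single u d" "Poly_Mapping.single [] c"]
  by (auto simp: bmul_single scale_single mult.commute)

lemma act_relation:
  assumes "(l, r) \<in> relations n"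
  shows "Q.act l = Q.act r"
proof -
  interpret ring "free_alg n" by (rule algebra_rings(1)) (use n2 in simp)
  have lr: "\<And>l r. (l, r) \<in> relations n \<Longrightarrow> l \<in> carrier (free_alg n) \<and> r \<in> carrier (free_alg n)"
    using relations_sound by (auto simp: sound_pair_def free_alg_simps)
  have sub: "{l - r | l r. (l, r) \<in> relations n} \<subseteq> carrier (free_alg n)"
  proof safe
    fix l r assume "(l, r) \<in> relations n"
    then show "l - r \<in> carrier (free_alg n)" using lr[of l r] keys_diff[of l r] by (auto simp: free_alg_simps)
  qed
  have "l - r \<in> rel_ideal n" unfolding rel_ideal_def using genideal_self[OF sub] assms by blast
  then show ?thesis using Q.act_eq_iff lr[OF assms] by blast
qed

lemma word_relation:
  assumes "(word u, word v) \<in> relations n"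
  shows "prod_list (map opr u) = prod_list (map opr v)"
proof -
  have "set u \<subseteq> gens n" "set v \<subseteq> gens n" using relations_sound[OF assms] by (auto simp: sound_pair_def)
  then show ?thesis using act_relation[OF assms] act_word by simp
qed

text \<open>The operators of the generators on the cosets satisfy the relations as equations, so the
  normal form becomes available modulo the ideal.\<close>

interpretation M: atl_monoid n opr zop
proof
  have i1: "1 \<in> {1..n - 1}" using n2 by auto
  show "n \<ge> 2" by (rule n2)
  show "opr (GF 1) * prod_list (map opr (t_power 1 a)) * opr (GF 1) = zop (nat \<bar>a\<bar>) * opr (GF 1)" for a
  proof -
    let ?u = "[GF 1] @ t_power 1 a @ [GF 1]"
    have g: "set ?u \<subseteq> gens n" "set [GF 1] \<subseteq> gens n" using n2 by (auto simp: gens_def t_power_def)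
    have "prod_list (map opr ?u) = Q.act (scale (z (nat \<bar>a\<bar>)) (word [GF 1]))"
      using act_relation[OF relations.F_t_F[OF i1, of a]] act_word[OF g(1)] by simp
    also have "\<dots> = zop (nat \<bar>a\<bar>) * opr (GF 1)" using act_scalar(1)[OF g(2), of "z (nat \<bar>a\<bar>)" 1] by (simp add: scale_single)
    finally show ?thesis by (simp add: mult.assoc)
  qed
  show "zop k * opr x = opr x * zop k" if "x \<in> gens n" for x k
    using act_scalar(1)[of "[x]" "z k" 1] act_scalar(2)[of "[x]" 1 "z k"] that by simp
  show "opr (GT i) * opr (GTinv i) = 1" if "i \<in> {1..n}" for i using word_relation[OF relations.t_tinv[OF that]] by simp
  show "opr (GTinv i) * opr (GT i) = 1" if "i \<in> {1..n}" for i using word_relation[OF relations.tinv_t[OF that]] by simp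
  show "opr (GT i) * opr (GT j) = opr (GT j) * opr (GT i)" if "i \<in> {1..n}" "j \<in> {1..n}" "i < j" for i j
    using word_relation[OF relations.t_t[OF that]] by simp
  show "opr (GW i) * opr (GW i) = 1" if "i \<in> {1..n - 1}" for i using word_relation[OF relations.w_w[OF that]] by simp
  show "opr (GW i) * opr (GW j) = opr (GW j) * opr (GW i)" if "i \<in> {1..n - 1}" "j \<in> {1..n - 1}" "i + 2 \<le> j" for i j
    using word_relation[OF relations.w_far[OF that(1,2)]] that(3) by simp
  show "opr (GW i) * opr (GW (Suc i)) * opr (GW i) = opr (GW (Suc i)) * opr (GW i) * opr (GW (Suc i))"
    if "i \<in> {1..n - 1}" "Suc i \<in> {1..n - 1}" for i
    using word_relation[OF relations.w_braid[OF that]] by (simp add: mult.assoc)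
  show "opr (GW i) * opr (GT i) = opr (GT (Suc i)) * opr (GW i)" if "i \<in> {1..n - 1}" for i
    using word_relation[OF relations.w_t[OF that]] by (simp add: Suc_eq_plus1)
  show "opr (GW i) * opr (GT (Suc i)) = opr (GT i) * opr (GW i)" if "i \<in> {1..n - 1}" for i
    using word_relation[OF relations.w_t_Suc[OF that]] by (simp add: Suc_eq_plus1)
  show "opr (GW i) * opr (GT j) = opr (GT j) * opr (GW i)" if "i \<in> {1..n - 1}" "j \<in> {1..n}" "j \<noteq> i" "j \<noteq> Suc i" for i j
    using word_relation[OF relations.w_t_far[OF that(1-3)]] that(4) by (simp add: Suc_eq_plus1)
  show "opr (GF 1) * opr (GW 1) = opr (GF 1) * opr (GT 1)" using word_relation[OF relations.F_w[OF i1]] by simp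
  have two: "1 + 1 = (2::nat)" by simp
  show "opr (GF 1) * opr (GT 1) = opr (GF 1) * opr (GTinv 2)" using word_relation[OF relations.F_t[OF i1]] unfolding two by simp
  show "opr (GW 1) * opr (GF 1) = opr (GTinv 1) * opr (GF 1)" using word_relation[OF relations.w_F[OF i1]] by simp
  show "opr (GTinv 1) * opr (GF 1) = opr (GT 2) * opr (GF 1)" using word_relation[OF relations.t_F[OF i1]] unfolding two by simp
  show "opr (GF 1) * opr (GF 3) = opr (GF 3) * opr (GF 1)" if "n \<ge> 4"
    using word_relation[OF relations.F_far[OF i1, of 3]] that by simp
  show "opr (GF 1) * opr (GW j) = opr (GW j) * opr (GF 1)" if "j \<in> {1..n - 1}" "3 \<le> j" for j
    using word_relation[OF relations.F_w_far[OF i1 that(1)]] that(2) by simp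
  show "opr (GF 1) * opr (GT j) = opr (GT j) * opr (GF 1)" if "j \<in> {1..n}" "3 \<le> j" for j
    using word_relation[OF relations.F_t_far[OF i1 that(1)]] that(2) by simp
  show "opr (GF 1) * opr (GW 2) * opr (GF 1) = opr (GF 1)" if "n \<ge> 3"
    using word_relation[OF relations.F_w_F[OF i1, of 2]] that by (simp add: mult.assoc)
  show "opr (GF 2) * opr (GW 1) * opr (GF 2) = opr (GF 2)" if "n \<ge> 3"
    using word_relation[OF relations.F_w_F[OF _ i1, of 2]] that by (simp add: mult.assoc)
  show "opr (GW i) * opr (GW (Suc i)) * opr (GF i) = opr (GF (Suc i)) * opr (GW i) * opr (GW (Suc i))"
    if "i \<in> {1..n - 1}" "Suc i \<in> {1..n - 1}" for i
    using word_relation[OF relations.w_w_F[OF that]] by (simp add: mult.assoc)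
qed

lemma ev_act: "set u \<subseteq> gens n \<Longrightarrow> M.ev u = Q.act (word u)"
  unfolding M.ev_def by (rule act_word)

lemma Zs_act: "M.Zs ks = Q.act (Poly_Mapping.single [] (prod_list (map z ks)))"
  unfolding M.Zs_def by (induction ks) (use act_scalar(1)[of "[]"] in \<open>auto simp: Q.act_one\<close>)

text \<open>Rewriting produces some product of z's as scalar. Since the ideal lies in the kernel,
  evaluation compares two multiples of single tangles; the scalar is a nonzero monomial, so the
  tangles agree, and the scalar must be \<open>wcoef n u\<close>.\<close>

lemma word_reduction:
  assumes u: "set u \<subseteq> gens n"
  shows "\<exists>m P m' \<sigma>. pairing n P \<and> M.oriented P \<and> \<sigma> permutes {1..n} \<and>
    wtangle n (tword n m @ data_word n P m' \<sigma>) = wtangle n u \<and>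
    Q.act (word u) = Q.act (Poly_Mapping.single [] (wcoef n u)) * M.ev (tword n m @ data_word n P m' \<sigma>)"
proof -
  obtain ks m P m' \<sigma> where w: "pairing n P" "M.oriented P" "\<sigma> permutes {1..n}"
    and e: "M.ev u = M.Zs ks * (M.tau m * (M.UP P * M.g m' \<sigma>))" using M.normal_form_oriented[OF u] by blast
  let ?w = "tword n m @ data_word n P m' \<sigma>" and ?c = "prod_list (map z ks)"
  have g: "set ?w \<subseteq> gens n" by (rule M.data_word_gens[OF w(1,3)])
  have e': "Q.act (word u) = Q.act (Poly_Mapping.single [] ?c) * M.ev ?w"
    using e unfolding M.data_word_ev[symmetric] ev_act[OF u] Zs_act .
  also have "\<dots> = Q.act (Poly_Mapping.single ?w ?c)" unfolding ev_act[OF g] using act_scalar(1)[OF g, of ?c 1] by simp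
  finally have "word u - Poly_Mapping.single ?w ?c \<in> rel_ideal n" using Q.act_eq_iff[OF in_carrier[OF u] in_carrier[OF g]] by blast
  then have "diagram n (word u - scale ?c (word ?w)) = 0"
    using subsetD[OF rel_ideal_kernel[of n]] n2 by (auto simp: a_kernel_def' ATL_def scale_single)
  then have d: "Poly_Mapping.single (wtangle n u) (wcoef n u) = Poly_Mapping.single (wtangle n ?w) (?c * wcoef n ?w)"
    unfolding linear_mapD(5)[OF linear_map_diagram] scale_single diagram_single by simp
  have "wcoef n ?w = 1" using wtangle_model(4)[OF g] data_word_values(1)[where m = m and m' = m', OF w(3,1)] by simp
  then have d': "Poly_Mapping.single (wtangle n u) (wcoef n u) = Poly_Mapping.single (wtangle n ?w) ?c" using d by simp
  have "is_monomial ?c" by (induction ks) (auto intro: is_monomial_1 is_monomial_mult is_monomial_z)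
  then have "?c \<noteq> 0" by (auto simp: is_monomial_def)
  then have t: "wtangle n ?w = wtangle n u"
    using arg_cong[OF d', of "\<lambda>x. Poly_Mapping.lookup x (wtangle n ?w)"] by (auto simp: lookup_single when_def split: if_splits)
  then have "wcoef n u = ?c" using arg_cong[OF d', of "\<lambda>x. Poly_Mapping.lookup x (wtangle n ?w)"] by simp
  then show ?thesis using w t e' by metis
qed

text \<open>One word for each tangle. Coefficient 1 makes its linear extension a section of
  \<open>diagram\<close>.\<close>

definition section_word :: "arrow_tangle \<Rightarrow> gen list" where
  "section_word F = (SOME u. set u \<subseteq> gens n \<and> wtangle n u = F \<and> wcoef n u = 1)"

lemma section_word:
  assumes "F \<in> arrow_flat_tangles n"
  shows "set (section_word F) \<subseteq> gens n" "wtangle n (section_word F) = F" "wcoef n (section_word F) = 1"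
  using someI_ex[OF tangle_word[OF n2 assms]] by (auto simp: section_word_def)

text \<open>The word and the chosen word of its tangle have normal forms with the same tangle, and
  these are equal modulo the ideal. They differ only by the scalar \<open>wcoef n u\<close>.\<close>

lemma word_section:
  assumes u: "set u \<subseteq> gens n"
  shows "word u - scale (wcoef n u) (word (section_word (wtangle n u))) \<in> rel_ideal n"
proof -
  let ?v = "section_word (wtangle n u)"
  note v = section_word[OF wtangle_model(1)[OF u]]
  obtain m P m' \<sigma> where w: "pairing n P" "M.oriented P" "\<sigma> permutes {1..n}"
    "wtangle n (tword n m @ data_word n P m' \<sigma>) = wtangle n u"
    "Q.act (word u) = Q.act (Poly_Mapping.single [] (wcoef n u)) * M.ev (tword n m @ data_word n P m' \<sigma>)"
    using word_reduction[OF u] by blast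
  obtain m1 P1 m1' \<sigma>1 where w1: "pairing n P1" "M.oriented P1" "\<sigma>1 permutes {1..n}"
    "wtangle n (tword n m1 @ data_word n P1 m1' \<sigma>1) = wtangle n ?v"
    "Q.act (word ?v) = Q.act (Poly_Mapping.single [] (wcoef n ?v)) * M.ev (tword n m1 @ data_word n P1 m1' \<sigma>1)"
    using word_reduction[OF v(1)] by blast
  have "M.ev (tword n m @ data_word n P m' \<sigma>) = M.ev (tword n m1 @ data_word n P1 m1' \<sigma>1)"
    by (rule M.data_words_equal) (use w w1 v(2) in auto)
  also have "\<dots> = Q.act (word ?v)" using w1(5) unfolding v(3) by (simp add: Q.act_one)
  finally have "Q.act (word u) = Q.act (Poly_Mapping.single ?v (wcoef n u))"
    using w(5) act_scalar(1)[OF v(1), of "wcoef n u" 1] by simp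
  then show ?thesis using Q.act_eq_iff[OF in_carrier[OF u] in_carrier[OF v(1)]] by (simp add: scale_single)
qed

lemma diagram_surj: "diagram n ` carrier (free_alg n) = carrier (ATL n)"
proof
  show "diagram n ` carrier (free_alg n) \<subseteq> carrier (ATL n)"
    using diagram_closed by (auto simp: free_alg_simps ATL_def)
  show "carrier (ATL n) \<subseteq> diagram n ` carrier (free_alg n)"
  proof
    fix y assume "y \<in> carrier (ATL n)"
    then have y: "Poly_Mapping.keys y \<subseteq> arrow_flat_tangles n" by (simp add: ATL_def)
    let ?x = "lin (\<lambda>F. word (section_word F)) y"
    have "diagram n ?x = y"
    proof (rule linear_maps_agree[of "\<lambda>y. diagram n (lin (\<lambda>F. word (section_word F)) y)" "\<lambda>y. y"])
      show "linear_map (\<lambda>y. diagram n (lin (\<lambda>F. word (section_word F)) y))"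
        by (rule linear_map_comp[OF linear_map_diagram linear_map_lin])
    qed (use y section_word in \<open>auto simp: linear_map_id diagram_word\<close>)
    moreover have "Poly_Mapping.keys ?x \<subseteq> lists (gens n)"
    proof (rule keys_lin)
      fix F assume "F \<in> Poly_Mapping.keys y"
      then have "set (section_word F) \<subseteq> gens n" using y section_word(1) by blast
      then show "Poly_Mapping.keys (word (section_word F) :: gen list \<Rightarrow>\<^sub>0 coeff_ring) \<subseteq> lists (gens n)"
        by (simp add: lists_eq_set)
    qed
    then have "?x \<in> carrier (free_alg n)" by (simp add: free_alg_simps)
    ultimately show "y \<in> diagram n ` carrier (free_alg n)" by (metis imageI)
  qed
qed

text \<open>Subtracting the section of the image is a linear operation that sends every word, hence
  every x, into the ideal. On the kernel it changes nothing.\<close>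

lemma kernel_rel_ideal: "a_kernel (free_alg n) (ATL n) (diagram n) = rel_ideal n"
proof
  have n: "1 \<le> n" using n2 by simp
  note I = rel_ideal_closed[OF n]
  show "rel_ideal n \<subseteq> a_kernel (free_alg n) (ATL n) (diagram n)" by (rule rel_ideal_kernel[OF n])
  show "a_kernel (free_alg n) (ATL n) (diagram n) \<subseteq> rel_ideal n"
  proof
    fix x assume "x \<in> a_kernel (free_alg n) (ATL n) (diagram n)"
    then have x: "Poly_Mapping.keys x \<subseteq> lists (gens n)" "diagram n x = 0" by (auto simp: a_kernel_def' free_alg_simps ATL_def)
    let ?h = "\<lambda>x. x - lin (\<lambda>F. word (section_word F)) (diagram n x)"
    have h: "linear_map ?h"
      by (intro linear_map_diff linear_map_id linear_map_comp[OF linear_map_lin linear_map_diagram])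
    have w: "?h (word u) \<in> rel_ideal n" if "u \<in> Poly_Mapping.keys x" for u
      using word_section[of u] x(1) that by (auto simp: diagram_word lists_eq_set)
    have sum: "(\<Sum>u\<in>S. f u) \<in> rel_ideal n" if "\<And>u. u \<in> S \<Longrightarrow> f u \<in> rel_ideal n" for S :: "gen list set" and f
      using that by (induction S rule: infinite_finite_induct) (auto intro: I)
    have "?h x = lin (\<lambda>u. ?h (word u)) x" by (rule linear_map_lin_eq[OF h])
    also have "\<dots> \<in> rel_ideal n" unfolding lin_def[of "\<lambda>u. ?h (word u)"] by (intro sum I(3) w)
    finally show "x \<in> rel_ideal n" using x(2) by (simp add: lin_def)
  qed
qed

end

theorem proposition3p2:
  fixes n :: nat
  assumes "n \<ge> 2"
  shows "has_presentation (ATL n) (gens n) (gen_val n) (relations n)"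
proof -
  have n: "1 \<le> n" using assms by simp
  have val: "diagram n (word [x]) = gen_val n x" if "x \<in> gens n" for x
    using star_id[OF gen_tangle_in[OF that]] by (simp add: diagram_word gen_val_def)
  show ?thesis unfolding has_presentation_def
    using algebra_rings(3)[OF n] diagram_hom(1)[OF n] val diagram_surj[OF assms] kernel_rel_ideal[OF assms]
    by (auto simp: rel_ideal_def)
qed

end
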